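(* Let $s,\sigma>0$ and let $E$ be an ordered basis of $\mathbf R^d$. Then the operator $Z_E$ from $\mathscr S(\mathbf R^d)$ to $C^\infty(\mathbf R^{2d})$ extends uniquely to a homeomorphism from $(\mathcal S_s^\sigma)'(\mathbf R^d)$ to $(\mathcal E^{\sigma,s}_{Z,E})'(\mathbf R^{2d})$. The same holds true with $(\Sigma_s^\sigma)'(\mathbf R^d)$ and $(\mathcal E^{\sigma,s;0}_{Z,E})'(\mathbf R^{2d})$ in place of $(\mathcal S_s^\sigma)'(\mathbf R^d)$ and $(\mathcal E^{\sigma,s}_{Z,E})'(\mathbf R^{2d})$, respectively, at each occurrence.
   Context: For an ordered basis $E=\{e_1,\dots,e_d\}$ of $\mathbf R^d$, the dual basis $E'=\{e_1',\dots,e_d'\}$ is defined by $\langle e_j,e_k'\rangle=2\pi\delta_{jk}$; $\Lambda_E=\{n_1e_1+\cdots+n_de_d : n\in\mathbf Z^d\}$ and $\Lambda_E'=\Lambda_{E'}$. Zak transform: $(Z_Ef)(x,\xi)=\sum_{j\in\Lambda_E}f(x-j)e^{i\langle j,\xi\rangle}$ for $f\in\mathscr S(\mathbf R^d)$. A function or distribution $F$ on $\mathbf R^{2d}$ is quasi-periodic of order $E$ if $F(x+k,\xi)=e^{i\langle k,\xi\rangle}F(x,\xi)$ and $F(x,\xi+\kappa)=F(x,\xi)$ for all $k\in\Lambda_E$, $\kappa\in\Lambda_E'$. Gelfand-Shilov spaces: $\mathcal S_{s_1,s_2}^{\sigma_1,\sigma_2}(\mathbf R^{d_1+d_2})$ (respectively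 $\Sigma_{s_1,s_2}^{\sigma_1,\sigma_2}(\mathbf R^{d_1+d_2})$) is the set of all $f\in C^\infty(\mathbf R^{d_1+d_2})$ such that $$\sup\frac{|x_1^{\alpha_1}x_2^{\alpha_2}\partial_{x_1}^{\beta_1}\partial_{x_2}^{\beta_2}f(x_1,x_2)|}{h^{|\alpha_1|+|\alpha_2|+|\beta_1|+|\beta_2|}\alpha_1!^{s_1}\alpha_2!^{s_2}\beta_1!^{\sigma_1}\beta_2!^{\sigma_2}}$$ (supremum over $\alpha_j,\beta_j\in\mathbf N^{d_j}$, $x_j\in\mathbf R^{d_j}$, $j=1,2$) is finite for some (respectively every) $h>0$, with the inductive (respectively projective) limit topology with respect to $h>0$. $\mathcal S_s^\sigma(\mathbf R^d)$ and $\Sigma_s^\sigma(\mathbf R^d)$ are the analogous spaces with one group of variables $x\in\mathbf R^d$ and parameters $s$ (powers of $x$) and $\sigma$ (derivatives). The distribution spaces $(\mathcal S_s^\sigma)'$, $(\Sigma_s^\sigma)'$, $(\mathcal S_{s,\sigma}^{\sigma,s})'$, $(\Sigma_{s,\sigma}^{\sigma,s})'$ are the dual spaces with their canonical (projective, respectively inductive, limit) topologies. $(\mathcal E^{\sigma,s}_{Z,E})'(\mathbf R^{2d})$ and $(\mathcal E^{\sigma,s;0}_{Z,E})'(\mathbf R^{2d})$ denote (by definition) the sets of quasi-periodic elements of order $E$ in $(\mathcal S_{s,\sigma}^{\sigma,s})'(\mathbf R^{2d})$ and $(\Sigma_{s,\sigma}^{\sigma,s})'(\mathbf R^{2d})$,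 respectively (with $d_1=d_2=d$ and variables $(x,\xi)$). *)

theory Defs
  imports "HOL-Analysis.Analysis"
begin

section \<open>Locally convex topologies on spaces of complex-valued functions\<close>

text \<open>
  All vector spaces below are linear subspaces \<open>V\<close> of \<open>'i \<Rightarrow> complex\<close> with pointwise operations.
  This covers test functions (\<open>'i = \<real>\<^sup>d\<close>) and functionals on test functions
  (\<open>'i = (\<real>\<^sup>d \<Rightarrow> complex)\<close>).
\<close>

definition seminorm_on :: "('i \<Rightarrow> complex) set \<Rightarrow> (('i \<Rightarrow> complex) \<Rightarrow> real) \<Rightarrow> bool" where
  "seminorm_on V p \<longleftrightarrow>
     (\<forall>f\<in>V. \<forall>g\<in>V. p (\<lambda>x. f x + g x) \<le> p f + p g) \<and>
     (\<forall>c. \<forall>f\<in>V. p (\<lambda>x. c * f x) = cmod c * p f)"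

definition linear_functional_on :: "('i \<Rightarrow> complex) set \<Rightarrow> (('i \<Rightarrow> complex) \<Rightarrow> complex) \<Rightarrow> bool" where
  "linear_functional_on V u \<longleftrightarrow>
     (\<forall>f\<in>V. \<forall>g\<in>V. u (\<lambda>x. f x + g x) = u f + u g) \<and>
     (\<forall>c. \<forall>f\<in>V. u (\<lambda>x. c * f x) = c * u f)"

definition linear_operator_on ::
    "('i \<Rightarrow> complex) set \<Rightarrow> (('i \<Rightarrow> complex) \<Rightarrow> ('j \<Rightarrow> complex)) \<Rightarrow> bool" where
  "linear_operator_on V T \<longleftrightarrow>
     (\<forall>f\<in>V. \<forall>g\<in>V. T (\<lambda>x. f x + g x) = (\<lambda>y. T f y + T g y)) \<and>
     (\<forall>c. \<forall>f\<in>V. T (\<lambda>x. c * f x) = (\<lambda>y. c * T f y))"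

text \<open>The topology on \<open>V\<close> generated by a family \<open>P\<close> of seminorms.\<close>

definition lc_topology ::
    "('i \<Rightarrow> complex) set \<Rightarrow> (('i \<Rightarrow> complex) \<Rightarrow> real) set \<Rightarrow> ('i \<Rightarrow> complex) topology" where
  "lc_topology V P = topology_generated_by
     (insert V {{g \<in> V. p (\<lambda>x. g x - f x) < r} | p f r. p \<in> P \<and> f \<in> V \<and> 0 < r})"

text \<open>The initial topology on \<open>V\<close> with respect to the maps \<open>j i\<close> from \<open>V\<close> to \<open>X i\<close>.\<close>

definition projective_limit_topology ::
    "('i \<Rightarrow> complex) set \<Rightarrow> 'k set \<Rightarrow> ('k \<Rightarrow> ('j \<Rightarrow> complex) topology) \<Rightarrow>
     ('k \<Rightarrow> ('i \<Rightarrow> complex) \<Rightarrow> ('j \<Rightarrow> complex)) \<Rightarrow> ('i \<Rightarrow> complex) topology" where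
  "projective_limit_topology V I X j =
     topology_generated_by {U. \<exists>i\<in>I. openin (pullback_topology V (j i) (X i)) U}"

text \<open>
  The finest locally convex topology on \<open>V\<close> for which all linear maps \<open>j i\<close> from \<open>X i\<close> to \<open>V\<close> are
  continuous: it is generated by all seminorms whose compositions with the \<open>j i\<close> are continuous.
\<close>

definition inductive_limit_topology ::
    "('i \<Rightarrow> complex) set \<Rightarrow> 'k set \<Rightarrow> ('k \<Rightarrow> ('j \<Rightarrow> complex) topology) \<Rightarrow>
     ('k \<Rightarrow> ('j \<Rightarrow> complex) \<Rightarrow> ('i \<Rightarrow> complex)) \<Rightarrow> ('i \<Rightarrow> complex) topology" where
  "inductive_limit_topology V I X j = lc_topology V
     {p. seminorm_on V p \<and> (\<forall>i\<in>I. continuous_map (X i) euclideanreal (p \<circ> j i))}"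

text \<open>
  Functionals on the space \<open>topspace X\<close> are extended by zero to all functions, so that equality of
  functionals is equality in HOL and \<open>continuous_dual X\<close> is again a linear space of functions.
\<close>

definition continuous_dual :: "('i \<Rightarrow> complex) topology \<Rightarrow> (('i \<Rightarrow> complex) \<Rightarrow> complex) set" where
  "continuous_dual X = {u. linear_functional_on (topspace X) u \<and>
     (\<forall>f. f \<notin> topspace X \<longrightarrow> u f = 0) \<and> continuous_map X euclidean u}"

definition restrict_functional ::
    "('i \<Rightarrow> complex) set \<Rightarrow> (('i \<Rightarrow> complex) \<Rightarrow> complex) \<Rightarrow> ('i \<Rightarrow> complex) \<Rightarrow> complex" where
  "restrict_functional V u = (\<lambda>f. if f \<in> V then u f else 0)"

definition dual_norm ::
    "('i \<Rightarrow> complex) set \<Rightarrow> (('i \<Rightarrow> complex) \<Rightarrow> real) \<Rightarrow> (('i \<Rightarrow> complex) \<Rightarrow> complex) \<Rightarrow> real" where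
  "dual_norm V N u = Sup {cmod (u f) | f. f \<in> V \<and> N f \<le> 1}"


section \<open>Smooth functions and the Schwartz space\<close>

definition partial_deriv :: "'a::euclidean_space \<Rightarrow> ('a \<Rightarrow> complex) \<Rightarrow> 'a \<Rightarrow> complex" where
  "partial_deriv b f x = vector_derivative (\<lambda>t. f (x + t *\<^sub>R b)) (at 0)"

definition iterated_deriv :: "'a::euclidean_space list \<Rightarrow> ('a \<Rightarrow> complex) \<Rightarrow> 'a \<Rightarrow> complex" where
  "iterated_deriv bs f = foldr partial_deriv bs f"

definition smooth :: "('a::euclidean_space \<Rightarrow> complex) \<Rightarrow> bool" where
  "smooth f \<longleftrightarrow> (\<forall>bs. set bs \<subseteq> Basis \<longrightarrow> (\<forall>x. iterated_deriv bs f differentiable (at x)))"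

text \<open>
  Multi-indices are functions \<open>'a \<Rightarrow> nat\<close> of which only the values on \<open>Basis\<close> matter. For smooth \<open>f\<close>
  the order of differentiation in \<open>multi_deriv\<close> is immaterial; an arbitrary one is fixed.
\<close>

definition multi_deriv :: "('a::euclidean_space \<Rightarrow> nat) \<Rightarrow> ('a \<Rightarrow> complex) \<Rightarrow> 'a \<Rightarrow> complex" where
  "multi_deriv \<beta> f = iterated_deriv
     (concat (map (\<lambda>b. replicate (\<beta> b) b) (SOME bs. distinct bs \<and> set bs = Basis))) f"

definition monomial_at :: "('a::euclidean_space \<Rightarrow> nat) \<Rightarrow> 'a \<Rightarrow> real" where
  "monomial_at \<alpha> x = (\<Prod>b\<in>Basis. (x \<bullet> b) ^ \<alpha> b)"

definition schwartz_space :: "('a::euclidean_space \<Rightarrow> complex) set" where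
  "schwartz_space = {f. smooth f \<and>
     (\<forall>\<alpha> \<beta>. bounded (range (\<lambda>x. monomial_at \<alpha> x *\<^sub>R multi_deriv \<beta> f x)))}"


section \<open>Gelfand-Shilov spaces\<close>

text \<open>
  The parameters \<open>s\<close> and \<open>\<sigma>\<close> are given per coordinate. Since \<open>\<alpha>! = (\<Prod>b\<in>Basis. \<alpha> b !)\<close>,
  the constant choice gives the spaces with one group of variables; two groups of variables are
  treated by the exponents \<open>two_groups\<close> on a product space.
\<close>

definition gs_quotient ::
    "('a::euclidean_space \<Rightarrow> real) \<Rightarrow> ('a \<Rightarrow> real) \<Rightarrow> real \<Rightarrow> ('a \<Rightarrow> complex) \<Rightarrow>
     ('a \<Rightarrow> nat) \<Rightarrow> ('a \<Rightarrow> nat) \<Rightarrow> 'a \<Rightarrow> real" where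
  "gs_quotient s \<sigma> h f \<alpha> \<beta> x =
     cmod (monomial_at \<alpha> x *\<^sub>R multi_deriv \<beta> f x) /
     (h ^ (\<Sum>b\<in>Basis. \<alpha> b + \<beta> b) *
      (\<Prod>b\<in>Basis. (fact (\<alpha> b) :: real) powr s b * (fact (\<beta> b) :: real) powr \<sigma> b))"

definition gs_step ::
    "('a::euclidean_space \<Rightarrow> real) \<Rightarrow> ('a \<Rightarrow> real) \<Rightarrow> real \<Rightarrow> ('a \<Rightarrow> complex) set" where
  "gs_step s \<sigma> h = {f. smooth f \<and> bdd_above (range (\<lambda>(\<alpha>, \<beta>, x). gs_quotient s \<sigma> h f \<alpha> \<beta> x))}"

definition gs_norm ::
    "('a::euclidean_space \<Rightarrow> real) \<Rightarrow> ('a \<Rightarrow> real) \<Rightarrow> real \<Rightarrow> ('a \<Rightarrow> complex) \<Rightarrow> real" where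
  "gs_norm s \<sigma> h f = (SUP (\<alpha>, \<beta>, x). gs_quotient s \<sigma> h f \<alpha> \<beta> x)"

definition gs_step_topology ::
    "('a::euclidean_space \<Rightarrow> real) \<Rightarrow> ('a \<Rightarrow> real) \<Rightarrow> real \<Rightarrow> ('a \<Rightarrow> complex) topology" where
  "gs_step_topology s \<sigma> h = lc_topology (gs_step s \<sigma> h) {gs_norm s \<sigma> h}"

definition gs_step_dual_topology ::
    "('a::euclidean_space \<Rightarrow> real) \<Rightarrow> ('a \<Rightarrow> real) \<Rightarrow> real \<Rightarrow> (('a \<Rightarrow> complex) \<Rightarrow> complex) topology" where
  "gs_step_dual_topology s \<sigma> h =
     lc_topology (continuous_dual (gs_step_topology s \<sigma> h))
       {dual_norm (gs_step s \<sigma> h) (gs_norm s \<sigma> h)}"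

definition two_groups :: "real \<Rightarrow> real \<Rightarrow> 'a::euclidean_space \<times> 'b::euclidean_space \<Rightarrow> real" where
  "two_groups s1 s2 b = (if snd b = 0 then s1 else s2)"

text \<open>The Roumieu case: the spaces \<open>\<S>\<close>, their duals, and the topologies of both.\<close>

definition gs_roumieu ::
    "('a::euclidean_space \<Rightarrow> real) \<Rightarrow> ('a \<Rightarrow> real) \<Rightarrow> ('a \<Rightarrow> complex) set" where
  "gs_roumieu s \<sigma> = (\<Union>h\<in>{0<..}. gs_step s \<sigma> h)"

definition gs_roumieu_topology ::
    "('a::euclidean_space \<Rightarrow> real) \<Rightarrow> ('a \<Rightarrow> real) \<Rightarrow> ('a \<Rightarrow> complex) topology" where
  "gs_roumieu_topology s \<sigma> =
     inductive_limit_topology (gs_roumieu s \<sigma>) {0<..} (gs_step_topology s \<sigma>) (\<lambda>h f. f)"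

definition gs_roumieu_dual ::
    "('a::euclidean_space \<Rightarrow> real) \<Rightarrow> ('a \<Rightarrow> real) \<Rightarrow> (('a \<Rightarrow> complex) \<Rightarrow> complex) set" where
  "gs_roumieu_dual s \<sigma> = continuous_dual (gs_roumieu_topology s \<sigma>)"

definition gs_roumieu_dual_topology ::
    "('a::euclidean_space \<Rightarrow> real) \<Rightarrow> ('a \<Rightarrow> real) \<Rightarrow> (('a \<Rightarrow> complex) \<Rightarrow> complex) topology" where
  "gs_roumieu_dual_topology s \<sigma> =
     projective_limit_topology (gs_roumieu_dual s \<sigma>) {0<..} (gs_step_dual_topology s \<sigma>)
       (\<lambda>h. restrict_functional (gs_step s \<sigma> h))"

text \<open>The Beurling case: the spaces \<open>\<Sigma>\<close>, their duals, and the topologies of both.\<close>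

definition gs_beurling ::
    "('a::euclidean_space \<Rightarrow> real) \<Rightarrow> ('a \<Rightarrow> real) \<Rightarrow> ('a \<Rightarrow> complex) set" where
  "gs_beurling s \<sigma> = (\<Inter>h\<in>{0<..}. gs_step s \<sigma> h)"

definition gs_beurling_topology ::
    "('a::euclidean_space \<Rightarrow> real) \<Rightarrow> ('a \<Rightarrow> real) \<Rightarrow> ('a \<Rightarrow> complex) topology" where
  "gs_beurling_topology s \<sigma> =
     projective_limit_topology (gs_beurling s \<sigma>) {0<..} (gs_step_topology s \<sigma>) (\<lambda>h f. f)"

definition gs_beurling_dual ::
    "('a::euclidean_space \<Rightarrow> real) \<Rightarrow> ('a \<Rightarrow> real) \<Rightarrow> (('a \<Rightarrow> complex) \<Rightarrow> complex) set" where
  "gs_beurling_dual s \<sigma> = continuous_dual (gs_beurling_topology s \<sigma>)"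

definition gs_beurling_dual_topology ::
    "('a::euclidean_space \<Rightarrow> real) \<Rightarrow> ('a \<Rightarrow> real) \<Rightarrow> (('a \<Rightarrow> complex) \<Rightarrow> complex) topology" where
  "gs_beurling_dual_topology s \<sigma> =
     inductive_limit_topology (gs_beurling_dual s \<sigma>) {0<..} (gs_step_dual_topology s \<sigma>)
       (\<lambda>h. restrict_functional (gs_beurling s \<sigma>))"

text \<open>The (bilinear) identification of a function with a functional on the test function space \<open>V\<close>.\<close>

definition distribution_of ::
    "('a::euclidean_space \<Rightarrow> complex) set \<Rightarrow> ('a \<Rightarrow> complex) \<Rightarrow> ('a \<Rightarrow> complex) \<Rightarrow> complex" where
  "distribution_of V F = restrict_functional V (\<lambda>\<phi>. \<integral>x. F x * \<phi> x \<partial>lborel)"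


section \<open>Lattices, the Zak transform and quasi-periodicity\<close>

definition basis_family :: "('n::finite \<Rightarrow> real ^ 'n) \<Rightarrow> bool" where
  "basis_family e \<longleftrightarrow> inj e \<and> independent (range e) \<and> span (range e) = UNIV"

definition dual_basis :: "('n::finite \<Rightarrow> real ^ 'n) \<Rightarrow> ('n \<Rightarrow> real ^ 'n)" where
  "dual_basis e = (THE e'. \<forall>j k. e j \<bullet> e' k = (if j = k then 2 * pi else 0))"

definition lattice_of :: "('n::finite \<Rightarrow> real ^ 'n) \<Rightarrow> (real ^ 'n) set" where
  "lattice_of e = {\<Sum>i\<in>UNIV. real_of_int (n i) *\<^sub>R e i | n. True}"

definition zak_transform ::
    "('n::finite \<Rightarrow> real ^ 'n) \<Rightarrow> (real ^ 'n \<Rightarrow> complex) \<Rightarrow> (real ^ 'n) \<times> (real ^ 'n) \<Rightarrow> complex" where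
  "zak_transform e f = (\<lambda>(x, \<xi>). \<Sum>\<^sub>\<infinity>j\<in>lattice_of e. f (x - j) * cis (j \<bullet> \<xi>))"

text \<open>
  Quasi-periodicity of a distribution \<open>F\<close> on the test function space \<open>V\<close>, where translations and
  multiplications by functions act on \<open>F\<close> by transposition: \<open>F(x + k, \<xi>)\<close> is the functional
  mapping \<open>\<phi>\<close> to \<open>F (\<lambda>(x, \<xi>). \<phi> (x - k, \<xi>))\<close>.
\<close>

definition quasi_periodic ::
    "('n::finite \<Rightarrow> real ^ 'n) \<Rightarrow> ((real ^ 'n) \<times> (real ^ 'n) \<Rightarrow> complex) set \<Rightarrow>
     (((real ^ 'n) \<times> (real ^ 'n) \<Rightarrow> complex) \<Rightarrow> complex) \<Rightarrow> bool" where
  "quasi_periodic e V F \<longleftrightarrow>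
     (\<forall>k\<in>lattice_of e. \<forall>\<phi>\<in>V. F (\<lambda>(x, \<xi>). \<phi> (x - k, \<xi>)) = F (\<lambda>(x, \<xi>). cis (k \<bullet> \<xi>) * \<phi> (x, \<xi>))) \<and>
     (\<forall>\<kappa>\<in>lattice_of (dual_basis e). \<forall>\<phi>\<in>V. F (\<lambda>(x, \<xi>). \<phi> (x, \<xi> - \<kappa>)) = F \<phi>)"

text \<open>The spaces of quasi-periodic distributions carry the subspace topology.\<close>

definition zak_roumieu_dual_topology ::
    "('n::finite \<Rightarrow> real ^ 'n) \<Rightarrow> real \<Rightarrow> real \<Rightarrow>
     (((real ^ 'n) \<times> (real ^ 'n) \<Rightarrow> complex) \<Rightarrow> complex) topology" where
  "zak_roumieu_dual_topology e s \<sigma> =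
     subtopology (gs_roumieu_dual_topology (two_groups s \<sigma>) (two_groups \<sigma> s))
       {F \<in> gs_roumieu_dual (two_groups s \<sigma>) (two_groups \<sigma> s).
          quasi_periodic e (gs_roumieu (two_groups s \<sigma>) (two_groups \<sigma> s)) F}"

definition zak_beurling_dual_topology ::
    "('n::finite \<Rightarrow> real ^ 'n) \<Rightarrow> real \<Rightarrow> real \<Rightarrow>
     (((real ^ 'n) \<times> (real ^ 'n) \<Rightarrow> complex) \<Rightarrow> complex) topology" where
  "zak_beurling_dual_topology e s \<sigma> =
     subtopology (gs_beurling_dual_topology (two_groups s \<sigma>) (two_groups \<sigma> s))
       {F \<in> gs_beurling_dual (two_groups s \<sigma>) (two_groups \<sigma> s).
          quasi_periodic e (gs_beurling (two_groups s \<sigma>) (two_groups \<sigma> s)) F}"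

text \<open>
  \<open>T\<close>, defined on distributions (functionals on \<open>V\<close>), extends an operator \<open>Z\<close> defined on
  Schwartz functions, the values of \<open>T\<close> being functionals on \<open>W\<close>.
\<close>

definition extends_from_schwartz ::
    "('a::euclidean_space \<Rightarrow> complex) set \<Rightarrow> ('b::euclidean_space \<Rightarrow> complex) set \<Rightarrow>
     (('a \<Rightarrow> complex) \<Rightarrow> ('b \<Rightarrow> complex)) \<Rightarrow>
     ((('a \<Rightarrow> complex) \<Rightarrow> complex) \<Rightarrow> (('b \<Rightarrow> complex) \<Rightarrow> complex)) \<Rightarrow> bool" where
  "extends_from_schwartz V W Z T \<longleftrightarrow>
     (\<forall>f\<in>schwartz_space. T (distribution_of V f) = distribution_of W (Z f))"

end

theory Submission
  imports Defs "HOL-Complex_Analysis.Complex_Analysis"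
begin

text \<open>
  The extension of the Zak transform is the transpose of
  \<open>zak_adjoint\<close>, which sends a test function \<open>\<phi>(x, \<xi>)\<close> to
  \<open>sum over j of the integral of \<phi>(x + j, \<xi>) cis (j \<bullet> \<xi>) over \<xi>\<close> and is continuous between the test function spaces.
  The inverse is the transpose of \<open>\<phi> \<mapsto> \<phi> \<otimes> \<psi>\<close> for a window \<open>\<psi>\<close> whose lattice Fourier
  coefficients vanish except the one at \<open>0\<close>, so that \<open>zak_adjoint (\<phi> \<otimes> \<psi>) = \<phi>\<close>. Conversely a
  quasi-periodic functional takes the same value at \<open>zak_adjoint \<phi> \<otimes> \<psi>\<close> and at \<open>\<phi>\<close>:
  quasi-periodicity moves the translations to modulations, Poisson summation turns the sum over
  the lattice into one over the dual lattice, and the periodization of \<open>\<psi>\<close> is constant.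
  Uniqueness follows from the density of functions in the dual spaces, obtained by convolving
  twice with an approximate identity and replacing the outer integral by a finite sum.
\<close>

text \<open>The parameters s and \<sigma> are unrelated, so the test spaces may be {0}. This is
  never decided from the parameters. Either the space is {0}, both duals vanish and the window 0
  will do; or a nonzero test function is at hand, and its existence forces s + \<sigma> \<ge> 1 (> 1
  in the Beurling case), which is what the Fourier transform needs to carry the class (s, \<sigma>)
  to the class (\<sigma>, s), where the window has to lie. The exponents fit because s governs both
  the powers of x and the derivatives in \<xi>: integration by parts in \<xi> gives decay in the
  lattice point j of the kind that pays for a translation by j in x. Functionals are bounded only at
  some scale h of the defining norms, so sums, products and convolutions are all estimated with
  explicit scales. The obstacle to density lies in the Beurling case: the dual carries an inductive
  limit topology, so a functional has to be extended to a step space, where test functions are not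
  known to be dense; the extension is obtained as the limit of the approximants themselves.\<close>

abbreviation "md \<equiv> multi_deriv"
abbreviation "mon \<equiv> monomial_at"
abbreviation "amon \<alpha> x \<equiv> \<bar>monomial_at \<alpha> x\<bar>"
abbreviation "itd \<equiv> iterated_deriv"
abbreviation "pd \<equiv> partial_deriv"
abbreviation "restr \<equiv> restrict_functional"
abbreviation "step_dual_top \<equiv> gs_step_dual_topology"
abbreviation "gsn \<equiv> gs_norm"
abbreviation "lfun \<equiv> linear_functional_on"
abbreviation "csl e \<equiv> count_space (lattice_of e)"
abbreviation "rsuc n \<equiv> inverse (real (Suc n))"
abbreviation lint :: "('a::euclidean_space \<Rightarrow> 'b::{banach,second_countable_topology}) \<Rightarrow> 'b" (binder "LB " 10)
  where "lint f \<equiv> integral\<^sup>L lborel f"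
abbreviation "bm \<equiv> borel_measurable borel"
abbreviation "inc \<beta> b \<equiv> \<beta>(b := Suc (\<beta> b))"
abbreviation "lat \<equiv> lattice_of"
notation inner (infixl "*." 70)
notation scaleR (infixr "*!" 75)
lemmas integrable_bd = Bochner_Integration.integrable_bound
  and integral_cg = Bochner_Integration.integral_cong and integral_nn = Bochner_Integration.integral_nonneg
  and bm_contI = borel_measurable_continuous_onI and lfun_def = linear_functional_on_def and restr_def = restrict_functional_def
  and int_mult_r = integral_mult_right_zero and int_mult_l = integral_mult_left_zero
  and intb_mult_r = integrable_mult_right and intb_mult_l = integrable_mult_left

section \<open>Partial derivatives\<close>

text \<open>A candidate for all partial derivatives of \<open>F (\<lambda>_. 0)\<close> at once.
  Smoothness and the values of \<open>multi_deriv\<close> for sums, dilations, characters, tensor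
  products and parameter integrals follow from exhibiting such a family, so each operation needs a
  single first-order check and no induction on the order.\<close>

definition deriv_family :: "(('a::euclidean_space => nat) => 'a => complex) => bool" where
 "deriv_family F \<longleftrightarrow> (\<forall>be x. (F be has_derivative
  (%v. \<Sum>b\<in>Basis. (v *. b) *! F (inc be b) x)) (at x))"

lemma partial_deriv_eq:
 assumes "(f has_derivative D) (at x)"
 shows "pd b f x = D b"
proof -
 have "((%t. f (x + t *! b)) has_derivative (%t. D (t *! b))) (at 0)"
 proof -
  have "((%t. x + t *! b) has_derivative (%t. t *! b)) (at 0)"
   by (auto intro!: derivative_eq_intros)
  from has_derivative_compose[OF this, of f D] assms show ?thesis by simp
 qed
 moreover have "D (t *! b) = t *! D b" for t
  using has_derivative_linear[OF assms] by (simp add: linear_cmul)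
 ultimately have "((%t. f (x + t *! b)) has_vector_derivative D b) (at 0)"
  by (simp add: has_vector_derivative_def)
 thus ?thesis
  unfolding partial_deriv_def by (rule vector_derivative_at)
qed

lemma has_derivative_partial_deriv:
 fixes f :: "'a::euclidean_space => complex"
 assumes "f differentiable (at x)"
 shows "(f has_derivative (%v. \<Sum>b\<in>Basis. (v *. b) *! pd b f x)) (at x)"
proof -
 obtain D where D: "(f has_derivative D) (at x)"
  using assms unfolding differentiable_def by blast
 have "D v = (\<Sum>b\<in>Basis. (v *. b) *! pd b f x)" for v
 proof -
  have lin: "linear D" using D by (rule has_derivative_linear)
  have "D v = D (\<Sum>b\<in>Basis. (v *. b) *! b)" by (simp add: euclidean_representation)
  also have "... = (\<Sum>b\<in>Basis. (v *. b) *! D b)"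
   using lin by (simp add: linear_sum linear_cmul)
  finally show ?thesis by (simp add: partial_deriv_eq[OF D])
 qed
 hence "D = (%v. \<Sum>b\<in>Basis. (v *. b) *! pd b f x)" by blast
 thus ?thesis using D by simp
qed

lemma partial_deriv_has_vector_derivative:
 fixes f :: "'a::euclidean_space => complex"
 assumes "f differentiable (at (x + t *! b))"
 shows "((%t. f (x + t *! b)) has_vector_derivative pd b f (x + t *! b)) (at t)"
proof -
 obtain D where D: "(f has_derivative D) (at (x + t *! b))"
  using assms unfolding differentiable_def by blast
 have "((%t. x + t *! b) has_derivative (%t. t *! b)) (at t)"
  by (auto intro!: derivative_eq_intros)
 from has_derivative_compose[OF this, of f D] D
 have "((%t. f (x + t *! b)) has_derivative (%t. D (t *! b))) (at t)" by simp
 moreover have "D (t *! b) = t *! D b" for t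
  using has_derivative_linear[OF D] by (simp add: linear_cmul)
 ultimately show ?thesis
  by (simp add: has_vector_derivative_def partial_deriv_eq[OF D])
qed

lemma iterated_deriv_Nil [simp]: "itd [] f = f"
 by (simp add: iterated_deriv_def)

lemma iterated_deriv_Cons [simp]: "itd (b # bs) f = pd b (itd bs f)"
 by (simp add: iterated_deriv_def)

lemma iterated_deriv_append: "itd (as @ bs) f = itd as (itd bs f)"
 by (simp add: iterated_deriv_def)

lemma smoothD: "smooth f ==> set bs \<subseteq> Basis ==> itd bs f differentiable (at x)"
 by (simp add: smooth_def)

lemma smooth_differentiable: "smooth f ==> f differentiable (at x)"
 using smoothD[of f "[]"] by simp

lemma smooth_continuous_on: "smooth f ==> continuous_on S f"
 by (meson continuous_at_imp_continuous_on differentiable_imp_continuous_within smooth_differentiable)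

lemma smooth_iterated_deriv: "smooth f ==> set bs \<subseteq> Basis ==> smooth (itd bs f)"
 unfolding smooth_def iterated_deriv_append[symmetric] by simp

lemma smooth_partial_deriv: "smooth f ==> b : Basis ==> smooth (pd b f)"
 using smooth_iterated_deriv[of f "[b]"] by simp

text \<open>The second difference of \<open>g\<close> over a square of side h equals h^2 times
  \<open>g12\<close> at one interior point and h^2 times \<open>g21\<close> at another, by two mean
  value theorems in either order. Continuity at the origin gives equality as h tends to 0.\<close>

lemma mixed_derivatives_eq_real:
 fixes g :: "real => real => real"
 assumes g1: "!!s t. ((%s. g s t) has_real_derivative g1 s t) (at s)"
  and g2: "!!s t. ((%t. g s t) has_real_derivative g2 s t) (at t)"
  and g12: "!!s t. ((%t. g1 s t) has_real_derivative g12 s t) (at t)"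
  and g21: "!!s t. ((%s. g2 s t) has_real_derivative g21 s t) (at s)"
  and c12: "continuous (at (0, 0)) (%(s, t). g12 s t)"
  and c21: "continuous (at (0, 0)) (%(s, t). g21 s t)"
 shows "g12 0 0 = g21 0 0"
proof -
 have ex: "\<exists>p q. 0 < fst p \<and> fst p < h \<and> 0 < snd p \<and> snd p < h \<and>
       0 < fst q \<and> fst q < h \<and> 0 < snd q \<and> snd q < h \<and>
       (case p of (s, t) => g12 s t) = (case q of (s, t) => g21 s t)" if h: "0 < h" for h
 proof -
  have "((%s. g s h - g s 0) has_real_derivative (g1 s h - g1 s 0)) (at s)" for s
   by (intro DERIV_diff g1)
  then obtain u where u: "0 < u" "u < h" "(g h h - g h 0) - (g 0 h - g 0 0) = (h - 0) * (g1 u h - g1 u 0)"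
   using MVT2[of 0 h "%s. g s h - g s 0" "%s. g1 s h - g1 s 0"] h by blast
  obtain v where v: "0 < v" "v < h" "g1 u h - g1 u 0 = (h - 0) * g12 u v"
   using MVT2[of 0 h "g1 u" "g12 u"] h g12 by blast
  have "((%t. g h t - g 0 t) has_real_derivative (g2 h t - g2 0 t)) (at t)" for t
   by (intro DERIV_diff g2)
  then obtain v' where v': "0 < v'" "v' < h" "(g h h - g 0 h) - (g h 0 - g 0 0) = (h - 0) * (g2 h v' - g2 0 v')"
   using MVT2[of 0 h "%t. g h t - g 0 t" "%t. g2 h t - g2 0 t"] h by blast
  obtain u' where u': "0 < u'" "u' < h" "g2 h v' - g2 0 v' = (h - 0) * g21 u' v'"
   using MVT2[of 0 h "%s. g2 s v'" "%s. g21 s v'"] h g21 by blast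
  have "h * (h * g12 u v) = h * (h * g21 u' v')"
   using u(3) v(3) v'(3) u'(3) by (simp add: algebra_simps)
  hence "g12 u v = g21 u' v'" using h by simp
  thus ?thesis using u v u' v' by (intro exI[of _ "(u,v)"] exI[of _ "(u',v')"]) simp
 qed
 have "\<forall>n. \<exists>pq. 0 < fst (fst pq) \<and> fst (fst pq) < 1 / real (Suc n) \<and> 0 < snd (fst pq) \<and> snd (fst pq) < 1 / real (Suc n) \<and>
       0 < fst (snd pq) \<and> fst (snd pq) < 1 / real (Suc n) \<and> 0 < snd (snd pq) \<and> snd (snd pq) < 1 / real (Suc n) \<and>
       (case fst pq of (s, t) => g12 s t) = (case snd pq of (s, t) => g21 s t)"
  using ex by (metis (no_types, lifting) fst_conv of_nat_0_less_iff snd_conv zero_less_Suc zero_less_divide_1_iff)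
 then obtain pq where pq: "!!n. 0 < fst (fst (pq n)) \<and> fst (fst (pq n)) < 1 / real (Suc n) \<and> 0 < snd (fst (pq n)) \<and> snd (fst (pq n)) < 1 / real (Suc n) \<and>
       0 < fst (snd (pq n)) \<and> fst (snd (pq n)) < 1 / real (Suc n) \<and> 0 < snd (snd (pq n)) \<and> snd (snd (pq n)) < 1 / real (Suc n) \<and>
       (case fst (pq n) of (s, t) => g12 s t) = (case snd (pq n) of (s, t) => g21 s t)"
  by metis
 have lim: "z \<longlonglongrightarrow> 0" if "!!n. 0 < z n \<and> z n < 1 / real (Suc n)" for z :: "nat => real"
 proof (rule tendsto_sandwich[OF _ _ tendsto_const LIMSEQ_inverse_real_of_nat])
  show "\<forall>\<^sub>F n in sequentially. 0 <= z n" using that by (auto intro!: always_eventually less_imp_le)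
  show "\<forall>\<^sub>F n in sequentially. z n <= rsuc n"
   using that by (auto intro!: always_eventually less_imp_le simp: inverse_eq_divide simp del: of_nat_Suc)
 qed
 have "(%n. (fst (fst (pq n)), snd (fst (pq n)))) \<longlonglongrightarrow> (0, 0)"
  by (intro tendsto_Pair lim) (use pq in auto)
 hence l1: "(%n. fst (pq n)) \<longlonglongrightarrow> (0, 0)" by simp
 have "(%n. (fst (snd (pq n)), snd (snd (pq n)))) \<longlonglongrightarrow> (0, 0)"
  by (intro tendsto_Pair lim) (use pq in auto)
 hence l2: "(%n. snd (pq n)) \<longlonglongrightarrow> (0, 0)" by simp
 have "(%n. (case fst (pq n) of (s, t) => g12 s t)) \<longlonglongrightarrow> g12 0 0"
  using continuous_at_sequentially[of "(0,0)" "%(s, t). g12 s t"] c12 l1 by (auto simp: o_def)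
 moreover have "(%n. (case snd (pq n) of (s, t) => g21 s t)) \<longlonglongrightarrow> g21 0 0"
  using continuous_at_sequentially[of "(0,0)" "%(s, t). g21 s t"] c21 l2 by (auto simp: o_def)
 ultimately show ?thesis using pq LIMSEQ_unique by simp
qed

lemma smooth_line_derivative:
 fixes f :: "'a::euclidean_space => complex"
 assumes "smooth f"
 shows "((%t. f (x + t *! b)) has_vector_derivative pd b f (x + t *! b)) (at t)"
 by (intro partial_deriv_has_vector_derivative smooth_differentiable assms)

text \<open>The mean value argument is real, so it is applied to the real and imaginary parts of
  \<open>f\<close> on the plane through x spanned by a and b.\<close>

lemma partial_deriv_commute:
 fixes f :: "'a::euclidean_space => complex"
 assumes f: "smooth f" and a: "a : Basis" and b: "b : Basis"
 shows "pd a (pd b f) = pd b (pd a f)"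
proof
 fix x
 define X where "X = (%(s::real) (t::real). x + s *! a + t *! b)"
 have X2: "X s t = (x + t *! b) + s *! a" for s t by (simp add: X_def)
 have *: "L (pd b (pd a f) x) = L (pd a (pd b f) x)"
  if L: "bounded_linear L" for L :: "complex => real"
 proof -
  note lin = bounded_linear.has_vector_derivative[OF L]
  have d1: "((%s. L (h (X s t))) has_real_derivative L (pd a h (X s t))) (at s)"
   if "smooth h" for h s t
   unfolding has_real_derivative_iff_has_vector_derivative X2
   by (intro lin smooth_line_derivative that)
  have d2: "((%t. L (h (X s t))) has_real_derivative L (pd b h (X s t))) (at t)"
   if "smooth h" for h s t
   unfolding has_real_derivative_iff_has_vector_derivative X_def
   by (intro lin smooth_line_derivative that)
  have c: "continuous (at (0, 0)) (%(s, t). L (h (X s t)))" if "smooth h" for h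
  proof -
   have "continuous_on UNIV (%p. L (h (X (fst p) (snd p))))"
    unfolding X_def
    by (intro continuous_on_compose2[OF linear_continuous_on[OF L] ]
       continuous_on_compose2[OF smooth_continuous_on[OF that]] continuous_intros) auto
   thus ?thesis
    by (simp add: case_prod_unfold continuous_on_eq_continuous_at)
  qed
  have "L (pd b (pd a f) (X 0 0)) = L (pd a (pd b f) (X 0 0))"
   using f a b
   by (intro mixed_derivatives_eq_real[of "%s t. L (f (X s t))" "%s t. L (pd a f (X s t))"
      "%s t. L (pd b f (X s t))" "%s t. L (pd b (pd a f) (X s t))"
      "%s t. L (pd a (pd b f) (X s t))"])
    (auto intro!: d1 d2 c smooth_partial_deriv)
  thus ?thesis by (simp add: X_def)
 qed
 show "pd a (pd b f) x = pd b (pd a f) x"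
  using *[OF bounded_linear_Re] *[OF bounded_linear_Im] by (simp add: complex_eq_iff)
qed

lemma iterated_deriv_move:
 assumes "smooth f" "set (as @ b # cs) \<subseteq> Basis"
 shows "itd (as @ b # cs) f = itd (b # as @ cs) f"
 using assms(2)
proof (induction as)
 case (Cons a as)
 have "itd ((a # as) @ b # cs) f = pd a (pd b (itd (as @ cs) f))"
  using Cons by simp
 also have "... = pd b (pd a (itd (as @ cs) f))"
  using Cons.prems by (intro partial_deriv_commute smooth_iterated_deriv assms) auto
 finally show ?case by simp
qed simp

definition basis_list :: "'a::euclidean_space list" where
 "basis_list = (SOME bs. distinct bs \<and> set bs = Basis)"

lemma basis_list: "distinct (basis_list :: 'a::euclidean_space list)" "set (basis_list :: 'a list) = Basis"
proof -
 have "\<exists>bs::'a list. distinct bs \<and> set bs = Basis"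
  using finite_distinct_list[OF finite_Basis] by blast
 from someI_ex[OF this] show "distinct (basis_list :: 'a list)" "set (basis_list :: 'a list) = Basis"
  unfolding basis_list_def by auto
qed

definition index_list :: "('a::euclidean_space => nat) => 'a list" where
 "index_list be = concat (map (%b. replicate (be b) b) basis_list)"

lemma multi_deriv_index_list: "md be f = itd (index_list be) f"
 by (simp add: multi_deriv_def index_list_def basis_list_def)

lemma set_index_list: "set (index_list be) \<subseteq> Basis"
 by (auto simp: index_list_def basis_list)

lemma count_index_list: "count_list (index_list be) b = (if b : Basis then be b else 0)"
proof -
 have *: "count_list (concat (map (%b. replicate (be b) b) bs)) b = (if b : set bs then be b else 0)"
  if "distinct bs" for bs :: "'a list"
  using that
 proof (induction bs)
  case (Cons a bs)
  have "count_list (replicate n a) b = (if a = b then n else 0)" for n a by (induction n) auto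
  thus ?case using Cons by (auto simp: count_list_append)
 qed simp
 show ?thesis unfolding index_list_def by (subst *) (simp_all add: basis_list)
qed

lemma length_index_list: "length (index_list be) = sum be Basis"
 by (simp add: index_list_def length_concat o_def sum_list_distinct_conv_sum_set basis_list)

lemma multi_deriv_cong: "(!!b. b : Basis ==> be b = ga b) ==> md be f = md ga f"
 unfolding multi_deriv_index_list index_list_def
 by (rule arg_cong[where f = "%l. itd (concat l) f"]) (simp add: basis_list)

lemma multi_deriv_zero [simp]: "md (%_. 0) f = f"
proof -
 have "index_list (%_::'a. 0) = []" by (simp add: index_list_def)
 thus ?thesis by (simp add: multi_deriv_index_list)
qed

lemma multi_deriv_differentiable: "smooth f ==> md be f differentiable (at x)"
 unfolding multi_deriv_index_list by (rule smoothD[OF _ set_index_list])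

lemma smooth_multi_deriv: "smooth f ==> smooth (md be f)"
 unfolding multi_deriv_index_list by (rule smooth_iterated_deriv[OF _ set_index_list])

lemma multi_deriv_Suc:
 fixes f :: "'a::euclidean_space => complex"
 assumes f: "smooth f" and b: "b : Basis"
 shows "md (inc be b) f = pd b (md be f)"
proof -
 obtain as cs where split: "basis_list = as @ b # cs"
  using b split_list[of b basis_list] by (auto simp: basis_list)
 have nin: "b \<notin> set as" "b \<notin> set cs" using basis_list(1)[where 'a='a] unfolding split by auto
 define P where "P = concat (map (%b. replicate (be b) b) as)"
 define Q where "Q = replicate (be b) b @ concat (map (%b. replicate (be b) b) cs)"
 have "index_list be = P @ Q" by (simp add: index_list_def split P_def Q_def)
 moreover have "index_list (inc be b) = P @ b # Q"
 proof -
  have "map (%c. replicate ((inc be b) c) c) as = map (%b. replicate (be b) b) as"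
   "map (%c. replicate ((inc be b) c) c) cs = map (%b. replicate (be b) b) cs"
   using nin by auto
  thus ?thesis
   by (simp only: index_list_def split P_def Q_def map_append list.map concat_append concat.simps) simp
 qed
 moreover have "set (P @ b # Q) \<subseteq> Basis"
  using set_index_list[of be] b calculation(1) by auto
 ultimately show ?thesis
  using iterated_deriv_move[OF f, of P b Q] by (simp add: multi_deriv_index_list)
qed

lemma deriv_family_multi_deriv: "smooth f ==> deriv_family (%be. md be f)"
 unfolding deriv_family_def
 by (simp add: multi_deriv_Suc has_derivative_partial_deriv multi_deriv_differentiable)

lemma deriv_family_partial:
 assumes "deriv_family F" "b : Basis"
 shows "pd b (F be) = F (inc be b)"
proof
 fix x
 have "(F be has_derivative (%v. \<Sum>b\<in>Basis. (v *. b) *! F (inc be b) x)) (at x)"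
  using assms by (simp add: deriv_family_def)
 from partial_deriv_eq[OF this, of b]
 have "pd b (F be) x = (\<Sum>c\<in>Basis. (b *. c) *! F (be(c := Suc (be c))) x)" .
 also have "... = (\<Sum>c\<in>Basis. if c = b then F (be(c := Suc (be c))) x else 0)"
  using assms(2) by (intro sum.cong) (auto simp: inner_Basis)
 also have "... = F (inc be b) x" using assms(2) by (simp add: sum.delta)
 finally show "pd b (F be) x = F (inc be b) x" .
qed

lemma deriv_family_iterated:
 assumes "deriv_family F" "set bs \<subseteq> Basis"
 shows "itd bs (F be) = F (%b. be b + count_list bs b)"
 using assms(2)
proof (induction bs)
 case (Cons b bs)
 hence "itd (b # bs) (F be) = pd b (F (%b. be b + count_list bs b))" by simp
 also have "... = F ((%b. be b + count_list bs b)(b := Suc (be b + count_list bs b)))"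
  using Cons.prems by (subst deriv_family_partial[OF assms(1)]) auto
 also have "(%b. be b + count_list bs b)(b := Suc (be b + count_list bs b)) = (%c. be c + count_list (b # bs) c)"
  by (auto simp: fun_eq_iff)
 finally show ?case .
qed simp

lemma deriv_family_smooth:
 assumes "deriv_family F" shows "smooth (F be)"
 unfolding smooth_def differentiable_def
 using assms by (auto simp: deriv_family_iterated deriv_family_def)

text \<open>A family may depend on the values of its index outside \<open>Basis\<close>, which
  \<open>multi_deriv\<close> does not see; hence the truncated index on the right.\<close>

lemma deriv_family_multi:
 assumes "deriv_family F"
 shows "md be (F (%_. 0)) = F (%b. if b : Basis then be b else 0)"
 using deriv_family_iterated[OF assms set_index_list, of be "%_. 0"]
 by (simp add: multi_deriv_index_list count_index_list)

lemma smooth_iterated_multi: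
 assumes "smooth f" "set bs \<subseteq> Basis"
 shows "itd bs f = md (count_list bs) f"
 using deriv_family_iterated[OF deriv_family_multi_deriv[OF assms(1)] assms(2), of "%_. 0"] by simp

lemma deriv_familyD:
 "deriv_family F ==> (F be has_derivative (%v. \<Sum>b\<in>Basis. (v *. b) *! F (inc be b) x)) (at x)"
 by (simp add: deriv_family_def)

lemma deriv_family_add:
 assumes "deriv_family F" "deriv_family G"
 shows "deriv_family (%be x. F be x + G be x)"
 unfolding deriv_family_def
 using has_derivative_add[OF deriv_familyD[OF assms(1)] deriv_familyD[OF assms(2)]]
 by (simp add: scaleR_add_right sum.distrib)

lemma deriv_family_scale:
 assumes "deriv_family F"
 shows "deriv_family (%be x. c * F be x)"
 unfolding deriv_family_def
 using has_derivative_mult_right[OF deriv_familyD[OF assms(1)], of c]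
 by (simp add: sum_distrib_left)

lemma smooth_add: "smooth f ==> smooth g ==> smooth (%x. f x + g x)"
 using deriv_family_smooth[OF deriv_family_add[OF deriv_family_multi_deriv deriv_family_multi_deriv, of f g], of "%_. 0"]
 by simp

lemma multi_deriv_add:
 assumes "smooth f" "smooth g"
 shows "md be (%x. f x + g x) = (%x. md be f x + md be g x)"
 using deriv_family_multi[OF deriv_family_add[OF deriv_family_multi_deriv deriv_family_multi_deriv], OF assms, of be]
  multi_deriv_cong[of be "%b. if b : Basis then be b else 0" f]
  multi_deriv_cong[of be "%b. if b : Basis then be b else 0" g]
 by simp

lemma smooth_scale: assumes "smooth f" shows "smooth (%x. c * f x)"
 using deriv_family_smooth[OF deriv_family_scale[OF deriv_family_multi_deriv[OF assms], of c], of "%_. 0"]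
 by simp

lemma multi_deriv_scale:
 assumes "smooth f"
 shows "md be (%x. c * f x) = (%x. c * md be f x)"
 using deriv_family_multi[OF deriv_family_scale[OF deriv_family_multi_deriv[OF assms], of c], of be]
  multi_deriv_cong[of be "%b. if b : Basis then be b else 0" f]
 by simp

lemma deriv_family_affine:
 assumes "deriv_family F"
 shows "deriv_family (%be x. of_real (c ^ sum be Basis) * F be (a + c *! x))"
 unfolding deriv_family_def
proof (intro allI)
 fix be x
 have "((%x. a + c *! x) has_derivative (%v. c *! v)) (at x)"
  by (auto intro!: derivative_eq_intros)
 from has_derivative_compose[OF this deriv_familyD[OF assms]]
 have "((%x. F be (a + c *! x)) has_derivative
   (%v. \<Sum>b\<in>Basis. ((c *! v) *. b) *! F (inc be b) (a + c *! x))) (at x)" .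
 from has_derivative_mult_right[OF this, of "of_real (c ^ sum be Basis)"]
 show "((%x. of_real (c ^ sum be Basis) * F be (a + c *! x)) has_derivative
    (%v. \<Sum>b\<in>Basis. (v *. b) *! (of_real (c ^ sum (inc be b) Basis) * F (inc be b) (a + c *! x)))) (at x)"
 proof (rule has_derivative_eq_rhs, intro ext)
  fix v
  have s: "sum (inc be b) Basis = Suc (sum be Basis)" if "b : Basis" for b
  proof -
   have "sum (inc be b) Basis = (\<Sum>c\<in>Basis. be c + (if c = b then 1 else 0))"
    by (intro sum.cong) auto
   thus ?thesis using that by (simp add: sum.distrib)
  qed
  show "of_real (c ^ sum be Basis) * (\<Sum>b\<in>Basis. (c *! v *. b) *! F (inc be b) (a + c *! x)) =
   (\<Sum>b\<in>Basis. (v *. b) *! (of_real (c ^ sum (inc be b) Basis) * F (inc be b) (a + c *! x)))"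
   unfolding sum_distrib_left
   by (intro sum.cong refl) (simp add: s scaleR_conv_of_real del: fun_upd_apply)
 qed
qed

lemma smooth_affine: assumes "smooth f" shows "smooth (%x. f (a + c *! x))"
 using deriv_family_smooth[OF deriv_family_affine[OF deriv_family_multi_deriv[OF assms], of c a], of "%_. 0"]
 by simp

lemma multi_deriv_affine:
 assumes "smooth f"
 shows "md be (%x. f (a + c *! x)) = (%x. of_real (c ^ sum be Basis) * md be f (a + c *! x))"
 using deriv_family_multi[OF deriv_family_affine[OF deriv_family_multi_deriv[OF assms], of c a], of be]
  multi_deriv_cong[of be "%b. if b : Basis then be b else 0" f]
 by simp

lemma smooth_translate: "smooth f ==> smooth (%x. f (x - k))"
 using smooth_affine[of f "-k" 1] by simp

lemma multi_deriv_translate: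
 "smooth f ==> md be (%x. f (x - k)) = (%x. md be f (x - k))"
 using multi_deriv_affine[of f be "-k" 1] by simp

section \<open>Products and parameter integrals\<close>

text \<open>All ways of handing each derivative in a list to one of two factors. The Leibniz rule
  summed over this list has no binomial coefficients; its 2^n terms become the factor 2^n in the
  bounds.\<close>

fun splits :: "'b list => ('b list \<times> 'b list) list" where
 "splits [] = [([], [])]"
| "splits (b # bs) = map (%(c, d). (b # c, d)) (splits bs) @ map (%(c, d). (c, b # d)) (splits bs)"

lemma length_splits: "length (splits bs) = 2 ^ length bs"
 by (induction bs) auto

lemma count_splits: "(c, d) \<in> set (splits bs) ==> count_list c b + count_list d b = count_list bs b"
 by (induction bs arbitrary: c d) auto

lemma set_splits: "(c, d) \<in> set (splits bs) ==> set c \<subseteq> set bs \<and> set d \<subseteq> set bs"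
proof (induction bs arbitrary: c d)
 case (Cons b bs)
 thus ?case by fastforce
qed simp

lemma partial_deriv_mult:
 fixes f g :: "'a::euclidean_space => complex"
 assumes "f differentiable (at x)" "g differentiable (at x)"
 shows "pd b (%x. f x * g x) x = pd b f x * g x + f x * pd b g x"
proof -
 obtain D E where D: "(f has_derivative D) (at x)" and E: "(g has_derivative E) (at x)"
  using assms unfolding differentiable_def by blast
 show ?thesis
  by (simp add: partial_deriv_eq[OF has_derivative_mult[OF D E]] partial_deriv_eq[OF D] partial_deriv_eq[OF E])
qed

lemma iterated_deriv_mult_smooth:
 fixes f g :: "'a::euclidean_space => complex"
 assumes f: "smooth f" and g: "smooth g" and "set bs \<subseteq> Basis"
 shows "itd bs (%x. f x * g x) =
     (%x. \<Sum>p\<leftarrow>splits bs. itd (fst p) f x * itd (snd p) g x) \<and>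
    (\<forall>x. itd bs (%x. f x * g x) differentiable (at x))"
 using assms(3)
proof (induction bs)
 case Nil
 show ?case by (simp add: differentiable_mult[OF smooth_differentiable[OF f] smooth_differentiable[OF g]])
next
 case (Cons b bs)
 define P where "P = (%cs (p::'a list \<times> 'a list) x. itd (fst p) f x * itd (snd p) g x)"
 have sm: "set (fst p) \<subseteq> Basis \<and> set (snd p) \<subseteq> Basis" if "p : set (splits bs)" for p
  using set_splits[of "fst p" "snd p" bs] that Cons.prems by auto
 have diff: "itd c f differentiable (at x)" "itd d g differentiable (at x)"
  if "set c \<subseteq> Basis" "set d \<subseteq> Basis" for c d x using that f g by (auto intro: smoothD)
 have ps: "pd b (%x. \<Sum>p\<leftarrow>ps. h p x) x = (\<Sum>p\<leftarrow>ps. pd b (h p) x) \<and>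
    (%x. \<Sum>p\<leftarrow>ps. h p x) differentiable (at x)"
  if "!!p. p : set ps ==> h p differentiable (at x)" for ps x and h :: "'a list \<times> 'a list => 'a => complex"
  using that
 proof (induction ps)
  case Nil
  have z: "((%x::'a. 0::complex) has_derivative (%v. 0)) (at x)" by simp
  show ?case by (simp add: partial_deriv_eq[OF z])
 next
  case (Cons p ps)
  have dp: "h p differentiable (at x)" by (rule Cons.prems) simp
  have dps: "(%x. \<Sum>p\<leftarrow>ps. h p x) differentiable (at x)"
   and IH: "pd b (%x. \<Sum>p\<leftarrow>ps. h p x) x = (\<Sum>p\<leftarrow>ps. pd b (h p) x)"
   using Cons.IH Cons.prems by simp_all
  obtain D E where D: "(h p has_derivative D) (at x)" and E: "((%x. \<Sum>p\<leftarrow>ps. h p x) has_derivative E) (at x)"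
   using dp dps unfolding differentiable_def by blast
  have "pd b (%x. h p x + (\<Sum>p\<leftarrow>ps. h p x)) x = pd b (h p) x + pd b (%x. \<Sum>p\<leftarrow>ps. h p x) x"
   by (simp add: partial_deriv_eq[OF has_derivative_add[OF D E]] partial_deriv_eq[OF D] partial_deriv_eq[OF E])
  thus ?case using IH differentiable_add[OF dp dps] by simp
 qed
 have eq: "itd (b # bs) (%x. f x * g x) =
     (%x. \<Sum>p\<leftarrow>splits (b # bs). itd (fst p) f x * itd (snd p) g x)"
 proof
  fix x
  have "itd (b # bs) (%x. f x * g x) x =
    pd b (%x. \<Sum>p\<leftarrow>splits bs. itd (fst p) f x * itd (snd p) g x) x"
   using Cons by simp
  also have "... = (\<Sum>p\<leftarrow>splits bs. pd b (%x. itd (fst p) f x * itd (snd p) g x) x)"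
   using sm by (intro conjunct1[OF ps]) (auto intro!: differentiable_mult diff)
  also have "... = (\<Sum>p\<leftarrow>splits bs. pd b (itd (fst p) f) x * itd (snd p) g x +
           itd (fst p) f x * pd b (itd (snd p) g) x)"
   using sm by (intro arg_cong[where f=sum_list] map_cong refl partial_deriv_mult) (auto intro!: diff)
  also have "... = (\<Sum>p\<leftarrow>splits (b # bs). itd (fst p) f x * itd (snd p) g x)"
   by (simp add: sum_list_addf o_def case_prod_unfold)
  finally show "itd (b # bs) (%x. f x * g x) x = (\<Sum>p\<leftarrow>splits (b # bs). itd (fst p) f x * itd (snd p) g x)" .
 qed
 have sm': "set (fst p) \<subseteq> Basis \<and> set (snd p) \<subseteq> Basis" if "p : set (splits (b # bs))" for p
  using set_splits[of "fst p" "snd p" "b # bs"] that Cons.prems by auto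
 have "(%x. \<Sum>p\<leftarrow>splits (b # bs). itd (fst p) f x * itd (snd p) g x) differentiable (at x)" for x
  using sm' by (intro conjunct2[OF ps]) (auto intro!: differentiable_mult diff simp del: splits.simps)
 thus ?case using eq by metis
qed

lemma smooth_mult: "smooth f ==> smooth g ==> smooth (%x. f x * g x)"
 unfolding smooth_def[of "%x. f x * g x"] by (intro allI impI conjunct2[OF iterated_deriv_mult_smooth, rule_format])

text \<open>Only the crude factor 2 to the order of differentiation remains; in the weights used
  later it is absorbed by doubling the scale h.\<close>

lemma multi_deriv_mult_bound:
 fixes f g :: "'a::euclidean_space => complex"
 assumes f: "smooth f" and g: "smooth g"
  and B: "!!ga de. (!!b. b : Basis ==> ga b + de b = be b) ==> cmod (md ga f x) * cmod (md de g x) <= B"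
 shows "cmod (md be (%x. f x * g x) x) <= 2 ^ sum be Basis * B"
proof -
 let ?L = "splits (index_list be)"
 have "cmod (md be (%x. f x * g x) x) = cmod (\<Sum>p\<leftarrow>?L. itd (fst p) f x * itd (snd p) g x)"
  using iterated_deriv_mult_smooth[OF f g set_index_list] by (simp add: multi_deriv_index_list)
 also have "... <= (\<Sum>p\<leftarrow>?L. cmod (itd (fst p) f x * itd (snd p) g x))"
 proof -
  have "cmod (sum_list zs) <= sum_list (map cmod zs)" for zs
   by (induction zs) (auto intro: norm_triangle_le)
  from this[of "map (%p. itd (fst p) f x * itd (snd p) g x) ?L"]
  show ?thesis by (simp add: o_def)
 qed
 also have "... <= (\<Sum>p\<leftarrow>?L. B)"
 proof (rule sum_list_mono)
  fix p assume p: "p : set ?L"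
  obtain c d where cd: "p = (c, d)" by (cases p)
  have s: "set c \<subseteq> Basis" "set d \<subseteq> Basis"
   using set_splits[of c d] p cd set_index_list[of be] by auto
  have "cmod (itd c f x) * cmod (itd d g x) <= B"
   unfolding smooth_iterated_multi[OF f s(1)] smooth_iterated_multi[OF g s(2)]
   by (rule B) (use count_splits[of c d "index_list be"] p cd in \<open>simp add: count_index_list\<close>)
  thus "cmod (itd (fst p) f x * itd (snd p) g x) <= B"
   by (simp add: cd norm_mult)
 qed
 also have "... = 2 ^ sum be Basis * B"
  by (simp add: sum_list_triv length_splits length_index_list)
 finally show ?thesis .
qed

section \<open>Differentiation under the integral sign\<close>

lemma has_vector_derivative_quotient:
 assumes "(f has_vector_derivative D) (at 0)"
 shows "((%s. (1 / s) *! (f s - f 0)) \<longlongrightarrow> D) (at 0)"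
proof -
 have "((%h. norm (f h - f 0 - h *! D) / \<bar>h\<bar>) \<longlongrightarrow> 0) (at 0)"
  using assms by (simp add: has_vector_derivative_def has_derivative_at)
 moreover have "\<forall>\<^sub>F h in at 0. norm (f h - f 0 - h *! D) / \<bar>h\<bar> = norm ((1 / h) *! (f h - f 0) - D)"
  unfolding eventually_at_filter
 proof (intro always_eventually allI impI)
  fix h :: real assume h: "h ~= 0"
  have "(1 / h) *! (f h - f 0) - D = (1 / h) *! (f h - f 0 - h *! D)"
   using h by (simp add: scaleR_diff_right)
  thus "norm (f h - f 0 - h *! D) / \<bar>h\<bar> = norm ((1 / h) *! (f h - f 0) - D)"
   by simp
 qed
 ultimately have "((%h. norm ((1 / h) *! (f h - f 0) - D)) \<longlongrightarrow> 0) (at 0)"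
  by (rule Lim_transform_eventually)
 thus ?thesis by (simp add: LIM_zero_iff tendsto_norm_zero_iff)
qed

lemma has_vector_derivative_quotient_seq:
 fixes t :: "nat => real"
 assumes "(f has_vector_derivative D) (at 0)" "t \<longlonglongrightarrow> 0" "!!n. t n ~= 0"
 shows "(%n. (1 / t n) *! (f (t n) - f 0)) \<longlonglongrightarrow> D"
 using has_vector_derivative_quotient[OF assms(1)] assms(2,3)
 unfolding tendsto_at_iff_sequentially comp_def by simp

text \<open>Dominating the partial derivatives on a ball makes each \<open>f om\<close> Lipschitz at
  \<open>x0\<close> with constant \<open>G om\<close>, so the difference quotients minus the
  candidate derivative are at most 2 * \<open>G om\<close>, and dominated convergence applies along
  every sequence of increments. Measurability of the partial derivatives comes from their being
  limits of difference quotients.\<close>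

lemma has_derivative_integral:
 fixes f :: "'w => 'a::euclidean_space => complex"
 assumes r: "0 < r"
  and der: "!!om x. om \<in> space M ==> x : ball x0 r ==>
   (f om has_derivative (%v. \<Sum>b\<in>Basis. (v *. b) *! f' b om x)) (at x)"
  and bd: "!!b om x. b : Basis ==> om \<in> space M ==> x : ball x0 r ==> norm (f' b om x) <= g om"
  and g: "integrable M g"
  and int: "!!x. x : ball x0 r ==> integrable M (%om. f om x)"
 shows "!!b. b : Basis ==> integrable M (%om. f' b om x0)"
  and "((%x. \<integral>om. f om x \<partial>M) has_derivative (%v. \<Sum>b\<in>Basis. (v *. b) *! (\<integral>om. f' b om x0 \<partial>M))) (at x0)"
proof -
 define G where "G = (%om. real (card (Basis::'a set)) * g om)"
 have x0: "x0 : ball x0 r" using r by simp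
 have bdD: "norm (\<Sum>b\<in>Basis. (v *. b) *! f' b om x) <= G om * norm v"
  if "om \<in> space M" "x : ball x0 r" for v om x
 proof -
  have "norm (\<Sum>b\<in>Basis. (v *. b) *! f' b om x) <= (\<Sum>b\<in>(Basis::'a set). norm v * g om)"
   by (intro norm_sum[THEN order_trans] sum_mono)
    (auto intro!: mult_mono bd that simp: Basis_le_norm)
  thus ?thesis by (simp add: G_def mult_ac)
 qed
 have lip: "norm (f om x - f om x0) <= G om * norm (x - x0)" if "om \<in> space M" "x : ball x0 r" for om x
 proof (rule differentiable_bound[where S="ball x0 r" and f'="%x v. \<Sum>b\<in>Basis. (v *. b) *! f' b om x"])
  show "(f om has_derivative (%v. \<Sum>b\<in>Basis. (v *. b) *! f' b om x)) (at x within ball x0 r)"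
   if "x : ball x0 r" for x
   using der[OF \<open>om \<in> space M\<close> that] by (rule has_derivative_at_withinI)
  show "onorm (%v. \<Sum>b\<in>Basis. (v *. b) *! f' b om x) <= G om" if "x : ball x0 r" for x
   by (rule onorm_le) (use bdD \<open>om \<in> space M\<close> that in auto)
 qed (use that r in auto)
 show int': "integrable M (%om. f' b om x0)" if b: "b : Basis" for b
 proof -
  define t where "t n = r / real (n + 2)" for n
  have t: "0 < t n" "t n < r" for n using r by (auto simp: t_def field_simps intro!: add_pos_nonneg)
  have tl: "t \<longlonglongrightarrow> 0" unfolding t_def using LIMSEQ_ignore_initial_segment[OF lim_const_over_n[of r], of 2] by simp
  have nb: "norm b = 1" using b by simp
  have "(%om. f' b om x0) \<in> borel_measurable M"
  proof (rule borel_measurable_LIMSEQ_metric)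
   show "(%om. (1 / t n) *! (f om (x0 + t n *! b) - f om x0)) : borel_measurable M" for n
    using t[of n] nb r by (intro borel_measurable_scaleR borel_measurable_diff borel_measurable_const borel_measurable_integrable int)
     (auto simp: dist_norm)
   fix om assume w: "om \<in> space M"
   have "f om differentiable (at (x0 + 0 *! b))"
    using der[OF w x0] unfolding differentiable_def by auto
   from partial_deriv_has_vector_derivative[OF this]
   have "((%t. f om (x0 + t *! b)) has_vector_derivative pd b (f om) x0) (at 0)" by simp
   moreover have "pd b (f om) x0 = f' b om x0"
   proof -
    have "pd b (f om) x0 = (\<Sum>c\<in>Basis. (b *. c) *! f' c om x0)"
     by (rule partial_deriv_eq[OF der[OF w x0]])
    also have "... = (\<Sum>c\<in>Basis. if c = b then f' c om x0 else 0)"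
     using b by (intro sum.cong) (auto simp: inner_Basis)
    finally show ?thesis using b by simp
   qed
   ultimately have "((%t. f om (x0 + t *! b)) has_vector_derivative f' b om x0) (at 0)" by simp
   from has_vector_derivative_quotient_seq[OF this tl] t
   show "(%n. (1 / t n) *! (f om (x0 + t n *! b) - f om x0)) \<longlonglongrightarrow> f' b om x0"
    by (simp add: less_imp_neq[symmetric])
  qed
  thus ?thesis
   using bd[OF b _ x0] by (intro integrable_bd[OF g]) (auto intro!: AE_I2 order_trans[OF _ abs_ge_self])
 qed
 define D where "D = (%om v. \<Sum>b\<in>Basis. (v *. b) *! f' b om x0)"
 have intD: "integrable M (%om. D om v)" for v
  unfolding D_def by (intro Bochner_Integration.integrable_sum integrable_scaleR_right int')
 have D_int: "(\<integral>om. D om v \<partial>M) = (\<Sum>b\<in>Basis. (v *. b) *! (\<integral>om. f' b om x0 \<partial>M))" for v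
  unfolding D_def by (subst Bochner_Integration.integral_sum) (auto intro!: integrable_scaleR_right int')
 have bl: "bounded_linear (%v::'a. \<Sum>b\<in>Basis. (v *. b) *! (\<integral>om. f' b om x0 \<partial>M))"
  by (intro bounded_linear_sum bounded_linear_scaleR_left[THEN bounded_linear_compose] bounded_linear_inner_left)
 have "((%h. norm ((\<integral>om. f om (x0 + h) \<partial>M) - (\<integral>om. f om x0 \<partial>M) - (\<Sum>b\<in>Basis. (h *. b) *! (\<integral>om. f' b om x0 \<partial>M))) / norm h) \<longlongrightarrow> 0) (at 0)"
  unfolding tendsto_at_iff_sequentially
 proof (intro allI impI)
  fix X :: "nat => 'a" assume X: "\<forall>i. X i : UNIV - {0}" "X \<longlonglongrightarrow> 0"
  \<comment> \<open>Increments leaving the ball are assigned 0, since neither integrability nor the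
    Lipschitz bound is available there; along a null sequence this concerns finitely many
    terms.\<close>
  define q where "q n om = (if norm (X n) < r then (1 / norm (X n)) *! (f om (x0 + X n) - f om x0 - D om (X n)) else 0)" for n om
  have "(%n. \<integral>om. q n om \<partial>M) \<longlonglongrightarrow> (\<integral>om. 0 \<partial>M)"
  proof (rule integral_dominated_convergence)
   show "integrable M (%om. 2 * G om)" using g by (auto simp: G_def)
   show "q n : borel_measurable M" for n
   proof (cases "norm (X n) < r")
    case True
    have "(%om. f om (x0 + X n)) : borel_measurable M" "(%om. f om x0) \<in> borel_measurable M" "(%om. D om (X n)) : borel_measurable M"
     using True int[of "x0 + X n"] int[OF x0] intD by (auto simp: dist_norm)
    thus ?thesis unfolding q_def using True by simp
   qed (simp add: q_def[abs_def])
   show "AE om in M. (%n. q n om) \<longlonglongrightarrow> 0"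
   proof (rule AE_I2)
    fix om assume w: "om \<in> space M"
    have "((%h. norm (f om (x0 + h) - f om x0 - D om h) / norm h) \<longlongrightarrow> 0) (at 0)"
     using der[OF w x0] by (simp add: has_derivative_at D_def)
    hence l: "(%n. norm (f om (x0 + X n) - f om x0 - D om (X n)) / norm (X n)) \<longlonglongrightarrow> 0"
     using X unfolding tendsto_at_iff_sequentially comp_def by simp
    show "(%n. q n om) \<longlonglongrightarrow> 0"
     by (rule Lim_null_comparison[OF always_eventually l]) (auto simp: q_def divide_inverse mult.commute)
   qed
   show "AE om in M. norm (q n om) <= 2 * G om" for n
   proof (rule AE_I2)
    fix om assume w: "om \<in> space M"
    obtain b :: 'a where "b : Basis" using nonempty_Basis by blast
    hence "0 <= g om" using bd[OF _ w x0, of b] norm_ge_zero order_trans by blast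
    hence Gp: "0 <= G om" by (simp add: G_def)
    show "norm (q n om) <= 2 * G om"
    proof (cases "norm (X n) < r")
     case True
     have "norm (f om (x0 + X n) - f om x0 - D om (X n)) <= G om * norm (X n) + G om * norm (X n)"
      using lip[OF w, of "x0 + X n"] bdD[OF w x0, of "X n"] True
      by (intro order_trans[OF norm_triangle_ineq4 add_mono]) (auto simp: dist_norm D_def)
     moreover have "norm (X n) > 0" using X by auto
     moreover have "norm (q n om) = norm (f om (x0 + X n) - f om x0 - D om (X n)) / norm (X n)"
      using True by (simp add: q_def divide_inverse mult.commute)
     ultimately show ?thesis by (simp add: divide_le_eq)
    qed (use Gp in \<open>simp add: q_def\<close>)
   qed
  qed simp
  hence "(%n. norm (\<integral>om. q n om \<partial>M)) \<longlonglongrightarrow> 0" by (simp add: tendsto_norm_zero_iff)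
  moreover have "\<forall>\<^sub>F n in sequentially. norm (\<integral>om. q n om \<partial>M) = norm ((\<integral>om. f om (x0 + X n) \<partial>M) - (\<integral>om. f om x0 \<partial>M) - (\<Sum>b\<in>Basis. (X n *. b) *! (\<integral>om. f' b om x0 \<partial>M))) / norm (X n)"
  proof -
   have "\<forall>\<^sub>F n in sequentially. norm (X n) < r"
    using tendstoD[OF X(2) r] by (simp add: dist_norm)
   thus ?thesis
   proof eventually_elim
    case (elim n)
    have "(\<integral>om. q n om \<partial>M) = (1 / norm (X n)) *! (\<integral>om. f om (x0 + X n) - f om x0 - D om (X n) \<partial>M)"
     using elim by (simp add: q_def)
    also have "(\<integral>om. f om (x0 + X n) - f om x0 - D om (X n) \<partial>M) = (\<integral>om. f om (x0 + X n) \<partial>M) - (\<integral>om. f om x0 \<partial>M) - (\<integral>om. D om (X n) \<partial>M)"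
     using int[of "x0 + X n"] int[OF x0] intD elim by (simp add: dist_norm)
    finally show ?case by (simp add: D_int)
   qed
  qed
  ultimately show "((%h. norm ((\<integral>om. f om (x0 + h) \<partial>M) - (\<integral>om. f om x0 \<partial>M) - (\<Sum>b\<in>Basis. (h *. b) *! (\<integral>om. f' b om x0 \<partial>M))) / norm h) \<circ> X) \<longlonglongrightarrow> 0"
   by (simp add: o_def tendsto_cong)
 qed
 thus "((%x. \<integral>om. f om x \<partial>M) has_derivative (%v. \<Sum>b\<in>Basis. (v *. b) *! (\<integral>om. f' b om x0 \<partial>M))) (at x0)"
  using bl by (simp add: has_derivative_at)
qed

lemma deriv_family_integral:
 fixes F :: "'w => ('a::euclidean_space => nat) => 'a => complex"
 assumes fam: "!!om. om \<in> space M ==> deriv_family (F om)"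
  and bd: "!!be. \<exists>g. integrable M g \<and> (\<forall>om\<in>space M. \<forall>x. norm (F om be x) <= g om)"
  and meas: "!!be x. (%om. F om be x) \<in> borel_measurable M"
 shows "deriv_family (%be x. \<integral>om. F om be x \<partial>M)" and "integrable M (%om. F om be x)"
proof -
 show int: "integrable M (%om. F om be x)" for be x
 proof -
  obtain g where "integrable M g" "\<forall>om\<in>space M. \<forall>x. norm (F om be x) <= g om" using bd by blast
  thus ?thesis
   by (intro integrable_bd[of M g, OF _ meas])
    (auto intro!: AE_I2 intro: order_trans[OF _ abs_ge_self])
 qed
 show "deriv_family (%be x. \<integral>om. F om be x \<partial>M)"
  unfolding deriv_family_def
 proof (intro allI)
  fix be x
  have "\<forall>b. \<exists>g. integrable M g \<and> (\<forall>om\<in>space M. \<forall>x. norm (F om (inc be b) x) <= g om)"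
   using bd by blast
  then obtain g where g: "!!b. integrable M (g b)"
   "!!b om y. om \<in> space M ==> norm (F om (inc be b) y) <= g b om"
   by metis
  show "((%x. \<integral>om. F om be x \<partial>M) has_derivative (%v. \<Sum>b\<in>Basis. (v *. b) *! (\<integral>om. F om (inc be b) x \<partial>M))) (at x)"
  proof (rule has_derivative_integral(2)[where r=1 and g="%om. \<Sum>b\<in>Basis. \<bar>g b om\<bar>"])
   show "integrable M (%om. \<Sum>b\<in>Basis. \<bar>g b om\<bar>)" using g(1) by auto
   fix b om y assume "b : (Basis::'a set)" "om \<in> space M"
   hence "norm (F om (inc be b) y) <= \<bar>g b om\<bar>" using g(2) by (meson abs_ge_self order_trans)
   also have "... <= (\<Sum>b\<in>Basis. \<bar>g b om\<bar>)" using \<open>b \<in> Basis\<close> by (intro member_le_sum) auto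
   finally show "norm (F om (inc be b) y) <= (\<Sum>b\<in>Basis. \<bar>g b om\<bar>)" .
  qed (use fam int in \<open>auto simp: deriv_family_def simp del: fun_upd_apply\<close>)
 qed
qed

text \<open>A derivative in x is the limit of difference quotients with increments 1 / (n + 1), so
  measurability in the parameter survives each differentiation.\<close>

lemma measurable_multi_deriv:
 fixes f :: "'w => 'a::euclidean_space => complex"
 assumes sm: "!!om. om \<in> space M ==> smooth (f om)" and meas: "!!x. (%om. f om x) \<in> borel_measurable M"
 shows "(%om. md be (f om) x) \<in> borel_measurable M"
proof -
 have "(%om. itd bs (f om) x) \<in> borel_measurable M" if "set bs \<subseteq> Basis" for bs x
  using that
 proof (induction bs arbitrary: x)
  case (Cons b bs)
  show ?case
  proof (rule borel_measurable_LIMSEQ_metric)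
   show "(%om. real (Suc n) *! (itd bs (f om) (x + (1 / real (Suc n)) *! b) - itd bs (f om) x)) : borel_measurable M" for n
    using Cons by simp
   fix om assume w: "om \<in> space M"
   have "((%t. itd bs (f om) (x + t *! b)) has_vector_derivative pd b (itd bs (f om)) (x + 0 *! b)) (at 0)"
    by (intro smooth_line_derivative smooth_iterated_deriv sm w) (use Cons in auto)
   from has_vector_derivative_quotient_seq[OF this LIMSEQ_inverse_real_of_nat]
   show "(%n. real (Suc n) *! (itd bs (f om) (x + (1 / real (Suc n)) *! b) - itd bs (f om) x)) \<longlonglongrightarrow> itd (b # bs) (f om) x"
    by (simp add: inverse_eq_divide del: of_nat_Suc)
  qed
 qed (simp add: meas)
 thus ?thesis unfolding multi_deriv_index_list using set_index_list by blast
qed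

section \<open>Characters, tensor products and slices\<close>

lemma smooth_integral:
 fixes f :: "'w => 'a::euclidean_space => complex"
 assumes sm: "!!om. om \<in> space M ==> smooth (f om)"
  and bd: "!!be. \<exists>g. integrable M g \<and> (\<forall>om\<in>space M. \<forall>x. norm (md be (f om) x) <= g om)"
  and meas: "!!x. (%om. f om x) \<in> borel_measurable M"
 shows "smooth (%x. \<integral>om. f om x \<partial>M)"
  and "md be (%x. \<integral>om. f om x \<partial>M) x = (\<integral>om. md be (f om) x \<partial>M)"
  and "integrable M (%om. md be (f om) x)"
proof -
 note DF = deriv_family_integral[where F = "%om be. md be (f om)",
   OF deriv_family_multi_deriv[OF sm] bd measurable_multi_deriv[OF sm meas]]
 have fam: "deriv_family (%be x. \<integral>om. md be (f om) x \<partial>M)" by (rule DF(1))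
 show "integrable M (%om. md be (f om) x)" by (rule DF(2))
 show "smooth (%x. \<integral>om. f om x \<partial>M)" using deriv_family_smooth[OF fam, of "%_. 0"] by simp
 have "md (%b. if b : Basis then be b else 0) h = md be h" for h :: "'a => complex"
  by (rule multi_deriv_cong) simp
 thus "md be (%x. \<integral>om. f om x \<partial>M) x = (\<integral>om. md be (f om) x \<partial>M)"
  using deriv_family_multi[OF fam, of be] by simp
qed

lemma monomial_at_Suc:
 assumes "b : Basis"
 shows "mon (inc be b) k = (k *. b) * mon be k"
proof -
 have "mon (inc be b) k = (\<Prod>c\<in>Basis. (if c = b then k *. b else 1) * (k *. c) ^ be c)"
  unfolding monomial_at_def by (intro prod.cong) auto
 also have "... = (\<Prod>c\<in>Basis. (if c = b then k *. b else 1)) * mon be k"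
  unfolding monomial_at_def by (rule prod.distrib)
 also have "(\<Prod>c\<in>(Basis::'a set). (if c = b then k *. b else 1)) = k *. b"
  using assms by (simp add: prod.delta)
 finally show ?thesis .
qed

lemma sum_upd_Suc:
 assumes "b : Basis"
 shows "sum (inc be b) (Basis::'a::euclidean_space set) = Suc (sum be Basis)"
proof -
 have "sum (inc be b) Basis = (\<Sum>c\<in>Basis. be c + (if c = b then 1 else 0))"
  by (intro sum.cong) auto
 thus ?thesis using assms by (simp add: sum.distrib)
qed

lemma has_derivative_cis_inner:
 fixes k :: "'a::euclidean_space"
 shows "((%x. cis (k *. x)) has_derivative (%v. (k *. v) *! (\<i> * cis (k *. x)))) (at x)"
 by (rule has_derivative_cis) (auto intro!: derivative_eq_intros)

lemma deriv_family_cis: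
 fixes k :: "'a::euclidean_space"
 shows "deriv_family (%be x. \<i> ^ sum be Basis * of_real (mon be k) * cis (k *. x))"
 unfolding deriv_family_def
proof (intro allI)
 fix be x
 show "((%x. \<i> ^ sum be Basis * of_real (mon be k) * cis (k *. x)) has_derivative
  (%v. \<Sum>b\<in>Basis. (v *. b) *! (\<i> ^ sum (inc be b) Basis * of_real (mon (inc be b) k) * cis (k *. x)))) (at x)"
 proof (rule has_derivative_eq_rhs[OF has_derivative_mult_right[OF has_derivative_cis_inner]], intro ext)
  fix v
  have kv: "complex_of_real (k *. v) = (\<Sum>b\<in>Basis. of_real (v *. b) * of_real (k *. b))"
   by (subst euclidean_inner) (simp add: mult.commute)
  show "\<i> ^ sum be Basis * of_real (mon be k) * (k *. v) *! (\<i> * cis (k *. x)) =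
   (\<Sum>b\<in>Basis. (v *. b) *! (\<i> ^ sum (inc be b) Basis * of_real (mon (inc be b) k) * cis (k *. x)))"
   by (simp add: sum_upd_Suc monomial_at_Suc scaleR_conv_of_real kv sum_distrib_right sum_distrib_left
      mult_ac del: fun_upd_apply)
 qed
qed

lemma smooth_cis: "smooth (%x. cis (k *. x))"
 using deriv_family_smooth[OF deriv_family_cis[of k], of "%_. 0"] by (simp add: monomial_at_def)

lemma monomial_at_cong: "(!!b. b : Basis ==> be b = ga b) ==> mon be k = mon ga k"
 by (simp add: monomial_at_def)

lemma norm_multi_deriv_cis: "cmod (md be (%x. cis (k *. x)) x) = amon be k"
proof -
 have "md be (%x. cis (k *. x)) =
   (%x. \<i> ^ sum (%b. if b : Basis then be b else 0) Basis * of_real (mon (%b. if b : Basis then be b else 0) k) * cis (k *. x))"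
  using deriv_family_multi[OF deriv_family_cis[of k], of be] by (simp add: monomial_at_def)
 moreover have "mon (%b. if b : Basis then be b else 0) k = mon be k"
  by (rule monomial_at_cong) simp
 ultimately show ?thesis by (simp add: norm_mult norm_power)
qed

lemma deriv_family_coordinate_prod:
 fixes g :: "'a::euclidean_space => nat => real => complex"
 assumes g: "!!b n t. b : Basis ==> (g b n has_vector_derivative g b (Suc n) t) (at t)"
 shows "deriv_family (%be x. \<Prod>b\<in>Basis. g b (be b) (x *. b))"
 unfolding deriv_family_def
proof (intro allI)
 fix be x
 have "((%x. g b (be b) (x *. b)) has_derivative (%v. (v *. b) *! g b (Suc (be b)) (x *. b))) (at x)" if "b : Basis" for b
 proof -
  have "((%x. x *. b) has_derivative (%v. v *. b)) (at x)" by (auto intro!: derivative_eq_intros)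
  moreover have "(g b (be b) has_derivative (%t. t *! g b (Suc (be b)) (x *. b))) (at (x *. b))"
   using g[OF that] by (simp add: has_vector_derivative_def)
  ultimately show ?thesis by (rule has_derivative_compose)
 qed
 hence "((%x. \<Prod>b\<in>Basis. g b (be b) (x *. b)) has_derivative
  (%v. \<Sum>b\<in>Basis. (v *. b) *! g b (Suc (be b)) (x *. b) * (\<Prod>c\<in>Basis - {b}. g c (be c) (x *. c)))) (at x)"
  by (rule has_derivative_prod)
 thus "((%x. \<Prod>b\<in>Basis. g b (be b) (x *. b)) has_derivative
  (%v. \<Sum>b\<in>Basis. (v *. b) *! (\<Prod>c\<in>Basis. g c ((inc be b) c) (x *. c)))) (at x)"
 proof (rule has_derivative_eq_rhs, intro ext sum.cong refl)
  fix v b assume b: "b : (Basis::'a set)"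
  have "(\<Prod>c\<in>Basis. g c ((inc be b) c) (x *. c)) = g b (Suc (be b)) (x *. b) * (\<Prod>c\<in>Basis - {b}. g c ((inc be b) c) (x *. c))"
   using b by (subst prod.remove[of _ b]) auto
  also have "(\<Prod>c\<in>Basis - {b}. g c ((inc be b) c) (x *. c)) = (\<Prod>c\<in>Basis - {b}. g c (be c) (x *. c))"
   by (intro prod.cong) auto
  finally show "(v *. b) *! g b (Suc (be b)) (x *. b) * (\<Prod>c\<in>Basis - {b}. g c (be c) (x *. c)) =
     (v *. b) *! (\<Prod>c\<in>Basis. g c ((inc be b) c) (x *. c))" by simp
 qed
qed

lemma sum_Basis_prod:
 fixes F :: "'a::euclidean_space \<times> 'b::euclidean_space => 'c::comm_monoid_add"
 shows "sum F Basis = (\<Sum>u\<in>Basis. F (u, 0)) + (\<Sum>v\<in>Basis. F (0, v))"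
proof -
 have "sum F Basis = sum F ((%u. (u, 0)) ` Basis) + sum F ((%v. (0, v)) ` Basis)"
  unfolding Basis_prod_def by (rule sum.union_disjoint) auto
 thus ?thesis by (simp add: sum.reindex inj_on_def o_def)
qed

lemma prod_Basis_prod:
 fixes F :: "'a::euclidean_space \<times> 'b::euclidean_space => 'c::comm_monoid_mult"
 shows "prod F Basis = (\<Prod>u\<in>Basis. F (u, 0)) * (\<Prod>v\<in>Basis. F (0, v))"
proof -
 have "prod F Basis = prod F ((%u. (u, 0)) ` Basis) * prod F ((%v. (0, v)) ` Basis)"
  unfolding Basis_prod_def by (rule prod.union_disjoint) auto
 thus ?thesis by (simp add: prod.reindex inj_on_def o_def)
qed

text \<open>On the basis of a product space exactly one component is nonzero, so the second one
  decides which of the two indices applies.\<close>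

definition join :: "('a::euclidean_space => nat) => ('b::euclidean_space => nat) => 'a \<times> 'b => nat" where
 "join al be = (%(u, v). if v = 0 then al u else be v)"

lemma join_simps:
 "join al be (u, 0) = al u"
 "v : Basis ==> join al be (0, v) = be v"
 "v : Basis ==> join al be (u, v) = be v"
 by (auto simp: join_def)

lemma join_upd1: "join (al(u := n)) be = (join al be)((u, 0) := n)"
 by (auto simp: join_def fun_eq_iff)

lemma join_upd2:
 fixes f :: "'a::euclidean_space \<times> 'b::euclidean_space => complex"
 assumes "v : Basis"
 shows "md ((join al be)((0, v) := n)) f = md (join al (be(v := n))) f"
proof (intro multi_deriv_cong)
 fix b :: "'a \<times> 'b" assume "b : Basis"
 with assms show "((join al be)((0, v) := n)) b = join al (be(v := n)) b"
  by (cases "snd b = 0") (auto simp: join_def Basis_prod_def split: prod.splits)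
qed

lemma join_zero [simp]: "join (%_. 0) (%_. 0) = (%_. 0)"
 by (auto simp: join_def fun_eq_iff)

lemma deriv_family_slice1:
 assumes f: "smooth (f :: 'a::euclidean_space \<times> 'b::euclidean_space => complex)"
 shows "deriv_family (%al x. md (join al be) f (x, y :: 'b))"
 unfolding deriv_family_def
proof (intro allI)
 fix al and x :: 'a
 have "((%x. (x, y)) has_derivative (%v. (v, 0))) (at x)" by (auto intro!: derivative_eq_intros)
 from has_derivative_compose[OF this deriv_familyD[OF deriv_family_multi_deriv[OF f], of "join al be" "(x, y)"]]
 show "((%x. md (join al be) f (x, y)) has_derivative (%v. \<Sum>b\<in>Basis. (v *. b) *! md (join (al(b := Suc (al b))) be) f (x, y))) (at x)"
  by (simp add: sum_Basis_prod join_upd1 join_simps)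
qed

lemma deriv_family_slice2:
 assumes f: "smooth (f :: 'a::euclidean_space \<times> 'b::euclidean_space => complex)"
 shows "deriv_family (%be y. md (join al be) f (x :: 'a, y))"
 unfolding deriv_family_def
proof (intro allI)
 fix be and y :: 'b
 have "((%y. (x, y)) has_derivative (%v. (0, v))) (at y)" by (auto intro!: derivative_eq_intros)
 from has_derivative_compose[OF this deriv_familyD[OF deriv_family_multi_deriv[OF f], of "join al be" "(x, y)"]]
 show "((%y. md (join al be) f (x, y)) has_derivative (%v. \<Sum>b\<in>Basis. (v *. b) *! md (join al (inc be b)) f (x, y))) (at y)"
  by (simp add: sum_Basis_prod join_upd2 join_simps cong: sum.cong)
qed

lemma smooth_slice1: "smooth f ==> smooth (%x. md (join (%_. 0) be) f (x, y))"
 by (rule deriv_family_smooth[OF deriv_family_slice1])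

lemma smooth_slice2: "smooth f ==> smooth (%y. md (join al (%_. 0)) f (x, y))"
 by (rule deriv_family_smooth[OF deriv_family_slice2])

lemma multi_deriv_join_cong:
 "(!!b. b : Basis ==> al b = al' b) ==> (!!b. b : Basis ==> be b = be' b) ==> md (join al be) f = md (join al' be') f"
 by (intro multi_deriv_cong) (auto simp: join_def Basis_prod_def)

lemma multi_deriv_slice1:
 assumes "smooth f"
 shows "md al (%x. md (join (%_. 0) be) f (x, y)) = (%x. md (join al be) f (x, y))"
 using deriv_family_multi[OF deriv_family_slice1[OF assms], of al]
  multi_deriv_join_cong[of "%b. if b : Basis then al b else 0" al be be f] by simp

lemma multi_deriv_slice2:
 assumes "smooth f"
 shows "md be (%y. md (join al (%_. 0)) f (x, y)) = (%y. md (join al be) f (x, y))"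
 using deriv_family_multi[OF deriv_family_slice2[OF assms], of be]
  multi_deriv_join_cong[of al al "%b. if b : Basis then be b else 0" be f] by simp

lemma deriv_family_tensor:
 fixes F :: "('a::euclidean_space => nat) => 'a => complex" and G :: "('b::euclidean_space => nat) => 'b => complex"
 assumes F: "deriv_family F" and G: "deriv_family G"
 shows "deriv_family (%be (x, y). F (%u. be (u, 0)) x * G (%v. be (0, v)) y)"
 unfolding deriv_family_def
proof (intro allI)
 fix be :: "'a \<times> 'b => nat" and z :: "'a \<times> 'b"
 obtain x y where z: "z = (x, y)" by (cases z)
 define al1 al2 where "al1 = (%u. be (u, 0))" and "al2 = (%v. be (0, v))"
 have u: "(%u'. (be((u, 0) := n)) (u', 0)) = al1(u := n)" "(%v. (be((u, 0) := n)) (0, v)) = al2" if "u : Basis" for u :: 'a and n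
  using that by (auto simp: al1_def al2_def fun_eq_iff)
 have v: "(%u. (be((0, v) := n)) (u, 0)) = al1" "(%v'. (be((0, v) := n)) (0, v')) = al2(v := n)" if "v : Basis" for v :: 'b and n
  using that by (auto simp: al1_def al2_def fun_eq_iff)
 have "(fst has_derivative fst) (at (x, y))" "(snd has_derivative snd) (at (x, y))"
  by (auto intro!: derivative_eq_intros)
 from has_derivative_mult[OF has_derivative_compose[OF this(1), of "F al1"] has_derivative_compose[OF this(2), of "G al2"]]
 have "((%z. F al1 (fst z) * G al2 (snd z)) has_derivative
  (%w. F al1 (fst (x, y)) * (\<Sum>b\<in>Basis. (snd w *. b) *! G (al2(b := Suc (al2 b))) (snd (x, y))) + (\<Sum>b\<in>Basis. (fst w *. b) *! F (al1(b := Suc (al1 b))) (fst (x, y))) * G al2 (snd (x, y)))) (at (x, y))"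
  using deriv_familyD[OF F, of al1] deriv_familyD[OF G, of al2] by blast
 hence d: "((%z. F al1 (fst z) * G al2 (snd z)) has_derivative
  (%v. \<Sum>b\<in>Basis. (v *. b) *! (case z of (x, y) => F (%u. (inc be b) (u, 0)) x * G (%v. (inc be b) (0, v)) y))) (at z)"
  unfolding z[symmetric] proof (rule has_derivative_eq_rhs, intro ext)
  fix w :: "'a \<times> 'b"
  have a: "be (u, 0) = al1 u" "be (0, v) = al2 v" for u v by (auto simp: al1_def al2_def)
  show "F al1 (fst z) * (\<Sum>b\<in>Basis. (snd w *. b) *! G (al2(b := Suc (al2 b))) (snd z)) + (\<Sum>b\<in>Basis. (fst w *. b) *! F (al1(b := Suc (al1 b))) (fst z)) * G al2 (snd z) =
   (\<Sum>b\<in>Basis. (w *. b) *! (case z of (x, y) => F (%u. (inc be b) (u, 0)) x * G (%v. (inc be b) (0, v)) y))"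
   by (simp add: z sum_Basis_prod u v a sum_distrib_left sum_distrib_right add.commute inner_prod_def del: fun_upd_apply cong: sum.cong)
 qed
 have e: "(%(x, y). F (%u. be (u, 0)) x * G (%v. be (0, v)) y) = (%z. F al1 (fst z) * G al2 (snd z))"
  by (auto simp: al1_def al2_def fun_eq_iff)
 show "((%(x, y). F (%u. be (u, 0)) x * G (%v. be (0, v)) y) has_derivative
  (%v. \<Sum>b\<in>Basis. (v *. b) *! (case z of (x, y) => F (%u. (inc be b) (u, 0)) x * G (%v. (inc be b) (0, v)) y))) (at z)"
  unfolding e by (rule d)
qed

lemma smooth_tensor:
 assumes f: "smooth f" and g: "smooth g"
 shows "smooth (%(x, y). f x * g y)"
 using deriv_family_smooth[OF deriv_family_tensor[OF deriv_family_multi_deriv[OF f] deriv_family_multi_deriv[OF g]], of "%_. 0"]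
 by simp

lemma multi_deriv_tensor:
 fixes f :: "'a::euclidean_space => complex" and g :: "'b::euclidean_space => complex"
 assumes f: "smooth f" and g: "smooth g"
 shows "md be (%(x, y). f x * g y) (x, y) = md (%u. be (u, 0)) f x * md (%v. be (0, v)) g y"
proof -
 have "md (%u. if (u, 0::'b) \<in> Basis then be (u, 0) else 0) f = md (%u. be (u, 0)) f"
  "md (%v. if (0::'a, v) \<in> Basis then be (0, v) else 0) g = md (%v. be (0, v)) g"
  by (rule multi_deriv_cong, simp add: Basis_prod_def)+
 thus ?thesis
  using deriv_family_multi[OF deriv_family_tensor[OF deriv_family_multi_deriv[OF f] deriv_family_multi_deriv[OF g]], of be]
  by (simp add: fun_eq_iff)
qed

lemma multi_deriv_const:
 "smooth (%x::'a::euclidean_space. c::complex)"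
 "md be (%x::'a. c) x = (if \<forall>b\<in>Basis. be b = 0 then c else 0)"
proof -
 have d: "deriv_family (%be (x::'a). if \<forall>b\<in>Basis. be b = 0 then c else 0)"
  unfolding deriv_family_def
 proof (intro allI)
  fix be and x :: 'a
  have "(\<Sum>b\<in>Basis. (v *. b) *! (if \<forall>ba\<in>Basis. (inc be b) ba = 0 then c else 0)) = 0" for v :: 'a
   by (intro sum.neutral) auto
  thus "((%x. if \<forall>b\<in>Basis. be b = 0 then c else 0) has_derivative
    (%v. \<Sum>b\<in>Basis. (v *. b) *! (if \<forall>ba\<in>Basis. (inc be b) ba = 0 then c else 0))) (at x)"
   by simp
 qed
 show "smooth (%x::'a. c)" using deriv_family_smooth[OF d, of "%_. 0"] by simp
 show "md be (%x::'a. c) x = (if \<forall>b\<in>Basis. be b = 0 then c else 0)"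
  using deriv_family_multi[OF d, of be] by simp
qed

lemma deriv_family_cnj:
 assumes "deriv_family F"
 shows "deriv_family (%be x. cnj (F be x))"
 unfolding deriv_family_def
 using bounded_linear.has_derivative[OF bounded_linear_cnj deriv_familyD[OF assms]]
 by simp

lemma smooth_cnj: assumes "smooth f" shows "smooth (%x. cnj (f x))"
 using deriv_family_smooth[OF deriv_family_cnj[OF deriv_family_multi_deriv[OF assms]], of "%_. 0"] by simp

lemma multi_deriv_cnj:
 assumes "smooth f" shows "md be (%x. cnj (f x)) x = cnj (md be f x)"
 using deriv_family_multi[OF deriv_family_cnj[OF deriv_family_multi_deriv[OF assms]], of be]
  multi_deriv_cong[of be "%b. if b : Basis then be b else 0" f]
 by simp

section \<open>Gelfand-Shilov bounds\<close>

definition gsw :: "('a::euclidean_space => real) => real => ('a => nat) => real" where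
 "gsw s h al = (\<Prod>b\<in>Basis. h ^ al b * fact (al b) powr s b)"

text \<open>The step norm with its supremum cleared: \<open>C\<close> is an explicit bound for it at
  the scale \<open>h\<close>. Constants and scales can then be carried through an estimate, and
  linear dependence on \<open>C\<close> is the continuity of the operator concerned.\<close>

definition gsb ::
  "('a::euclidean_space => real) => ('a => real) => real => real => ('a => complex) => bool" where
 "gsb s sr h C f \<longleftrightarrow> smooth f \<and> 0 <= C \<and>
  (\<forall>al be x. amon al x * cmod (md be f x) <= C * (gsw s h al * gsw sr h be))"

abbreviation "gsw1 s \<equiv> gsw (%_. s)"
abbreviation "gsw2 s sr \<equiv> gsw (two_groups s sr)"
abbreviation "gsb1 s sr \<equiv> gsb (%_. s) (%_. sr)"
abbreviation "gsb2 s sr \<equiv> gsb (two_groups s sr) (two_groups sr s)"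

lemma gsbI:
 assumes "smooth f" "0 <= C"
  "!!al be x. amon al x * cmod (md be f x) <= C * (gsw s h al * gsw sr h be)"
 shows "gsb s sr h C f"
 using assms by (simp add: gsb_def)

lemma gsbD:
 assumes "gsb s sr h C f"
 shows "smooth f" "0 <= C"
  "amon al x * cmod (md be f x) <= C * (gsw s h al * gsw sr h be)"
 using assms by (simp_all add: gsb_def)

lemma gsw_pos: "0 < h ==> 0 < gsw s h al"
 unfolding gsw_def by (intro prod_pos) auto

lemma gsw_nonneg: "0 < h ==> 0 <= gsw s h al"
 by (rule less_imp_le[OF gsw_pos])

lemma gsw_zero [simp]: "gsw s h (%_. 0) = 1"
 by (simp add: gsw_def)

lemma gsw_cong: "(!!b. b : Basis ==> al b = be b) ==> gsw s h al = gsw s h be"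
 unfolding gsw_def by (intro prod.cong) auto

lemma fact_mult_le_fact_add: "fact m * fact n <= (fact (m + n) :: real)"
proof -
 have "fact m * fact n <= (fact (m + n) :: nat)"
  by (intro dvd_imp_le fact_fact_dvd_fact) simp
 thus ?thesis by (metis of_nat_fact of_nat_le_iff of_nat_mult)
qed

lemma fact_add_le: "(fact (m + n) :: real) <= 2 ^ (m + n) * (fact m * fact n)"
proof -
 have "(m + n choose m) <= (\<Sum>k\<le>m + n. m + n choose k)" by (rule member_le_sum) auto
 hence "(m + n choose m) <= 2 ^ (m + n)" by (simp add: choose_row_sum)
 hence c: "real (m + n choose m) <= 2 ^ (m + n)"
  by (metis of_nat_le_iff of_nat_numeral of_nat_power)
 have "(fact m * fact n * (m + n choose m) :: nat) = fact (m + n)"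
  using binomial_fact_lemma[of m "m + n"] by simp
 hence "(fact (m + n) :: real) = fact m * fact n * real (m + n choose m)"
  by (metis of_nat_fact of_nat_mult)
 also have "... <= fact m * fact n * 2 ^ (m + n)"
  by (intro mult_left_mono c) simp
 finally show ?thesis by (simp add: mult_ac)
qed

lemma gsw_add_le:
 assumes "0 < h" "!!b. 0 <= s b"
 shows "gsw s h al * gsw s h be <= gsw s h (%b. al b + be b)"
 unfolding gsw_def prod.distrib[symmetric]
proof (intro prod_mono conjI)
 fix b :: 'a
 have "h ^ al b * fact (al b) powr s b * (h ^ be b * fact (be b) powr s b) =
   h ^ (al b + be b) * (fact (al b) * fact (be b)) powr s b"
  by (simp add: power_add powr_mult)
 also have "... <= h ^ (al b + be b) * fact (al b + be b) powr s b"
  using assms by (intro mult_left_mono powr_mono2 fact_mult_le_fact_add) auto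
 finally show "h ^ al b * fact (al b) powr s b * (h ^ be b * fact (be b) powr s b) <= h ^ (al b + be b) * fact (al b + be b) powr s b" .
qed (use assms in auto)

text \<open>From (m + n)! \<le> 2^(m+n) m! n!, raised to the power \<open>s b\<close>. The uniform
  bound q turns the extra factor into a dilation of h; this is the origin of the factors
  \<open>2 powr q\<close> and \<open>2 powr s\<close> in the scales below.\<close>

lemma gsw_add_ge:
 assumes "0 < h" "!!b. 0 <= s b" "!!b. s b <= q"
 shows "gsw s h (%b. al b + be b) <= gsw s (2 powr q * h) al * gsw s (2 powr q * h) be"
 unfolding gsw_def prod.distrib[symmetric]
proof (intro prod_mono conjI)
 fix b :: 'a
 have "fact (al b + be b) powr s b <= (2 ^ (al b + be b) * (fact (al b) * fact (be b))) powr s b"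
  using assms by (intro powr_mono2 fact_add_le) auto
 also have "... = (2 powr s b) ^ (al b + be b) * (fact (al b) powr s b * fact (be b) powr s b)"
  by (simp add: powr_mult powr_power powr_powr flip: powr_realpow) (simp add: mult.commute)
 also have "... <= (2 powr q) ^ (al b + be b) * (fact (al b) powr s b * fact (be b) powr s b)"
  using assms by (intro mult_right_mono power_mono powr_mono) auto
 finally have "h ^ (al b + be b) * fact (al b + be b) powr s b \<le>
   h ^ (al b + be b) * ((2 powr q) ^ (al b + be b) * (fact (al b) powr s b * fact (be b) powr s b))"
  using assms by (intro mult_left_mono) auto
 thus "h ^ (al b + be b) * fact (al b + be b) powr s b \<le>
  (2 powr q * h) ^ al b * fact (al b) powr s b * ((2 powr q * h) ^ be b * fact (be b) powr s b)"
  by (simp add: power_mult_distrib power_add mult_ac)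
qed (use assms in auto)

lemma gsw_scale: "c ^ sum al Basis * gsw s h al = gsw s (c * h) al"
 unfolding gsw_def power_sum prod.distrib[symmetric]
 by (simp add: power_mult_distrib mult_ac)

lemma gsw_mono: "0 < h ==> h <= h' ==> gsw s h al <= gsw s h' al"
 unfolding gsw_def by (intro prod_mono conjI mult_right_mono power_mono) auto

lemma monomial_at_zero [simp]: "mon (%_. 0) x = 1"
 by (simp add: monomial_at_def)

lemma monomial_at_add: "mon (%b. al b + be b) x = mon al x * mon be x"
 by (simp add: monomial_at_def power_add prod.distrib)

lemma abs_monomial_at: "amon al x = (\<Prod>b\<in>Basis. \<bar>x *. b\<bar> ^ al b)"
 by (simp add: monomial_at_def abs_prod power_abs)

lemma abs_monomial_at_scaleR: "amon al (c *! x) = \<bar>c\<bar> ^ sum al Basis * amon al x"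
 by (simp add: abs_monomial_at power_sum prod.distrib[symmetric] abs_mult power_mult_distrib)

text \<open>In each coordinate the whole exponent goes to the larger of the two summands, by |a + b|
  \<le> 2 max(|a|, |b|). A single product results instead of a binomial sum, at the price that the
  splitting depends on x and y.\<close>

lemma monomial_at_split:
 obtains al' al'' where "!!b. al' b + al'' b = al b"
  "amon al (x + y) <= 2 ^ sum al Basis * (\<bar>mon al' x\<bar> * \<bar>mon al'' y\<bar>)"
proof -
 define al' where "al' = (%b. if \<bar>x *. b\<bar> \<ge> \<bar>y *. b\<bar> then al b else 0)"
 define al'' where "al'' = (%b. if \<bar>x *. b\<bar> \<ge> \<bar>y *. b\<bar> then 0 else al b)"
 have "amon al (x + y) <= (\<Prod>b\<in>Basis. 2 ^ al b * (\<bar>x *. b\<bar> ^ al' b * \<bar>y *. b\<bar> ^ al'' b))"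
  unfolding abs_monomial_at
 proof (intro prod_mono conjI)
  fix b :: 'a
  have "\<bar>(x + y) *. b\<bar> ^ al b <= (2 * max \<bar>x *. b\<bar> \<bar>y *. b\<bar>) ^ al b"
   by (intro power_mono) (auto simp: inner_add_left)
  also have "... = 2 ^ al b * (\<bar>x *. b\<bar> ^ al' b * \<bar>y *. b\<bar> ^ al'' b)"
   by (auto simp: al'_def al''_def power_mult_distrib max_def)
  finally show "\<bar>(x + y) *. b\<bar> ^ al b <= 2 ^ al b * (\<bar>x *. b\<bar> ^ al' b * \<bar>y *. b\<bar> ^ al'' b)" .
 qed auto
 thus ?thesis
  by (intro that[of al' al'']) (auto simp: al'_def al''_def prod.distrib power_sum abs_monomial_at)
qed

text \<open>Powers of x split into powers of x - k and of k, so decay of \<open>f\<close> is asked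
  jointly with powers of \<open>k\<close>. The form serves functions that themselves depend on
  \<open>k\<close> and whose decay in \<open>k\<close> pays for the translation; for a fixed
  function a bound on the powers of \<open>k\<close> takes its place.\<close>

lemma gsb_translate_weighted:
 fixes f :: "'a::euclidean_space => complex"
 assumes h: "0 < h" and s: "!!b. 0 <= s b" and f: "smooth f" and C: "0 <= C"
  and bd: "!!ga al be x. amon ga k * (amon al x * cmod (md be f x)) \<le>
   C * (gsw s h ga * (gsw s h al * gsw sr h be))"
 shows "gsb s sr (2 * h) C (%x. f (x - k))"
proof (rule gsbI[OF smooth_translate[OF f] C])
 fix al be and x :: 'a
 obtain al' al'' where a: "!!b. al' b + al'' b = al b"
  "amon al (x - k + k) <= 2 ^ sum al Basis * (\<bar>mon al' (x - k)\<bar> * \<bar>mon al'' k\<bar>)"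
  using monomial_at_split[of al "x - k" k] by blast
 have "amon al x * cmod (md be (%x. f (x - k)) x) \<le>
   2 ^ sum al Basis * (\<bar>mon al' (x - k)\<bar> * \<bar>mon al'' k\<bar>) * cmod (md be f (x - k))"
  unfolding multi_deriv_translate[OF f] using a(2) by (intro mult_right_mono) auto
 also have "... <= 2 ^ sum al Basis * (C * (gsw s h al'' * (gsw s h al' * gsw sr h be)))"
  using bd[of al'' al' "x - k" be] by (simp add: mult_ac)
 also have "... = C * (2 ^ sum al Basis * (gsw s h al' * gsw s h al'') * gsw sr h be)"
  by (simp add: mult_ac)
 also have "... <= C * (2 ^ sum al Basis * gsw s h al * gsw sr (2 * h) be)"
  using gsw_add_le[of h s al' al'', OF h s] gsw_mono[of h "2 * h" sr be] h a(1) C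
   gsw_pos[OF h, of s al] gsw_pos[OF h, of sr be]
  by (intro mult_left_mono mult_mono) auto
 also have "... = C * (gsw s (2 * h) al * gsw sr (2 * h) be)"
  by (simp add: gsw_scale)
 finally show "amon al x * cmod (md be (%x. f (x - k)) x) <= C * (gsw s (2 * h) al * gsw sr (2 * h) be)" .
qed

lemma gsb_mult_weighted:
 fixes f g :: "'a::euclidean_space => complex"
 assumes h: "0 < h" and sr: "!!b. 0 <= sr b" and f: "smooth f" and g: "smooth g" and C: "0 <= C"
  and bd: "!!ga al be x. cmod (md ga g x) * (amon al x * cmod (md be f x)) \<le>
   C * (gsw sr h ga * (gsw s h al * gsw sr h be))"
 shows "gsb s sr (2 * h) C (%x. g x * f x)"
proof (rule gsbI[OF smooth_mult[OF g f] C])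
 fix al be and x :: 'a
 \<comment> \<open>The weight enters as a constant frozen at \<open>x0\<close> and is attached to
   one factor, so that the unweighted Leibniz bound yields the weighted one.\<close>
 have "cmod (md be (%x. (of_real (amon al x0) * g x) * f x) x0) <=
    2 ^ sum be Basis * (C * (gsw s h al * gsw sr h be))" for x0 :: 'a
 proof (rule multi_deriv_mult_bound[OF smooth_scale[OF g] f])
  fix ga de :: "'a => nat" assume gd: "!!b. b : Basis ==> ga b + de b = be b"
  have "cmod (md ga (%x. of_real (amon al x0) * g x) x0) * cmod (md de f x0) =
   cmod (md ga g x0) * (amon al x0 * cmod (md de f x0))"
   by (simp add: multi_deriv_scale[OF g] norm_mult)
  also have "... <= C * (gsw s h al * (gsw sr h ga * gsw sr h de))"
   using bd[of ga x0 al de] by (simp add: mult_ac)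
  also have "... <= C * (gsw s h al * gsw sr h (%b. ga b + de b))"
   using C h gsw_add_le[of h sr ga de, OF h sr] by (intro mult_left_mono) (auto intro: gsw_nonneg)
  also have "gsw sr h (%b. ga b + de b) = gsw sr h be"
   by (rule gsw_cong) (rule gd)
  finally show "cmod (md ga (%x. of_real (amon al x0) * g x) x0) * cmod (md de f x0)
   <= C * (gsw s h al * gsw sr h be)" .
 qed
 from this[of x] have "amon al x * cmod (md be (%x. g x * f x) x) <= C * (gsw s h al * (2 ^ sum be Basis * gsw sr h be))"
  by (simp add: mult.assoc multi_deriv_scale[OF smooth_mult[OF g f]] norm_mult) (simp add: mult_ac)
 also have "... <= C * (gsw s (2 * h) al * gsw sr (2 * h) be)"
  unfolding gsw_scale using C h gsw_mono[of h "2 * h" s al]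
  by (intro mult_left_mono mult_right_mono) (auto intro: gsw_nonneg)
 finally show "amon al x * cmod (md be (%x. g x * f x) x) <= C * (gsw s (2 * h) al * gsw sr (2 * h) be)" .
qed

text \<open>Differentiating a character produces powers of its frequency, so here the powers of
  \<open>k\<close> are weighed against the derivative exponents \<open>sr\<close>.\<close>

lemma gsb_cis_weighted:
 fixes f :: "'a::euclidean_space => complex"
 assumes h: "0 < h" and sr: "!!b. 0 <= sr b" and f: "smooth f" and C: "0 <= C"
  and bd: "!!ga al be x. amon ga k * (amon al x * cmod (md be f x)) \<le>
   C * (gsw sr h ga * (gsw s h al * gsw sr h be))"
 shows "gsb s sr (2 * h) C (%x. cis (k *. x) * f x)"
 using bd by (intro gsb_mult_weighted[OF h sr f smooth_cis C]) (simp add: norm_multi_deriv_cis)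

text \<open>A product over coordinates rather than a power of the norm: \<open>1 / pw\<close> is a
  tensor product of one-dimensional functions, and its first power is integrable in every
  dimension.\<close>

definition pw :: "'a::euclidean_space => real" where
 "pw k = (\<Prod>b\<in>Basis. 1 + (k *. b)\<^sup>2)"

lemma pw_pos: "0 < pw k"
 unfolding pw_def by (intro prod_pos) (auto intro: add_pos_nonneg)

text \<open>A bound for all exponents leaves room for two further powers in each coordinate, which
  is what \<open>pw\<close> costs; the scale grows by \<open>2 powr q\<close>. The quantity
  \<open>A\<close> is an arbitrary number, so that one statement extracts decay in space, in
  frequency and over a lattice.\<close>

lemma pw_absorb:
 fixes s :: "'a::euclidean_space => real"
 assumes h: "0 < h" and s: "!!b. 0 <= s b" "!!b. s b <= q"
 obtains P where "0 < P" "!!(k::'a) A C ga. 0 <= A ==> (!!ga. amon ga k * A <= C * gsw s h ga) ==>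
  pw k * (amon ga k * A) <= C * P * gsw s (2 powr q * h) ga"
proof -
 define H where "H = 2 powr q * h"
 have H: "0 < H" using h by (simp add: H_def)
 define Q where "Q = (\<Prod>b\<in>(Basis::'a set). max 1 (H ^ 2 * 2 powr s b))"
 define P where "P = 2 ^ card (Basis::'a set) * Q"
 have "Q \<ge> 1" unfolding Q_def by (rule prod_ge_1) simp
 hence P: "0 < P" by (auto simp: P_def)
 have main: "pw k * (amon ga k * A) <= C * P * gsw s H ga"
  if A: "0 <= A" and bd: "!!ga. amon ga k * A <= C * gsw s h ga" for k :: 'a and A C ga
 proof -
  have C: "0 <= C" using bd[of "%_. 0"] A by simp
  \<comment> \<open>Two powers where the coordinate has modulus at least 1 and none elsewhere give 1
    + t^2 \<le> 2 |t|^de in each coordinate t. The weights of all such exponents are bounded by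
    \<open>Q\<close>, whatever k is.\<close>
  define de where "de = (%b. if \<bar>k *. b\<bar> \<ge> 1 then 2 else 0 :: nat)"
  have "pw k <= (\<Prod>b\<in>(Basis::'a set). 2 * \<bar>k *. b\<bar> ^ de b)"
   unfolding pw_def
  proof (intro prod_mono conjI)
   fix b :: 'a
   show "1 + (k *. b)\<^sup>2 <= 2 * \<bar>k *. b\<bar> ^ de b"
   proof (cases "\<bar>k *. b\<bar> \<ge> 1")
    case True
    hence "1 <= \<bar>k *. b\<bar> ^ 2" by (rule one_le_power)
    thus ?thesis using True by (simp add: de_def)
   next
    case False
    hence "\<bar>k *. b\<bar> ^ 2 <= 1" by (intro power_le_one) auto
    thus ?thesis using False by (simp add: de_def)
   qed
  qed auto
  hence pw: "pw k <= 2 ^ card (Basis::'a set) * amon de k"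
   by (simp add: prod.distrib abs_monomial_at)
  have "gsw s H de <= Q"
   unfolding gsw_def Q_def de_def using H by (intro prod_mono) (auto simp: fact_2)
  hence W: "gsw s h (%b. ga b + de b) <= gsw s H ga * Q"
   using gsw_add_ge[of h s q ga de, OF h s] gsw_pos[OF H, of s ga] unfolding H_def[symmetric]
   by (meson less_imp_le mult_left_mono order_trans)
  have "pw k * (amon ga k * A) <= 2 ^ card (Basis::'a set) * amon de k * (amon ga k * A)"
   using pw A by (intro mult_right_mono) auto
  also have "... = 2 ^ card (Basis::'a set) * (amon (%b. ga b + de b) k * A)"
   by (simp add: monomial_at_add abs_mult mult_ac)
  also have "... <= 2 ^ card (Basis::'a set) * (C * (gsw s H ga * Q))"
   using bd[of "%b. ga b + de b"] W C by (intro mult_left_mono) (auto intro: order_trans mult_left_mono)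
  finally show ?thesis by (simp add: P_def mult_ac)
 qed
 show thesis by (rule that[OF P]) (rule main[unfolded H_def])
qed

text \<open>With a = (r/h)^(1/s) the quotient (r/h)^m / m!^s equals (a^m / m!)^s and is at most
  exp(a s), because a^m / m! is a term of the exponential series. Taking r = max(R, 1) keeps the
  base positive.\<close>

lemma power_le_fact_powr:
 fixes s h R :: real
 assumes "0 < s" "0 < h"
 obtains c where "0 < c" "!!t m. \<bar>t\<bar> <= R ==> \<bar>t\<bar> ^ m <= c * (h ^ m * fact m powr s)"
proof -
 define r where "r = max R 1"
 have r: "0 < r" "R <= r" by (auto simp: r_def)
 define a where "a = (r / h) powr (1 / s)"
 have a: "0 < a" using r assms by (simp add: a_def)
 show thesis
 proof (rule that[of "exp (a * s)"])
  fix t :: real and m :: nat assume t: "\<bar>t\<bar> <= R"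
  have "a ^ m / fact m <= exp a"
  proof -
   have "(\<Sum>n\<in>{m}. a ^ n /\<^sub>R fact n) <= (\<Sum>n. a ^ n /\<^sub>R fact n)"
    using a by (intro sum_le_suminf summable_exp_generic) auto
   thus ?thesis by (simp add: exp_def divide_inverse mult.commute)
  qed
  hence "a ^ m <= exp a * fact m" by (simp add: divide_le_eq)
  hence "(a ^ m) powr s <= (exp a * fact m) powr s" using a assms by (intro powr_mono2) auto
  also have "... = exp (a * s) * fact m powr s" by (simp add: powr_mult exp_powr_real)
  also have "(a ^ m) powr s = (r / h) ^ m"
  proof -
   have "(a ^ m) powr s = a powr (real m * s)" using a by (simp add: powr_powr flip: powr_realpow)
   also have "... = (r / h) powr real m" using assms by (simp add: a_def powr_powr)
   also have "... = (r / h) ^ m" using r assms by (simp add: powr_realpow)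
   finally show ?thesis .
  qed
  finally have *: "(r / h) ^ m <= exp (a * s) * fact m powr s" .
  have "\<bar>t\<bar> ^ m <= r ^ m" using t r by (intro power_mono) auto
  also have "... = h ^ m * (r / h) ^ m" using assms by (simp add: power_divide)
  also have "... <= h ^ m * (exp (a * s) * fact m powr s)" using * assms by (intro mult_left_mono) auto
  finally show "\<bar>t\<bar> ^ m <= exp (a * s) * (h ^ m * fact m powr s)" by (simp add: mult_ac)
 qed simp
qed

lemma monomial_le_gsw:
 fixes s :: "'a::euclidean_space => real"
 assumes "0 < h" "!!b. 0 < s b"
 obtains c where "0 < c" "!!(k::'a) ga. (!!b. b : Basis ==> \<bar>k *. b\<bar> <= R) ==> amon ga k <= c * gsw s h ga"
proof -
 have "\<forall>b. \<exists>c>0. \<forall>t m. \<bar>t\<bar> <= R --> \<bar>t\<bar> ^ m <= c * (h ^ m * fact m powr s b)"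
  using power_le_fact_powr[OF assms(2) assms(1)] by metis
 then obtain c where c: "!!b. 0 < c b" "!!b t m. \<bar>t\<bar> <= R ==> \<bar>t\<bar> ^ m <= c b * (h ^ m * fact m powr s b)"
  by metis
 show thesis
 proof (rule that[of "prod c Basis"])
  show "0 < prod c Basis" using c(1) by (intro prod_pos) auto
  fix k :: 'a and ga assume k: "!!b. b : Basis ==> \<bar>k *. b\<bar> <= R"
  have "amon ga k <= (\<Prod>b\<in>Basis. c b * (h ^ ga b * fact (ga b) powr s b))"
   unfolding abs_monomial_at using c k by (intro prod_mono) auto
  thus "amon ga k <= prod c Basis * gsw s h ga"
   by (simp add: gsw_def prod.distrib)
 qed
qed

lemma gsb_translate:
 assumes "gsb s sr h C f" "0 < h" "!!b. 0 <= s b" "0 <= c" "!!ga. amon ga k <= c * gsw s h ga"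
 shows "gsb s sr (2 * h) (c * C) (%x. f (x - k))"
proof (rule gsb_translate_weighted[OF assms(2,3)])
 fix ga al be x
 show "amon ga k * (amon al x * cmod (md be f x)) <= c * C * (gsw s h ga * (gsw s h al * gsw sr h be))"
  using mult_mono[OF assms(5)[of ga] gsbD(3)[OF assms(1), of al x be]] assms(2,4)
  by (simp add: mult_ac gsw_nonneg)
qed (use assms gsbD[OF assms(1)] in auto)

lemma gsb_cis:
 assumes "gsb s sr h C f" "0 < h" "!!b. 0 <= sr b" "0 <= c" "!!ga. amon ga k <= c * gsw sr h ga"
 shows "gsb s sr (2 * h) (c * C) (%x. cis (k *. x) * f x)"
proof (rule gsb_cis_weighted[OF assms(2,3)])
 fix ga al be x
 show "amon ga k * (amon al x * cmod (md be f x)) <= c * C * (gsw sr h ga * (gsw s h al * gsw sr h be))"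
  using mult_mono[OF assms(5)[of ga] gsbD(3)[OF assms(1), of al x be]] assms(2,4)
  by (simp add: mult_ac gsw_nonneg)
qed (use assms gsbD[OF assms(1)] in auto)

lemma gsb_mult:
 assumes "gsb s sr h C f" "0 < h" "!!b. 0 <= sr b" "0 <= c" "smooth g" "!!ga x. cmod (md ga g x) <= c * gsw sr h ga"
 shows "gsb s sr (2 * h) (c * C) (%x. g x * f x)"
proof (rule gsb_mult_weighted[OF assms(2,3)])
 fix ga al be x
 show "cmod (md ga g x) * (amon al x * cmod (md be f x)) <= c * C * (gsw sr h ga * (gsw s h al * gsw sr h be))"
  using mult_mono[OF assms(6)[of ga x] gsbD(3)[OF assms(1), of al x be]] assms(2,4)
  by (simp add: mult_ac gsw_nonneg)
qed (use assms gsbD[OF assms(1)] in auto)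

lemma gsb_deriv:
 assumes "gsb s sr h C f"
 shows "cmod (md be f x) <= C * gsw sr h be"
 using gsbD(3)[OF assms, of "%_. 0" x be] by simp

lemma gsb_mono:
 assumes f: "gsb s sr h C f" and h: "0 < h" "h <= h'" and C: "C <= C'"
 shows "gsb s sr h' C' f"
proof (rule gsbI)
 have C0: "0 <= C" using gsbD(2)[OF f] .
 thus "0 <= C'" using C by simp
 fix al be x
 have "C * (gsw s h al * gsw sr h be) <= C' * (gsw s h' al * gsw sr h' be)"
  using C0 C h gsw_mono[OF h, of s al] gsw_mono[OF h, of sr be] gsw_pos[OF h(1), of s al] gsw_pos[OF h(1), of sr be]
  by (intro mult_mono) auto
 thus "amon al x * cmod (md be f x) <= C' * (gsw s h' al * gsw sr h' be)"
  using gsbD(3)[OF f, of al x be] by linarith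
qed (use gsbD[OF f] in auto)

lemma gsb_add:
 assumes f: "gsb s sr h C f" and g: "gsb s sr h D g"
 shows "gsb s sr h (C + D) (%x. f x + g x)"
proof (rule gsbI)
 fix al be x
 have "amon al x * cmod (md be f x + md be g x) <= amon al x * (cmod (md be f x) + cmod (md be g x))"
  by (intro mult_left_mono norm_triangle_ineq) auto
 thus "amon al x * cmod (md be (%x. f x + g x) x) <= (C + D) * (gsw s h al * gsw sr h be)"
  using gsbD(3)[OF f, of al x be] gsbD(3)[OF g, of al x be]
  by (simp add: multi_deriv_add[OF gsbD(1)[OF f] gsbD(1)[OF g]] algebra_simps)
qed (use gsbD[OF f] gsbD[OF g] in \<open>auto intro: smooth_add\<close>)

lemma gsb_scale:
 assumes f: "gsb s sr h C f"
 shows "gsb s sr h (cmod c * C) (%x. c * f x)"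
proof (rule gsbI)
 fix al be x
 show "amon al x * cmod (md be (%x. c * f x) x) <= cmod c * C * (gsw s h al * gsw sr h be)"
  using mult_left_mono[OF gsbD(3)[OF f, of al x be], of "cmod c"]
  by (simp add: multi_deriv_scale[OF gsbD(1)[OF f]] norm_mult mult_ac)
qed (use gsbD[OF f] in \<open>auto intro: smooth_scale\<close>)

lemma gsb_diff:
 assumes f: "gsb s sr h C f" and g: "gsb s sr h D g"
 shows "gsb s sr h (C + D) (%x. f x - g x)"
 using gsb_add[OF f gsb_scale[OF g, of "-1"]] by simp

text \<open>The measure is arbitrary: for Lebesgue measure this bounds averages and convolutions,
  for a counting measure it is termwise differentiation and estimation of a lattice series.\<close>

lemma gsb_integral:
 fixes f :: "'w => 'a::euclidean_space => complex"
 assumes h: "0 < h" and f: "!!om. om \<in> space M ==> gsb s sr h (g om) (f om)" and g: "integrable M g"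
  and meas: "!!x. (%om. f om x) \<in> borel_measurable M"
 shows "gsb s sr h (\<integral>om. g om \<partial>M) (%x. \<integral>om. f om x \<partial>M)"
proof -
 note I = smooth_integral[where M=M and f=f, OF gsbD(1)[OF f] _ meas]
 have bd: "\<exists>g. integrable M g \<and> (\<forall>om\<in>space M. \<forall>x. norm (md be (f om) x) <= g om)" for be
  using gsb_deriv[OF f] g by (intro exI[of _ "%om. g om * gsw sr h be"]) auto
 show ?thesis
 proof (rule gsbI)
  show "smooth (%x. \<integral>om. f om x \<partial>M)" using I bd by blast
  show "0 <= (\<integral>om. g om \<partial>M)" using gsbD(2)[OF f] by (rule integral_nn)
  fix al be x
  have int: "integrable M (%om. md be (f om) x)" using I(3)[OF _ bd] .
  have "amon al x * cmod (md be (%x. \<integral>om. f om x \<partial>M) x) = amon al x * cmod (\<integral>om. md be (f om) x \<partial>M)"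
   using I(2)[OF _ bd] by simp
  also have "... <= amon al x * (\<integral>om. cmod (md be (f om) x) \<partial>M)"
   by (intro mult_left_mono integral_norm_bound) auto
  also have "... = (\<integral>om. amon al x * cmod (md be (f om) x) \<partial>M)" by simp
  also have "... <= (\<integral>om. g om * (gsw s h al * gsw sr h be) \<partial>M)"
   using int g gsbD(3)[OF f] by (intro integral_mono) auto
  finally show "amon al x * cmod (md be (%x. \<integral>om. f om x \<partial>M) x) <= (\<integral>om. g om \<partial>M) * (gsw s h al * gsw sr h be)" by simp
 qed
qed

lemma monomial_at_prod: "mon be (x, y) = mon (%u. be (u, 0)) x * mon (%v. be (0, v)) y"
 by (simp add: monomial_at_def prod_Basis_prod)

lemma gsw_two_groups:
 "gsw (two_groups s1 s2) h be = gsw (%_. s1) h (%u. be (u, 0)) * gsw (%_. s2) h (%v. be (0, v))"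
 unfolding gsw_def prod_Basis_prod
 by (intro arg_cong2[where f="(*)"] prod.cong refl) (auto simp: two_groups_def)

lemma gsb_tensor:
 assumes f: "gsb (%_. s1) (%_. sr1) h C f" and g: "gsb (%_. s2) (%_. sr2) h D g" and h: "0 < h"
 shows "gsb (two_groups s1 s2) (two_groups sr1 sr2) h (C * D) (%(x, y). f x * g y)"
proof (rule gsbI)
 show "smooth (%(x, y). f x * g y)" using smooth_tensor gsbD(1)[OF f] gsbD(1)[OF g] .
 show "0 <= C * D" using gsbD(2)[OF f] gsbD(2)[OF g] by simp
 fix al be and z :: "'a \<times> 'b"
 obtain x y where z: "z = (x, y)" by (cases z)
 show "amon al z * cmod (md be (%(x, y). f x * g y) z) \<le>
     C * D * (gsw (two_groups s1 s2) h al * gsw (two_groups sr1 sr2) h be)"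
  using mult_mono[OF gsbD(3)[OF f, of "%u. al (u, 0)" x "%u. be (u, 0)"] gsbD(3)[OF g, of "%v. al (0, v)" y "%v. be (0, v)"]]
   gsbD(2)[OF f] h
  by (simp add: z multi_deriv_tensor[OF gsbD(1)[OF f] gsbD(1)[OF g]] monomial_at_prod gsw_two_groups
    norm_mult abs_mult mult_ac gsw_nonneg)
qed

lemma gsb_dilate:
 fixes f :: "'a::euclidean_space => complex"
 assumes f: "gsb s sr h C f" and h: "0 < h" and c: "1 <= c"
 shows "gsb s sr (c * h) C (%x. f (c *! x))"
proof (rule gsbI)
 show "smooth (%x. f (c *! x))" using smooth_affine[OF gsbD(1)[OF f], of 0 c] by simp
 fix al be and x :: 'a
 have "amon al x <= c ^ sum al Basis * amon al x" using mult_right_mono[OF one_le_power[OF c], of "amon al x" "sum al Basis"] by simp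
 hence m: "amon al x <= amon al (c *! x)" using c by (simp add: abs_monomial_at_scaleR)
 have "cmod (md be (%x. f (c *! x)) x) = c ^ sum be Basis * cmod (md be f (c *! x))"
  using multi_deriv_affine[OF gsbD(1)[OF f], of be 0 c] c by (simp add: norm_mult norm_power)
 hence "amon al x * cmod (md be (%x. f (c *! x)) x) \<le>
   c ^ sum be Basis * (amon al (c *! x) * cmod (md be f (c *! x)))"
  using m c by (simp add: mult_ac) (intro mult_left_mono mult_right_mono, auto)
 also have "... <= c ^ sum be Basis * (C * (gsw s h al * gsw sr h be))"
  using gsbD(3)[OF f] c by (intro mult_left_mono) auto
 also have "... = C * (gsw s h al * gsw sr (c * h) be)"
  by (simp add: gsw_scale[symmetric] mult_ac)
 also have "... <= C * (gsw s (c * h) al * gsw sr (c * h) be)"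
  using gsbD(2)[OF f] c h gsw_mono[of h "c * h" s al]
  by (intro mult_left_mono mult_right_mono) (auto intro: gsw_nonneg)
 finally show "amon al x * cmod (md be (%x. f (c *! x)) x) <= C * (gsw s (c * h) al * gsw sr (c * h) be)" .
qed (use gsbD[OF f] in auto)

text \<open>The mean value inequality along the segment from x to x - y supplies the factor |y|. Its
  points differ from x by t y with t in [0, 1], so powers of x are split uniformly in t. One extra
  derivative in each of the d directions costs d H with H = \<open>2 powr q * h\<close>, because the
  weight of a unit index is H itself.\<close>

lemma gsb_translate_diff:
 fixes f :: "'a::euclidean_space => complex"
 assumes f: "gsb s sr h C f" and h: "0 < h" and s: "!!b. 0 <= s b" and sr: "!!b. 0 <= sr b" "!!b. sr b <= q" and q: "0 <= q"
  and c: "0 <= c" "!!ga. amon ga y <= c * gsw s h ga"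
 shows "gsb s sr (2 * (2 powr q * h)) (norm y * (c * C * (real DIM('a) * (2 powr q * h)))) (%x. f (x - y) - f x)"
proof (rule gsbI)
 define H where "H = 2 powr q * h"
 have "1 <= 2 powr q" using q by (simp add: ge_one_powr_ge_zero)
 hence H: "h <= H" "0 < H" using h by (auto simp: H_def mult_ge1_I)
 have smf: "smooth f" using gsbD(1)[OF f] .
 have C: "0 <= C" using gsbD(2)[OF f] .
 have sm: "smooth (%x. f (x - y))" by (rule smooth_translate[OF smf])
 show "smooth (%x. f (x - y) - f x)"
  using smooth_add[OF sm smooth_scale[OF smf, of "-1"]] by simp
 show "0 <= norm y * (c * C * (real DIM('a) * H))" using c C H by simp
 fix al be and x :: 'a
 have md: "md be (%x. f (x - y) - f x) x = md be f (x - y) - md be f x"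
  using multi_deriv_add[OF sm smooth_scale[OF smf, of "-1"], of be] multi_deriv_scale[OF smf, of be "-1"]
  by (simp add: multi_deriv_translate[OF smf])
 define ph where "ph t = of_real (mon al x) * md be f (x + t *! (- y))" for t :: real
 define ph' where "ph' t = of_real (mon al x) * (\<Sum>b\<in>Basis. ((- y) *. b) *! md (inc be b) f (x + t *! (- y)))" for t :: real
 have dph: "(ph has_derivative (%ta. ta *! ph' t)) (at t within {0..1})" for t
 proof -
  have "((%t. x + t *! (- y)) has_derivative (%ta. ta *! (- y))) (at t)" by (auto intro!: derivative_eq_intros)
  from has_derivative_compose[OF this deriv_familyD[OF deriv_family_multi_deriv[OF smf], of be "x + t *! (- y)"]]
  have "((%t. md be f (x + t *! (- y))) has_derivative (%ta. ta *! (\<Sum>b\<in>Basis. ((- y) *. b) *! md (inc be b) f (x + t *! (- y))))) (at t)"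
   by (simp add: scaleR_sum_right del: fun_upd_apply)
  from has_derivative_at_withinI[OF has_derivative_mult_right[OF this, of "of_real (mon al x)"]]
  show ?thesis unfolding ph_def ph'_def by (simp only: mult_scaleR_right)
 qed
 define B where "B = norm y * (c * C * (real DIM('a) * H)) * (gsw s (2 * H) al * gsw sr (2 * H) be)"
 have "norm (ph' t) <= B" if t: "t : {0..1}" for t
 proof -
  obtain al' al'' where a: "!!b. al' b + al'' b = al b"
   "\<bar>mon al ((x + t *! (- y)) + t *! y)\<bar> <= 2 ^ sum al Basis * (\<bar>mon al' (x + t *! (- y))\<bar> * \<bar>mon al'' (t *! y)\<bar>)"
   using monomial_at_split[of al "x + t *! (- y)" "t *! y"] by blast
  have "\<bar>mon al'' (t *! y)\<bar> <= 1 * \<bar>mon al'' y\<bar>"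
   unfolding abs_monomial_at_scaleR using t by (intro mult_right_mono power_le_one) auto
  hence mt: "\<bar>mon al'' (t *! y)\<bar> <= c * gsw s h al''" using c(2)[of al''] by simp
  have "norm (ph' t) <= amon al x * (\<Sum>b\<in>(Basis::'a set). norm y * cmod (md (inc be b) f (x + t *! (- y))))"
   unfolding ph'_def norm_mult norm_of_real
   by (intro mult_left_mono order_trans[OF norm_sum] sum_mono) (auto intro!: mult_right_mono simp: Basis_le_norm simp del: fun_upd_apply)
  also have "... = (\<Sum>b\<in>(Basis::'a set). norm y * (amon al x * cmod (md (inc be b) f (x + t *! (- y)))))"
   by (simp add: sum_distrib_left mult_ac)
  also have "... <= (\<Sum>b\<in>(Basis::'a set). norm y * (c * C * H * (gsw s (2 * H) al * gsw sr (2 * H) be)))"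
  proof (intro sum_mono mult_left_mono)
   fix b :: 'a assume b: "b : Basis"
   let ?be = "be(b := Suc (be b))"
   define e where "e = (%c. if c = b then 1 else 0 :: nat)"
   have "gsw sr h ?be = gsw sr h (%c. be c + e c)"
    by (rule gsw_cong) (auto simp: e_def)
   also have "... <= gsw sr H be * gsw sr H e"
    unfolding H_def by (rule gsw_add_ge[of h sr q be e, OF h sr])
   also have "gsw sr H e = H"
   proof -
    have "gsw sr H e = (\<Prod>c\<in>Basis. if c = b then H else 1)"
     unfolding gsw_def by (intro prod.cong) (auto simp: e_def)
    thus ?thesis using b by simp
   qed
   finally have w: "gsw sr h ?be <= gsw sr H be * H" .
   have "amon al x * cmod (md ?be f (x + t *! (- y))) \<le>
    2 ^ sum al Basis * (\<bar>mon al' (x + t *! (- y))\<bar> * \<bar>mon al'' (t *! y)\<bar>) * cmod (md ?be f (x + t *! (- y)))"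
    using a(2) by (intro mult_right_mono) auto
   also have "... = 2 ^ sum al Basis * ((\<bar>mon al' (x + t *! (- y))\<bar> * cmod (md ?be f (x + t *! (- y)))) * \<bar>mon al'' (t *! y)\<bar>)"
    by (simp add: mult_ac)
   also have "... <= 2 ^ sum al Basis * ((C * (gsw s h al' * gsw sr h ?be)) * (c * gsw s h al''))"
    using C h by (intro mult_left_mono mult_mono gsbD(3)[OF f] mt) (auto intro!: mult_nonneg_nonneg gsw_nonneg)
   also have "... = C * c * (2 ^ sum al Basis * (gsw s h al' * gsw s h al'')) * gsw sr h ?be"
    by (simp add: mult_ac)
   also have "... <= C * c * (2 ^ sum al Basis * gsw s h al) * (gsw sr H be * H)"
    using gsw_add_le[of h s al' al'', OF h s] a(1) w C c h
    by (intro mult_mono mult_left_mono) (auto intro!: mult_nonneg_nonneg gsw_nonneg)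
   also have "... = c * C * H * (gsw s (2 * h) al * gsw sr H be)"
    unfolding gsw_scale by (simp only: mult_ac)
   also have "... <= c * C * H * (gsw s (2 * H) al * gsw sr (2 * H) be)"
    using h H C c by (intro mult_left_mono mult_mono gsw_mono) (auto intro!: mult_nonneg_nonneg gsw_nonneg)
   finally show "amon al x * cmod (md ?be f (x + t *! (- y))) <= c * C * H * (gsw s (2 * H) al * gsw sr (2 * H) be)" .
  qed simp
  also have "... = B" by (simp add: B_def mult_ac)
  finally show ?thesis .
 qed
 hence "norm (ph 1 - ph 0) <= B * norm (1 - 0 :: real)"
  by (intro differentiable_bound[of "{0..1}" ph "%t ta. ta *! ph' t"] dph onorm_le) (auto intro: mult_right_mono simp: mult.commute[of _ "\<bar>_\<bar>"] mult_left_mono)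
 hence "amon al x * cmod (md be f (x - y) - md be f x) <= B"
  by (simp add: ph_def norm_mult flip: right_diff_distrib)
 thus "amon al x * cmod (md be (%x. f (x - y) - f x) x) \<le>
  norm y * (c * C * (real DIM('a) * H)) * (gsw s (2 * H) al * gsw sr (2 * H) be)"
  unfolding md B_def .
qed

section \<open>The step spaces and their norms in terms of explicit bounds\<close>

lemma gs_quotient_eq:
 "gs_quotient s sr h f al be x = amon al x * cmod (md be f x) / (gsw s h al * gsw sr h be)"
 by (simp add: gs_quotient_def gsw_def power_sum power_add prod.distrib mult_ac)

lemma gs_quotient_le_iff:
 assumes "0 < h"
 shows "gs_quotient s sr h f al be x <= C \<longleftrightarrow>
  amon al x * cmod (md be f x) <= C * (gsw s h al * gsw sr h be)"
 unfolding gs_quotient_eq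
 by (rule pos_divide_le_eq) (intro mult_pos_pos gsw_pos assms)

lemma mem_gs_step_iff:
 assumes "0 < h"
 shows "f : gs_step s sr h \<longleftrightarrow> (\<exists>C. gsb s sr h C f)"
proof
 assume "f : gs_step s sr h"
 then obtain C where sm: "smooth f" and C: "!!al be x. gs_quotient s sr h f al be x <= C"
  by (auto simp: gs_step_def bdd_above_def)
 have "0 <= gs_quotient s sr h f (%_. 0) (%_. 0) 0" by (simp add: gs_quotient_eq)
 hence "0 <= C" using C order_trans by blast
 hence "gsb s sr h C f"
  using C sm by (intro gsbI) (auto simp: gs_quotient_le_iff[OF assms])
 thus "\<exists>C. gsb s sr h C f" by blast
next
 assume "\<exists>C. gsb s sr h C f"
 then obtain C where C: "gsb s sr h C f" by blast
 hence "gs_quotient s sr h f al be x <= C" for al be x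
  using gsbD(3)[OF C, of al x be] by (simp add: gs_quotient_le_iff[OF assms])
 thus "f : gs_step s sr h" using gsbD(1)[OF C] by (auto simp: gs_step_def bdd_above_def)
qed

lemma gs_norm_le:
 assumes "0 < h" "gsb s sr h C f"
 shows "gsn s sr h f <= C"
 unfolding gs_norm_def
proof (rule cSUP_least, simp, clarify)
 fix al be x
 show "gs_quotient s sr h f al be x <= C"
  using gsbD(3)[OF assms(2), of al x be] by (simp add: gs_quotient_le_iff[OF assms(1)])
qed

lemma gsb_gs_norm:
 assumes "0 < h" "f : gs_step s sr h"
 shows "gsb s sr h (gsn s sr h f) f"
proof -
 have q: "gs_quotient s sr h f al be x <= gsn s sr h f" for al be x
  unfolding gs_norm_def using assms(2) cSUP_upper[of "(al, be, x)" UNIV "%(al, be, x). gs_quotient s sr h f al be x"]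
  by (auto simp: gs_step_def)
 have "0 <= gs_quotient s sr h f (%_. 0) (%_. 0) 0" by (simp add: gs_quotient_eq)
 hence "0 <= gsn s sr h f" using q order_trans by blast
 thus ?thesis
  using q assms(2)
  by (intro gsbI) (auto simp: gs_step_def gs_quotient_le_iff[OF assms(1)])
qed

section \<open>Integrability of the polynomial weight\<close>

lemma integrable_inverse_one_plus_square: "integrable lborel (%t::real. 1 / (1 + t\<^sup>2))"
proof (rule integrableI_bounded)
 let ?f = "%t::real. 1 / (1 + t\<^sup>2)"
 let ?h = "%t. ennreal (?f t) * indicator {0..} t"
 show "?f : borel_measurable lborel" by measurable
 have nn: "0 < 1 + t\<^sup>2" for t :: real by (rule add_pos_nonneg) auto
 have half: "(\<integral>\<^sup>+t. ?h t \<partial>lborel) = ennreal (pi / 2 - arctan 0)"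
  by (rule nn_integral_FTC_atLeast[OF _ _ _ tendsto_arctan_at_top])
   (auto intro!: DERIV_arctan[THEN DERIV_cong] simp: divide_inverse nn less_imp_le)
 have "(\<integral>\<^sup>+t. ?h t \<partial>lborel) = ennreal \<bar>- 1\<bar> * (\<integral>\<^sup>+t. ?h (0 + (- 1) * t) \<partial>lborel)"
  by (rule nn_integral_real_affine) auto
 hence half': "(\<integral>\<^sup>+t. ?h (- t) \<partial>lborel) = ennreal (pi / 2 - arctan 0)" using half by simp
 have "(\<integral>\<^sup>+t. ennreal (norm (?f t)) \<partial>lborel) <= (\<integral>\<^sup>+t. ?h t + ?h (- t) \<partial>lborel)"
  using nn by (intro nn_integral_mono) (auto simp: indicator_def less_imp_le abs_of_pos)
 also have "... = (\<integral>\<^sup>+t. ?h t \<partial>lborel) + (\<integral>\<^sup>+t. ?h (- t) \<partial>lborel)"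
  by (rule nn_integral_add) auto
 also have "... < \<infinity>" unfolding half half' by simp
 finally show "(\<integral>\<^sup>+t. ennreal (norm (?f t)) \<partial>lborel) < \<infinity>" .
qed

lemma abs_pw [simp]: "\<bar>pw x\<bar> = pw x"
 using pw_pos[of x] by simp

lemma continuous_on_pw: "continuous_on S (pw :: 'a::euclidean_space => real)"
 unfolding pw_def[abs_def] by (intro continuous_intros)

lemma borel_measurable_pw [measurable]: "pw : bm"
 by (rule bm_contI[OF continuous_on_pw])

lemma integrable_pw: "integrable lborel (%x::'a::euclidean_space. 1 / pw x)"
proof (rule integrableI_bounded)
 have fin: "(\<integral>\<^sup>+t. ennreal (1 / (1 + t\<^sup>2)) \<partial>lborel) < \<infinity>"
  using integrable_inverse_one_plus_square unfolding integrable_iff_bounded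
  by (simp add: add_nonneg_nonneg)
 have "ennreal (norm (1 / pw x)) = (\<Prod>b\<in>Basis. ennreal (1 / (1 + (x *. b)\<^sup>2)))" for x :: 'a
  using pw_pos[of x] by (simp add: pw_def prod_ennreal prod_dividef)
 hence "(\<integral>\<^sup>+x. ennreal (norm (1 / pw (x::'a))) \<partial>lborel) = (\<integral>\<^sup>+x. (\<Prod>b\<in>(Basis::'a set). ennreal (1 / (1 + (x *. b)\<^sup>2))) \<partial>lborel)"
  by simp
 also have "... = (\<Prod>b\<in>(Basis::'a set). (\<integral>\<^sup>+t. ennreal (1 / (1 + t\<^sup>2)) \<partial>lborel))"
  by (rule nn_integral_lborel_prod[where f="%_ t. ennreal (1 / (1 + t\<^sup>2))"]) auto
 also have "... < \<infinity>"
 proof -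
  obtain r where "0 <= r" "(\<integral>\<^sup>+t. ennreal (1 / (1 + t\<^sup>2)) \<partial>lborel) = ennreal r"
   using fin by (cases "(\<integral>\<^sup>+t. ennreal (1 / (1 + t\<^sup>2)) \<partial>lborel)") auto
  thus ?thesis by (simp add: ennreal_power)
 qed
 finally show "(\<integral>\<^sup>+x. ennreal (norm (1 / pw (x::'a))) \<partial>lborel) < \<infinity>" .
qed measurable

lemma pw_ge_1: "1 <= pw x"
 unfolding pw_def by (rule prod_ge_1) auto

text \<open>Peetre's inequality for this weight, from 1 + (a + b)^2 \<le> 2 (1 + a^2)(1 + b^2) in
  each coordinate. Its main use is the quotient form \<open>inverse_pw_le\<close>.\<close>

lemma pw_add: "pw (x + y :: 'a::euclidean_space) <= 2 ^ DIM('a) * (pw x * pw y)"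
proof -
 have "pw (x + y) <= (\<Prod>b\<in>(Basis::'a set). 2 * ((1 + (x *. b)\<^sup>2) * (1 + (y *. b)\<^sup>2)))"
  unfolding pw_def
 proof (intro prod_mono conjI)
  fix b :: 'a
  have "((x + y) *. b)\<^sup>2 <= 2 * (x *. b)\<^sup>2 + 2 * (y *. b)\<^sup>2"
   using sum_squares_bound[of "x *. b" "y *. b"] by (simp add: inner_add_left power2_sum)
  moreover have "0 <= (x *. b)\<^sup>2 * (y *. b)\<^sup>2" by simp
  ultimately show "1 + ((x + y) *. b)\<^sup>2 <= 2 * ((1 + (x *. b)\<^sup>2) * (1 + (y *. b)\<^sup>2))"
   by (simp only: distrib_left distrib_right mult_1_left mult_1_right)
 qed auto
 thus ?thesis by (simp add: prod.distrib pw_def)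
qed

lemma pw_minus [simp]: "pw (- x) = pw x"
 by (simp add: pw_def)

lemma inverse_pw_le:
 "1 / pw (x :: 'a::euclidean_space) <= 2 ^ DIM('a) * pw y / pw (x + y)"
 using pw_add[of x y] pw_pos[of x] pw_pos[of "x + y"]
 by (simp add: field_simps)

lemma pw_bounded:
 fixes x :: "'a::euclidean_space"
 assumes "norm x <= r"
 shows "pw x <= (1 + r\<^sup>2) ^ DIM('a)"
proof -
 have "pw x <= (\<Prod>b\<in>(Basis::'a set). 1 + r\<^sup>2)"
  unfolding pw_def
 proof (intro prod_mono conjI add_left_mono)
  fix b :: 'a assume "b : Basis"
  hence "\<bar>x *. b\<bar> <= r" using Basis_le_norm[of b x] assms by linarith
  from power_mono[OF this, of 2] show "(x *. b)\<^sup>2 <= r\<^sup>2" by simp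
 qed auto
 thus ?thesis by simp
qed

section \<open>Translation invariance of Lebesgue integrals\<close>

lemma lborel_integrable_translate:
 fixes f :: "'a::euclidean_space => 'b::{banach, second_countable_topology}"
 assumes "integrable lborel f"
 shows "integrable lborel (%x. f (x + k))"
proof -
 have "integrable (distr lborel borel ((+) k)) f" using assms by (simp add: lborel_distr_plus)
 thus ?thesis by (subst (asm) integrable_distr_eq) (use assms in \<open>auto simp: add.commute\<close>)
qed

lemma lborel_integral_translate:
 fixes f :: "'a::euclidean_space => 'b::{banach, second_countable_topology}"
 assumes "f : bm"
 shows "(LB x. f (x + k)) = (LB x. f x)"
 using integral_distr[of "(+) k" lborel borel f] assms by (simp add: lborel_distr_plus add.commute)

lemma nn_integral_lborel_translate:
 fixes f :: "'a::euclidean_space => ennreal"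
 assumes "f : bm"
 shows "(\<integral>\<^sup>+x. f (x + k) \<partial>lborel) = (\<integral>\<^sup>+x. f x \<partial>lborel)"
 using nn_integral_distr[of "(+) k" lborel borel f] assms by (simp add: lborel_distr_plus add.commute)

section \<open>Integration by parts and Fourier coefficients\<close>

lemma integrable_pw_bound:
 fixes f :: "'a::euclidean_space => complex"
 assumes "f : bm" "!!x. cmod (f x) <= C / pw x"
 shows "integrable lborel f"
proof (rule integrable_bd[OF intb_mult_r[OF integrable_pw, of C]])
 have "cmod (f x) <= norm (C * (1 / pw x))" for x
  using order_trans[OF assms(2)[of x] abs_ge_self] by simp
 thus "AE x in lborel. cmod (f x) <= norm (C * (1 / pw x))" by simp
qed (use assms(1) in simp)

lemma smooth_borel_measurable: "smooth f ==> f : bm"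
 by (intro bm_contI smooth_continuous_on)

text \<open>Translation invariance makes the integral of f(y + x) over y constant in x, and its
  derivative under the integral sign is the integral of the partial derivative.\<close>

lemma integral_partial_deriv_eq_0:
 fixes f :: "'a::euclidean_space => complex"
 assumes f: "smooth f" and C: "!!x. cmod (f x) <= C / pw x"
  and D: "!!b x. b : Basis ==> cmod (pd b f x) <= D / pw x"
  and b: "b : Basis"
 shows "(LB x. pd b f x) = 0"
proof -
 \<comment> \<open>The bound \<open>D / pw\<close> made uniform over translations by vectors of the
   unit ball, by Peetre's inequality; the inner 1 in \<open>1 + 1\<^sup>2\<close> is the
   radius.\<close>
 define g where "g x = D * (2 ^ DIM('a) * (1 + 1\<^sup>2) ^ DIM('a) / pw x)" for x :: 'a
 have "0 <= D" using order_trans[OF norm_ge_zero D[OF b, of 0]] pw_pos[of "0::'a"] by (simp add: zero_le_divide_iff)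
 have int: "integrable lborel f"
  by (rule integrable_pw_bound[OF smooth_borel_measurable[OF f] C])
 have "((%x. \<integral>om. f (om + x) \<partial>lborel) has_derivative (%v. \<Sum>b\<in>Basis. (v *. b) *! (LB om. pd b f (om + 0)))) (at 0)"
 proof (rule has_derivative_integral(2)[where r=1 and g=g])
  show "((%x. f (om + x)) has_derivative (%v. \<Sum>b\<in>Basis. (v *. b) *! pd b f (om + x))) (at x)" for om x
  proof -
   have "((%x. om + x) has_derivative (%v. v)) (at x)" by (auto intro!: derivative_eq_intros)
   from has_derivative_compose[OF this has_derivative_partial_deriv[OF smooth_differentiable[OF f]]] show ?thesis .
  qed
  show "integrable lborel g"
   unfolding g_def using intb_mult_r[OF integrable_pw, of "D * (2 ^ DIM('a) * (1 + 1\<^sup>2) ^ DIM('a))"]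
   by simp
  fix b om x :: 'a assume b: "b : Basis" and x: "x : ball 0 1"
  have "1 / pw (om + x) <= 2 ^ DIM('a) * pw (- x) / pw ((om + x) + (- x))"
   by (rule inverse_pw_le)
  also have "... <= 2 ^ DIM('a) * (1 + 1\<^sup>2) ^ DIM('a) / pw om"
   using pw_bounded[of x 1] x pw_pos[of om] by (auto intro!: divide_right_mono)
  finally show "norm (pd b f (om + x)) <= g om"
   using D[OF b, of "om + x"] mult_left_mono[OF _ \<open>0 <= D\<close>] unfolding g_def by (fastforce intro: order_trans)
 qed (auto intro: lborel_integrable_translate[OF int])
 moreover have "(%x. \<integral>om. f (om + x) \<partial>lborel) = (%x. \<integral>om. f om \<partial>lborel)"
  using lborel_integral_translate[OF smooth_borel_measurable[OF f]] by auto
 ultimately have d: "((%x::'a. \<integral>om. f om \<partial>lborel) has_derivative (%v. \<Sum>b\<in>Basis. (v *. b) *! (LB om. pd b f om))) (at 0)"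
  by simp
 have "pd b (%x::'a. \<integral>om. f om \<partial>lborel) 0 = (\<Sum>c\<in>Basis. (b *. c) *! (LB om. pd c f om))"
  by (rule partial_deriv_eq[OF d])
 also have "... = (\<Sum>c\<in>Basis. if c = b then (LB om. pd c f om) else 0)"
  using b by (intro sum.cong) (auto simp: inner_Basis)
 also have "... = (LB om. pd b f om)" using b by simp
 also have "pd b (%x::'a. \<integral>om. f om \<partial>lborel) 0 = 0"
  by (subst partial_deriv_eq[OF has_derivative_const]) simp
 finally show ?thesis by simp
qed

text \<open>The Fourier transform with the sign of the Zak transform. At a lattice point it is, up
  to the volume of the cell, the Fourier coefficient of the periodization over the dual
  lattice.\<close>

definition fco :: "'a::euclidean_space => ('a => complex) => complex" where
 "fco k p = (LB x. p x * cis (k *. x))"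

lemma cis_measurable [measurable]: "(%x. cis (k *. x)) : bm"
 by (intro bm_contI continuous_intros)

lemma fco_iterated_deriv:
 fixes p :: "'a::euclidean_space => complex"
 assumes p: "smooth p" and bd: "!!be. \<exists>C. \<forall>x. cmod (md be p x) <= C / pw x"
  and bs: "set bs \<subseteq> Basis"
 shows "cmod (fco k (itd bs p)) = amon (count_list bs) k * cmod (fco k p)"
 using bs
proof (induction bs)
 case (Cons b bs)
 hence b: "b : Basis" and bs: "set bs \<subseteq> Basis" by auto
 define g where "g = itd bs p"
 have g: "smooth g" unfolding g_def by (rule smooth_iterated_deriv[OF p bs])
 have gd: "g = md (count_list bs) p" unfolding g_def by (rule smooth_iterated_multi[OF p bs])
 have pg: "pd c g = md ((count_list bs)(c := Suc (count_list bs c))) p" if "c : Basis" for c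
  unfolding gd multi_deriv_Suc[OF p that] ..
 obtain C where C: "!!x. cmod (g x) <= C / pw x" using bd unfolding gd by metis
 have "\<forall>c\<in>Basis. \<exists>D. \<forall>x. cmod (pd c g x) <= D / pw x" using bd pg by simp
 then obtain D where D: "!!c x. c : Basis ==> cmod (pd c g x) <= D c / pw x" by metis
 define D' where "D' = (\<Sum>c\<in>Basis. \<bar>D c\<bar> + \<bar>k *. c\<bar> * \<bar>C\<bar>)"
 let ?q = "%x. g x * cis (k *. x)"
 have pdq: "pd c ?q x = pd c g x * cis (k *. x) + g x * ((k *. c) *! (\<i> * cis (k *. x)))" for c x
  by (subst partial_deriv_mult) (auto intro!: smooth_differentiable g smooth_cis simp: partial_deriv_eq[OF has_derivative_cis_inner])
 have zero: "(LB x. pd b ?q x) = 0"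
 proof (rule integral_partial_deriv_eq_0[OF smooth_mult[OF g smooth_cis] _ _ b])
  show "cmod (g x * cis (k *. x)) <= C / pw x" for x using C[of x] by (simp add: norm_mult)
  show "cmod (pd c ?q x) <= D' / pw x" if c: "c : Basis" for c x
  proof -
   have "cmod (pd c ?q x) <= cmod (pd c g x) + cmod (g x) * \<bar>k *. c\<bar>"
    unfolding pdq by (rule order_trans[OF norm_triangle_ineq]) (simp add: norm_mult)
   also have "... <= \<bar>D c\<bar> / pw x + \<bar>C\<bar> / pw x * \<bar>k *. c\<bar>"
    using D[OF c, of x] C[of x] pw_pos[of x]
    by (intro add_mono mult_right_mono) (auto elim!: order_trans intro!: divide_right_mono)
   also have "... = (\<bar>D c\<bar> + \<bar>k *. c\<bar> * \<bar>C\<bar>) / pw x" by (simp add: add_divide_distrib)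
   also have "... <= D' / pw x"
    unfolding D'_def using c pw_pos[of x] by (intro divide_right_mono member_le_sum) auto
   finally show ?thesis .
  qed
 qed
 have i1: "integrable lborel (%x. pd b g x * cis (k *. x))"
  by (rule integrable_pw_bound[where C="D b"])
   (use D[OF b] smooth_borel_measurable[OF smooth_partial_deriv[OF g b]] in \<open>auto simp: norm_mult\<close>)
 have i2: "integrable lborel (%x. g x * cis (k *. x))"
  by (rule integrable_pw_bound[where C=C])
   (use C smooth_borel_measurable[OF g] in \<open>auto simp: norm_mult\<close>)
 have "0 = (LB x. pd b g x * cis (k *. x) + (\<i> * of_real (k *. b)) * (g x * cis (k *. x)))"
  using zero unfolding pdq by (simp add: scaleR_conv_of_real mult_ac)
 also have "... = fco k (pd b g) + (\<i> * of_real (k *. b)) * fco k g"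
  using i1 i2 by (simp add: fco_def)
 finally have "fco k (pd b g) = - ((\<i> * of_real (k *. b)) * fco k g)"
  by (simp add: eq_neg_iff_add_eq_0)
 hence "cmod (fco k (itd (b # bs) p)) = \<bar>k *. b\<bar> * cmod (fco k g)"
  by (simp add: g_def norm_mult)
 also have "... = \<bar>k *. b\<bar> * (amon (count_list bs) k * cmod (fco k p))"
  using Cons.IH[OF bs] by (simp add: g_def)
 also have "\<bar>k *. b\<bar> * (amon (count_list bs) k * cmod (fco k p)) = \<bar>mon (count_list (b # bs)) k\<bar> * cmod (fco k p)"
 proof -
  have "count_list (b # bs) = (count_list bs)(b := Suc (count_list bs b))" by (auto simp: fun_eq_iff)
  thus ?thesis using monomial_at_Suc[OF b, of "count_list bs" k] by (simp add: abs_mult del: fun_upd_apply)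
 qed
 finally show ?case .
qed (simp add: monomial_at_def)

lemma fco_multi_deriv:
 fixes p :: "'a::euclidean_space => complex"
 assumes p: "smooth p" and bd: "!!be. \<exists>C. \<forall>x. cmod (md be p x) <= C / pw x"
 shows "cmod (fco k (md ga p)) = amon ga k * cmod (fco k p)"
proof -
 have "mon (count_list (index_list ga)) k = mon ga k"
  by (rule monomial_at_cong) (simp add: count_index_list)
 thus ?thesis
  using fco_iterated_deriv[OF p bd set_index_list[of ga]] by (simp add: multi_deriv_index_list)
qed

lemma cmod_fco_le:
 fixes p :: "'a::euclidean_space => complex"
 assumes "p : bm" "!!x. cmod (p x) <= C / pw x"
 shows "cmod (fco k p) <= C * (LB x. 1 / pw (x::'a))"
proof -
 have "cmod (fco k p) <= (LB x. cmod (p x * cis (k *. x)))"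
  unfolding fco_def by (rule integral_norm_bound)
 also have "... <= (LB x. C * (1 / pw (x::'a)))"
 proof (rule integral_mono)
  show "integrable lborel (%x. cmod (p x * cis (k *. x)))"
   by (intro integrable_norm integrable_pw_bound[where C=C]) (use assms in \<open>auto simp: norm_mult\<close>)
  show "integrable lborel (%x::'a. C * (1 / pw x))"
   by (rule intb_mult_r[OF integrable_pw])
 qed (use assms(2) in \<open>auto simp: norm_mult\<close>)
 finally show ?thesis by (simp only: int_mult_r)
qed

section \<open>Lattices and fundamental domains\<close>

lemma integral_count_space_swap:
 fixes F :: "'j => 'x => 'b::{banach, second_countable_topology}"
 assumes J: "countable J" and M: "sigma_finite_measure M"
  and F: "!!j. j : J ==> integrable M (F j)"
  and S: "integrable (count_space J) (%j. \<integral>x. norm (F j x) \<partial>M)"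
 shows "(\<integral>j. (\<integral>x. F j x \<partial>M) \<partial>count_space J) = (\<integral>x. (\<integral>j. F j x \<partial>count_space J) \<partial>M)"
  and "integrable M (%x. \<integral>j. F j x \<partial>count_space J)"
  and "AE x in M. integrable (count_space J) (%j. F j x)"
proof -
 interpret pair_sigma_finite "count_space J" M
  using M sigma_finite_measure_count_space_countable[OF J] by (rule pair_sigma_finite.intro[rotated])
 have "integrable (count_space J \<Otimes>\<^sub>M M) (case_prod F)"
 proof (rule Fubini_integrable)
  show "case_prod F : borel_measurable (count_space J \<Otimes>\<^sub>M M)"
   using F by (intro measurable_pair_measure_countable1 J) auto
 qed (use F S in \<open>auto intro!: AE_I2\<close>)
 from Fubini_integral[OF this] integral_snd[OF this] show "(\<integral>j. (\<integral>x. F j x \<partial>M) \<partial>count_space J) = (\<integral>x. (\<integral>j. F j x \<partial>count_space J) \<partial>M)"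
  by simp
 show "integrable M (%x. \<integral>j. F j x \<partial>count_space J)" "AE x in M. integrable (count_space J) (%j. F j x)"
  using integrable_snd[OF \<open>integrable _ (case_prod F)\<close>] AE_integrable_snd[OF \<open>integrable _ (case_prod F)\<close>] by simp_all
qed

text \<open>Biorthogonality is stored together with both expansions, which makes the relation
  symmetric: statements about a lattice and its dual can be used with the roles exchanged.\<close>

definition dual_pair :: "('n::finite => real ^ 'n) => ('n => real ^ 'n) => bool" where
 "dual_pair e e' \<longleftrightarrow> (\<forall>j k. e j *. e' k = (if j = k then 2 * pi else 0)) \<and>
  (\<forall>x. x = (\<Sum>i\<in>UNIV. (x *. e' i / (2 * pi)) *! e i)) \<and> (\<forall>x. x = (\<Sum>i\<in>UNIV. (x *. e i / (2 * pi)) *! e' i))"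

lemma dual_pair_sym: "dual_pair e e' ==> dual_pair e' e"
 unfolding dual_pair_def by (auto simp: inner_commute)

text \<open>The dual vectors are 2 pi times the images of the coordinate axes under the adjoint of
  the coordinate map of the basis. Spanning gives the uniqueness that the definite description in
  \<open>dual_basis\<close> requires.\<close>

lemma dual_pair_dual_basis:
 fixes e :: "'n::finite => real ^ 'n"
 assumes "basis_family e"
 shows "dual_pair e (dual_basis e)"
proof -
 have inj: "inj e" and ind: "independent (range e)" and span: "span (range e) = UNIV"
  using assms by (auto simp: basis_family_def)
 obtain g where g: "linear g" "!!x. x : range e ==> g x = axis (inv e x) (1::real)"
  using linear_independent_extend[OF ind, of "%x. axis (inv e x) 1"] by blast
 have g': "g (e i) = axis i 1" for i using g(2)[of "e i"] inj by simp
 define f where "f k = (2 * pi) *! adjoint g (axis k 1)" for k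
 have f: "e j *. f k = (if j = k then 2 * pi else 0)" for j k
  unfolding f_def by (simp add: adjoint_works[OF g(1)] g' inner_axis_axis)
 have orth: "x = 0" if "!!j. e j *. x = 0" for x
 proof -
  have "x : span (range e)" using span by simp
  hence "x *. x = 0"
   using that by (intro orthogonal_to_span[of x "range e" x, unfolded orthogonal_def]) (auto simp: inner_commute)
  thus ?thesis by simp
 qed
 have d: "dual_basis e = f"
  unfolding dual_basis_def
 proof (rule the_equality)
  fix f' assume f': "\<forall>j k. e j *. f' k = (if j = k then 2 * pi else 0)"
  have "f' k - f k = 0" for k by (rule orth) (simp add: inner_diff_right f f')
  thus "f' = f" by auto
 qed (use f in simp)
 have c: "(\<Sum>i\<in>UNIV. (c i) *! e i) *. f k = c k * (2 * pi)" for c :: "'n => real" and k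
  by (simp add: inner_sum_left f if_distrib[of "%x. _ * x"] cong: if_cong)
 have "x = (\<Sum>i\<in>UNIV. (x *. f i / (2 * pi)) *! e i)" for x
 proof -
  have "x : range (%u. \<Sum>v\<in>range e. u v *! v)"
   using span span_finite[of "range e"] by auto
  then obtain u where u: "x = (\<Sum>v\<in>range e. u v *! v)" by blast
  hence "x = (\<Sum>i\<in>UNIV. u (e i) *! e i)" using inj by (simp add: sum.reindex)
  moreover from c[of "%i. u (e i)"] this have "x *. f k / (2 * pi) = u (e k)" for k by simp
  ultimately show ?thesis by simp
 qed
 moreover have "x = (\<Sum>i\<in>UNIV. (x *. e i / (2 * pi)) *! f i)" for x
 proof -
  have "x - (\<Sum>i\<in>UNIV. (x *. e i / (2 * pi)) *! f i) = 0"
   by (rule orth) (simp add: inner_diff_right inner_sum_right f inner_commute if_distrib[of "%x. _ * x"] cong: if_cong)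
  thus ?thesis by simp
 qed
 ultimately show ?thesis using f by (simp add: dual_pair_def d)
qed

lemma countable_lattice: "countable (lat e)"
proof -
 have "lat e = range (%n::'a => int. \<Sum>i\<in>UNIV. real_of_int (n i) *! e i)"
  by (auto simp: lattice_of_def)
 thus ?thesis by simp
qed

lemma lattice_zero: "0 : lat e"
 unfolding lattice_of_def by (rule CollectI, rule exI[of _ "%_. 0"]) simp

lemma lattice_add: "j : lat e ==> k : lat e ==> j + k : lat e"
 unfolding lattice_of_def
 by (clarify, rename_tac m n, rule_tac x="%i. m i + n i" in exI) (simp add: scaleR_left_distrib sum.distrib)

lemma lattice_minus: "j : lat e ==> - j : lat e"
 unfolding lattice_of_def
 by (clarify, rename_tac m, rule_tac x="%i. - m i" in exI) (simp add: sum_negf)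

lemma lattice_basis: "e i : lat e"
proof -
 have "e i = (\<Sum>k\<in>UNIV. real_of_int (if k = i then 1 else 0) *! e k)"
  by (simp add: if_distrib[of "%x. x *! _"] if_distrib[of real_of_int] cong: if_cong)
 thus ?thesis unfolding lattice_of_def by (rule_tac CollectI, rule_tac exI[of _ "%k. if k = i then 1 else 0"]) simp
qed

lemma lattice_inner_basis:
 assumes "dual_pair e e'" "j : lat e"
 obtains m :: int where "j *. e' k = 2 * pi * of_int m"
proof -
 obtain n where "j = (\<Sum>i\<in>UNIV. real_of_int (n i) *! e i)" using assms(2) by (auto simp: lattice_of_def)
 hence "j *. e' k = 2 * pi * of_int (n k)"
  using assms(1) by (simp add: dual_pair_def inner_sum_left if_distrib[of "%x. _ * x"] cong: if_cong)
 thus ?thesis using that by blast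
qed

lemma cis_lattice_inner:
 assumes "dual_pair e e'" "j : lat e" "ka \<in> lat e'"
 shows "cis (j *. ka) = 1"
proof -
 obtain n where n: "ka = (\<Sum>i\<in>UNIV. real_of_int (n i) *! e' i)" using assms(3) by (auto simp: lattice_of_def)
 have "\<forall>i. \<exists>m::int. j *. e' i = 2 * pi * of_int m" using lattice_inner_basis[OF assms(1,2)] by metis
 then obtain m :: "_ => int" where m: "!!i. j *. e' i = 2 * pi * of_int (m i)" by metis
 have "j *. ka = 2 * pi * of_int (\<Sum>i\<in>UNIV. n i * m i)"
  by (simp add: n inner_sum_right m sum_distrib_left mult_ac)
 thus ?thesis by (metis cis_multiple_2pi Ints_of_int)
qed

text \<open>A fundamental domain of the lattice of \<open>e\<close> when \<open>e'\<close> is dual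
  to \<open>e\<close>: the inner products of x with the \<open>e'\<close> vectors, divided by 2 pi,
  are the lattice coordinates of x, and they are confined to [-1/2, 1/2). Half-open sides let the
  translates tile without overlap. Accordingly \<open>cell e\<close> belongs to the dual
  lattice.\<close>

definition cell :: "('n::finite => real ^ 'n) => (real ^ 'n) set" where
 "cell e' = {x. \<forall>i. - pi <= x *. e' i \<and> x *. e' i < pi}"

lemma cell_measurable [measurable]: "cell e' : sets borel"
 unfolding cell_def by measurable

lemma cell_indicator_measurable [measurable]:
 "(%x. indicator (cell e') (x - j) :: real) \<in> bm"
 "(%x. indicator (cell e') (x - j) :: ennreal) \<in> bm"
 by (rule measurable_compose[OF _ borel_measurable_indicator[OF cell_measurable]], measurable)+

lemma cell_translate:
 assumes "dual_pair e e'"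
 shows "\<exists>!j. j : lat e \<and> x - j : cell e'"
proof
 define n where "n i = \<lfloor>(x *. e' i + pi) / (2 * pi)\<rfloor>" for i
 define j where "j = (\<Sum>i\<in>UNIV. real_of_int (n i) *! e i)"
 have ip: "(\<Sum>i\<in>UNIV. real_of_int (n i) *! e i) *. e' k = 2 * pi * of_int (n k)" for n k
  using assms by (simp add: dual_pair_def inner_sum_left if_distrib[of "%x. _ * x"] cong: if_cong)
 have fl: "- pi <= y - 2 * pi * of_int m \<and> y - 2 * pi * of_int m < pi \<longleftrightarrow> m = \<lfloor>(y + pi) / (2 * pi)\<rfloor>" for y m
  unfolding eq_commute[of m] floor_eq_iff by (auto simp: field_simps)
 show "j : lat e \<and> x - j : cell e'"
  by (auto simp: cell_def j_def lattice_of_def inner_diff_left ip fl n_def)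
 fix j' assume j': "j' : lat e \<and> x - j' : cell e'"
 then obtain m where m: "j' = (\<Sum>i\<in>UNIV. real_of_int (m i) *! e i)" by (auto simp: lattice_of_def)
 have "m i = n i" for i using j' unfolding m n_def by (simp add: cell_def inner_diff_left ip fl)
 hence "m = n" by auto
 thus "j' = j" by (simp add: m j_def)
qed

lemma cell_translateE:
 assumes "dual_pair e e'"
 obtains j where "j : lat e" "!!k. k : lat e ==> x - k : cell e' \<longleftrightarrow> k = j"
proof (rule ex1E[OF cell_translate[OF assms, of x]])
 fix j assume j: "j : lat e \<and> x - j : cell e'" and u: "\<forall>k. k : lat e \<and> x - k : cell e' --> k = j"
 show thesis by (rule that[of j]) (use j u in blast)+
qed

lemma cell_bounded:
 assumes "dual_pair e e'"
 obtains R where "0 < R" "!!x. x : cell e' ==> norm x <= R"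
proof -
 define R where "R = 1 + (\<Sum>i\<in>UNIV. norm (e i))"
 have "0 < R" by (auto simp: R_def intro!: add_pos_nonneg sum_nonneg)
 moreover have "norm x <= R" if x: "x : cell e'" for x
 proof -
  have "x = (\<Sum>i\<in>UNIV. (x *. e' i / (2 * pi)) *! e i)" using assms unfolding dual_pair_def by blast
  hence "norm x <= (\<Sum>i\<in>UNIV. norm ((x *. e' i / (2 * pi)) *! e i))" by (metis norm_sum)
  also have "... <= (\<Sum>i\<in>UNIV. norm (e i))"
  proof (rule sum_mono)
   fix i
   have "\<bar>x *. e' i / (2 * pi)\<bar> <= 1" using x pi_gt_zero by (simp add: cell_def abs_le_iff field_simps) (smt (verit) x)
   hence "\<bar>x *. e' i / (2 * pi)\<bar> * norm (e i) <= 1 * norm (e i)" by (rule mult_right_mono) simp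
   thus "norm ((x *. e' i / (2 * pi)) *! e i) <= norm (e i)" by simp
  qed
  finally show ?thesis by (simp add: R_def)
 qed
 ultimately show ?thesis using that by blast
qed

lemma nn_integral_cell_translates:
 assumes dp: "dual_pair e e'" and f: "f : bm"
 shows "(\<integral>\<^sup>+j. (\<integral>\<^sup>+x. f x * indicator (cell e') (x - j) \<partial>lborel) \<partial>csl e) = (\<integral>\<^sup>+x. f x \<partial>lborel)"
proof -
 have "(\<integral>\<^sup>+j. (\<integral>\<^sup>+x. f x * indicator (cell e') (x - j) \<partial>lborel) \<partial>csl e) =
  (\<integral>\<^sup>+x. (\<integral>\<^sup>+j. f x * indicator (cell e') (x - j) \<partial>csl e) \<partial>lborel)"
  using f by (intro nn_integral_count_space_nn_integral[symmetric] countable_lattice borel_measurable_times_ennreal) auto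
 moreover have "(\<integral>\<^sup>+j. f x * indicator (cell e') (x - j) \<partial>csl e) = f x" for x
 proof -
  obtain j0 where j0: "j0 : lat e" "!!j. j : lat e ==> x - j : cell e' \<longleftrightarrow> j = j0"
   using cell_translateE[OF dp, of x] by blast
  have "(\<integral>\<^sup>+j. f x * indicator (cell e') (x - j) \<partial>csl e) =
    (\<integral>\<^sup>+j. f x * indicator {j0} j \<partial>csl e)"
   by (intro nn_integral_cong) (simp add: indicator_def j0(2))
  also have "... = f x" using j0(1) by (simp add: nn_integral_cmult_indicator)
  finally show ?thesis .
 qed
 ultimately show ?thesis by simp
qed

lemma emeasure_cell:
 assumes dp: "dual_pair e e'"
 shows "emeasure lborel (cell e') < \<infinity>" "0 < measure lborel (cell e')"
proof -
 obtain R where R: "!!x. x : cell e' ==> norm x <= R" using cell_bounded[OF dp] by metis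
 hence "cell e' \<subseteq> cball 0 R" by auto
 from emeasure_mono[OF this, of lborel] have "emeasure lborel (cell e') <= emeasure lborel (cball (0::real^'a) R)" by simp
 also have "... < \<infinity>" by (rule emeasure_lborel_cball_finite)
 finally show fin: "emeasure lborel (cell e') < \<infinity>" .
 define U where "U = {x. \<forall>i. - pi < x *. e' i \<and> x *. e' i < pi}"
 have "U = (\<Inter>i. {x. - pi < x *. e' i} \<inter> {x. x *. e' i < pi})" by (auto simp: U_def)
 hence "open U" by (auto intro!: open_INT open_Int open_Collect_less continuous_intros)
 moreover have "0 : U" by (auto simp: U_def)
 ultimately have "\<not> negligible U" using open_not_negligible by blast
 hence "\<not> negligible (cell e')" by (rule contrapos_nn) (auto intro: negligible_subset simp: U_def cell_def less_imp_le)
 hence "emeasure lborel (cell e') ~= 0"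
  using null_sets_completionI[of "cell e'" lborel] by (auto simp: negligible_iff_null_sets null_sets_def)
 thus "0 < measure lborel (cell e')"
  using fin by (simp add: measure_def enn2real_positive_iff zero_less_iff_neq_zero)
qed

text \<open>By Peetre's inequality the value of \<open>1 / pw\<close> at j is at most a constant
  times its average over the cell moved to j. The moved cells tile the space, so the lattice sum is
  controlled by an integral.\<close>

lemma integrable_lattice_pw:
 assumes dp: "dual_pair e e'"
 shows "integrable (csl e) (%j. 1 / pw j)"
proof (rule integrableI_bounded)
 obtain R where R: "!!x. x : cell e' ==> norm x <= R" using cell_bounded[OF dp] by metis
 define C where "C = 2 ^ CARD('a) * (1 + R\<^sup>2) ^ CARD('a)"
 have C: "0 <= C" by (simp add: C_def)
 let ?m = "measure lborel (cell e')"
 have le: "ennreal (1 / pw j) <= ennreal (C / ?m) * (\<integral>\<^sup>+x. ennreal (1 / pw x) * indicator (cell e') (x - j) \<partial>lborel)" for j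
 proof -
  have "ennreal (1 / pw j) * emeasure lborel (cell e') = (\<integral>\<^sup>+x. ennreal (1 / pw j) * indicator (cell e') (x - j) \<partial>lborel)"
  proof -
   have "(\<integral>\<^sup>+x. ennreal (1 / pw j) * indicator (cell e') (x + (- j)) \<partial>lborel) = (\<integral>\<^sup>+x. ennreal (1 / pw j) * indicator (cell e') x \<partial>lborel)"
    by (rule nn_integral_lborel_translate) measurable
   thus ?thesis by (simp add: nn_integral_cmult_indicator)
  qed
  also have "... <= (\<integral>\<^sup>+x. ennreal C * (ennreal (1 / pw x) * indicator (cell e') (x - j)) \<partial>lborel)"
  proof (rule nn_integral_mono)
   fix x
   have "1 / pw j <= C * (1 / pw x)" if "x - j : cell e'"
   proof -
    have "1 / pw j <= 2 ^ CARD('a) * pw (x - j) / pw x"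
     using inverse_pw_le[of j "x - j"] by simp
    also have "... <= 2 ^ CARD('a) * (1 + R\<^sup>2) ^ CARD('a) / pw x"
     using pw_bounded[OF R[OF that]] pw_pos[of x] by (intro divide_right_mono mult_left_mono) auto
    finally show ?thesis by (simp add: C_def)
   qed
   thus "ennreal (1 / pw j) * indicator (cell e') (x - j) <= ennreal C * (ennreal (1 / pw x) * indicator (cell e') (x - j))"
    using C pw_pos[of x] by (auto simp: indicator_def ennreal_mult[symmetric] ennreal_leI)
  qed
  also have "... = ennreal C * (\<integral>\<^sup>+x. ennreal (1 / pw x) * indicator (cell e') (x - j) \<partial>lborel)"
   by (rule nn_integral_cmult) measurable
  finally have "ennreal (1 / ?m) * (ennreal (1 / pw j) * emeasure lborel (cell e')) <= ennreal (1 / ?m) * (ennreal C * (\<integral>\<^sup>+x. ennreal (1 / pw x) * indicator (cell e') (x - j) \<partial>lborel))"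
   by (rule mult_left_mono) simp
  moreover have "ennreal (1 / ?m) * (ennreal (1 / pw j) * emeasure lborel (cell e')) = ennreal (1 / pw j)"
   using emeasure_cell[OF dp] pw_pos[of j]
   by (simp add: emeasure_eq_ennreal_measure less_top[symmetric] ennreal_mult[symmetric] less_imp_le)
  ultimately show ?thesis using C emeasure_cell(2)[OF dp] by (simp add: ennreal_mult[symmetric] mult.assoc[symmetric])
 qed
 have "(\<integral>\<^sup>+j. ennreal (norm (1 / pw j)) \<partial>csl e) \<le>
  (\<integral>\<^sup>+j. ennreal (C / ?m) * (\<integral>\<^sup>+x. ennreal (1 / pw x) * indicator (cell e') (x - j) \<partial>lborel) \<partial>csl e)"
 proof (rule nn_integral_mono)
  fix j :: "real ^ 'a"
  have "norm (1 / pw j) = 1 / pw j" using pw_pos[of j] by simp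
  thus "ennreal (norm (1 / pw j)) <= ennreal (C / ?m) * (\<integral>\<^sup>+x. ennreal (1 / pw x) * indicator (cell e') (x - j) \<partial>lborel)"
   using le[of j] by simp
 qed
 also have "... = ennreal (C / ?m) * (\<integral>\<^sup>+x. ennreal (1 / pw (x::real^'a)) \<partial>lborel)"
  by (subst nn_integral_cmult) (auto simp: nn_integral_cell_translates[OF dp])
 also have "... < \<infinity>"
 proof -
  have "(\<integral>\<^sup>+x. ennreal (1 / pw (x::real^'a)) \<partial>lborel) < \<infinity>"
   using integrable_pw[where 'a="real^'a"] pw_pos unfolding integrable_iff_bounded by (simp add: less_imp_le)
  thus ?thesis by (simp add: ennreal_mult_less_top)
 qed
 finally show "(\<integral>\<^sup>+j. ennreal (norm (1 / pw j)) \<partial>csl e) < \<infinity>" .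
qed simp

text \<open>The function is cut along the translated cells, and each piece is moved back to the cell
  at the origin. At each x exactly one piece of the cut function is present, so the pieces sum to
  \<open>f\<close>.\<close>

lemma integral_periodization:
 fixes f :: "real ^ 'n::finite => 'b::{banach, second_countable_topology}"
 assumes dp: "dual_pair e e'" and f: "integrable lborel f"
 shows "(LB x. f x) = (LB x. (\<integral>j. indicator (cell e') x *! f (x + j) \<partial>csl e))"
  and "integrable lborel (%x. \<integral>j. indicator (cell e') x *! f (x + j) \<partial>csl e)"
  and "(LB x. f x) = (\<integral>j. (LB x. indicator (cell e') x *! f (x + j)) \<partial>csl e)"
proof -
 let ?J = "csl e"
 define G where "G j x = indicator (cell e') (x - j) *! f x" for j x
 define F where "F j x = indicator (cell e') x *! f (x + j)" for j x
 have fm [measurable]: "f : bm" using f by simp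
 have GF: "F j x = G j (x + j)" for j x by (simp add: F_def G_def)
 have iG: "integrable lborel (G j)" for j
 proof (rule integrable_bd[OF f])
  show "G j : borel_measurable lborel" unfolding G_def[abs_def] by measurable
 qed (auto simp: G_def indicator_def)
 have "F j = (%x. G j (x + j))" for j by (auto simp: GF fun_eq_iff)
 hence iF: "integrable lborel (F j)" for j using lborel_integrable_translate[OF iG, of j j] by simp
 have nG: "(LB x. norm (F j x)) = (LB x. norm (G j x))" for j
  using lborel_integral_translate[of "%x. norm (G j x)" j] iG[of j] by (simp add: GF)
 have SG: "integrable ?J (%j. \<integral>x. norm (G j x) \<partial>lborel)"
 proof (rule integrableI_bounded)
  have "ennreal (norm (LB x. norm (G j x))) = (\<integral>\<^sup>+x. ennreal (norm (f x)) * indicator (cell e') (x - j) \<partial>lborel)" for j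
  proof -
   have "ennreal (norm (LB x. norm (G j x))) = (\<integral>\<^sup>+x. ennreal (norm (G j x)) \<partial>lborel)"
    using iG[of j] by (subst nn_integral_eq_integral) (auto simp: integral_nonneg_AE)
   also have "... = (\<integral>\<^sup>+x. ennreal (norm (f x)) * indicator (cell e') (x - j) \<partial>lborel)"
    by (intro nn_integral_cong) (auto simp: G_def indicator_def)
   finally show ?thesis .
  qed
  hence "(\<integral>\<^sup>+j. ennreal (norm (LB x. norm (G j x))) \<partial>?J) = (\<integral>\<^sup>+x. ennreal (norm (f x)) \<partial>lborel)"
   using nn_integral_cell_translates[OF dp, of "%x. ennreal (norm (f x))"] by simp
  also have "... < \<infinity>" using f unfolding integrable_iff_bounded by simp
  finally show "(\<integral>\<^sup>+j. ennreal (norm (LB x. norm (G j x))) \<partial>?J) < \<infinity>" .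
 qed simp
 have Gs: "(\<integral>j. G j x \<partial>?J) = f x" for x
 proof -
  obtain j0 where j0: "j0 : lat e" "!!j. j : lat e ==> x - j : cell e' \<longleftrightarrow> j = j0"
   using cell_translateE[OF dp, of x] by blast
  have "(\<integral>j. G j x \<partial>?J) = (\<integral>j. indicator {j0} j *! f x \<partial>?J)"
   by (intro integral_cg) (simp_all add: G_def indicator_def j0(2))
  also have "... = f x" using j0(1) by (simp add: measure_count_space)
  finally show ?thesis .
 qed
 note lb = sigma_finite_lborel
 have "(LB x. f x) = (\<integral>j. (LB x. G j x) \<partial>?J)"
  using integral_count_space_swap(1)[OF countable_lattice lb iG SG] by (simp add: Gs)
 also have "... = (\<integral>j. (LB x. F j x) \<partial>?J)"
  using lborel_integral_translate[OF borel_measurable_integrable[OF iG, simplified]] by (simp add: GF)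
 finally have eq: "(LB x. f x) = (\<integral>j. (LB x. F j x) \<partial>?J)" .
 thus "(LB x. f x) = (\<integral>j. (LB x. indicator (cell e') x *! f (x + j)) \<partial>?J)"
  by (simp add: F_def)
 note eq
 also have "(\<integral>j. (LB x. F j x) \<partial>?J) = (LB x. (\<integral>j. F j x \<partial>?J))"
  using integral_count_space_swap(1)[OF countable_lattice lb iF SG[folded nG]] by simp
 finally show "(LB x. f x) = (LB x. (\<integral>j. indicator (cell e') x *! f (x + j) \<partial>?J))"
  by (simp add: F_def)
 show "integrable lborel (%x. \<integral>j. indicator (cell e') x *! f (x + j) \<partial>?J)"
  using integral_count_space_swap(2)[OF countable_lattice lb iF SG[folded nG]] by (simp add: F_def)
qed

section \<open>The transposed Zak transform\<close>

lemma pw_nonneg [simp]: "0 <= pw x"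
 by (rule less_imp_le[OF pw_pos])

declare pw_pos [simp]

lemma monomial_at_join: "mon (join al de) (x, y) = mon al x * mon de y"
 unfolding monomial_at_prod
 by (intro arg_cong2[where f="(*)"] monomial_at_cong) (auto simp: join_simps)

lemma gsw_join:
 "gsw (two_groups s1 s2) h (join al de) = gsw (%_. s1) h al * gsw (%_. s2) h de"
 unfolding gsw_two_groups
 by (intro arg_cong2[where f="(*)"] gsw_cong) (auto simp: join_simps)

lemma gsb_slice:
 assumes h: "0 < h" and s2: "0 <= s2"
 obtains P where "0 < P" "!!(ph :: 'a::euclidean_space \<times> 'b::euclidean_space => complex) C al be ga x y.
  gsb (two_groups s1 s2) (two_groups sr1 sr2) h C ph ==>
  amon al x * cmod (md (join be ga) ph (x, y)) \<le>
   C * P * (gsw (%_. s1) h al * (gsw (%_. sr1) h be * gsw (%_. sr2) h ga)) / pw y"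
proof -
 obtain P where P: "0 < P" "!!(k::'b) A C ga. 0 <= A ==> (!!ga. amon ga k * A <= C * gsw (%_. s2) h ga) ==>
  pw k * (amon ga k * A) <= C * P * gsw (%_. s2) (2 powr s2 * h) ga"
  by (rule pw_absorb[OF h, of "%_. s2" s2]) (use s2 in auto)
 show thesis
 proof (rule that[OF P(1)])
  fix ph :: "'a \<times> 'b => complex" and C :: real and al be :: "'a => nat" and ga :: "'b => nat" and x :: 'a and y :: 'b
  assume ph: "gsb (two_groups s1 s2) (two_groups sr1 sr2) h C ph"
  let ?A = "amon al x * cmod (md (join be ga) ph (x, y))"
  let ?W = "gsw (%_. s1) h al * (gsw (%_. sr1) h be * gsw (%_. sr2) h ga)"
  have "pw y * (amon (%_. 0) y * ?A) <= C * ?W * P * gsw (%_. s2) (2 powr s2 * h) (%_::'b. 0)"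
  proof (rule P(2)[of ?A y "C * ?W" "%_. 0"])
   show "amon de y * ?A <= C * ?W * gsw (%_. s2) h de" for de
    using gsbD(3)[OF ph, of "join al de" "(x, y)" "join be ga"]
    by (simp add: monomial_at_join gsw_join abs_mult mult_ac)
  qed simp
  thus "?A <= C * P * ?W / pw y"
   using pw_pos[of y] by (simp add: field_simps)
 qed
qed

definition zak_coeff :: "('a::euclidean_space \<times> 'b::euclidean_space => complex) => 'b => 'a => complex" where
 "zak_coeff ph j x = (LB y. ph (x, y) * cis (j *. y))"

text \<open>Integration by parts in the second variable trades powers of j for derivatives there,
  whose weight has the exponent \<open>sr2\<close>. In the application \<open>sr2\<close> is the
  exponent s of the powers of x, so the decay in j has exactly the weight needed for a translation
  by j in x.\<close>

lemma zak_coeff_bounded: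
 assumes h: "0 < h" and s2: "0 <= s2"
 obtains P where "0 < P" "!!(ph :: 'a::euclidean_space \<times> 'b::euclidean_space => complex) C j.
  gsb (two_groups s1 s2) (two_groups sr1 sr2) h C ph ==>
  smooth (zak_coeff ph j) \<and> (\<forall>ga al be x. amon ga j * (amon al x * cmod (md be (zak_coeff ph j) x)) \<le>
   C * P * (gsw (%_. sr2) h ga * (gsw (%_. s1) h al * gsw (%_. sr1) h be)))"
proof -
 obtain P where P: "0 < P" "!!(ph :: 'a \<times> 'b => complex) C al be ga x y.
  gsb (two_groups s1 s2) (two_groups sr1 sr2) h C ph ==>
  amon al x * cmod (md (join be ga) ph (x, y)) \<le>
   C * P * (gsw (%_. s1) h al * (gsw (%_. sr1) h be * gsw (%_. sr2) h ga)) / pw y"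
  using gsb_slice[OF h s2, of s1 sr1 sr2, where 'a='a and 'b='b] by blast
 define I where "I = (LB y. 1 / pw (y::'b))"
 have I: "0 <= I" unfolding I_def using pw_pos by (intro integral_nn) (simp add: less_imp_le)
 show thesis
 \<comment> \<open>\<open>I\<close> has only been shown to be nonnegative; adding 1 keeps the
   constant positive.\<close>
 proof (rule that[of "P * (I + 1)"])
  show "0 < P * (I + 1)" using P(1) I by simp
  fix ph :: "'a \<times> 'b => complex" and C :: real and j :: 'b
  assume ph: "gsb (two_groups s1 s2) (two_groups sr1 sr2) h C ph"
  have sph: "smooth ph" using gsbD(1)[OF ph] .
  have C: "0 <= C" using gsbD(2)[OF ph] .
  have sl: "(%x. md (join (%_. 0) (%_. 0)) ph (x, y)) = (%x. ph (x, y))" for y by simp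
  have sm1: "smooth (%x. ph (x, y))" for y using smooth_slice1[OF sph, of "%_. 0" y] by simp
  have md1: "md be (%x. ph (x, y)) x = md (join be (%_. 0)) ph (x, y)" for be x y
   using fun_cong[OF multi_deriv_slice1[OF sph, of be "%_. 0" y], of x] by simp
  have cont: "(%y. md be ph (x, y)) : bm" for be x
   by (intro bm_contI continuous_on_compose2[OF smooth_continuous_on[OF smooth_multi_deriv[OF sph]]] continuous_intros) auto
  have fm: "(%y. ph (x, y)) : bm" for x using cont[of "%_. 0"] by simp
  note SI = smooth_integral[where M=lborel and f="%y x. cis (j *. y) * ph (x, y)"]
  have sm: "smooth (%x. cis (j *. y) * ph (x, y))" for y by (rule smooth_scale[OF sm1])
  have md: "md be (%x. cis (j *. y) * ph (x, y)) x = cis (j *. y) * md (join be (%_. 0)) ph (x, y)" for be x y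
   by (simp add: multi_deriv_scale[OF sm1] md1)
  have bd: "\<exists>g. integrable lborel g \<and> (\<forall>y\<in>space lborel. \<forall>x. norm (md be (%x. cis (j *. y) * ph (x, y)) x) <= g y)" for be
  proof (intro exI conjI ballI allI)
   show "integrable lborel (%y::'b. C * P * gsw (%_. sr1) h be * (1 / pw y))"
    by (rule intb_mult_r[OF integrable_pw])
   show "norm (md be (%x. cis (j *. y) * ph (x, y)) x) <= C * P * gsw (%_. sr1) h be * (1 / pw y)" for y x
    using P(2)[OF ph, of "%_. 0" x be "%_. 0" y] by (simp add: md norm_mult)
  qed
  have meas: "(%y. cis (j *. y) * ph (x, y)) : borel_measurable lborel" for x using fm by simp
  have zc: "zak_coeff ph j = (%x. \<integral>y. cis (j *. y) * ph (x, y) \<partial>lborel)"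
   by (auto simp: zak_coeff_def mult.commute fun_eq_iff)
  have mdz: "md be (zak_coeff ph j) x = fco j (%y. md (join be (%_. 0)) ph (x, y))" for be x
   unfolding zc SI(2)[OF sm bd meas] md fco_def by (simp add: mult.commute)
  show "smooth (zak_coeff ph j) \<and> (\<forall>ga al be x. amon ga j * (amon al x * cmod (md be (zak_coeff ph j) x)) \<le>
   C * (P * (I + 1)) * (gsw (%_. sr2) h ga * (gsw (%_. s1) h al * gsw (%_. sr1) h be)))"
  proof (intro conjI allI)
   show "smooth (zak_coeff ph j)" unfolding zc by (rule SI(1)[OF sm bd meas])
   fix ga :: "'b => nat" and al be :: "'a => nat" and x :: 'a
   let ?p = "%y. md (join be (%_. 0)) ph (x, y)"
   let ?W = "gsw (%_. s1) h al * (gsw (%_. sr1) h be * gsw (%_. sr2) h ga)"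
   have sp: "smooth ?p" by (rule smooth_slice2[OF sph])
   have mp: "md ga ?p = (%y. md (join be ga) ph (x, y))" for ga by (rule multi_deriv_slice2[OF sph])
   have bp: "\<exists>C. \<forall>y. cmod (md ga ?p y) <= C / pw y" for ga
    using P(2)[OF ph, of "%_. 0" x be ga] unfolding mp by (intro exI[of _ "C * P * (gsw (%_. s1) h (%_::'a. 0) * (gsw (%_. sr1) h be * gsw (%_. sr2) h ga))"]) simp
   have "amon ga j * (amon al x * cmod (md be (zak_coeff ph j) x)) =
    amon al x * cmod (fco j (md ga ?p))"
    by (simp add: fco_multi_deriv[OF sp bp] mdz mult_ac)
   also have "... = cmod (fco j (%y. of_real (mon al x) * md ga ?p y))"
   proof -
    have "fco j (%y. of_real (mon al x) * md ga ?p y) = of_real (mon al x) * fco j (md ga ?p)"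
     by (simp add: fco_def mult.assoc)
    thus ?thesis by (simp add: norm_mult)
   qed
   also have "... <= C * P * ?W * I"
    unfolding I_def
   proof (rule cmod_fco_le)
    show "(%y. complex_of_real (mon al x) * md ga ?p y) \<in> bm"
     unfolding mp using cont by simp
    show "cmod (complex_of_real (mon al x) * md ga ?p y) <= C * P * ?W / pw y" for y
     unfolding mp using P(2)[OF ph, of al x be ga y] by (simp add: norm_mult)
   qed
   also have "... <= C * P * ?W * (I + 1)"
    using C P(1) h by (intro mult_left_mono mult_nonneg_nonneg) (auto intro: gsw_nonneg)
   finally show "amon ga j * (amon al x * cmod (md be (zak_coeff ph j) x)) \<le>
    C * (P * (I + 1)) * (gsw (%_. sr2) h ga * (gsw (%_. s1) h al * gsw (%_. sr1) h be))"
    by (simp add: mult_ac)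
  qed
 qed
qed

lemma monomial_at_minus [simp]: "amon ga (- j) = amon ga j"
 by (simp add: abs_monomial_at)

lemma one_le_two_powr: "0 <= s ==> h <= 2 powr s * h" if "0 < h" for s h :: real
 using that by (simp add: ge_one_powr_ge_zero)

text \<open>One factor \<open>pw j\<close> is split off from the decay in j to make the lattice sum
  converge; what remains still pays for a translation by j.\<close>

lemma zak_coeff_decay:
 fixes s sr h :: real
 assumes h: "0 < h" and s: "0 <= s" and sr: "0 <= sr"
 obtains P where "0 < P" "!!(ph :: 'a::euclidean_space \<times> 'a => complex) C j.
  gsb2 s sr h C ph ==>
  smooth (zak_coeff ph j) \<and> (\<forall>ga al be x. amon ga j * (amon al x * cmod (md be (zak_coeff ph j) x)) \<le>
   C * P / pw j * (gsw1 s (2 powr s * h) ga * (gsw1 s (2 powr s * h) al * gsw1 sr (2 powr s * h) be)))"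
proof -
 define H where "H = 2 powr s * h"
 have H: "h <= H" "0 < H" using h s one_le_two_powr[OF h s] by (auto simp: H_def)
 obtain P where P: "0 < P" "!!(ph :: 'a \<times> 'a => complex) C j.
  gsb2 s sr h C ph ==>
  smooth (zak_coeff ph j) \<and> (\<forall>ga al be x. amon ga j * (amon al x * cmod (md be (zak_coeff ph j) x)) \<le>
   C * P * (gsw1 s h ga * (gsw1 s h al * gsw1 sr h be)))"
  using zak_coeff_bounded[OF h sr, of s sr s, where 'a='a and 'b='a] by blast
 obtain Q where Q: "0 < Q" "!!(k::'a) A C ga. 0 <= A ==> (!!ga. amon ga k * A <= C * gsw1 s h ga) ==>
  pw k * (amon ga k * A) <= C * Q * gsw1 s (2 powr s * h) ga"
  by (rule pw_absorb[OF h, of "%_. s" s]) (use s in auto)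
 show thesis
 proof (rule that[of "P * Q"])
  show "0 < P * Q" using P(1) Q(1) by simp
  fix ph :: "'a \<times> 'a => complex" and C :: real and j :: 'a
  assume ph: "gsb2 s sr h C ph"
  have C: "0 <= C" using gsbD(2)[OF ph] .
  note B = P(2)[OF ph, of j]
  show "smooth (zak_coeff ph j) \<and> (\<forall>ga al be x. amon ga j * (amon al x * cmod (md be (zak_coeff ph j) x)) \<le>
   C * (P * Q) / pw j * (gsw1 s (2 powr s * h) ga * (gsw1 s (2 powr s * h) al * gsw1 sr (2 powr s * h) be)))"
   unfolding H_def[symmetric]
  proof (intro conjI allI)
   show "smooth (zak_coeff ph j)" using B by blast
   fix ga al be :: "'a => nat" and x :: 'a
   let ?A = "amon al x * cmod (md be (zak_coeff ph j) x)"
   let ?W = "gsw1 s h al * gsw1 sr h be"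
   have "pw j * (amon ga j * ?A) <= C * P * ?W * Q * gsw1 s H ga"
    unfolding H_def
   proof (rule Q(2))
    show "amon ga j * ?A <= C * P * ?W * gsw1 s h ga" for ga
     using B[THEN conjunct2, rule_format, of ga al x be] by (simp add: mult_ac)
   qed simp
   also have "... <= C * P * (gsw1 s H al * gsw1 sr H be) * Q * gsw1 s H ga"
    using C P(1) Q(1) h H by (intro mult_right_mono mult_left_mono mult_mono gsw_mono) (auto intro!: mult_nonneg_nonneg gsw_nonneg)
   finally show "amon ga j * ?A <= C * (P * Q) / pw j * (gsw1 s H ga * (gsw1 s H al * gsw1 sr H be))"
    using pw_pos[of j] by (simp add: field_simps)
  qed
 qed
qed

text \<open>The lattice sum is written as an integral over a counting measure, so that it shares the
  estimates and exchange theorems of Lebesgue integrals.\<close>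

definition zak_adjoint :: "('n::finite => real ^ 'n) => ((real ^ 'n) \<times> (real ^ 'n) => complex) => real ^ 'n => complex" where
 "zak_adjoint e ph x = (\<integral>j. zak_coeff ph j (x + j) \<partial>csl e)"

lemma zak_coeff_translate_bounded:
 fixes s sr h :: real
 assumes h: "0 < h" and s: "0 <= s" and sr: "0 <= sr"
 obtains P where "0 < P" "!!(ph :: 'a::euclidean_space \<times> 'a => complex) C j.
  gsb2 s sr h C ph ==>
  gsb1 s sr (2 * (2 powr s * h)) (C * P / pw j) (%x. zak_coeff ph j (x + j))"
proof -
 obtain P where P: "0 < P" "!!(ph :: 'a \<times> 'a => complex) C j.
  gsb2 s sr h C ph ==>
  smooth (zak_coeff ph j) \<and> (\<forall>ga al be x. amon ga j * (amon al x * cmod (md be (zak_coeff ph j) x)) \<le>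
   C * P / pw j * (gsw1 s (2 powr s * h) ga * (gsw1 s (2 powr s * h) al * gsw1 sr (2 powr s * h) be)))"
  using zak_coeff_decay[OF h s sr, where 'a='a] by blast
 show thesis
 proof (rule that[OF P(1)])
  fix ph :: "'a \<times> 'a => complex" and C :: real and j :: 'a
  assume ph: "gsb2 s sr h C ph"
  have "gsb1 s sr (2 * (2 powr s * h)) (C * P / pw j) (%x. zak_coeff ph j (x - (- j)))"
   using P(2)[OF ph, of j] h s gsbD(2)[OF ph] P(1) pw_pos[of j]
   by (intro gsb_translate_weighted) (auto simp: less_imp_le)
  thus "gsb1 s sr (2 * (2 powr s * h)) (C * P / pw j) (%x. zak_coeff ph j (x + j))" by simp
 qed
qed

lemma zak_adjoint_bounded:
 fixes s sr h :: real and e :: "'n::finite => real ^ 'n"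
 assumes dp: "dual_pair e e'" and h: "0 < h" and s: "0 <= s" and sr: "0 <= sr"
 obtains P where "0 < P" "!!ph C. gsb2 s sr h C ph ==>
  gsb1 s sr (2 * (2 powr s * h)) (C * P) (zak_adjoint e ph)"
  "!!ph C x. gsb2 s sr h C ph ==> integrable (csl e) (%j. zak_coeff ph j (x + j))"
proof -
 obtain P where P: "0 < P" "!!(ph :: (real^'n) \<times> (real^'n) => complex) C j.
  gsb2 s sr h C ph ==>
  gsb1 s sr (2 * (2 powr s * h)) (C * P / pw j) (%x. zak_coeff ph j (x + j))"
  using zak_coeff_translate_bounded[OF h s sr, where 'a="real^'n"] by blast
 define S where "S = (\<integral>j. 1 / pw j \<partial>csl e)"
 have S: "0 <= S" unfolding S_def using pw_pos by (intro integral_nn) (simp add: less_imp_le)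
 have H: "0 < 2 * (2 powr s * h)" using h by simp
 show thesis
 proof (rule that[of "P * (S + 1)"])
  show "0 < P * (S + 1)" using P(1) S by simp
  fix ph :: "(real^'n) \<times> (real^'n) => complex" and C :: real
  assume ph: "gsb2 s sr h C ph"
  have C: "0 <= C" using gsbD(2)[OF ph] .
  have int: "integrable (csl e) (%j. C * P / pw j)"
   using intb_mult_r[OF integrable_lattice_pw[OF dp], of "C * P"] by simp
  have "gsb1 s sr (2 * (2 powr s * h)) (\<integral>j. C * P / pw j \<partial>csl e) (%x. \<integral>j. zak_coeff ph j (x + j) \<partial>csl e)"
   by (intro gsb_integral H P(2) ph int) simp
  moreover have "(\<integral>j. C * P / pw j \<partial>csl e) = C * P * S"
   unfolding S_def int_mult_r[symmetric] by simp
  ultimately have "gsb1 s sr (2 * (2 powr s * h)) (C * P * S) (zak_adjoint e ph)"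
   by (simp add: zak_adjoint_def[abs_def])
  thus "gsb1 s sr (2 * (2 powr s * h)) (C * (P * (S + 1))) (zak_adjoint e ph)"
   by (rule gsb_mono[OF _ H order_refl]) (use C P(1) in \<open>simp add: algebra_simps\<close>)
  fix x :: "real^'n"
  show "integrable (csl e) (%j. zak_coeff ph j (x + j))"
   by (rule integrable_bd[OF int])
    (use gsb_deriv[OF P(2)[OF ph], of "%_. 0"] C P(1) in \<open>auto intro!: AE_I2 simp: abs_mult abs_of_nonneg\<close>)
 qed
qed

text \<open>A character of frequency -j in the second variable costs powers of j with the weight of
  the derivatives there, again of exponent s, and the decay of \<open>f\<close> in j covers them. On
  the product space the frequency is (0, -j), whose powers in the first component are 0 or
  1.\<close>

lemma gsb_cis_tensor:
 fixes pz :: "'a::euclidean_space => complex" and f :: "'a => complex"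
 assumes h: "0 < h" and s: "0 <= s" and sr: "0 <= sr" and f: "smooth f" and C: "0 <= C"
  and bd: "!!ga al be x. amon ga j * (amon al x * cmod (md be f x)) \<le>
   C * (gsw1 s h ga * (gsw1 s h al * gsw1 sr h be))"
  and pz: "gsb1 sr s h D pz"
 shows "gsb2 s sr (2 * h) (C * D) (%(x, xi). cis (- (j *. xi)) * (f x * pz xi))"
proof -
 have spz: "smooth pz" and D: "0 <= D" using gsbD[OF pz] by auto
 have "gsb2 s sr (2 * h) (C * D) (%z. cis ((0, - j) *. z) * (case z of (x, xi) => f x * pz xi))"
 proof (rule gsb_cis_weighted[OF h])
  show "0 <= two_groups sr s b" for b :: "'a \<times> 'a" using s sr by (simp add: two_groups_def)
  show "smooth (%(x, xi). f x * pz xi)" by (rule smooth_tensor[OF f spz])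
  show "0 <= C * D" using C D by simp
  fix ga al be :: "'a \<times> 'a => nat" and z :: "'a \<times> 'a"
  obtain x xi where z: "z = (x, xi)" by (cases z)
  define ga1 ga2 al1 al2 be1 be2 where "ga1 = (%u. ga (u, 0::'a))" and "ga2 = (%v. ga (0::'a, v))" and "al1 = (%u. al (u, 0::'a))" and "al2 = (%v. al (0::'a, v))"
   and "be1 = (%u. be (u, 0::'a))" and "be2 = (%v. be (0::'a, v))"
  have g0: "amon ga1 0 <= gsw1 sr h ga1"
  proof (cases "\<forall>b\<in>Basis. ga1 b = 0")
   case True
   have "mon ga1 0 = mon (%_. 0) (0::'a)" by (rule monomial_at_cong) (use True in simp)
   moreover have "gsw1 sr h ga1 = gsw1 sr h (%_::'a. 0)" by (rule gsw_cong) (use True in simp)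
   ultimately show ?thesis by simp
  next
   case False
   hence "mon ga1 (0::'a) = 0" by (auto simp: monomial_at_def)
   thus ?thesis using gsw_nonneg[OF h] by simp
  qed
  have "amon ga (0, - j) * (amon al z * cmod (md be (%(x, xi). f x * pz xi) z)) =
   amon ga1 0 * ((amon ga2 j * (amon al1 x * cmod (md be1 f x))) * (amon al2 xi * cmod (md be2 pz xi)))"
   unfolding z multi_deriv_tensor[OF f spz] monomial_at_prod ga1_def[symmetric] ga2_def[symmetric] al1_def[symmetric] al2_def[symmetric] be1_def[symmetric] be2_def[symmetric]
   by (simp add: abs_mult norm_mult mult_ac)
  also have "... <= gsw1 sr h ga1 * ((C * (gsw1 s h ga2 * (gsw1 s h al1 * gsw1 sr h be1))) * (D * (gsw1 sr h al2 * gsw1 s h be2)))"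
   by (intro mult_mono g0 bd gsbD(3)[OF pz]) (use C D h in \<open>auto intro!: mult_nonneg_nonneg gsw_nonneg\<close>)
  also have "... = C * D * (gsw2 sr s h ga * (gsw2 s sr h al * gsw2 sr s h be))"
   unfolding gsw_two_groups ga1_def[symmetric] ga2_def[symmetric] al1_def[symmetric] al2_def[symmetric] be1_def[symmetric] be2_def[symmetric]
   by (simp add: mult_ac)
  finally show "amon ga (0, - j) * (amon al z * cmod (md be (%(x, xi). f x * pz xi) z)) \<le>
   C * D * (gsw2 sr s h ga * (gsw2 s sr h al * gsw2 sr s h be))" .
 qed
 moreover have "(%z. cis ((0, - j) *. z) * (case z of (x, xi) => f x * pz xi)) = (%(x, xi). cis (- (j *. xi)) * (f x * pz xi))"
  by (auto simp: inner_prod_def)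
 ultimately show ?thesis by simp
qed

text \<open>As \<kappa> = (\<xi> + \<kappa>) - \<xi>, powers of \<kappa> are divided between \<phi>,
  which decays in \<xi>, and the window, which decays in its argument; both decays have the exponent
  \<open>sr\<close>. In the scale, one factor \<open>2 powr (s + sr)\<close> comes from adding the
  powers of \<xi> to the given monomial, the other from splitting off \<open>pw\<close>; 4 covers
  the doublings in the division and in the Leibniz rule.\<close>

lemma gsb_mult_snd_translate:
 assumes h: "0 < h" and s: "0 <= s" and sr: "0 <= sr"
 obtains P where "0 < P" "!!(ph :: 'a::euclidean_space \<times> 'a => complex) C pz D ka ga al be z.
  gsb2 s sr h C ph ==> gsb1 sr s h D (pz :: 'a => complex) ==>
  amon ga ka * (amon al z * cmod (md be (%(x, xi). ph (x, xi) * pz (xi + ka)) z)) \<le>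
   C * D * P / pw ka * (gsw1 sr (4 * (2 powr (s + sr)) * (2 powr (s + sr)) * h) ga *
    (gsw2 s sr (4 * (2 powr (s + sr)) * (2 powr (s + sr)) * h) al * gsw2 sr s (4 * (2 powr (s + sr)) * (2 powr (s + sr)) * h) be))"
proof -
 define q where "q = s + sr"
 define H where "H = 4 * (2 powr q * h)"
 define H0 where "H0 = 2 powr q * h"
 have q: "0 <= q" "s <= q" "sr <= q" using s sr by (auto simp: q_def)
 have H0: "0 < H0" "h <= H0" using h one_le_two_powr[OF h q(1)] by (auto simp: H0_def)
 have HH: "H = 4 * H0" by (simp add: H_def H0_def)
 have H: "0 < H" "2 * H0 <= H" "H0 <= H" using H0 by (auto simp: HH)
 obtain Q where Q: "0 < Q" "!!(k::'a) A C ga. 0 <= A ==> (!!ga. amon ga k * A <= C * gsw1 sr H ga) ==>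
  pw k * (amon ga k * A) <= C * Q * gsw1 sr (2 powr q * H) ga"
  by (rule pw_absorb[OF H(1), of "%_. sr" q]) (use sr q in auto)
 have tg: "0 <= two_groups s sr b" "two_groups s sr b <= q" "0 <= two_groups sr s b" for b :: "'a \<times> 'a" using s sr q by (auto simp: two_groups_def)
 have main: "amon ga ka * (amon al z * cmod (md be (%(x, xi). ph (x, xi) * pz (xi + ka)) z)) \<le>
   C * D * (gsw1 sr H ga * (gsw2 s sr H al * gsw2 sr s H be))"
  if ph: "gsb2 s sr h C ph" and pz: "gsb1 sr s h D (pz :: 'a => complex)" for ph :: "'a \<times> 'a => complex" and C pz D ka ga al be z
 proof -
  obtain x xi where z: "z = (x, xi)" by (cases z)
  have C: "0 <= C" and D: "0 <= D" and sph: "smooth ph" and spz: "smooth pz" using gsbD(1,2)[OF ph] gsbD(1,2)[OF pz] by auto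
  have spz': "smooth (%xi. pz (xi + ka))" using smooth_translate[OF spz, of "- ka"] by simp
  have mpz': "md de (%xi. pz (xi + ka)) xi = md de pz (xi + ka)" for de using fun_cong[OF multi_deriv_translate[OF spz, of de "- ka"], of xi] by simp
  define g where "g = (%(x::'a, xi). 1 * pz (xi + ka))"
  have sg: "smooth g" unfolding g_def by (rule smooth_tensor[OF multi_deriv_const(1) spz'])
  have mg: "md de g z = md (%u. de (u, 0)) (%_. 1) x * md (%v. de (0, v)) pz (xi + ka)" for de
   unfolding g_def z multi_deriv_tensor[OF multi_deriv_const(1) spz'] mpz' ..
  have one: "cmod (md de (%_. 1) x) <= gsw1 sr H0 de" for de
  proof (cases "\<forall>b\<in>Basis. de b = 0")
   case True
   have "gsw1 sr H0 de = gsw1 sr H0 (%_::'a. 0)" by (rule gsw_cong) (use True in simp)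
   thus ?thesis using True by (simp add: multi_deriv_const)
  qed (use H0 in \<open>auto simp: multi_deriv_const gsw_nonneg\<close>)
  obtain ga' ga'' where g: "!!b. ga' b + ga'' b = ga b"
   "amon ga (- xi + (xi + ka)) <= 2 ^ sum ga Basis * (\<bar>mon ga' (- xi)\<bar> * \<bar>mon ga'' (xi + ka)\<bar>)"
   using monomial_at_split[of ga "- xi" "xi + ka"] by blast
  have eqs: "(%(x, xi). ph (x, xi) * pz (xi + ka)) = (%z. ph z * g z)" by (auto simp: g_def)
  have leib: "cmod (md be (%z. ph z * (of_real (amon ga ka * amon al z0) * g z)) z) <=
   2 ^ sum be Basis * (2 ^ sum ga Basis * (C * D * (gsw1 sr H0 ga * (gsw2 s sr H0 al * gsw2 sr s H0 be))))" if "z0 = z" for z0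
  proof (rule multi_deriv_mult_bound[OF sph smooth_scale[OF sg]])
    have wj: "gsw2 s sr h (%b. join (%_::'a. 0) ga' b + al b) <= gsw2 s sr H0 (join (%_::'a. 0) ga') * gsw2 s sr H0 al"
    unfolding H0_def by (rule gsw_add_ge) (use h tg in auto)
  fix be' de :: "'a \<times> 'a => nat" assume bd: "!!b. b : Basis ==> be' b + de b = be b"
   define de1 de2 where "de1 = (%u. de (u, 0::'a))" and "de2 = (%v. de (0::'a, v))"
   have "cmod (md be' ph z) * cmod (md de (%z. of_real (amon ga ka * amon al z0) * g z) z) =
     amon ga ka * (cmod (md de1 (%_. 1) x) * ((amon al z * cmod (md be' ph z)) * cmod (md de2 pz (xi + ka))))"
    unfolding multi_deriv_scale[OF sg] mg de1_def[symmetric] de2_def[symmetric] that by (simp add: norm_mult mult_ac)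
   also have "... <= (2 ^ sum ga Basis * (\<bar>mon ga' xi\<bar> * \<bar>mon ga'' (xi + ka)\<bar>)) * (gsw1 sr H0 de1 * ((amon al z * cmod (md be' ph z)) * cmod (md de2 pz (xi + ka))))"
    using g(2) by (intro mult_mono mult_right_mono one) (auto intro!: mult_nonneg_nonneg)
   also have "... = 2 ^ sum ga Basis * (gsw1 sr H0 de1 * ((\<bar>mon (%b. join (%_::'a. 0) ga' b + al b) z\<bar> * cmod (md be' ph z)) * (\<bar>mon ga'' (xi + ka)\<bar> * cmod (md de2 pz (xi + ka)))))"
    unfolding monomial_at_add by (simp add: z monomial_at_join abs_mult mult_ac)
   also have "... <= 2 ^ sum ga Basis * (gsw1 sr H0 de1 * ((C * (gsw2 s sr h (%b. join (%_::'a. 0) ga' b + al b) * gsw2 sr s h be')) * (D * (gsw1 sr h ga'' * gsw1 s h de2))))"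
    by (intro mult_mono mult_left_mono gsbD(3)[OF ph] gsbD(3)[OF pz]) (use C D H0 h in \<open>auto intro!: mult_nonneg_nonneg gsw_nonneg\<close>)
   also have "... <= 2 ^ sum ga Basis * (gsw1 sr H0 de1 * ((C * ((gsw2 s sr H0 (join (%_::'a. 0) ga') * gsw2 s sr H0 al) * gsw2 sr s H0 be')) * (D * (gsw1 sr H0 ga'' * gsw1 s H0 de2))))"
    by (intro mult_left_mono mult_mono gsw_mono h H0(2) wj)
     (use C D H0 h in \<open>auto intro!: mult_nonneg_nonneg gsw_nonneg\<close>)
   also have "... = 2 ^ sum ga Basis * (C * D * ((gsw1 sr H0 ga' * gsw1 sr H0 ga'') * (gsw2 s sr H0 al * (gsw2 sr s H0 be' * gsw2 sr s H0 de))))"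
    unfolding gsw_join gsw_zero gsw_two_groups[of sr s H0 de] de1_def de2_def by (simp add: mult_ac)
   also have "... <= 2 ^ sum ga Basis * (C * D * (gsw1 sr H0 ga * (gsw2 s sr H0 al * gsw2 sr s H0 be)))"
   proof -
    have "gsw2 sr s H0 (%b. be' b + de b) = gsw2 sr s H0 be" by (rule gsw_cong) (rule bd)
    hence 1: "gsw2 sr s H0 be' * gsw2 sr s H0 de <= gsw2 sr s H0 be"
     using gsw_add_le[of H0 "two_groups sr s" be' de, OF H0(1) tg(3)] by simp
    have 2: "gsw1 sr H0 ga' * gsw1 sr H0 ga'' <= gsw1 sr H0 ga"
     using gsw_add_le[of H0 "%_. sr" ga' ga'', OF H0(1) sr] g(1) by simp
    show ?thesis by (intro mult_left_mono mult_mono 1 2) (use C D H0 in \<open>auto intro!: mult_nonneg_nonneg gsw_nonneg\<close>)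
   qed
   finally show "cmod (md be' ph z) * cmod (md de (%z. of_real (amon ga ka * amon al z0) * g z) z) \<le>
     2 ^ sum ga Basis * (C * D * (gsw1 sr H0 ga * (gsw2 s sr H0 al * gsw2 sr s H0 be)))" .
  qed
  have "amon ga ka * (amon al z * cmod (md be (%z. ph z * g z) z)) =
   cmod (md be (%w. ph w * (of_real (amon ga ka * amon al z) * g w)) z)"
  proof -
   have "(%w. ph w * (of_real (amon ga ka * amon al z) * g w)) = (%w. of_real (amon ga ka * amon al z) * (ph w * g w))"
    by (simp add: mult_ac)
   thus ?thesis by (simp only: multi_deriv_scale[OF smooth_mult[OF sph sg]] norm_mult norm_of_real abs_mult abs_abs mult.assoc)
  qed
  also have "... <= 2 ^ sum be Basis * (2 ^ sum ga Basis * (C * D * (gsw1 sr H0 ga * (gsw2 s sr H0 al * gsw2 sr s H0 be))))"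
   by (rule leib) simp
  also have "... = C * D * ((2 ^ sum ga Basis * gsw1 sr H0 ga) * (gsw2 s sr H0 al * (2 ^ sum be Basis * gsw2 sr s H0 be)))"
   by (simp add: mult_ac)
  also have "... <= C * D * (gsw1 sr H ga * (gsw2 s sr H al * gsw2 sr s H be))"
   unfolding gsw_scale
   by (intro mult_left_mono mult_mono gsw_mono) (use C D H H0 in \<open>auto intro!: mult_nonneg_nonneg gsw_nonneg\<close>)
  finally show ?thesis unfolding eqs .
 qed
 have K: "4 * (2 powr (s + sr)) * (2 powr (s + sr)) * h = 2 powr q * H" by (simp add: H_def q_def)
 show thesis
 proof (rule that[OF Q(1)], unfold K)
  fix ph :: "'a \<times> 'a => complex" and C :: real and pz :: "'a => complex" and D :: real and ka :: 'a and ga :: "'a => nat" and al be :: "'a \<times> 'a => nat" and z :: "'a \<times> 'a"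
  assume ph: "gsb2 s sr h C ph" and pz: "gsb1 sr s h D pz"
  have C: "0 <= C" and D: "0 <= D" using gsbD(2)[OF ph] gsbD(2)[OF pz] by auto
  let ?A = "amon al z * cmod (md be (%(x, xi). ph (x, xi) * pz (xi + ka)) z)"
  let ?W = "%H. gsw2 s sr H al * gsw2 sr s H be"
  have "pw ka * (amon ga ka * ?A) <= C * D * ?W H * Q * gsw1 sr (2 powr q * H) ga"
   by (rule Q(2)) (use main[OF ph pz] in \<open>simp_all add: mult_ac\<close>)
  also have "... <= C * D * ?W (2 powr q * H) * Q * gsw1 sr (2 powr q * H) ga"
   by (intro mult_right_mono mult_left_mono mult_mono gsw_mono one_le_two_powr H(1) q(1))
    (use C D H Q(1) in \<open>auto intro!: mult_nonneg_nonneg gsw_nonneg\<close>)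
  finally show "amon ga ka * ?A <= C * D * Q / pw ka * (gsw1 sr (2 powr q * H) ga * ?W (2 powr q * H))"
   using pw_pos[of ka] by (simp add: field_simps)
 qed
qed

section \<open>Triviality below the critical line\<close>

lemma summable_power_fact_powr:
 fixes x de :: real
 assumes "0 < de" "0 <= x"
 shows "summable (%k. x ^ k * fact k powr (- de))"
proof -
 obtain c where c: "0 < c" "!!t m. \<bar>t\<bar> <= 2 * x ==> \<bar>t\<bar> ^ m <= c * (1 ^ m * fact m powr de)"
  using power_le_fact_powr[of de 1 "2 * x"] assms by auto
 have "norm (x ^ k * fact k powr (- de)) <= c * (1 / 2) ^ k" for k
 proof -
  have "(2 * x) ^ k <= c * fact k powr de" using c(2)[of "2 * x" k] assms by simp
  hence "x ^ k * fact k powr (- de) <= c * (1 / 2) ^ k"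
   by (simp add: powr_minus field_simps)
  thus ?thesis using assms by simp
 qed
 moreover have "summable (%k. c * (1 / 2 :: real) ^ k)" by (intro summable_mult summable_geometric) simp
 ultimately show ?thesis by (rule summable_comparison_test'[rotated, where N=0])
qed

text \<open>The Lagrange remainder is a statement about real functions, so real and imaginary parts
  are treated separately. For \<open>sr < 1\<close> the factorial in the denominator wins, and the
  remainder vanishes at every distance from a.\<close>

lemma taylor_sums_complex:
 fixes f :: "nat => real => complex"
 assumes der: "!!k t. (f k has_vector_derivative f (Suc k) t) (at t)"
  and bd: "!!k t. cmod (f k t) <= C * (h ^ k * fact k powr sr)" and h: "0 < h" and sr: "sr < 1"
 shows "(%k. f k a / fact k * of_real x ^ k) sums f 0 (a + x)"
proof -
 have C: "0 <= C" using order_trans[OF norm_ge_zero bd[of 0 0]] by simp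
 have part: "(%k. L (f k a) / fact k * x ^ k) sums L (f 0 (a + x))"
  if L: "bounded_linear L" and L1: "!!z. \<bar>L z\<bar> <= cmod z" for L :: "complex => real"
 proof -
  define diff where "diff k u = L (f k (a + u))" for k u
  have d: "\<forall>m x. DERIV (diff m) x :> diff (Suc m) x"
  proof (intro allI)
   fix m x
   have "((%u. a + u) has_vector_derivative 1) (at x)" by (auto intro!: derivative_eq_intros)
   hence "((%u. f m (a + u)) has_vector_derivative f (Suc m) (a + x)) (at x)"
    using vector_diff_chain_at[of "%u. a + u" 1 x "f m" "f (Suc m) (a + x)"] der by (simp add: o_def)
   from bounded_linear.has_vector_derivative[OF L this]
   show "DERIV (diff m) x :> diff (Suc m) x"
    unfolding diff_def has_real_derivative_iff_has_vector_derivative .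
  qed
  have "(%n. \<Sum>m<n. diff m 0 / fact m * x ^ m) \<longlonglongrightarrow> diff 0 x"
  proof -
   have err: "\<bar>(\<Sum>m<n. diff m 0 / fact m * x ^ m) - diff 0 x\<bar> <= C * ((h * \<bar>x\<bar>) ^ n * fact n powr (- (1 - sr)))" for n
   proof -
    obtain t where t: "\<bar>t\<bar> <= \<bar>x\<bar>" "diff 0 x = (\<Sum>m<n. diff m 0 / fact m * x ^ m) + diff n t / fact n * x ^ n"
     using Maclaurin_all_le[of diff "diff 0" x n] d by auto
    have "\<bar>diff n t / fact n * x ^ n\<bar> = \<bar>diff n t\<bar> / fact n * \<bar>x\<bar> ^ n" by (simp add: abs_mult power_abs)
    also have "... <= (C * (h ^ n * fact n powr sr)) / fact n * \<bar>x\<bar> ^ n"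
     unfolding diff_def by (intro mult_right_mono divide_right_mono order_trans[OF L1 bd]) auto
    also have "... = C * ((h * \<bar>x\<bar>) ^ n * fact n powr (- (1 - sr)))"
     by (simp add: power_mult_distrib powr_diff)
    finally show ?thesis using t(2) by simp
   qed
   have "(%n. C * ((h * \<bar>x\<bar>) ^ n * fact n powr (- (1 - sr)))) \<longlonglongrightarrow> C * 0"
    using sr h by (intro tendsto_mult_left summable_LIMSEQ_zero summable_power_fact_powr) auto
   hence lim0: "(%n. C * ((h * \<bar>x\<bar>) ^ n * fact n powr (- (1 - sr)))) \<longlonglongrightarrow> 0" by (simp only: mult_zero_right)
   have "(%n. (\<Sum>m<n. diff m 0 / fact m * x ^ m) - diff 0 x) \<longlonglongrightarrow> 0"
    by (rule Lim_null_comparison[OF always_eventually lim0]) (simp only: real_norm_def err simp_thms)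
   thus ?thesis by (rule LIM_zero_cancel)
  qed
  thus ?thesis by (simp add: sums_def diff_def)
 qed
 have re: "Re (f k a / fact k * of_real x ^ k) = Re (f k a) / fact k * x ^ k"
  "Im (f k a / fact k * of_real x ^ k) = Im (f k a) / fact k * x ^ k" for k
 proof -
  have "f k a / fact k * of_real x ^ k = (x ^ k / fact k) *! f k a" by (simp add: scaleR_conv_of_real)
  thus "Re (f k a / fact k * of_real x ^ k) = Re (f k a) / fact k * x ^ k"
   "Im (f k a / fact k * of_real x ^ k) = Im (f k a) / fact k * x ^ k" by simp_all
 qed
 show ?thesis
  unfolding sums_complex_iff re
  using part[OF bounded_linear_Re abs_Re_le_cmod] part[OF bounded_linear_Im abs_Im_le_cmod] by blast
qed

text \<open>The Taylor series of \<open>F\<close> at a real point \<open>t\<close>, evaluated at \<open>\<lambda>t\<close> with \<open>\<bar>\<lambda>\<bar> = 1\<close>, involves only the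
 numbers \<open>t\<^sup>k F\<^bsup>(k)\<^esup>(t)\<close>. These are bounded independently of \<open>t\<close>, so that \<open>F\<close> is a bounded entire function.\<close>

lemma real_gelfand_shilov_trivial:
 fixes f :: "nat => real => complex"
 assumes der: "!!k t. (f k has_vector_derivative f (Suc k) t) (at t)"
  and bd: "!!m k t. \<bar>t\<bar> ^ m * cmod (f k t) <= C * ((h ^ m * fact m powr s) * (h ^ k * fact k powr sr))"
  and h: "0 < h" and sr: "sr < 1" and S: "summable (%k. (2 * h\<^sup>2) ^ k * fact k powr (s + sr - 1))"
 shows "f 0 t = 0"
proof -
 have bd0: "cmod (f k t) <= C * (h ^ k * fact k powr sr)" for k t using bd[of t 0 k] by simp
 have C: "0 <= C" using order_trans[OF norm_ge_zero bd0[of 0 0]] by simp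
 define F where "F a z = (\<Sum>k. f k a / fact k * (z - of_real a) ^ k)" for a :: real and z :: complex
 have sm: "summable (%k. f k a / fact k * w ^ k)" for a and w :: complex
 proof (rule summable_comparison_test)
  show "\<exists>N. \<forall>n\<ge>N. norm (f n a / fact n * w ^ n) <= C * ((h * cmod w) ^ n * fact n powr (- (1 - sr)))"
  proof (intro exI allI impI)
   fix n
   have "norm (f n a / fact n * w ^ n) = cmod (f n a) / fact n * cmod w ^ n"
    by (simp add: norm_mult norm_divide norm_power)
   also have "... <= (C * (h ^ n * fact n powr sr)) / fact n * cmod w ^ n"
    by (intro mult_right_mono divide_right_mono bd0) auto
   also have "... = C * ((h * cmod w) ^ n * fact n powr (- (1 - sr)))"
    by (simp add: power_mult_distrib powr_diff)
   finally show "norm (f n a / fact n * w ^ n) <= C * ((h * cmod w) ^ n * fact n powr (- (1 - sr)))" .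
  qed
  show "summable (%n. C * ((h * cmod w) ^ n * fact n powr (- (1 - sr))))"
   using sr h by (intro summable_mult summable_power_fact_powr) auto
 qed
 have hol: "F a holomorphic_on UNIV" for a
 proof -
  have "((%w. \<Sum>k. f k a / fact k * w ^ k) has_field_derivative (\<Sum>n. diffs (%k. f k a / fact k) n * w ^ n)) (at w)" for w :: complex
   by (rule termdiffs_strong_converges_everywhere) (rule sm)
  hence "(%w. \<Sum>k. f k a / fact k * w ^ k) holomorphic_on UNIV"
   by (auto simp: holomorphic_on_def field_differentiable_def)
  moreover have "(%z. z - complex_of_real a) holomorphic_on UNIV" by (intro holomorphic_intros)
  ultimately show ?thesis
   using holomorphic_on_compose_gen[of "%z. z - of_real a" UNIV "%w. \<Sum>k. f k a / fact k * w ^ k" UNIV]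
   by (simp add: o_def F_def[abs_def])
 qed
 have real: "F a (of_real t) = f 0 t" for a t
  using taylor_sums_complex[OF der bd0 h sr, of a "t - a"] by (simp add: F_def sums_iff)
 \<comment> \<open>All the Taylor series reproduce f on the real line, which has a limit point; the
   entire functions therefore agree, and \<open>F 0\<close> may be estimated through the expansion
   at any real point.\<close>
 have same: "F a z = F 0 z" for a z
 proof -
  have "F a z - F 0 z = 0"
  proof (rule analytic_continuation[of "%z. F a z - F 0 z" UNIV "range of_real" 0 z])
   show "(0::complex) islimpt range of_real"
    unfolding islimpt_approachable
   proof (intro allI impI)
    fix e :: real assume "0 < e"
    hence "complex_of_real (e / 2) ~= 0 \<and> dist (complex_of_real (e / 2)) 0 < e" by (simp add: dist_norm norm_divide)
    thus "\<exists>x'\<in>range of_real. x' ~= (0::complex) \<and> dist x' 0 < e" by (rule bexI[OF _ rangeI])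
   qed
  qed (auto intro!: holomorphic_intros hol simp: real)
  thus ?thesis by simp
 qed
 define M where "M = (\<Sum>k. C * ((2 * h\<^sup>2) ^ k * fact k powr (s + sr - 1)))"
 have "cmod (F 0 z) <= M" for z
 proof -
  define t where "t = cmod z"
  define l where "l = (if z = 0 then 1 else z / of_real (cmod z))"
  have z: "z = l * of_real t" "cmod l = 1" by (auto simp: l_def t_def norm_divide)
  have le: "norm (f k t / fact k * (z - of_real t) ^ k) <= C * ((2 * h\<^sup>2) ^ k * fact k powr (s + sr - 1))" for k
  proof -
   \<comment> \<open>The distance from t to z = l t is |l - 1| |t| with |l - 1| \<le> 2, the origin
     of the 2 in the series \<open>S\<close>. Its (h^2)^k combines h^k from the k-th power of t with
     h^k from the k-th derivative.\<close>
   have "cmod (l - 1) <= 2" using norm_triangle_ineq4[of l 1] z(2) by simp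
   hence l2: "cmod (l - 1) ^ k <= 2 ^ k" by (intro power_mono) auto
   have "z - of_real t = (l - 1) * of_real t" by (simp add: z(1) algebra_simps)
   hence "norm (f k t / fact k * (z - of_real t) ^ k) = cmod (l - 1) ^ k * ((\<bar>t\<bar> ^ k * cmod (f k t)) / fact k)"
    by (simp add: norm_mult norm_divide norm_power power_mult_distrib)
   also have "... <= 2 ^ k * ((C * ((h ^ k * fact k powr s) * (h ^ k * fact k powr sr))) / fact k)"
    by (rule mult_mono[OF l2 divide_right_mono[OF bd[of t k k]]]) auto
   also have "... = C * ((2 * h\<^sup>2) ^ k * fact k powr (s + sr - 1))"
    by (simp add: power_mult_distrib powr_diff powr_add power2_eq_square)
   finally show ?thesis .
  qed
  have "cmod (F t z) <= M"
  proof -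
   have sM: "summable (%k. C * ((2 * h\<^sup>2) ^ k * fact k powr (s + sr - 1)))" by (rule summable_mult[OF S])
   have sN: "summable (%k. norm (f k t / fact k * (z - of_real t) ^ k))"
    by (rule summable_comparison_test'[OF sM, where N=0]) (use le in simp)
   show ?thesis unfolding F_def M_def by (rule order_trans[OF summable_norm[OF sN] suminf_le[OF le sN sM]])
  qed
  thus ?thesis by (simp only: same[of t z])
 qed
 hence "bounded (range (F 0))" by (auto simp: bounded_iff)
 then obtain c where c: "!!z. F 0 z = c"
  using Liouville_theorem[OF hol[of 0]] by (auto simp: constant_on_def)
 have fc: "f 0 t = c" for t using real[of 0 t] c by simp
 have lim: "\<bar>t\<bar> * cmod c <= C * h" for t
  using bd[of t 1 0] by (simp add: fc)
 have "c = 0"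
 proof (rule ccontr)
  assume "c ~= 0"
  hence "((C * h + 1) / cmod c) * cmod c <= C * h"
   using lim[of "(C * h + 1) / cmod c"] C h by simp
  thus False using \<open>c ~= 0\<close> by simp
 qed
 thus ?thesis using fc by simp
qed

text \<open>Restriction to lines parallel to one basis vector reduces this to one variable. The
  summability holds for all h if s + sr < 1, and for s + sr = 1 if 2 h^2 < 1; the second case
  excludes the critical line for the Beurling class, where h may be taken small.\<close>

lemma gsb_trivial:
 fixes f :: "'a::euclidean_space => complex"
 assumes f: "gsb1 s sr h C f" and h: "0 < h" and sr: "sr < 1"
  and S: "summable (%k. (2 * h\<^sup>2) ^ k * fact k powr (s + sr - 1))"
 shows "f x = 0"
proof -
 obtain b :: 'a where b: "b : Basis" using nonempty_Basis by blast
 define x0 where "x0 = x - (x *. b) *! b"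
 have x0: "x0 *. b = 0" using b by (simp add: x0_def inner_diff_left)
 define e where "e n = (%_. 0)(b := n)" for n :: nat
 have w: "gsw (%_. r) h (e n) = h ^ n * fact n powr r" for n r
 proof -
  have "gsw (%_. r) h (e n) = (\<Prod>c\<in>(Basis::'a set). if c = b then h ^ n * fact n powr r else 1)"
   unfolding gsw_def by (intro prod.cong) (auto simp: e_def)
  thus ?thesis using b by simp
 qed
 have m: "mon (e n) (x0 + t *! b) = t ^ n" for n t
 proof -
  have "mon (e n) (x0 + t *! b) = (\<Prod>c\<in>Basis. if c = b then t ^ n else 1)"
   unfolding monomial_at_def using b x0 by (intro prod.cong) (auto simp: e_def inner_add_left)
  thus ?thesis using b by simp
 qed
 have smf: "smooth f" using gsbD(1)[OF f] .
 define g where "g k t = md (e k) f (x0 + t *! b)" for k t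
 have "g 0 (x *. b) = 0"
 proof (rule real_gelfand_shilov_trivial[OF _ _ h sr S])
  show "(g k has_vector_derivative g (Suc k) t) (at t)" for k t
  proof -
   have "((%t. md (e k) f (x0 + t *! b)) has_vector_derivative pd b (md (e k) f) (x0 + t *! b)) (at t)"
    by (rule smooth_line_derivative[OF smooth_multi_deriv[OF smf]])
   moreover have "pd b (md (e k) f) = md (e (Suc k)) f"
    using multi_deriv_Suc[OF smf b, of "e k"] by (simp add: e_def)
   ultimately show ?thesis by (simp add: g_def[abs_def])
  qed
  show "\<bar>t\<bar> ^ m * cmod (g k t) <= C * ((h ^ m * fact m powr s) * (h ^ k * fact k powr sr))" for m k t
   using gsbD(3)[OF f, of "e m" "x0 + t *! b" "e k"] by (simp add: m w g_def power_abs)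
 qed
 moreover have "e 0 = (%_. 0)" by (auto simp: e_def)
 moreover have "x0 + (x *. b) *! b = x" by (simp add: x0_def)
 ultimately show ?thesis by (simp add: g_def)
qed

section \<open>The Fourier transform\<close>

text \<open>The falling factorial m (m - 1) ... (m - j + 1), the coefficient in the j-th derivative
  of t^m. It vanishes for j > m, which makes the truncated exponents m - j harmless.\<close>

definition falling :: "nat => nat => real" where
 "falling m j = (if j <= m then fact m / fact (m - j) else 0)"

lemma falling_nonneg: "0 <= falling m j"
 by (simp add: falling_def)

lemma falling_has_derivative:
 "((%t. complex_of_real (falling m n * t ^ (m - n))) has_vector_derivative of_real (falling m (Suc n) * t ^ (m - Suc n))) (at t)"
proof -
 have d: "((%t. falling m n * t ^ (m - n)) has_real_derivative (falling m n * (of_nat (m - n) * t ^ (m - n - Suc 0)))) (at t)"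
  by (auto intro!: derivative_eq_intros)
 have "falling m n * (of_nat (m - n) * t ^ (m - n - Suc 0)) = falling m (Suc n) * t ^ (m - Suc n)"
 proof (cases "n < m")
  case True
  hence "(fact (m - n) :: real) = of_nat (m - n) * fact (m - Suc n)"
   by (metis Suc_diff_Suc fact_Suc of_nat_mult of_nat_fact)
  moreover have "m - n - Suc 0 = m - Suc n" by simp
  ultimately show ?thesis using True by (simp add: falling_def)
 qed (auto simp: falling_def)
 from DERIV_cong[OF d this]
 have "((%t. falling m n * t ^ (m - n)) has_real_derivative (falling m (Suc n) * t ^ (m - Suc n))) (at t)" .
 thus ?thesis by (intro has_vector_derivative_of_real) (simp add: has_real_derivative_iff_has_vector_derivative)
qed

lemma multi_deriv_monomial:
 fixes be :: "'a::euclidean_space => nat"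
 shows "smooth (%x. complex_of_real (mon be x))"
  and "cmod (md ga (%x. complex_of_real (mon be x)) x) = (\<Prod>b\<in>Basis. falling (be b) (ga b)) * amon (%b. be b - ga b) x"
proof -
 define F where "F = (%(ga::'a => nat) (x::'a). \<Prod>b\<in>Basis. complex_of_real (falling (be b) (ga b) * (x *. b) ^ (be b - ga b)))"
 have fam: "deriv_family F"
  unfolding F_def
  by (rule deriv_family_coordinate_prod[where g="%b n t. complex_of_real (falling (be b) n * t ^ (be b - n))"])
   (rule falling_has_derivative)
 have F0: "F (%_. 0) = (%x. complex_of_real (mon be x))"
  by (simp add: F_def monomial_at_def falling_def)
 show "smooth (%x. complex_of_real (mon be x))"
  using deriv_family_smooth[OF fam, of "%_. 0"] by (simp add: F0)
 have "md ga (%x. complex_of_real (mon be x)) x = (\<Prod>b\<in>Basis. complex_of_real (falling (be b) (ga b) * (x *. b) ^ (be b - ga b)))"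
  using deriv_family_multi[OF fam, of ga] by (simp add: F0) (simp add: F_def)
 also have "cmod ... = (\<Prod>b\<in>Basis. falling (be b) (ga b) * \<bar>x *. b\<bar> ^ (be b - ga b))"
  by (simp add: prod_norm[symmetric] norm_mult norm_power falling_nonneg del: of_real_mult)
   (simp add: abs_mult power_abs falling_nonneg)
 finally show "cmod (md ga (%x. complex_of_real (mon be x)) x) = (\<Prod>b\<in>Basis. falling (be b) (ga b)) * amon (%b. be b - ga b) x"
  by (simp add: abs_monomial_at prod.distrib)
qed

text \<open>One coordinate of the estimate for the derivatives of x^m f(x). Handing j of the n
  derivatives to the monomial yields at most 2^m j! and lowers both weights, a gain of H^(-2j)
  j!^(-s-sr). The constant \<open>c\<close> says that H^(-2j) j!^(1-s-sr) stays bounded; this is how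
  the size of s + sr enters.\<close>

lemma falling_weight_le:
 fixes s sr H c :: real
 assumes H: "0 < H" and s: "0 <= s" and sr: "0 <= sr" and c: "1 <= c * (H ^ (2 * j) * fact j powr (s + sr - 1))"
  and jn: "j <= n" and c0: "0 <= c"
 shows "falling m j * (H ^ (m - j) * fact (m - j) powr s) * (H ^ (n - j) * fact (n - j) powr sr) \<le>
  c * 2 ^ m * ((H ^ m * fact m powr s) * (H ^ n * fact n powr sr))"
proof (cases "j <= m")
 case False
 thus ?thesis using H c0 by (simp add: falling_def)
next
 case True
 have "real (m choose j) <= 2 ^ m" using binomial_le_pow2[of m j] by (metis of_nat_le_iff of_nat_numeral of_nat_power)
 moreover have "falling m j = real (m choose j) * fact j"
  using True by (simp add: falling_def binomial_fact)
 ultimately have f: "falling m j <= 2 ^ m * fact j" by (simp add: mult_right_mono)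
 have le: "fact (k - j) powr r * fact j powr r <= fact k powr r" if "j <= k" "0 <= r" for k and r :: real
 proof -
  have "fact (k - j) * fact j <= (fact k :: real)" using fact_mult_le_fact_add[of "k - j" j] that by simp
  thus ?thesis using that by (simp add: powr_mult[symmetric] powr_mono2)
 qed
 have "falling m j * (H ^ (m - j) * fact (m - j) powr s) * (H ^ (n - j) * fact (n - j) powr sr)
  <= (2 ^ m * fact j) * (H ^ (m - j) * fact (m - j) powr s) * (H ^ (n - j) * fact (n - j) powr sr) * 1"
  using f H by (simp add: mult_right_mono)
 also have "... <= (2 ^ m * fact j) * (H ^ (m - j) * fact (m - j) powr s) * (H ^ (n - j) * fact (n - j) powr sr) * (c * (H ^ (2 * j) * fact j powr (s + sr - 1)))"
  using c H by (intro mult_left_mono) auto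
 also have "... = c * 2 ^ m * ((H ^ (m - j) * H ^ j * (fact (m - j) powr s * fact j powr s)) * (H ^ (n - j) * H ^ j * (fact (n - j) powr sr * fact j powr sr)))"
  by (simp add: powr_diff powr_add power_mult power2_eq_square mult_2 power_add field_simps)
 also have "... <= c * 2 ^ m * ((H ^ (m - j) * H ^ j * fact m powr s) * (H ^ (n - j) * H ^ j * fact n powr sr))"
  using le[OF True s] le[OF jn sr] H c0 by (intro mult_left_mono mult_mono) auto
 also have "... = c * 2 ^ m * ((H ^ m * fact m powr s) * (H ^ n * fact n powr sr))"
  using True jn by (simp add: power_add[symmetric])
 finally show ?thesis .
qed

text \<open>The Fourier transform exchanges powers and derivatives, hence the exponents. The factors
  2^|\<alpha>| from the Leibniz rule and 2^|\<beta>| from the falling factorials double H, adding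
  the exponents of two monomials turns h into H, and splitting off \<open>pw\<close> costs only a
  constant. The coordinatewise constant \<open>c\<close> appears to the power of the
  dimension.\<close>

lemma gsb_fourier:
 fixes s sr h c :: real
 defines "H \<equiv> 2 powr s * h"
 assumes h: "0 < h" and s: "0 <= s" and sr: "0 <= sr" and c: "!!j. 1 <= c * (H ^ (2 * j) * fact j powr (s + sr - 1))"
 shows "\<exists>P>0. \<forall>C (f::'a::euclidean_space => complex). gsb1 s sr h C f --> gsb1 sr s (2 * H) (C * P) (%xi. fco xi f)"
proof -
 have H: "0 < H" "h <= H" using h s one_le_two_powr[OF h s] by (auto simp: H_def)
 have c0: "1 <= c" using c[of 0] by simp
 define c' where "c' = c ^ DIM('a)"
 have c': "0 < c'" using c0 by (simp add: c'_def)
 obtain Q where Q: "0 < Q" "!!(k::'a) A C ga. 0 <= A ==> (!!ga. amon ga k * A <= C * gsw1 s H ga) ==>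
  pw k * (amon ga k * A) <= C * Q * gsw1 s (2 powr s * H) ga"
  by (rule pw_absorb[OF H(1), of "%_. s" s]) (use s in auto)
 define I where "I = (LB y. 1 / pw (y::'a))"
 have I: "0 <= I" unfolding I_def by (intro integral_nn) simp
 \<comment> \<open>An auxiliary monomial, frozen at the point of evaluation, is carried through the
   Leibniz rule so that \<open>pw\<close> can be split off at the end.\<close>
 have main: "cmod (md al (%x. of_real (mon be x) * f x) x) <= C * c' * Q * (2 ^ sum al Basis * 2 ^ sum be Basis * (gsw1 s H be * gsw1 sr H al)) / pw x"
  if f: "gsb1 s sr h C f" for C f and al be :: "'a => nat" and x :: 'a
 proof -
  have sf: "smooth f" and C: "0 <= C" using gsbD[OF f] by auto
  have sg: "smooth (%x. complex_of_real (mon be x) * f x)" by (rule smooth_mult[OF multi_deriv_monomial(1) sf])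
  let ?A = "cmod (md al (%x. complex_of_real (mon be x) * f x) x)"
  have "amon de x * ?A <= (C * c' * (2 ^ sum al Basis * 2 ^ sum be Basis * (gsw1 s H be * gsw1 sr H al))) * gsw1 s H de" for de
  proof -
   have "amon de x * ?A = cmod (md al (%y. (of_real (mon be y)) * (of_real (mon de x) * f y)) x)"
   proof -
    have "(%y. complex_of_real (mon be y) * (of_real (mon de x) * f y)) = (%y. of_real (mon de x) * (complex_of_real (mon be y) * f y))"
     by (simp add: mult_ac)
    thus ?thesis by (simp only: multi_deriv_scale[OF sg] norm_mult norm_of_real)
   qed
   also have "... <= 2 ^ sum al Basis * (C * c' * (2 ^ sum be Basis * (gsw1 s H be * gsw1 sr H al)) * gsw1 s H de)"
   proof (rule multi_deriv_mult_bound[OF multi_deriv_monomial(1) smooth_scale[OF sf]])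
    fix ga ep :: "'a => nat" assume ge: "!!b. b : Basis ==> ga b + ep b = al b"
    let ?fa = "\<Prod>b\<in>Basis. falling (be b) (ga b)"
    have "cmod (md ga (%y. complex_of_real (mon be y)) x) * cmod (md ep (%y. of_real (mon de x) * f y) x) =
     ?fa * (\<bar>mon (%b. (be b - ga b) + de b) x\<bar> * cmod (md ep f x))"
     unfolding multi_deriv_monomial(2) multi_deriv_scale[OF sf] monomial_at_add by (simp add: norm_mult abs_mult mult_ac)
    also have "... <= ?fa * (C * (gsw1 s h (%b. (be b - ga b) + de b) * gsw1 sr h ep))"
     by (intro mult_left_mono gsbD(3)[OF f] prod_nonneg) (auto simp: falling_nonneg)
    also have "... <= ?fa * (C * ((gsw1 s H (%b. be b - ga b) * gsw1 s H de) * gsw1 sr H ep))"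
    proof -
     have "gsw1 s h (%b. (be b - ga b) + de b) <= gsw1 s H (%b. be b - ga b) * gsw1 s H de"
      unfolding H_def by (rule gsw_add_ge) (use h s in auto)
     thus ?thesis using C h H
      by (intro mult_left_mono mult_mono gsw_mono prod_nonneg) (auto simp: falling_nonneg intro!: mult_nonneg_nonneg gsw_nonneg)
    qed
    also have "... = C * (?fa * gsw1 s H (%b. be b - ga b) * gsw1 sr H ep) * gsw1 s H de"
     by (simp add: mult_ac)
    also have "?fa * gsw1 s H (%b. be b - ga b) * gsw1 sr H ep =
     (\<Prod>b\<in>Basis. falling (be b) (ga b) * (H ^ (be b - ga b) * fact (be b - ga b) powr s) * (H ^ ep b * fact (ep b) powr sr))"
     by (simp add: gsw_def prod.distrib)
    also have "C * ... * gsw1 s H de <= C * (\<Prod>b\<in>(Basis::'a set). c * 2 ^ be b * ((H ^ be b * fact (be b) powr s) * (H ^ al b * fact (al b) powr sr))) * gsw1 s H de"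
    proof (intro mult_right_mono mult_left_mono prod_mono conjI)
     fix b :: 'a assume b: "b : Basis"
     have "ep b = al b - ga b" "ga b <= al b" using ge[OF b] by auto
     thus "falling (be b) (ga b) * (H ^ (be b - ga b) * fact (be b - ga b) powr s) * (H ^ ep b * fact (ep b) powr sr) <= c * 2 ^ be b * ((H ^ be b * fact (be b) powr s) * (H ^ al b * fact (al b) powr sr))"
      using falling_weight_le[OF H(1) s sr c, of "ga b" "al b" "be b"] c0 by simp
    qed (use C H in \<open>auto simp: falling_nonneg intro!: mult_nonneg_nonneg gsw_nonneg\<close>)
    also have "(\<Prod>b\<in>(Basis::'a set). c * 2 ^ be b * ((H ^ be b * fact (be b) powr s) * (H ^ al b * fact (al b) powr sr))) =
      c' * (2 ^ sum be Basis * (gsw1 s H be * gsw1 sr H al))"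
     by (simp add: prod.distrib gsw_def c'_def power_sum)
    finally show "cmod (md ga (%y. complex_of_real (mon be y)) x) * cmod (md ep (%y. of_real (mon de x) * f y) x) \<le>
     C * c' * (2 ^ sum be Basis * (gsw1 s H be * gsw1 sr H al)) * gsw1 s H de" by (simp add: mult_ac)
   qed
   finally show ?thesis by (simp add: mult_ac)
  qed
  from Q(2)[of ?A x _ "%_. 0", OF _ this] show ?thesis by (simp add: field_simps)
 qed
 have res: "gsb1 sr s (2 * H) (C * (c' * Q * (I + 1))) (%xi. fco xi f)"
  if f: "gsb1 s sr h C f" for C and f :: "'a => complex"
 proof -
  have sf: "smooth f" and C: "0 <= C" using gsbD[OF f] by auto
  define g where "g be x = of_real (mon be x) * f x" for be and x :: 'a
  have sg: "smooth (g be)" for be unfolding g_def by (rule smooth_mult[OF multi_deriv_monomial(1) sf])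
  have mg: "cmod (md al (g be) x) <= C * c' * Q * (2 ^ sum al Basis * 2 ^ sum be Basis * (gsw1 s H be * gsw1 sr H al)) / pw x" for al be x
   unfolding g_def by (rule main[OF f])
  define F where "F = (%(x::'a) be xi. f x * (\<i> ^ sum be Basis * of_real (mon be x) * cis (x *. xi)))"
  have Fn: "cmod (F x be xi) = cmod (g be x)" for x be xi by (simp add: F_def g_def norm_mult norm_power)
  have famF: "deriv_family (F x)" for x unfolding F_def by (rule deriv_family_scale[OF deriv_family_cis])
  have bdF: "\<exists>k. integrable lborel k \<and> (\<forall>x\<in>space lborel. \<forall>xi. norm (F x be xi) <= k x)" for be
  proof (intro exI conjI ballI allI)
   show "integrable lborel (%x::'a. C * c' * Q * (2 ^ sum be Basis * gsw1 s H be) * (1 / pw x))"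
    by (rule intb_mult_r[OF integrable_pw])
   show "norm (F x be xi) <= C * c' * Q * (2 ^ sum be Basis * gsw1 s H be) * (1 / pw x)" for x xi
    using mg[of "%_. 0" be x] by (simp add: Fn)
  qed
  have measF: "(%x. F x be xi) \<in> borel_measurable lborel" for be xi
  proof -
   have "(%x. g be x * cis (xi *. x)) : bm" using smooth_borel_measurable[OF sg] by simp
   hence "(%x. \<i> ^ sum be Basis * (g be x * cis (xi *. x))) : bm" by simp
   thus ?thesis by (simp add: F_def g_def mult_ac inner_commute)
  qed
  note DF = deriv_family_integral(1)[where F=F and M=lborel, OF famF bdF measF]
  have F0: "(%xi. \<integral>x. F x (%_. 0) xi \<partial>lborel) = (%xi. fco xi f)"
   by (simp add: F_def fco_def inner_commute)
  show ?thesis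
  proof (rule gsbI)
   show "smooth (%xi. fco xi f)" using deriv_family_smooth[OF DF, of "%_. 0"] by (simp add: F0)
   show "0 <= C * (c' * Q * (I + 1))" using C c' Q I by simp
   fix al be and xi :: 'a
   have "md be (%xi. fco xi f) xi = (LB x. F x (%b. if b : Basis then be b else 0) xi)"
    using deriv_family_multi[OF DF, of be] by (simp add: F0)
   also have "... = (LB x. \<i> ^ sum be Basis * (g be x * cis (xi *. x)))"
   proof -
    have "mon (%b. if b : Basis then be b else 0) x = mon be x" for x by (rule monomial_at_cong) simp
    thus ?thesis by (simp add: F_def g_def inner_commute mult_ac)
   qed
   also have "... = \<i> ^ sum be Basis * fco xi (g be)" by (simp add: fco_def)
   finally have "amon al xi * cmod (md be (%xi. fco xi f) xi) = amon al xi * cmod (fco xi (g be))"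
    by (simp add: norm_mult norm_power)
   also have "... = cmod (fco xi (md al (g be)))"
    by (rule fco_multi_deriv[symmetric, OF sg]) (use mg in blast)
   also have "... <= C * c' * Q * (2 ^ sum al Basis * 2 ^ sum be Basis * (gsw1 s H be * gsw1 sr H al)) * I"
    unfolding I_def by (rule cmod_fco_le[OF smooth_borel_measurable[OF smooth_multi_deriv[OF sg]] mg])
   also have "... = C * (c' * Q * I) * ((2 ^ sum al Basis * gsw1 sr H al) * (2 ^ sum be Basis * gsw1 s H be))"
    by (simp add: mult_ac)
   also have "... <= C * (c' * Q * (I + 1)) * (gsw1 sr (2 * H) al * gsw1 s (2 * H) be)"
    unfolding gsw_scale using C c' Q I H by (intro mult_right_mono mult_left_mono) (auto intro!: mult_nonneg_nonneg gsw_nonneg)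
   finally show "amon al xi * cmod (md be (%xi. fco xi f) xi) <= C * (c' * Q * (I + 1)) * (gsw1 sr (2 * H) al * gsw1 s (2 * H) be)" .
  qed
 qed
 show ?thesis using res c' Q I by (intro exI[of _ "c' * Q * (I + 1)"]) auto
qed

section \<open>The two classes of test functions\<close>

text \<open>\<open>R\<close> selects the Roumieu class when true and the Beurling class when false,
  so that both halves of the theorem share one proof.\<close>

definition gsc :: "bool => ('a::euclidean_space => real) => ('a => real) => ('a => complex) set" where
 "gsc R s sr = (if R then gs_roumieu s sr else gs_beurling s sr)"

lemma mem_gs_roumieu: "f : gs_roumieu s sr \<longleftrightarrow> (\<exists>h>0. \<exists>C. gsb s sr h C f)"
 unfolding gs_roumieu_def using mem_gs_step_iff by (fastforce simp: Bex_def)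

lemma mem_gs_beurling: "f : gs_beurling s sr \<longleftrightarrow> (\<forall>h>0. \<exists>C. gsb s sr h C f)"
 unfolding gs_beurling_def using mem_gs_step_iff by fastforce

lemma gsc_roumieuI: "R ==> 0 < h ==> gsb s sr h C f ==> f : gsc R s sr"
 by (auto simp: gsc_def mem_gs_roumieu)

text \<open>An estimate that multiplies every scale by a fixed factor \<open>K\<close> preserves
  both classes: the Roumieu class by applying it at the given scale, the Beurling class by applying
  it at h / K.\<close>

lemma gsc_map:
 assumes K: "0 < K" and L: "!!h C. 0 < h ==> gsb s sr h C f ==> \<exists>C'. gsb s' sr' (K * h) C' g"
  and f: "f : gsc R s sr"
 shows "g : gsc R s' sr'"
proof (cases R)
 case True
 then obtain h C where "0 < h" "gsb s sr h C f" using f by (auto simp: gsc_def mem_gs_roumieu)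
 with L K show ?thesis using gsc_roumieuI[OF True, of "K * h"] by (metis mult_pos_pos)
next
 case False
 have "\<exists>C'. gsb s' sr' h C' g" if h: "0 < h" for h
 proof -
  have "0 < h / K" using h K by simp
  moreover obtain C where "gsb s sr (h / K) C f" using f False \<open>0 < h / K\<close> by (auto simp: gsc_def mem_gs_beurling)
  ultimately show ?thesis using L[of "h / K" C] K by simp
 qed
 thus ?thesis using False by (simp add: gsc_def mem_gs_beurling)
qed

text \<open>With two arguments the Roumieu class needs a common scale, the maximum of the two given
  ones.\<close>

lemma gsc_map2:
 assumes K: "0 < K" and L: "!!h C D. 0 < h ==> gsb s sr h C f ==> gsb t ta h D k ==> \<exists>C'. gsb s' sr' (K * h) C' g"
  and f: "f : gsc R s sr" and k: "k : gsc R t ta"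
 shows "g : gsc R s' sr'"
proof (cases R)
 case True
 then obtain h1 C where 1: "0 < h1" "gsb s sr h1 C f" using f by (auto simp: gsc_def mem_gs_roumieu)
 from k True obtain h2 D where 2: "0 < h2" "gsb t ta h2 D k" by (auto simp: gsc_def mem_gs_roumieu)
 have h: "0 < max h1 h2" using 1 by simp
 have "gsb s sr (max h1 h2) C f" "gsb t ta (max h1 h2) D k"
  using 1 2 by (auto intro: gsb_mono)
 from L[OF h this] K h show ?thesis using gsc_roumieuI[OF True, of "K * max h1 h2"] by (metis mult_pos_pos)
next
 case False
 have "\<exists>C'. gsb s' sr' h C' g" if h: "0 < h" for h
 proof -
  have "0 < h / K" using h K by simp
  moreover obtain C where "gsb s sr (h / K) C f" using f False \<open>0 < h / K\<close> by (auto simp: gsc_def mem_gs_beurling)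
  moreover obtain D where "gsb t ta (h / K) D k" using k False \<open>0 < h / K\<close> by (auto simp: gsc_def mem_gs_beurling)
  ultimately show ?thesis using L[of "h / K" C D] K by simp
 qed
 thus ?thesis using False by (simp add: gsc_def mem_gs_beurling)
qed

lemma gsc_boundedE:
 assumes "f : gsc R s sr"
 obtains h C where "0 < h" "gsb s sr h C f"
proof (cases R)
 case True
 thus ?thesis using assms that by (auto simp: gsc_def mem_gs_roumieu)
next
 case False
 then obtain C where "gsb s sr 1 C f" using assms by (auto simp: gsc_def mem_gs_beurling dest: spec[of _ 1])
 thus ?thesis using that[of 1] by simp
qed

lemma gsc_smooth: "f : gsc R s sr ==> smooth f"
 using gsc_boundedE gsbD(1) by metis

lemma gsb_zero: "gsb s sr h 0 (%_. 0)"
 by (rule gsbI) (simp_all add: multi_deriv_const)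

lemma gsc_add: "f : gsc R s sr ==> g : gsc R s sr ==> (%x. f x + g x) \<in> gsc R s sr"
 by (rule gsc_map2[where K=1 and f=f and k=g]) (auto intro: gsb_add)

lemma gsc_scale: "f : gsc R s sr ==> (%x. c * f x) \<in> gsc R s sr"
 by (rule gsc_map[of 1]) (auto intro: gsb_scale)

lemma gsc_zero: "(%_. 0) \<in> gsc R s sr"
 using gsb_zero gsc_roumieuI[OF _ zero_less_one gsb_zero] by (cases R) (auto simp: gsc_def mem_gs_beurling)

lemma gsc_diff: "f : gsc R s sr ==> g : gsc R s sr ==> (%x. f x - g x) \<in> gsc R s sr"
 using gsc_add[of f R s sr "%x. (-1) * g x"] gsc_scale[of g R s sr "-1"] by simp

lemma gsc_sum: "(!!i. i : A ==> f i : gsc R s sr) ==> (%x. \<Sum>i\<in>A. f i x) \<in> gsc R s sr"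
 by (induction A rule: infinite_finite_induct) (auto intro: gsc_zero gsc_add)

lemma monomial_le_gsw_at:
 fixes s :: "'a::euclidean_space => real"
 assumes h: "0 < h" and s: "!!b. 0 < s b"
 obtains c where "0 < c" "!!ga. amon ga k <= c * gsw s h ga"
proof (rule monomial_le_gsw[OF h s, where R="norm k"])
 fix c assume c: "0 < c" "!!(k'::'a) ga. (!!b. b : Basis ==> \<bar>k' *. b\<bar> <= norm k) ==> \<bar>mon ga k'\<bar> <= c * gsw s h ga"
 show thesis by (rule that[OF c(1) c(2)]) (rule Basis_le_norm)
qed

lemma gsc_translate:
 fixes s sr :: "'a::euclidean_space => real"
 assumes s: "!!b. 0 < s b" and f: "f : gsc R s sr"
 shows "(%x. f (x - k)) : gsc R s sr"
proof (rule gsc_map[OF _ _ f, of 2])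
 fix h C assume h: "0 < h" and b: "gsb s sr h C f"
 obtain c where c: "0 < c" "!!ga. amon ga k <= c * gsw s h ga"
  using monomial_le_gsw_at[where h=h and s=s and k=k, OF h s] by blast
 show "\<exists>C'. gsb s sr (2 * h) C' (%x. f (x - k))"
  by (intro exI, rule gsb_translate[OF b h less_imp_le[OF s] less_imp_le[OF c(1)] c(2)])
qed simp

lemma gsc_cis:
 fixes s sr :: "'a::euclidean_space => real"
 assumes sr: "!!b. 0 < sr b" and f: "f : gsc R s sr"
 shows "(%x. cis (k *. x) * f x) \<in> gsc R s sr"
proof (rule gsc_map[OF _ _ f, of 2])
 fix h C assume h: "0 < h" and b: "gsb s sr h C f"
 obtain c where c: "0 < c" "!!ga. amon ga k <= c * gsw sr h ga"
  using monomial_le_gsw_at[where h=h and s=sr and k=k, OF h sr] by blast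
 show "\<exists>C'. gsb s sr (2 * h) C' (%x. cis (k *. x) * f x)"
  by (intro exI, rule gsb_cis[OF b h less_imp_le[OF sr] less_imp_le[OF c(1)] c(2)])
qed simp

lemma gsc_mult:
 fixes s sr :: "'a::euclidean_space => real"
 assumes sr: "!!b. 0 <= sr b" and f: "f : gsc R s sr" and g: "g : gsc R s sr"
 shows "(%x. g x * f x) \<in> gsc R s sr"
proof (rule gsc_map2[OF _ _ f g, of 2])
 fix h C D assume "0 < h" "gsb s sr h C f" "gsb s sr h D g"
 thus "\<exists>C'. gsb s sr (2 * h) C' (%x. g x * f x)"
  using gsb_mult[of s sr h C f D g] gsb_deriv[of s sr h D g] gsbD(1,2)[of s sr h D g] sr by blast
qed simp

lemma gsc_cnj:
 assumes f: "f : gsc R s sr"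
 shows "(%x. cnj (f x)) : gsc R s sr"
proof (rule gsc_map[OF _ _ f, of 1])
 fix h C assume "0 < h" and b: "gsb s sr h C f"
 hence "gsb s sr h C (%x. cnj (f x))"
  using gsbD[OF b] by (auto intro!: gsbI smooth_cnj simp: multi_deriv_cnj)
 thus "\<exists>C'. gsb s sr (1 * h) C' (%x. cnj (f x))" by auto
qed simp

lemma gsc_tensor:
 assumes f: "f : gsc R (%_. s1) (%_. sr1)" and g: "g : gsc R (%_. s2) (%_. sr2)"
 shows "(%(x, y). f x * g y) \<in> gsc R (two_groups s1 s2) (two_groups sr1 sr2)"
 by (rule gsc_map2[OF _ _ f g, of 1]) (auto intro: gsb_tensor)

lemma gsc_zak_adjoint:
 assumes dp: "dual_pair e e'" and s: "0 <= s" and sr: "0 <= sr" and ph: "ph \<in> gsc R (two_groups s sr) (two_groups sr s)"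
 shows "zak_adjoint e ph \<in> gsc R (%_. s) (%_. sr)"
proof (rule gsc_map[OF _ _ ph, of "2 * 2 powr s"])
 fix h C assume h: "0 < h" and b: "gsb2 s sr h C ph"
 show "\<exists>C'. gsb1 s sr (2 * 2 powr s * h) C' (zak_adjoint e ph)"
  using zak_adjoint_bounded[OF dp h s sr] b by (metis mult.assoc)
qed simp

lemma gsb_pw:
 fixes f :: "'a::euclidean_space => complex"
 assumes f: "gsb s sr h C f" and h: "0 < h" and s: "!!b. 0 <= s b" "!!b. s b <= q"
 obtains D where "0 <= D" "!!x. cmod (f x) <= D / pw x"
proof -
 obtain P where P: "0 < P" "!!(k::'a) A C ga. 0 <= A ==> (!!ga. amon ga k * A <= C * gsw s h ga) ==>
  pw k * (amon ga k * A) <= C * P * gsw s (2 powr q * h) ga"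
  by (rule pw_absorb[OF h, of s q]) (use s in auto)
 have "pw x * (amon (%_. 0) x * cmod (f x)) <= C * P * gsw s (2 powr q * h) (%_::'a. 0)" for x
  by (rule P(2)) (use gsbD(3)[OF f, of _ x "%_. 0"] in auto)
 hence "cmod (f x) <= (C * P) / pw x" for x by (simp add: field_simps)
 thus thesis using that[of "C * P"] P(1) gsbD(2)[OF f] by simp
qed

lemma gsc_pw:
 fixes f :: "'a::euclidean_space => complex"
 assumes f: "f : gsc R (%_. s) sr" and s: "0 <= s"
 obtains D where "0 <= D" "!!x. cmod (f x) <= D / pw x"
proof (rule gsc_boundedE[OF f])
 fix h C assume "0 < h" "gsb (%_. s) sr h C f"
 thus thesis using gsb_pw[of "%_. s" sr h C f s] s that by (metis order_refl)
qed

lemma gsc_integrable: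
 fixes f :: "'a::euclidean_space => complex"
 assumes f: "f : gsc R (%_. s) sr" and s: "0 <= s"
 shows "integrable lborel f"
 using gsc_pw[OF f s] integrable_pw_bound smooth_borel_measurable[OF gsc_smooth[OF f]] by metis

section \<open>A window with constant periodization\<close>

lemma integral_pos_continuous:
 fixes f :: "'a::euclidean_space => real"
 assumes int: "integrable lborel f" and nn: "!!x. 0 <= f x" and c: "continuous_on UNIV f" and p: "0 < f x0"
 shows "0 < (LB x. f x)"
proof (rule ccontr)
 assume "\<not> 0 < (LB x. f x)"
 hence "(LB x. f x) = 0" using integral_nn[of lborel f] nn by (simp add: not_less order_antisym)
 hence "AE x in lborel. f x = 0" using integral_nonneg_eq_0_iff_AE[OF int] nn by simp
 hence "{x : space lborel. f x ~= 0} \<in> null_sets lborel"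
  using int by (subst AE_iff_null[symmetric]) auto
 hence "{x. f x ~= 0} \<in> null_sets lebesgue" by (auto intro: null_sets_completionI)
 hence "negligible {x. f x ~= 0}" by (simp add: negligible_iff_null_sets)
 moreover have "open {x. f x ~= 0}" using c by (intro open_Collect_neq continuous_intros)
 ultimately show False using open_not_negligible p by force
qed

text \<open>No condition on s + sr is imposed, because a nonzero \<open>f\<close> provides it: by
  triviality below the critical line, s + sr \<ge> 1 in the Roumieu class and s + sr > 1 in the
  Beurling class. This is what makes the constant \<open>c\<close> of the Fourier estimate
  available.\<close>

lemma gsc_fourier:
 fixes f :: "'a::euclidean_space => complex"
 assumes s: "0 < s" and sr: "0 < sr" and f: "f : gsc R (%_. s) (%_. sr)"
 shows "(%xi. fco xi f) \<in> gsc R (%_. sr) (%_. s)"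
proof (cases "\<exists>x. f x ~= 0")
 case False
 hence "f = (%_. 0)" by auto
 hence "(%xi. fco xi f) = (%_. 0)" by (auto simp: fco_def)
 thus ?thesis by (simp add: gsc_zero)
next
 case nz: True
 show ?thesis
 proof (cases R)
  case True
  then obtain h0 C where h0: "0 < h0" "gsb1 s sr h0 C f" using f by (auto simp: gsc_def mem_gs_roumieu)
  have ge: "1 <= s + sr"
  proof (rule ccontr)
   assume "\<not> 1 <= s + sr"
   hence "summable (%k. (2 * h0\<^sup>2) ^ k * fact k powr (- (1 - (s + sr))))" by (intro summable_power_fact_powr) auto
   hence "f x = 0" for x
    using gsb_trivial[OF h0(2,1)] s sr \<open>\<not> 1 <= s + sr\<close> by (simp add: algebra_simps)
   thus False using nz by simp
  qed
  \<comment> \<open>A scale of at least 1 makes \<open>2 powr s * h\<close> at least 1, so that with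
    s + sr \<ge> 1 the constant 1 serves as \<open>c\<close>.\<close>
  define h where "h = max h0 1"
  have h: "0 < h" "1 <= h" by (auto simp: h_def)
  have b: "gsb1 s sr h C f" using h0 by (auto simp: h_def intro: gsb_mono)
  have "1 * 1 <= 2 powr s * h" using s h by (intro mult_mono) (auto simp: ge_one_powr_ge_zero)
  hence c: "1 <= 1 * ((2 powr s * h) ^ (2 * j) * fact j powr (s + sr - 1))" for j
   using ge mult_mono[OF one_le_power[of "2 powr s * h" "2 * j"] ge_one_powr_ge_zero[of "fact j" "s + sr - 1"]] by simp
  from gsb_fourier[OF h(1) _ _ c, where 'a='a] b s sr h
  obtain P where "gsb1 sr s (2 * (2 powr s * h)) (C * P) (%xi. fco xi f)" by auto
  thus ?thesis using h by (intro gsc_roumieuI[OF True, of "2 * (2 powr s * h)"]) auto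
 next
  case False
  hence B: "!!h. 0 < h ==> \<exists>C. gsb1 s sr h C f" using f by (simp add: gsc_def mem_gs_beurling)
  have gt: "1 < s + sr"
  proof (rule ccontr)
   assume le: "\<not> 1 < s + sr"
   obtain C where C: "gsb1 s sr (1 / 2) C f" using B[of "1/2"] by auto
   have "summable (%k. (2 * (1 / 2)\<^sup>2) ^ k * fact k powr (s + sr - 1))"
   proof (rule summable_comparison_test'[where N=0])
    show "summable (%k. (1 / 2 :: real) ^ k)" by (rule summable_geometric) simp
    fix k :: nat
    have "(fact k :: real) powr (s + sr - 1) <= 1"
     using le powr_mono[of "s + sr - 1" 0 "fact k"] by simp
    thus "norm ((2 * (1 / 2)\<^sup>2) ^ k * (fact k :: real) powr (s + sr - 1)) <= (1 / 2) ^ k"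
     by (simp add: power2_eq_square mult_left_le)
   qed
   hence "f x = 0" for x using gsb_trivial[OF C] s sr le by simp
   thus False using nz by simp
  qed
  have "\<exists>C'. gsb1 sr s h' C' (%xi. fco xi f)" if h': "0 < h'" for h'
  proof -
   define h where "h = h' / (2 * 2 powr s)"
   have h: "0 < h" "2 * (2 powr s * h) = h'" using h' by (auto simp: h_def)
   define H where "H = 2 powr s * h"
   have H: "0 < H" using h by (simp add: H_def)
   \<comment> \<open>Here \<open>H\<close> may be small, and the powers of 1 / H^2 are dominated by
     factorials with the positive exponent s + sr - 1.\<close>
   obtain c where c: "0 < c" "!!t m. \<bar>t\<bar> <= 1 / H\<^sup>2 ==> \<bar>t\<bar> ^ m <= c * (1 ^ m * fact m powr (s + sr - 1))"
    using power_le_fact_powr[of "s + sr - 1" 1 "1 / H\<^sup>2"] gt by auto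
   have "1 <= c * (H ^ (2 * j) * fact j powr (s + sr - 1))" for j
   proof -
    have "1 = (H\<^sup>2) ^ j * (1 / H\<^sup>2) ^ j" using H by (simp add: power_mult_distrib[symmetric])
    also have "... <= (H\<^sup>2) ^ j * (c * fact j powr (s + sr - 1))"
     using c(2)[of "1 / H\<^sup>2" j] H by (intro mult_left_mono) simp_all
    finally show ?thesis unfolding power_mult[of H 2 j] by (simp only: mult.left_commute)
   qed
   thus ?thesis
    using gsb_fourier[OF h(1) _ _, of s sr c, folded H_def, where 'a='a] B[OF h(1)] s sr h(2) unfolding H_def by auto
  qed
  thus ?thesis using False by (simp add: gsc_def mem_gs_beurling)
 qed
qed

text \<open>The given nonzero function lives in the class (s, sr), the window must live in (sr, s).
  The Fourier transform of |f|^2 does, and it is nonzero at 0, where it is the integral of |f|^2.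
  Its squared modulus is normalized to integral 1, and averaging over the cell of the dual lattice
  makes the periodization constant.\<close>

lemma zak_window_exists:
 fixes e :: "'n::finite => real ^ 'n"
 assumes dp: "dual_pair e e'" and s: "0 < s" and sr: "0 < sr"
  and f: "f : gsc R (%_. s) (%_. sr)" and nz: "f (x0 :: real ^ 'n) ~= 0"
 obtains pz where "pz \<in> gsc R (%_. sr) (%_. s)"
  "!!xi. (\<integral>ka. pz (xi + ka) \<partial>csl e') = of_real (1 / measure lborel (cell e))"
  "!!j. j : lat e ==> fco j pz = (if j = 0 then 1 else 0)"
  "!!j. j : lat e ==> (LB et. indicator (cell e) et *! cis (j *. et)) = (if j = 0 then of_real (measure lborel (cell e)) else 0)"
proof -
 have pos: "\<exists>a>0. (LB x. cnj (k x) * k x) = of_real a" if k: "k : gsc R' (%_. s') sr'" "0 <= s'" "!!b. 0 <= sr' b" "k y0 ~= 0" for k R' s' sr' and y0 :: "real ^ 'n"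
 proof -
  have c: "(%x. cnj (k x) * k x) = (%x. of_real ((cmod (k x))\<^sup>2))" by (rule ext) (metis complex_norm_square mult.commute)
  have "integrable lborel (%x. cnj (k x) * k x)" by (rule gsc_integrable[OF gsc_mult[OF k(3,1) gsc_cnj[OF k(1)]] k(2)])
  hence i: "integrable lborel (%x. (cmod (k x))\<^sup>2)" unfolding c complex_of_real_integrable_eq .
  have "continuous_on UNIV k" by (rule smooth_continuous_on[OF gsc_smooth[OF k(1)]])
  hence "0 < (LB x. (cmod (k x))\<^sup>2)"
   by (intro integral_pos_continuous[OF i, of y0] continuous_intros) (use k(4) in auto)
  thus ?thesis unfolding c by (intro exI[of _ "\<integral>x. (cmod (k x))\<^sup>2 \<partial>lborel"] conjI integral_of_real i)
 qed
 define f2 where "f2 x = cnj (f x) * f x" for x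
 have f2: "f2 : gsc R (%_. s) (%_. sr)"
  unfolding f2_def using s sr by (intro gsc_mult gsc_cnj f) auto
 define g where "g xi = fco xi f2" for xi
 have g: "g : gsc R (%_. sr) (%_. s)" unfolding g_def by (rule gsc_fourier[OF s sr f2])
 have "g 0 = (LB x. cnj (f x) * f x)" by (simp add: g_def fco_def f2_def)
 hence g0: "g 0 ~= 0" using pos[OF f _ _ nz] s sr by auto
 obtain a where a: "0 < a" "(LB x. cnj (g x) * g x) = of_real a" using pos[OF g _ _ g0] s sr by auto
 define G where "G x = of_real (1 / a) * (cnj (g x) * g x)" for x
 have G: "G : gsc R (%_. sr) (%_. s)"
  unfolding G_def using s sr by (intro gsc_scale gsc_mult gsc_cnj g) auto
 have G1: "(LB x. G x) = 1" using a by (simp add: G_def)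
 have Gi: "integrable lborel G" by (rule gsc_integrable[OF G]) (use sr in simp)
 have Gm: "G : bm" by (rule smooth_borel_measurable[OF gsc_smooth[OF G]])
 let ?m = "measure lborel (cell e)"
 have m: "0 < ?m" and mfin: "emeasure lborel (cell e) < \<infinity>" using emeasure_cell[OF dual_pair_sym[OF dp]] by auto
 have ci: "integrable lborel (indicator (cell e) :: _ => real)" using mfin by simp
 define pz where "pz xi = of_real (1 / ?m) * (LB et. indicator (cell e) et *! G (xi + et))" for xi
 have pz: "pz \<in> gsc R (%_. sr) (%_. s)"
  unfolding pz_def
 proof (rule gsc_scale, rule gsc_map[OF _ _ G, of 2])
  fix h C assume h: "0 < h" and b: "gsb1 sr s h C G"
  obtain r where r: "!!x. x : cell e ==> norm x <= r" using cell_bounded[OF dual_pair_sym[OF dp]] by metis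
  obtain c where c: "0 < c" "!!(k'::real^'n) ga. (!!b. b : Basis ==> \<bar>k' *. b\<bar> <= r) ==> \<bar>mon ga k'\<bar> <= c * gsw1 sr h ga"
   using monomial_le_gsw[where h=h and s="%_::real^'n. sr" and R=r, OF h sr] by blast
  have "gsb1 sr s (2 * h) (LB et. indicator (cell e) et * (c * C)) (%xi. \<integral>et. indicator (cell e) et *! G (xi + et) \<partial>lborel)"
  proof (rule gsb_integral)
   show "integrable lborel (%et. indicator (cell e) et * (c * C))" by (rule intb_mult_l[OF ci])
   fix et :: "real^'n"
   show "gsb1 sr s (2 * h) (indicator (cell e) et * (c * C)) (%xi. indicator (cell e) et *! G (xi + et))"
   proof (cases "et \<in> cell e")
    case True
    have "amon ga (- et) <= c * gsw1 sr h ga" for ga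
     unfolding monomial_at_minus by (rule c(2)) (rule order_trans[OF Basis_le_norm r[OF True]])
    hence "gsb1 sr s (2 * h) (c * C) (%xi. G (xi - (- et)))"
     using sr c(1) by (intro gsb_translate[OF b h]) auto
    thus ?thesis using True by simp
   qed (simp add: gsb_zero)
  next
   fix xi :: "real^'n"
   have "(%et. G (et + xi)) : bm" using Gm by measurable
   thus "(%et. indicator (cell e) et *! G (xi + et)) : borel_measurable lborel" by (simp add: add.commute)
  qed (use h in simp)
  thus "\<exists>C'. gsb1 sr s (2 * h) C' (%xi. \<integral>et. indicator (cell e) et *! G (xi + et) \<partial>lborel)" by blast
 qed simp
 have P1: "(\<integral>ka. pz (xi + ka) \<partial>csl e') = of_real (1 / ?m)" for xi
 proof -
  have i: "integrable lborel (%et. G (et + xi))" by (rule lborel_integrable_translate[OF Gi])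
  have "(\<integral>ka. pz (xi + ka) \<partial>csl e') = of_real (1 / ?m) * (\<integral>ka. (LB et. indicator (cell e) et *! G ((et + ka) + xi)) \<partial>csl e')"
   by (simp add: pz_def add_ac)
  also have "... = of_real (1 / ?m) * (LB et. G (et + xi))"
   using integral_periodization(3)[OF dual_pair_sym[OF dp] i] by simp
  also have "... = of_real (1 / ?m)" using lborel_integral_translate[OF Gm, of xi] G1 by simp
  finally show ?thesis .
 qed
 have pzi: "integrable lborel pz" by (rule gsc_integrable[OF pz]) (use sr in simp)
 have pzm: "pz \<in> bm" by (rule smooth_borel_measurable[OF gsc_smooth[OF pz]])
 \<comment> \<open>Periodizing the integrand leaves the constant periodization of \<open>pz\<close>
   times the character, since the character is invariant under the dual lattice. The result does not
   depend on v.\<close>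
 have J: "(LB et. pz (et + v) * cis (j *. et)) = of_real (1 / ?m) * (LB et. indicator (cell e) et *! cis (j *. et))" if j: "j : lat e" for j v
 proof -
  have i: "integrable lborel (%et. pz (et + v) * cis (j *. et))"
  proof (rule integrable_bd[OF lborel_integrable_translate[OF pzi, of v]])
   have "(%et. pz (et + v)) : bm" using pzm by measurable
   thus "(%et. pz (et + v) * cis (j *. et)) : borel_measurable lborel" by simp
  qed (simp add: norm_mult)
  have "(LB et. pz (et + v) * cis (j *. et)) = (LB et. (\<integral>ka. indicator (cell e) et *! (pz ((et + ka) + v) * cis (j *. (et + ka))) \<partial>csl e'))"
   by (rule integral_periodization(1)[OF dual_pair_sym[OF dp] i])
  moreover have "(\<integral>ka. indicator (cell e) et *! (pz ((et + ka) + v) * cis (j *. (et + ka))) \<partial>csl e') = of_real (1 / ?m) * (indicator (cell e) et *! cis (j *. et))" for et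
  proof -
   have "(\<integral>ka. indicator (cell e) et *! (pz ((et + ka) + v) * cis (j *. (et + ka))) \<partial>csl e') =
    (\<integral>ka. (indicator (cell e) et *! cis (j *. et)) * pz ((et + v) + ka) \<partial>csl e')"
   proof (rule integral_cg[OF refl])
    fix ka assume "ka \<in> space (csl e')"
    hence "cis (j *. ka) = 1" using cis_lattice_inner[OF dp j] by simp
    thus "indicator (cell e) et *! (pz ((et + ka) + v) * cis (j *. (et + ka))) = (indicator (cell e) et *! cis (j *. et)) * pz ((et + v) + ka)"
     by (simp add: inner_add_right cis_mult[symmetric] add_ac mult_ac)
   qed
   thus ?thesis by (simp add: P1)
  qed
  ultimately show ?thesis by (simp only: int_mult_r)
 qed
 have ort: "fco j pz = (if j = 0 then 1 else 0)" if j: "j : lat e" for j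
 proof (cases "j = 0")
  case True
  thus ?thesis using J[OF j, of 0] m mfin by (simp add: fco_def scaleR_conv_of_real)
 next
  case False
  \<comment> \<open>Translation by a vector whose inner product with j is pi reverses the sign of
    the character, so the coefficient equals its own negative.\<close>
  define v where "v = (pi / (j *. j)) *! j"
  have jv: "j *. v = pi" using False by (simp add: v_def)
  have "(%et. pz et * cis (j *. et)) : bm" using pzm by simp
  from lborel_integral_translate[OF this, of v]
  have "fco j pz = (LB et. pz (et + v) * cis (j *. (et + v)))" by (simp add: fco_def)
  also have "... = - (LB et. pz (et + v) * cis (j *. et))"
   by (simp add: inner_add_right jv cis_mult[symmetric])
  also have "... = - fco j pz" using J[OF j, of v] J[OF j, of 0] by (simp add: fco_def)
  finally show ?thesis using False by simp
 qed
 \<comment> \<open>Orthogonality of the characters on the cell is read back from the coefficients of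
   the window, by the same identity at v = 0.\<close>
 have orc: "(LB et. indicator (cell e) et *! cis (j *. et)) = (if j = 0 then of_real ?m else 0)" if j: "j : lat e" for j
 proof -
  have "of_real (1 / ?m) * (LB et. indicator (cell e) et *! cis (j *. et)) = (if j = 0 then 1 else 0)"
   using J[OF j, of 0] ort[OF j] by (simp add: fco_def)
  thus ?thesis using m by (auto simp: field_simps split: if_splits)
 qed
 show thesis by (rule that[OF pz P1 ort orc])
qed

section \<open>Poisson summation\<close>

lemma pw_bound_nonneg:
 fixes f :: "'a::euclidean_space => complex"
 assumes "!!x. cmod (f x) <= C / pw x"
 shows "0 <= C"
proof -
 have "0 <= C / pw (0::'a)" by (rule order_trans[OF norm_ge_zero assms])
 thus ?thesis using pw_pos[of "0::'a"] by (metis divide_neg_pos not_le)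
qed

lemma lfun_add:
 "lfun V u ==> f : V ==> g : V ==> u (%x. f x + g x) = u f + u g"
 by (simp add: lfun_def)

lemma lfun_scale:
 "lfun V u ==> f : V ==> u (%x. c * f x) = c * u f"
 by (simp add: lfun_def)

lemma norm_integral_le:
 fixes f :: "'w => 'b::{banach, second_countable_topology}"
 assumes g: "integrable M g" and le: "!!om. om \<in> space M ==> norm (f om) <= g om"
 shows "norm (\<integral>om. f om \<partial>M) <= (\<integral>om. g om \<partial>M)"
proof -
 have "norm (\<integral>om. f om \<partial>M) <= (\<integral>om. norm (f om) \<partial>M)" by (rule integral_norm_bound)
 also have "... <= (\<integral>om. g om \<partial>M)"
  by (rule integral_mono'[OF g le]) (use order_trans[OF norm_ge_zero le] in auto)
 finally show ?thesis .
qed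

lemma isCont_integral:
 fixes f :: "'w => 'a::euclidean_space => 'b::{banach, second_countable_topology}"
 assumes r: "0 < r" and c: "!!om. om \<in> space M ==> isCont (f om) x0"
  and bd: "!!om x. om \<in> space M ==> x : ball x0 r ==> norm (f om x) <= g om" and g: "integrable M g"
  and meas: "!!x. (%om. f om x) \<in> borel_measurable M"
 shows "isCont (%x. \<integral>om. f om x \<partial>M) x0"
 unfolding continuous_at_sequentially
proof (intro allI impI)
 fix X :: "nat => 'a" assume X: "X \<longlonglongrightarrow> x0"
 define Y where "Y n = (if X n : ball x0 r then X n else x0)" for n
 have ev: "\<forall>\<^sub>F n in sequentially. Y n = X n"
  using tendstoD[OF X r] by eventually_elim (simp add: Y_def dist_commute)
 have Y: "Y \<longlonglongrightarrow> x0" by (rule Lim_transform_eventually[OF X]) (use ev in \<open>simp add: eq_commute\<close>)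
 have Yb: "Y n : ball x0 r" for n using r by (simp add: Y_def)
 have "(%n. \<integral>om. f om (Y n) \<partial>M) \<longlonglongrightarrow> (\<integral>om. f om x0 \<partial>M)"
 proof (rule integral_dominated_convergence[OF _ _ g])
  show "AE om in M. (%n. f om (Y n)) \<longlonglongrightarrow> f om x0"
   using c Y by (intro AE_I2) (auto simp: continuous_at_sequentially o_def)
  show "AE om in M. norm (f om (Y n)) <= g om" for n by (intro AE_I2 bd Yb)
 qed (use meas in auto)
 thus "((%x. \<integral>om. f om x \<partial>M) \<circ> X) \<longlonglongrightarrow> (\<integral>om. f om x0 \<partial>M)"
  unfolding o_def by (rule Lim_transform_eventually) (use ev in \<open>auto elim: eventually_mono\<close>)
qed

text \<open>The trigonometric polynomials \<open>\<Prod>\<^sub>i ((1 + cos \<langle>e\<^sub>i, \<eta>\<rangle>) / 2)\<^sup>N\<close> concentrate at the origin of the cell.\<close>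

lemma fourier_zero_imp_zero:
 fixes e e' :: "'n::finite => real ^ 'n" and Q :: "real ^ 'n => complex"
 assumes dp: "dual_pair e e'" and cont: "continuous_on UNIV Q" and M: "!!et. et \<in> cell e ==> cmod (Q et) <= M"
  and zero: "!!j. j : lat e ==> (LB et. indicator (cell e) et *! (Q et * cis (j *. et))) = 0"
 shows "Q 0 = 0"
proof (rule ccontr)
 assume Q0: "Q 0 ~= 0"
 let ?m = "measure lborel (cell e)"
 have mfin: "emeasure lborel (cell e) < \<infinity>" using emeasure_cell[OF dual_pair_sym[OF dp]] by auto
 define k where "k i et = (1 + cos (e i *. et)) / 2" for i and et :: "real ^ 'n"
 define K where "K et = (\<Prod>i\<in>UNIV. k i et)" for et
 have k01: "0 <= k i et" "k i et <= 1" for i et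
 proof -
  have c: "0 <= (1 + c) / 2" "(1 + c) / 2 <= 1" if "- 1 <= c" "c <= 1" for c :: real using that by auto
  show "0 <= k i et" "k i et <= 1" unfolding k_def by (rule c[OF cos_ge_minus_one cos_le_one])+
 qed
 have K01: "0 <= K et" "K et <= 1" for et unfolding K_def using k01 by (auto intro!: prod_nonneg prod_le_1)
 have kc: "complex_of_real (k i et) = 1 / 2 + (cis (e i *. et) + cis ((- e i) *. et)) / 4" for i et
  by (simp add: k_def complex_eq_iff)
 \<comment> \<open>Multiplication by \<open>k i\<close> replaces the coefficient at j by a
   combination of those at j, j + e i and j - e i. Functions on the cell with vanishing coefficients
   are therefore stable under multiplication by the kernel.\<close>
 define Z where "Z q \<longleftrightarrow> q : bm \<and> (\<exists>B. \<forall>et\<in>cell e. cmod (q et) <= B) \<and>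
   (\<forall>j\<in>lat e. (LB et. indicator (cell e) et *! (q et * cis (j *. et))) = 0)" for q :: "real ^ 'n => complex"
 have ci: "integrable lborel (indicator (cell e) :: _ => real)" using mfin by simp
 have bint: "integrable lborel (%et. indicator (cell e) et *! q et)" if "q : bm" "!!et. et \<in> cell e ==> norm (q et) <= B" for q :: "real ^ 'n => 'b::{banach, second_countable_topology}" and B
 proof (rule integrable_bd[OF intb_mult_l[OF ci, of B]])
  show "AE et in lborel. norm (indicator (cell e) et *! q et) <= norm (indicator (cell e) et * B)"
   using that(2) by (intro AE_I2) (auto simp: indicator_def intro: order_trans[OF _ abs_ge_self])
 qed (use that(1) in simp)
 have Zk: "Z (%et. q et * of_real (k i et))" if q: "Z q" for q i
 proof -
  obtain B where B: "!!et. et \<in> cell e ==> cmod (q et) <= B" and qm: "q : bm"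
   and qz: "!!j. j : lat e ==> (LB et. indicator (cell e) et *! (q et * cis (j *. et))) = 0" using q unfolding Z_def by blast
  have qi: "integrable lborel (%et. indicator (cell e) et *! (q et * cis (j *. et)))" for j
   by (rule bint[of _ B]) (use qm B in \<open>auto simp: norm_mult\<close>)
  have kb: "cmod (q et * of_real (k i et)) <= B" if "et \<in> cell e" for et
   using mult_mono[OF B[OF that] k01(2)[of i et]] k01(1)[of i et] order_trans[OF norm_ge_zero B[OF that]] by (simp add: norm_mult)
  have "(%et. k i et) \<in> bm"
   unfolding k_def by (intro bm_contI continuous_intros) simp
  hence km: "(%et. q et * of_real (k i et)) : bm" using qm by simp
  have "(LB et. indicator (cell e) et *! (q et * of_real (k i et) * cis (j *. et))) = 0" if j: "j : lat e" for j
  proof -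
   let ?I = "%l et. indicator (cell e) et *! (q et * cis (l *. et))"
   have "(LB et. indicator (cell e) et *! (q et * of_real (k i et) * cis (j *. et))) =
    (LB et. (1 / 2) * ?I j et + ((1 / 4) * ?I (j + e i) et + (1 / 4) * ?I (j - e i) et))"
    unfolding kc by (rule integral_cg[OF refl]) (simp add: scaleR_conv_of_real algebra_simps inner_add_left inner_diff_left cis_mult)
   also have "... = (1 / 2) * integral\<^sup>L lborel (?I j) + ((1 / 4) * integral\<^sup>L lborel (?I (j + e i)) + (1 / 4) * integral\<^sup>L lborel (?I (j - e i)))"
    using qi[of j] qi[of "j + e i"] qi[of "j - e i"]
    by (simp only: Bochner_Integration.integral_add Bochner_Integration.integrable_add intb_mult_r int_mult_r)
   also have "... = 0"
   proof -
    have "j - e i : lat e" using lattice_add[OF j lattice_minus[OF lattice_basis[of e i]]] by simp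
    from qz[OF j] qz[OF lattice_add[OF j lattice_basis[of e i]]] qz[OF this]
    show ?thesis by (simp only: mult_zero_right add_0_right)
   qed
   finally show ?thesis .
  qed
  thus ?thesis unfolding Z_def using km kb by blast
 qed
 have ZI: "Z (%et. q et * of_real (\<Prod>i\<in>I. k i et))" if "Z q" "finite I" for q I
  using that(2,1)
 proof (induction I arbitrary: q rule: finite_induct)
  case (insert i I)
  from insert.IH[OF Zk[OF insert.prems, of i]] insert.hyps show ?case by (simp add: mult_ac)
 qed simp
 have ZN: "Z (%et. Q et * of_real (K et ^ N))" for N
 proof (induction N)
  case 0
  show ?case unfolding Z_def using zero M bm_contI[OF cont] by auto
 next
  case (Suc N)
  from ZI[OF Suc, of UNIV] show ?case by (simp add: K_def mult_ac)
 qed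
 have Kc: "continuous_on UNIV K" unfolding K_def k_def by (intro continuous_intros) auto
 have Km: "K : bm" by (rule bm_contI[OF Kc])
 \<comment> \<open>A real function with value |Q 0|^2 > 0 at the origin whose integrals over the
   cell against all powers of \<open>K\<close> vanish.\<close>
 define R where "R et = Re (cnj (Q 0) * Q et)" for et
 have Rc: "continuous_on UNIV R" unfolding R_def by (intro continuous_intros cont)
 have Rm: "R : bm" by (rule bm_contI[OF Rc])
 have M0: "0 <= M"
 proof -
  have "0 : cell e" by (simp add: cell_def)
  thus ?thesis using M[of 0] norm_ge_zero order_trans by blast
 qed
 define M' where "M' = cmod (Q 0) * M"
 have Rb: "\<bar>R et\<bar> <= M'" if "et \<in> cell e" for et
 proof -
  have "\<bar>R et\<bar> <= cmod (cnj (Q 0) * Q et)" unfolding R_def by (rule abs_Re_le_cmod)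
  also have "... <= M'" unfolding M'_def norm_mult by (simp add: mult_left_mono M[OF that])
  finally show ?thesis .
 qed
 have RK: "(LB et. indicator (cell e) et *! (R et * K et ^ N)) = 0" for N
 proof -
  have "(LB et. indicator (cell e) et *! (Q et * of_real (K et ^ N) * cis (0 *. et))) = 0"
   using ZN[of N] lattice_zero unfolding Z_def by blast
  hence "(LB et. indicator (cell e) et *! (Q et * of_real (K et ^ N))) = 0" by simp
  hence z: "(LB et. cnj (Q 0) * (indicator (cell e) et *! (Q et * of_real (K et ^ N)))) = 0"
   by (simp only: int_mult_r mult_zero_right)
  have zi: "integrable lborel (%et. cnj (Q 0) * (indicator (cell e) et *! (Q et * of_real (K et ^ N))))"
   using ZN[of N] unfolding Z_def by (intro intb_mult_r) (use bint in blast)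
  have "(LB et. Re (cnj (Q 0) * (indicator (cell e) et *! (Q et * of_real (K et ^ N))))) = 0"
   using integral_Re[OF zi] z by simp
  moreover have "Re (cnj (Q 0) * (indicator (cell e) et *! (Q et * of_real (K et ^ N)))) = indicator (cell e) et *! (R et * K et ^ N)" for et
   by (simp add: R_def indicator_def mult.assoc[symmetric] del: of_real_power)
  ultimately show ?thesis by (simp only:)
 qed
 define ep where "ep = (cmod (Q 0))\<^sup>2 / 2"
 have ep: "0 < ep" using Q0 by (simp add: ep_def)
 have R0: "R 0 = 2 * ep" unfolding R_def ep_def by (simp add: cmod_power2) (simp add: power2_eq_square)
 have "\<exists>de>0. \<forall>et. norm et < de --> ep < R et"
 proof -
  have "isCont R 0" using Rc by (simp add: continuous_on_eq_continuous_at)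
  then obtain de where "0 < de" "!!et. dist et 0 < de ==> dist (R et) (R 0) < ep"
   unfolding continuous_at_eps_delta using ep by blast
  moreover have "ep < r" if "dist r (2 * ep) < ep" for r using that by (simp add: dist_real_def abs_less_iff)
  ultimately show ?thesis unfolding R0 by (metis dist_0_norm dist_commute)
 qed
 then obtain de where de: "0 < de" "!!et. norm et < de ==> ep < R et" by blast
 define A where "A = 1 + (\<Sum>i\<in>UNIV. norm (e' i))"
 have A: "0 < A" by (auto simp: A_def intro!: add_pos_nonneg sum_nonneg)
 define ta where "ta = min (de / A) 1"
 have ta: "0 < ta" "ta <= 1" "ta * A <= de" using de(1) A by (auto simp: ta_def min_def field_simps)
 have near: "norm et < de" if "!!i. \<bar>et *. e i\<bar> < ta" for et
 proof -
  have "et = (\<Sum>i\<in>UNIV. (et *. e i / (2 * pi)) *! e' i)" using dp unfolding dual_pair_def by blast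
  hence "norm et <= (\<Sum>i\<in>UNIV. norm ((et *. e i / (2 * pi)) *! e' i))" by (metis norm_sum)
  also have "... <= (\<Sum>i\<in>UNIV. ta * norm (e' i))"
  proof (rule sum_mono)
   fix i
   have "\<bar>et *. e i\<bar> / (2 * pi) <= \<bar>et *. e i\<bar> / 1" using pi_ge_two by (intro divide_left_mono) auto
   hence "\<bar>et *. e i / (2 * pi)\<bar> <= ta" using that[of i] by simp
   thus "norm ((et *. e i / (2 * pi)) *! e' i) <= ta * norm (e' i)" by (simp add: mult_right_mono del: abs_divide)
  qed
  also have "... < ta * A" using ta(1) by (simp add: A_def sum_distrib_left[symmetric])
  also have "... <= de" by (rule ta(3))
  finally show ?thesis .
 qed
 define rh where "rh = (1 + cos ta) / 2"
 have cta: "cos ta < 1" "- 1 < cos ta"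
  using cos_monotone_0_pi[of 0 ta] cos_monotone_0_pi[of ta pi] ta pi_gt3 by auto
 have rh: "0 < rh" "rh < 1" using cta by (auto simp: rh_def)
 have far: "K et <= rh" if et: "et \<in> cell e" and i: "ta <= \<bar>et *. e i\<bar>" for et i
 proof -
  have "\<bar>et *. e i\<bar> <= pi" using et by (auto simp: cell_def abs_le_iff dest!: spec[of _ i])
  hence "cos \<bar>et *. e i\<bar> <= cos ta" using ta i by (intro cos_monotone_0_pi_le) auto
  hence "k i et <= rh" by (simp add: k_def rh_def inner_commute)
  have "K et = k i et * (\<Prod>i'\<in>UNIV - {i}. k i' et)" unfolding K_def by (rule prod.remove) auto
  also have "... <= k i et * 1" using k01 by (intro mult_left_mono prod_le_1) auto
  finally show ?thesis using \<open>k i et <= rh\<close> by simp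
 qed
 \<comment> \<open>The midpoint between \<open>rh\<close> and 1. In the cell away from the origin
   \<open>K\<close> is at most \<open>rh\<close>, on a small ball it exceeds \<open>rh'\<close>. The
   integral over the ball is at least a constant times rh'^N, the negative part at most a constant
   times rh^N, which contradicts vanishing for large N.\<close>
 define rh' where "rh' = (1 + rh) / 2"
 have rh': "rh < rh'" "0 < rh'" "rh' < 1" using rh by (auto simp: rh'_def)
 have K0: "K 0 = 1" by (simp add: K_def k_def)
 have "\<exists>de>0. \<forall>et. norm et < de --> rh' < K et"
 proof -
  have "isCont K 0" using Kc by (simp add: continuous_on_eq_continuous_at)
  then obtain de where "0 < de" "!!et. dist et 0 < de ==> dist (K et) (K 0) < 1 - rh'"
   unfolding continuous_at_eps_delta using rh'(3) by (meson diff_gt_0_iff_gt)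
  moreover have "rh' < r" if "dist r 1 < 1 - rh'" for r using that by (simp add: dist_real_def abs_less_iff)
  ultimately show ?thesis using K0 by (metis dist_0_norm dist_commute)
 qed
 then obtain de2 where de2: "0 < de2" "!!et. norm et < de2 ==> rh' < K et" by blast
 define A2 where "A2 = 1 + (\<Sum>i\<in>UNIV. norm (e i))"
 have A2: "0 < A2" "!!i. norm (e i) <= A2"
 proof -
  show "0 < A2" by (auto simp: A2_def intro!: add_pos_nonneg sum_nonneg)
  fix i
  have "norm (e i) <= (\<Sum>i\<in>UNIV. norm (e i))" by (rule member_le_sum) auto
  thus "norm (e i) <= A2" by (simp add: A2_def)
 qed
 define de3 where "de3 = min de2 (ta / A2)"
 have de3: "0 < de3" "de3 <= de2" "de3 * A2 <= ta" using de2 ta A2(1) by (auto simp: de3_def min_def field_simps)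
 have U: "\<bar>et *. e i\<bar> < ta" if "norm et < de3" for et i
 proof -
  have "\<bar>et *. e i\<bar> <= norm et * norm (e i)" by (rule Cauchy_Schwarz_ineq2)
  also have "... <= norm et * A2" by (intro mult_left_mono A2) auto
  also have "... < de3 * A2" using that A2(1) by simp
  finally show ?thesis using de3(3) by simp
 qed
 define u where "u = measure lborel (ball (0 :: real ^ 'n) de3)"
 have u: "0 < u" unfolding u_def using de3(1) by (rule content_ball_pos)
 have key: "ep * u * rh' ^ N <= M' * ?m * rh ^ N" for N
 proof -
  have pw: "(ep * rh' ^ N) * indicator (ball 0 de3) et - (M' * rh ^ N) * indicator (cell e) et <= indicator (cell e) et *! (R et * K et ^ N)" for et
  proof (cases "\<forall>i. \<bar>et *. e i\<bar> < ta")
   case True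
   have "- pi <= et *. e i \<and> et *. e i < pi" for i
    using True[rule_format, of i] ta(2) pi_gt3 unfolding abs_less_iff by linarith
   hence "et \<in> cell e" by (simp add: cell_def)
   have R: "ep < R et" by (rule de(2)[OF near]) (use True in blast)
   have "(ep * rh' ^ N) * indicator (ball 0 de3) et <= R et * K et ^ N"
   proof (cases "et \<in> ball 0 de3")
    case True
    hence "rh' < K et" using de2(2)[of et] de3(2) by simp
    hence "rh' ^ N <= K et ^ N" using rh'(2) by (intro power_mono) auto
    thus ?thesis using R ep rh'(2) True by (simp add: mult_mono)
   qed (use R ep K01(1)[of et] in simp)
   moreover have "0 <= M' * rh ^ N" using M0 rh by (simp add: M'_def)
   ultimately show ?thesis using \<open>et \<in> cell e\<close> by simp
  next
   case False
   then obtain i where i: "ta <= \<bar>et *. e i\<bar>" by (auto simp: not_less)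
   have nb: "et \<notin> ball 0 de3" using U[of et i] i by auto
   show ?thesis
   proof (cases "et \<in> cell e")
    case True
    have "K et ^ N <= rh ^ N" by (intro power_mono far[OF True i] K01)
    hence "\<bar>R et * K et ^ N\<bar> <= M' * rh ^ N"
     unfolding abs_mult using K01(1)[of et] Rb[OF True] by (intro mult_mono) (auto intro: order_trans)
    thus ?thesis using nb True by simp
   qed (use nb in simp)
  qed
  have i1: "integrable lborel (%et. (ep * rh' ^ N) * indicator (ball (0 :: real ^ 'n) de3) et)"
   by (intro intb_mult_r integrable_real_indicator emeasure_bounded_finite) auto
  have i2: "integrable lborel (%et. (M' * rh ^ N) * indicator (cell e) et)" using ci by (rule intb_mult_r)
  have i3: "integrable lborel (%et. indicator (cell e) et *! (R et * K et ^ N))"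
  proof (rule bint[of _ "M'"])
   show "norm (R et * K et ^ N) <= M'" if "et \<in> cell e" for et
    using mult_mono[OF Rb[OF that] power_le_one[OF K01(1)[of et] K01(2)[of et], of N]] K01(1)[of et] order_trans[OF abs_ge_zero Rb[OF that]]
    by (simp add: abs_mult)
  qed (use Rm Km in simp)
  have "(LB et. (ep * rh' ^ N) * indicator (ball (0 :: real ^ 'n) de3) et - (M' * rh ^ N) * indicator (cell e) et) <= (LB et. indicator (cell e) et *! (R et * K et ^ N))"
   by (rule integral_mono[OF Bochner_Integration.integrable_diff[OF i1 i2] i3 pw])
  hence "(ep * rh' ^ N) * u - (M' * rh ^ N) * ?m <= 0"
   unfolding RK Bochner_Integration.integral_diff[OF i1 i2] by (simp add: u_def)
  thus ?thesis by (simp add: mult_ac)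
 qed
 obtain N where N: "M' * ?m / (ep * u) < (rh' / rh) ^ N"
  using real_arch_pow[of "rh' / rh"] rh rh' by auto
 hence "M' * ?m * rh ^ N < ep * u * rh' ^ N"
  using ep u rh by (simp add: power_divide field_simps)
 thus False using key[of N] by simp
qed

text \<open>With \<xi> replaced by \<xi> + \<eta>, both sides are continuous in \<eta> and have the
  same Fourier coefficients over the cell, computed by exchanging sum and integral on the left and
  by unfolding the periodization on the right. Their difference therefore vanishes at \<eta> = 0,
  which is the claim.\<close>

lemma poisson_summation:
 fixes e e' :: "'n::finite => real ^ 'n" and p :: "real ^ 'n => complex"
 assumes dp: "dual_pair e e'" and cont: "continuous_on UNIV p" and C: "!!et. cmod (p et) <= C / pw et"
  and D: "!!j. j : lat e ==> cmod (fco j p) <= D / pw j"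
  and orth: "!!j. j : lat e ==> (LB et. indicator (cell e) et *! cis (j *. et)) = (if j = 0 then of_real (measure lborel (cell e)) else 0)"
 shows "(\<integral>j. fco j p * cis (- (j *. xi)) \<partial>csl e) =
  of_real (measure lborel (cell e)) * (\<integral>ka. p (xi + ka) \<partial>csl e')"
proof -
 let ?m = "measure lborel (cell e)" and ?J = "csl e" and ?J' = "csl e'"
 note dp' = dual_pair_sym[OF dp]
 have mfin: "emeasure lborel (cell e) < \<infinity>" using emeasure_cell[OF dp'] by auto
 have C0: "0 <= C" by (rule pw_bound_nonneg[OF C])
 have D0: "0 <= D" using order_trans[OF norm_ge_zero D[OF lattice_zero]] pw_pos[of "0 :: real ^ 'n"]
  by (metis divide_neg_pos not_le)
 have pm: "p : bm" by (rule bm_contI[OF cont])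
 have pint: "integrable lborel p" by (rule integrable_pw_bound[OF pm C])
 define p1 where "p1 et = p (xi + et)" for et
 have p1m: "p1 : bm" unfolding p1_def using pm by measurable
 have p1i: "integrable lborel p1" using lborel_integrable_translate[OF pint, of xi] by (simp add: p1_def[abs_def] add.commute)
 define c where "c j = fco j p * cis (- (j *. xi))" for j
 have c_p1: "fco j p1 = c j" for j
 proof -
  have "(%et. p et * cis (j *. et)) : bm" using pm by simp
  from lborel_integral_translate[OF this, of xi]
  have "fco j p = (LB et. cis (j *. xi) * (p1 et * cis (j *. et)))"
   by (simp add: fco_def p1_def inner_add_right cis_mult[symmetric] add.commute mult_ac)
  also have "... = cis (j *. xi) * fco j p1" by (simp add: fco_def)
  finally show ?thesis by (simp add: c_def mult.assoc cis_mult mult.left_commute[of "cis _"])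
 qed
 have cb: "cmod (c j) <= D / pw j" if "j : lat e" for j using D[OF that] by (simp add: c_def norm_mult)
 have Di: "integrable ?J (%j. D / pw j)" using intb_mult_r[OF integrable_lattice_pw[OF dp], of D] by simp
 have ci: "integrable lborel (indicator (cell e) :: _ => real)" using mfin by simp
 define Q1 where "Q1 et = (\<integral>j. c j * cis (- (j *. et)) \<partial>?J)" for et
 define Q2 where "Q2 et = (\<integral>ka. p1 (et + ka) \<partial>?J')" for et
 have Q1c: "continuous_on UNIV Q1"
 proof -
  have "isCont Q1 et" for et
   unfolding Q1_def
  proof (rule isCont_integral[where r=1, OF _ _ _ Di])
   have "continuous_on UNIV (%et. c j * cis (- (j *. et)))" for j by (intro continuous_intros)
   thus "isCont (%et. c j * cis (- (j *. et))) et" for j by (simp add: continuous_on_eq_continuous_at)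
   show "cmod (c j * cis (- (j *. x))) <= D / pw j" if "j : space ?J" for j x
    using cb that by (simp add: norm_mult)
  qed auto
  thus ?thesis by (simp add: continuous_on_eq_continuous_at)
 qed
 have Q1b: "cmod (Q1 et) <= (\<integral>j. D / pw j \<partial>?J)" for et
  unfolding Q1_def
  by (rule norm_integral_le[OF Di]) (use cb in \<open>auto simp: norm_mult\<close>)
 have pw: "cmod (p1 (et + ka)) <= (C * 2 ^ CARD('n) * pw (- (xi + et))) / pw ka" for et ka
 proof -
  have "cmod (p1 (et + ka)) <= C * (1 / pw (xi + (et + ka)))" using C by (simp add: p1_def)
  also have "... <= C * (2 ^ DIM(real ^ 'n) * pw (- (xi + et)) / pw ((xi + (et + ka)) + (- (xi + et))))"
   by (intro mult_left_mono inverse_pw_le C0)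
  finally show ?thesis by (simp add: mult_ac)
 qed
 define B where "B r = C * 2 ^ CARD('n) * (1 + (norm xi + r)\<^sup>2) ^ CARD('n)" for r
 have pwB: "cmod (p1 (et + ka)) <= B r / pw ka" if "norm et <= r" for et ka r
 proof -
  have "norm (- (xi + et)) <= norm xi + r" unfolding norm_minus_cancel using norm_triangle_ineq[of xi et] that by linarith
  from pw_bounded[OF this] have "pw (- (xi + et)) <= (1 + (norm xi + r)\<^sup>2) ^ CARD('n)" by simp
  hence "(C * 2 ^ CARD('n) * pw (- (xi + et))) / pw ka <= B r / pw ka"
   unfolding B_def using C0 by (intro divide_right_mono mult_left_mono) auto
  thus ?thesis using pw[of et ka] by linarith
 qed
 have Bi: "integrable ?J' (%ka. B r / pw ka)" for r
  using intb_mult_r[OF integrable_lattice_pw[OF dp'], of "B r"] by simp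
 have Q2c: "continuous_on UNIV Q2"
 proof -
  have "isCont Q2 et" for et
   unfolding Q2_def
  proof (rule isCont_integral[where r=1, OF _ _ _ Bi[of "norm et + 1"]])
   show "isCont (%et. p1 (et + ka)) et" for ka
    unfolding p1_def by (intro continuous_intros isCont_o2[OF _ continuous_on_interior[OF cont]]) auto
   show "cmod (p1 (x + ka)) <= B (norm et + 1) / pw ka" if "x : ball et 1" for x ka
   proof (rule pwB)
    have "norm (x - et) < 1" using that by (simp add: dist_norm norm_minus_commute)
    thus "norm x <= norm et + 1" using norm_triangle_ineq2[of x et] by linarith
   qed
  qed auto
  thus ?thesis by (simp add: continuous_on_eq_continuous_at)
 qed
 obtain r where r: "!!x. x : cell e ==> norm x <= r" using cell_bounded[OF dp'] by metis
 have Q2b: "cmod (Q2 et) <= (\<integral>ka. B r / pw ka \<partial>?J')" if "et \<in> cell e" for et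
  unfolding Q2_def
  by (rule norm_integral_le[OF Bi[of r]]) (rule pwB[OF r[OF that]])
 define Q where "Q et = Q1 et - of_real ?m * Q2 et" for et
 have "Q 0 = 0"
 proof (rule fourier_zero_imp_zero[OF dp])
  show "continuous_on UNIV Q" unfolding Q_def by (intro continuous_intros Q1c Q2c)
  show "cmod (Q et) <= (\<integral>j. D / pw j \<partial>?J) + ?m * (\<integral>ka. B r / pw ka \<partial>?J')" if "et \<in> cell e" for et
   unfolding Q_def
   by (rule order_trans[OF norm_triangle_ineq4]) (use Q1b[of et] Q2b[OF that] in \<open>auto simp: norm_mult intro!: add_mono mult_left_mono\<close>)
  fix k assume k: "k : lat e"
  define G where "G j et = indicator (cell e) et *! (c j * cis ((k - j) *. et))" for j et
  have Gi: "integrable lborel (G j)" for j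
  proof (rule integrable_bd[OF intb_mult_l[OF ci, of "cmod (c j)"]])
   show "G j : borel_measurable lborel" unfolding G_def[abs_def] by simp
  qed (auto simp: G_def indicator_def norm_mult)
  have Gn: "(LB et. norm (G j et)) = cmod (c j) * ?m" for j
  proof -
   have "norm (G j et) = cmod (c j) * indicator (cell e) et" for et by (simp add: G_def norm_mult)
   thus ?thesis using mfin by simp
  qed
  have GS: "integrable ?J (%j. \<integral>et. norm (G j et) \<partial>lborel)"
   unfolding Gn by (intro intb_mult_l integrable_bd[OF Di]) (use cb D0 in \<open>auto intro!: AE_I2\<close>)
  note sw = integral_count_space_swap[OF countable_lattice sigma_finite_lborel Gi GS]
  have G1: "(\<integral>j. G j et \<partial>?J) = indicator (cell e) et *! (Q1 et * cis (k *. et))" for et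
  proof -
   have "(\<integral>j. G j et \<partial>?J) = (\<integral>j. (indicator (cell e) et *! cis (k *. et)) * (c j * cis (- (j *. et))) \<partial>?J)"
    by (intro integral_cg refl) (simp add: G_def inner_diff_left cis_mult mult_ac)
   also have "... = (indicator (cell e) et *! cis (k *. et)) * Q1 et" by (simp only: int_mult_r Q1_def)
   finally show ?thesis by (simp add: mult_ac)
  qed
  have "(LB et. indicator (cell e) et *! (Q1 et * cis (k *. et))) = (\<integral>j. (LB et. G j et) \<partial>?J)"
   unfolding sw(1) G1 ..
  also have "... = (\<integral>j. (if j = k then c k * of_real ?m else 0) \<partial>?J)"
  proof (rule integral_cg[OF refl])
   fix j assume "j : space ?J"
   hence "k - j : lat e" using lattice_add[OF k lattice_minus[of j e]] by simp
   from orth[OF this] have o: "(LB et. indicator (cell e) et *! cis ((k - j) *. et)) = (if j = k then of_real ?m else 0)" by auto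
   have "(LB et. G j et) = (LB et. c j * (indicator (cell e) et *! cis ((k - j) *. et)))"
    by (intro integral_cg refl) (simp add: G_def)
   thus "(LB et. G j et) = (if j = k then c k * of_real ?m else 0)" by (simp only: int_mult_r o) simp
  qed
  also have "... = (\<integral>j. indicator {k} j *! (c k * of_real ?m) \<partial>?J)"
   by (intro integral_cg refl) simp
  also have "... = c k * of_real ?m" using k by (simp add: measure_count_space)
  finally have 1: "(LB et. indicator (cell e) et *! (Q1 et * cis (k *. et))) = c k * of_real ?m" .
  have i1: "integrable lborel (%et. indicator (cell e) et *! (Q1 et * cis (k *. et)))" using sw(2) unfolding G1 .
  have pk: "integrable lborel (%et. p1 et * cis (k *. et))"
   by (rule integrable_bd[OF p1i]) (use p1m in \<open>auto simp: norm_mult\<close>)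
  have P2: "(\<integral>ka. indicator (cell e) et *! (p1 (et + ka) * cis (k *. (et + ka))) \<partial>?J') = indicator (cell e) et *! (Q2 et * cis (k *. et))" for et
  proof -
   have "(\<integral>ka. indicator (cell e) et *! (p1 (et + ka) * cis (k *. (et + ka))) \<partial>?J') = (\<integral>ka. (indicator (cell e) et *! cis (k *. et)) * p1 (et + ka) \<partial>?J')"
   proof (rule integral_cg[OF refl])
    fix ka assume "ka \<in> space ?J'"
    hence "cis (k *. ka) = 1" using cis_lattice_inner[OF dp k] by simp
    thus "indicator (cell e) et *! (p1 (et + ka) * cis (k *. (et + ka))) = (indicator (cell e) et *! cis (k *. et)) * p1 (et + ka)"
     by (simp add: inner_add_right cis_mult[symmetric] mult_ac)
   qed
   also have "... = (indicator (cell e) et *! cis (k *. et)) * Q2 et" by (simp only: int_mult_r Q2_def)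
   finally show ?thesis by (simp add: mult_ac)
  qed
  have 2: "(LB et. indicator (cell e) et *! (Q2 et * cis (k *. et))) = c k"
   using integral_periodization(1)[OF dp' pk] unfolding P2 c_p1[symmetric] fco_def by simp
  have i2: "integrable lborel (%et. indicator (cell e) et *! (Q2 et * cis (k *. et)))"
   using integral_periodization(2)[OF dp' pk] unfolding P2 .
  have "(LB et. indicator (cell e) et *! (Q et * cis (k *. et))) =
   (LB et. indicator (cell e) et *! (Q1 et * cis (k *. et)) - of_real ?m * (indicator (cell e) et *! (Q2 et * cis (k *. et))))"
   by (intro integral_cg refl) (simp add: Q_def algebra_simps scaleR_conv_of_real)
  also have "... = c k * of_real ?m - of_real ?m * c k"
   unfolding Bochner_Integration.integral_diff[OF i1 intb_mult_r[OF i2]] int_mult_r 1 2 ..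
  finally show "(LB et. indicator (cell e) et *! (Q et * cis (k *. et))) = 0" by simp
 qed
 thus ?thesis by (simp add: Q_def Q1_def Q2_def c_def p1_def)
qed

section \<open>Interchanging functionals with sums\<close>

lemma count_space_split_finite:
 fixes u :: "'j => 'b::{banach, second_countable_topology}"
 assumes A: "finite A" "A \<subseteq> J" and u: "integrable (count_space J) u"
 shows "(\<integral>j. u j \<partial>count_space J) = (\<Sum>j\<in>A. u j) + (\<integral>j. (if j : A then 0 else u j) \<partial>count_space J)"
  and "integrable (count_space J) (%j. if j : A then 0 else u j)"
proof -
 have i1: "integrable (count_space J) (%j. if j : A then u j else 0)"
  by (rule integrable_bd[OF u]) auto
 show i2: "integrable (count_space J) (%j. if j : A then 0 else u j)"
  by (rule integrable_bd[OF u]) auto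
 have fin: "finite {j : J. (if j : A then u j else 0) ~= 0}" by (rule finite_subset[OF _ A(1)]) auto
 have "(\<integral>j. (if j : A then u j else 0) \<partial>count_space J) = (\<Sum>j\<in>A. u j)"
  unfolding lebesgue_integral_count_space_finite_support[OF fin]
  by (rule sum.mono_neutral_cong_left) (use A in auto)
 moreover have "(\<integral>j. u j \<partial>count_space J) = (\<integral>j. (if j : A then u j else 0) + (if j : A then 0 else u j) \<partial>count_space J)"
  by (intro integral_cg) auto
 ultimately show "(\<integral>j. u j \<partial>count_space J) = (\<Sum>j\<in>A. u j) + (\<integral>j. (if j : A then 0 else u j) \<partial>count_space J)"
  by (simp add: Bochner_Integration.integral_add[OF i1 i2])
qed

lemma linear_functional_sum:
 assumes F: "lfun (gsc R s sr) F" and "finite A" "!!j. j : A ==> f j : gsc R s sr"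
 shows "F (%x. \<Sum>j\<in>A. f j x) = (\<Sum>j\<in>A. F (f j))"
 using assms(2,3)
proof (induction A rule: finite_induct)
 case empty
 show ?case using lfun_scale[OF F gsc_zero, of 0] by simp
next
 case (insert a A)
 have "F (%x. f a x + (\<Sum>j\<in>A. f j x)) = F (f a) + F (%x. \<Sum>j\<in>A. f j x)"
  by (rule lfun_add[OF F _ gsc_sum]) (use insert.prems in auto)
 thus ?case using insert by simp
qed

text \<open>The remainder after finitely many terms is bounded at the scale h by the tail of the sum
  of the \<open>c j\<close>, and the remaining values of \<open>F\<close> are bounded by the same
  tail up to \<open>D\<close>. In the Beurling class a bound at one scale does not place the sum in
  the class, hence the premise \<open>tot\<close>.\<close>

lemma functional_integral_swap:
 fixes f :: "'j => 'a::euclidean_space => complex"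
 assumes J: "countable J" and F: "lfun (gsc R s sr) F" and h: "0 < h"
  and bd: "!!g c. g : gsc R s sr ==> gsb s sr h c g ==> cmod (F g) <= D * c"
  and f: "!!j. j : J ==> f j : gsc R s sr" "!!j. j : J ==> gsb s sr h (c j) (f j)"
  and c: "integrable (count_space J) c" and tot: "(%x. \<integral>j. f j x \<partial>count_space J) \<in> gsc R s sr"
 shows "F (%x. \<integral>j. f j x \<partial>count_space J) = (\<integral>j. F (f j) \<partial>count_space J)"
proof -
 let ?M = "count_space J" and ?T = "%x. \<integral>j. f j x \<partial>count_space J"
 have D0: "0 <= D"
 proof -
  have z: "gsb s sr h 1 (%_. 0)" by (rule gsb_mono[OF gsb_zero h]) auto
  show ?thesis using bd[OF gsc_zero z] order_trans[OF norm_ge_zero] by fastforce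
 qed
 have c0: "0 <= c j" if "j : J" for j using gsbD(2)[OF f(2)[OF that]] .
 have fi: "integrable ?M (%j. f j x)" for x
  by (rule integrable_bd[OF c])
   (use gsb_deriv[OF f(2), of _ "%_. 0" x] c0 in \<open>auto intro!: AE_I2\<close>)
 have Fi: "integrable ?M (%j. F (f j))"
  by (rule integrable_bd[OF intb_mult_r[OF c, of D]])
   (use bd[OF f(1) f(2)] D0 c0 in \<open>auto intro!: AE_I2\<close>)
 have est: "cmod (F ?T - (\<integral>j. F (f j) \<partial>?M)) <= 2 * D * (\<integral>j. (if j : A then 0 else c j) \<partial>?M)"
  if A: "finite A" "A \<subseteq> J" for A
 proof -
  let ?cA = "\<integral>j. (if j : A then 0 else c j) \<partial>?M"
  let ?t = "%x. \<integral>j. (if j : A then (%_. 0) else f j) x \<partial>?M"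
  let ?S = "%x. \<Sum>j\<in>A. f j x"
  have Sc: "?S : gsc R s sr" by (rule gsc_sum) (use A f in auto)
  have t: "?t = (%x. ?T x - ?S x)"
  proof
   fix x
   have "(%j. (if j : A then (%_. 0) else f j) x) = (%j. if j : A then 0 else f j x)" by auto
   thus "?t x = ?T x - ?S x" using count_space_split_finite(1)[OF A fi[of x]] by simp
  qed
  have tc: "?t : gsc R s sr" unfolding t by (rule gsc_diff[OF tot Sc])
  have "gsb s sr h ?cA ?t"
   by (rule gsb_integral[OF h _ count_space_split_finite(2)[OF A c]]) (use f gsb_zero in auto)
  from bd[OF tc this] have Ft: "cmod (F ?t) <= D * ?cA" .
  have "F (%x. ?t x + ?S x) = F ?t + F ?S"
   by (rule lfun_add[OF F tc Sc])
  moreover have "(%x. ?t x + ?S x) = ?T" using fun_cong[OF t] by auto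
  moreover have "F ?S = (\<Sum>j\<in>A. F (f j))" by (rule linear_functional_sum[OF F A(1)]) (use A f in auto)
  ultimately have "F ?T - (\<integral>j. F (f j) \<partial>?M) = F ?t - (\<integral>j. (if j : A then 0 else F (f j)) \<partial>?M)"
   unfolding count_space_split_finite(1)[OF A Fi] by simp
  moreover have "cmod (\<integral>j. (if j : A then 0 else F (f j)) \<partial>?M) <= (\<integral>j. D * (if j : A then 0 else c j) \<partial>?M)"
   by (rule norm_integral_le[OF intb_mult_r[OF count_space_split_finite(2)[OF A c]]])
    (use bd[OF f(1) f(2)] in auto)
  ultimately show ?thesis
   using Ft norm_triangle_ineq4[of "F ?t" "\<integral>j. (if j : A then 0 else F (f j)) \<partial>?M"] by simp
 qed
 define A where "A n = {j : J. to_nat_on J j < n}" for n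
 have A: "finite (A n)" "A n \<subseteq> J" for n
 proof -
  have "inj_on (to_nat_on J) (A n)" using inj_on_to_nat_on[OF J] by (rule inj_on_subset) (auto simp: A_def)
  moreover have "finite (to_nat_on J ` A n)" by (rule finite_subset[of _ "{..<n}"]) (auto simp: A_def)
  ultimately show "finite (A n)" by (metis finite_imageD)
  show "A n \<subseteq> J" by (auto simp: A_def)
 qed
 have "(%n. \<integral>j. (if j : A n then 0 else c j) \<partial>?M) \<longlonglongrightarrow> (\<integral>j. 0 \<partial>?M)"
 proof (rule integral_dominated_convergence[where w="%j. norm (c j)"])
  show "AE j in ?M. (%n. if j : A n then 0 else c j) \<longlonglongrightarrow> 0"
  proof (intro AE_I2)
   fix j assume j: "j : space ?M"
   have "\<forall>\<^sub>F n in sequentially. to_nat_on J j < n" by (rule eventually_gt_at_top)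
   hence "\<forall>\<^sub>F n in sequentially. (if j : A n then 0 else c j) = 0"
    by eventually_elim (use j in \<open>auto simp: A_def\<close>)
   thus "(%n. if j : A n then 0 else c j) \<longlonglongrightarrow> 0" by (rule tendsto_eventually)
  qed
 qed (use c in auto)
 hence "(%n. 2 * D * (\<integral>j. (if j : A n then 0 else c j) \<partial>?M)) \<longlonglongrightarrow> 2 * D * 0" by (intro tendsto_mult_left) simp
 hence "cmod (F ?T - (\<integral>j. F (f j) \<partial>?M)) <= 2 * D * 0"
  by (rule LIMSEQ_le_const) (use est[OF A] in blast)
 thus ?thesis by simp
qed

section \<open>Quasi-periodic functionals\<close>

abbreviation "gs1 R s sr \<equiv> gsc R (%_. s) (%_. sr)"
abbreviation "gs2 R s sr \<equiv> gsc R (two_groups s sr) (two_groups sr s)"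

text \<open>An element of the Roumieu class is bounded at all scales from some \<open>h0\<close> on,
  one of the Beurling class at all scales; the conditional premise expresses both.\<close>

lemma gsc_level:
 assumes "f : gsc R s sr"
 obtains h0 where "0 < h0" "!!h. 0 < h ==> (R ==> h0 <= h) ==> \<exists>C. gsb s sr h C f"
proof (cases R)
 case True
 then obtain h0 C where "0 < h0" "gsb s sr h0 C f" using assms by (auto simp: gsc_def mem_gs_roumieu)
 thus thesis using that[of h0] gsb_mono True by (metis order_refl)
next
 case False
 thus thesis using that[of 1] assms by (auto simp: gsc_def mem_gs_beurling)
qed

text \<open>Continuity expressed by bounds. In the Roumieu class a bound must hold at arbitrarily
  large scales, hence at every scale; in the Beurling class at some scale. The lower bound
  \<open>h0\<close>, active only for \<open>R\<close>, merges the two.\<close>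

definition gsf ::
  "bool => ('a::euclidean_space => real) => ('a => real) => (('a => complex) => complex) => bool" where
 "gsf R s sr F \<longleftrightarrow> lfun (gsc R s sr) F \<and>
  (\<forall>h0>0. \<exists>h>0. (R --> h0 <= h) \<and> (\<exists>D\<ge>0. \<forall>g\<in>gsc R s sr. \<forall>c. gsb s sr h c g --> cmod (F g) <= D * c))"

lemma gsf_linear: "gsf R s sr F ==> lfun (gsc R s sr) F"
 by (simp add: gsf_def)

lemma gsfE:
 assumes "gsf R s sr F" "0 < h0"
 obtains h D where "0 < h" "R ==> h0 <= h" "0 <= D"
  "!!g c. g : gsc R s sr ==> gsb s sr h c g ==> cmod (F g) <= D * c"
 using assms unfolding gsf_def by metis

lemma two_groups_pos: "0 < s ==> 0 < sr ==> 0 < two_groups s sr b"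
 by (simp add: two_groups_def)

lemma pw_Pair: "pw (x, y) = pw x * pw y"
 unfolding pw_def prod_Basis_prod by simp

lemma gs2_decay:
 assumes s: "0 <= s" "0 <= sr" and ph: "ph \<in> gs2 R s sr"
 obtains C where "0 <= C" "!!x y. cmod (ph (x, y)) <= C / (pw x * pw y)"
proof -
 obtain h C where h: "0 < h" and C: "gsb2 s sr h C ph"
  using gsc_boundedE[OF ph] by blast
 obtain D where "0 <= D" "!!z. cmod (ph z) <= D / pw z"
  by (rule gsb_pw[OF C h, of "max s sr"]) (use s in \<open>auto simp: two_groups_def\<close>)
 thus thesis using that[of D] by (metis pw_Pair)
qed

lemma gs2_decay_snd:
 assumes s: "0 <= s" "0 <= sr" and ph: "ph \<in> gs2 R s sr"
 obtains C where "0 <= C" "!!x y. cmod (ph (x, y)) <= C / pw y"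
proof -
 obtain C where C: "0 <= C" "!!x y. cmod (ph (x, y)) <= C / (pw x * pw y)"
  using gs2_decay[OF s ph] by blast
 have "cmod (ph (x, y)) <= C / pw y" for x y
 proof -
  have "C / (pw x * pw y) <= C / (1 * pw y)"
   by (intro divide_left_mono mult_right_mono pw_ge_1 mult_pos_pos) (use C(1) pw_pos in auto)
  thus ?thesis using C(2)[of x y] by simp
 qed
 thus thesis using that C(1) by blast
qed

lemma gs2_continuous: "ph \<in> gs2 R s sr ==> continuous_on UNIV (%y. ph (x, y))"
 by (rule continuous_on_compose2[OF smooth_continuous_on[OF gsc_smooth]]) (auto intro!: continuous_intros)

lemma zak_coeff_integrable:
 fixes ph :: "'a::euclidean_space \<times> 'a => complex"
 assumes s: "0 <= s" "0 <= sr" and ph: "ph \<in> gs2 R s sr"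
 shows "integrable lborel (%y. ph (x, y) * cis (j *. y))"
proof -
 obtain C where C: "!!x y. cmod (ph (x, y)) <= C / pw y" using gs2_decay_snd[OF s ph] by blast
 show ?thesis
  by (rule integrable_pw_bound[of _ C])
   (auto simp: norm_mult C intro!: borel_measurable_times bm_contI[OF gs2_continuous[OF ph]])
qed

lemma zak_adjoint_integrable:
 assumes dp: "dual_pair e e'" and s: "0 <= s" "0 <= sr" and ph: "ph \<in> gs2 R s sr"
 shows "integrable (csl e) (%j. zak_coeff ph j (x + j))"
proof -
 obtain h C where h: "0 < h" and C: "gsb2 s sr h C ph"
  using gsc_boundedE[OF ph] by blast
 show ?thesis using zak_adjoint_bounded[OF dp h s] C by metis
qed

lemma zak_adjoint_add:
 assumes dp: "dual_pair e e'" and s: "0 <= s" "0 <= sr" and ph: "ph \<in> gs2 R s sr" and pz: "pz \<in> gs2 R s sr"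
 shows "zak_adjoint e (%z. ph z + pz z) = (%x. zak_adjoint e ph x + zak_adjoint e pz x)"
proof -
 have c: "zak_coeff (%z. ph z + pz z) j x = zak_coeff ph j x + zak_coeff pz j x" for j x
  unfolding zak_coeff_def distrib_right
  by (rule Bochner_Integration.integral_add[OF zak_coeff_integrable[OF s ph] zak_coeff_integrable[OF s pz]])
 show ?thesis unfolding zak_adjoint_def c
  by (intro ext Bochner_Integration.integral_add zak_adjoint_integrable[OF dp s ph] zak_adjoint_integrable[OF dp s pz])
qed

lemma zak_adjoint_scale: "zak_adjoint e (%z. c * ph z) = (%x. c * zak_adjoint e ph x)"
 unfolding zak_adjoint_def zak_coeff_def mult.assoc int_mult_r ..

lemma zak_adjoint_tensor:
 fixes e :: "'n::finite => real ^ 'n"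
 assumes pz: "!!j. j : lat e ==> fco j pz = (if j = 0 then 1 else 0)"
 shows "zak_adjoint e (%(x, y). ph x * pz y) = ph"
proof
 fix x
 have "zak_coeff (%(x, y). ph x * pz y) j x = ph x * fco j pz" for j x
  unfolding zak_coeff_def fco_def by (simp only: prod.case mult.assoc int_mult_r)
 hence "zak_adjoint e (%(x, y). ph x * pz y) x = (\<integral>j. (if j = 0 then ph x else 0) \<partial>csl e)"
  unfolding zak_adjoint_def by (intro integral_cg) (auto simp: pz)
 also have "... = (\<Sum>j | j : lat e \<and> (if j = 0 then ph x else 0) ~= 0. (if j = 0 then ph x else 0))"
  by (rule lebesgue_integral_count_space_finite_support) (auto intro: finite_subset[of _ "{0}"])
 also have "... = (\<Sum>j\<in>{0 :: real ^ 'n}. ph x)" by (rule sum.mono_neutral_cong_left) (auto simp: lattice_zero)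
 finally show "zak_adjoint e (%(x, y). ph x * pz y) x = ph x" by simp
qed

lemma lattice_shift_bij: "k : lat e ==> bij_betw (%j. j + k) (lat e) (lat e)"
 using lattice_add[of _ e "- k"] by (intro bij_betwI[of _ _ _ "%j. j - k"]) (auto intro: lattice_add lattice_minus)

lemma lattice_minus_bij: "bij_betw uminus (lat e) (lat e)"
 by (intro bij_betwI[of _ _ _ uminus]) (auto intro: lattice_minus)

text \<open>Multiplying by the character raises the frequency j to j + k, and the shift of the
  summation index by k turns this into a translation of x.\<close>

lemma zak_adjoint_shift_fst:
 assumes k: "k : lat e"
 shows "zak_adjoint e (%(x, xi). ph (x - k, xi)) = zak_adjoint e (%(x, xi). cis (k *. xi) * ph (x, xi))"
proof
 fix x
 have c: "zak_coeff (%(x, xi). cis (k *. xi) * ph (x, xi)) j x = zak_coeff ph (j + k) x" for j x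
  unfolding zak_coeff_def by (intro integral_cg) (simp_all add: inner_add_left cis_mult[symmetric])
 have "zak_adjoint e (%(x, xi). cis (k *. xi) * ph (x, xi)) x = (\<integral>j. zak_coeff ph (j + k) (x + (j + k) - k) \<partial>csl e)"
  unfolding zak_adjoint_def c by simp
 also have "... = (\<integral>j. zak_coeff ph j (x + j - k) \<partial>csl e)"
  by (rule integral_bij_count_space[OF lattice_shift_bij[OF k], of "%j. zak_coeff ph j (x + j - k)"])
 finally show "zak_adjoint e (%(x, xi). ph (x - k, xi)) x = zak_adjoint e (%(x, xi). cis (k *. xi) * ph (x, xi)) x"
  unfolding zak_adjoint_def zak_coeff_def by simp
qed

lemma zak_adjoint_shift_snd:
 assumes dp: "dual_pair e e'" and ka: "ka \<in> lat e'" and ph: "ph \<in> gs2 R s sr"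
 shows "zak_adjoint e (%(x, xi). ph (x, xi - ka)) = zak_adjoint e ph"
proof -
 have "zak_coeff (%(x, xi). ph (x, xi - ka)) j x = zak_coeff ph j x" if j: "j : lat e" for j x
 proof -
  have c: "cis (j *. (y + ka)) = cis (j *. y)" for y
   using cis_lattice_inner[OF dp j ka] by (simp add: inner_add_right cis_mult[symmetric])
  have "(LB y. ph (x, y + (- ka)) * cis (j *. y)) = (LB y. ph (x, y + (- ka)) * cis (j *. (y + (- ka) + ka)))" by simp
  also have "... = (LB y. ph (x, y) * cis (j *. (y + ka)))"
   by (rule lborel_integral_translate[of "%y. ph (x, y) * cis (j *. (y + ka))" "- ka"])
    (unfold c, intro borel_measurable_times cis_measurable bm_contI[OF gs2_continuous[OF ph]])
  finally show ?thesis unfolding zak_coeff_def c by simp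
 qed
 thus ?thesis unfolding zak_adjoint_def by (intro ext integral_cg) auto
qed

text \<open>The second family is the first one moved back by \<kappa> in \<xi>, which costs one more
  doubling of the scale; hence 8 = 2 * 4. \<open>K\<close> does not depend on h, as is required for
  membership in the classes.\<close>

lemma zak_periodize_bounded:
 fixes s sr h K :: real and ph :: "'a::euclidean_space \<times> 'a => complex" and pz :: "'a => complex"
 assumes h: "0 < h" and s: "0 <= s" and sr: "0 <= sr" and K: "K = 8 * (2 powr (s + sr)) * (2 powr (s + sr))"
  and ph: "gsb2 s sr h C ph" and pz: "gsb1 sr s h D pz"
 obtains P where
  "!!ka. gsb2 s sr (K * h) (P / pw ka) (%(x, xi). ph (x, xi) * pz (xi + ka))"
  "!!ka. gsb2 s sr (K * h) (P / pw ka) (%(x, xi). ph (x, xi - ka) * pz xi)"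
proof -
 define L where "L = 4 * (2 powr (s + sr)) * (2 powr (s + sr)) * h"
 have L: "0 < L" "K * h = 2 * L" using h by (auto simp: L_def K)
 obtain P where P: "0 < P" and B: "!!(ph :: 'a \<times> 'a => complex) C pz D ka ga al be z.
  gsb2 s sr h C ph ==> gsb1 sr s h D (pz :: 'a => complex) ==>
  amon ga ka * (amon al z * cmod (md be (%(x, xi). ph (x, xi) * pz (xi + ka)) z)) \<le>
   C * D * P / pw ka * (gsw1 sr L ga * (gsw2 s sr L al * gsw2 sr s L be))"
  using gsb_mult_snd_translate[OF h s sr, where 'a='a] unfolding L_def by blast
 have main: "gsb2 s sr (K * h) (C * D * P / pw ka) (%(x, xi). ph (x, xi) * pz (xi + ka)) \<and>
  gsb2 s sr (K * h) (C * D * P / pw ka) (%(x, xi). ph (x, xi - ka) * pz xi)" for ka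
 proof -
  define f where "f = (%(x, xi). ph (x, xi) * pz (xi + ka))"
  define A where "A = C * D * P / pw ka"
  have A: "0 <= A" using gsbD(2)[OF ph] gsbD(2)[OF pz] P by (simp add: A_def)
  note B = B[OF ph pz, of _ ka, folded f_def A_def]
  have pzt: "smooth (%xi. pz (xi + ka))" using smooth_translate[OF gsbD(1)[OF pz], of "- ka"] by simp
  have one: "smooth (%_ :: 'a. 1 :: complex)" using smooth_cis[of "0 :: 'a"] by simp
  have sm: "smooth f" using smooth_mult[OF gsbD(1)[OF ph] smooth_tensor[OF one pzt]]
   unfolding f_def by (simp add: split_def)
  have g: "gsb2 s sr L A f"
   by (rule gsbI[OF sm A]) (use B[of "%_. 0"] in simp)
  have "gsb2 s sr (2 * L) A (%z. f (z - (0, ka)))"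
  proof (rule gsb_translate_weighted[OF L(1) _ sm A])
   fix ga al be :: "'a \<times> 'a => nat" and z :: "'a \<times> 'a"
   let ?w = "gsw1 sr L (%v. ga (0, v)) * (gsw2 s sr L al * gsw2 sr s L be)"
   have le: "\<bar>mon (%u. ga (u, 0)) (0 :: 'a)\<bar> <= gsw1 s L (%u. ga (u, 0))"
   proof (cases "\<forall>u\<in>Basis. ga (u, 0 :: 'a) = 0")
    case True
    thus ?thesis by (simp add: monomial_at_def gsw_def)
   next
    case False
    hence "mon (%u. ga (u, 0)) (0 :: 'a) = 0" by (auto simp: monomial_at_def)
    thus ?thesis using gsw_nonneg[OF L(1)] by simp
   qed
   have "amon ga (0, ka) * (amon al z * cmod (md be f z)) =
    \<bar>mon (%u. ga (u, 0)) (0 :: 'a)\<bar> * (\<bar>mon (%v. ga (0, v)) ka\<bar> * (amon al z * cmod (md be f z)))"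
    by (simp add: monomial_at_prod abs_mult)
   also have "... <= gsw1 s L (%u. ga (u, 0)) * (A * ?w)"
    by (intro mult_mono le B) (use gsw_nonneg[OF L(1)] in auto)
   also have "... = A * (gsw2 s sr L ga * (gsw2 s sr L al * gsw2 sr s L be))"
    by (simp add: gsw_two_groups mult_ac)
   finally show "amon ga (0, ka) * (amon al z * cmod (md be f z)) <= ..." .
  qed (use s sr in \<open>auto simp: two_groups_def\<close>)
  moreover have "(%z. f (z - (0, ka))) = (%(x, xi). ph (x, xi - ka) * pz xi)" by (auto simp: f_def)
  moreover have "gsb2 s sr (2 * L) A f"
   by (rule gsb_mono[OF g L(1)]) (use L(1) in auto)
  ultimately show ?thesis unfolding L(2) A_def f_def by simp
 qed
 show thesis by (rule that[of "C * D * P"]) (use main in auto)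
qed

text \<open>Each exchange of \<open>F\<close> with a lattice sum needs summands bounded at one
  common scale \<open>H\<close> with summable constants, which the preceding estimates supply. The
  volume of the cell produced by Poisson summation cancels against the value of the constant
  periodization.\<close>

lemma zak_adjoint_of_quasi_periodic:
 fixes e e' :: "'n::finite => real ^ 'n" and ph :: "(real ^ 'n) \<times> (real ^ 'n) => complex"
 assumes dp: "dual_pair e e'" and e': "e' = dual_basis e" and s: "0 < s" and sr: "0 < sr"
  and F: "gsf R (two_groups s sr) (two_groups sr s) F" and qp: "quasi_periodic e (gs2 R s sr) F"
  and ph: "ph \<in> gs2 R s sr" and pz: "pz \<in> gs1 R sr s"
  and per: "!!xi. (\<integral>ka. pz (xi + ka) \<partial>csl e') = of_real (1 / measure lborel (cell e))"
  and orth: "!!j. j : lat e ==> (LB et. indicator (cell e) et *! cis (j *. et)) = (if j = 0 then of_real (measure lborel (cell e)) else 0)"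
 shows "F (%(x, xi). zak_adjoint e ph x * pz xi) = F ph"
proof -
 let ?s = "two_groups s sr" and ?sr = "two_groups sr s"
 note dp' = dual_pair_sym[OF dp] and s0 = less_imp_le[OF s] and sr0 = less_imp_le[OF sr]
 define K where "K = 8 * (2 powr (s + sr)) * (2 powr (s + sr))"
 have K: "0 < K" by (simp add: K_def)
 have p1: "2 powr s <= 2 powr (s + sr)" "1 <= 2 powr (s + sr)" using s sr by (auto simp: ge_one_powr_ge_zero)
 have "2 powr (s + sr) * 1 <= 2 powr (s + sr) * 2 powr (s + sr)" using p1 by (intro mult_left_mono) auto
 hence KK: "2 * 2 powr s <= K" unfolding K_def mult.assoc mult_1_right using p1 by linarith
 obtain hph where hph: "0 < hph" "!!h. 0 < h ==> (R ==> hph <= h) ==> \<exists>C. gsb ?s ?sr h C ph" using gsc_level[OF ph] by blast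
 obtain hpz where hpz: "0 < hpz" "!!h. 0 < h ==> (R ==> hpz <= h) ==> \<exists>C. gsb1 sr s h C pz" using gsc_level[OF pz] by blast
 \<comment> \<open>\<open>F\<close> is asked for a bound at a scale \<open>H\<close> so large that h
   = H / K is at least the scales from which \<phi> and the window are bounded; in the Beurling
   class every h will do.\<close>
 have "0 < K * max hph hpz" using K hph(1) by simp
 then obtain H D where H: "0 < H" "R ==> K * max hph hpz <= H"
  and D: "!!g c. g : gs2 R s sr ==> gsb ?s ?sr H c g ==> cmod (F g) <= D * c" using gsfE[OF F] by metis
 define h where "h = H / K"
 have h: "0 < h" "K * h = H" using H K by (auto simp: h_def)
 have hR: "R ==> max hph hpz <= h" using H(2) unfolding h_def pos_le_divide_eq[OF K] by (simp only: mult.commute)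
 obtain C where C: "gsb ?s ?sr h C ph" using hph(2)[OF h(1)] hR by auto
 obtain C' where C': "gsb1 sr s h C' pz" using hpz(2)[OF h(1)] hR by auto
 have hs: "0 < 2 * (2 powr s * h)" "2 * (2 powr s * h) <= H" "h <= 2 powr s * h" "2 powr s * h <= 2 * (2 powr s * h)"
  using h KK mult_right_mono[OF KK, of h] one_le_two_powr[OF h(1) s0] by (auto simp: mult.assoc)
 have lin: "lfun (gs2 R s sr) F" by (rule gsf_linear[OF F])
 have swap: "F (%z. \<integral>j. f j z \<partial>count_space J) = (\<integral>j. F (f j) \<partial>count_space J)"
  if "countable J" "!!j. f j : gs2 R s sr" "!!j. gsb ?s ?sr H (c / pw j) (f j)" "integrable (count_space J) (%j. c / pw j)"
   "(%z. \<integral>j. f j z \<partial>count_space J) \<in> gs2 R s sr" for J and f :: "real ^ 'n => (real ^ 'n) \<times> (real ^ 'n) => complex" and c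
  by (rule functional_integral_swap[OF that(1) lin H(1) D that(2,3,4,5)])
 let ?J = "lat e" and ?J' = "lat e'"
 \<comment> \<open>Four families of summands: as they arise from the lattice sum, after
   quasi-periodicity in x, after Poisson summation, and after quasi-periodicity in \<xi>. The last
   one sums over \<kappa> to a multiple of \<phi>.\<close>
 let ?f1 = "%j (x, xi). zak_coeff ph j (x + j) * pz xi"
 let ?f2 = "%j (x, xi). cis (- (j *. xi)) * (zak_coeff ph j x * pz xi)"
 let ?f3 = "%ka (x, xi). ph (x, xi - ka) * pz xi"
 let ?f4 = "%ka (x, xi). ph (x, xi) * pz (xi + ka)"
 let ?vol = "measure lborel (cell e)"
 have vol: "0 < ?vol" by (rule emeasure_cell(2)[OF dp'])
 have intJ: "integrable (count_space ?J) (%j. c / pw j)" and intJ': "integrable (count_space ?J') (%j. c / pw j)" for c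
  using intb_mult_r[OF integrable_lattice_pw[OF dp], of c] intb_mult_r[OF integrable_lattice_pw[OF dp'], of c] by simp_all
 have zt_mem: "(%x. zak_coeff ph j (x + j)) : gs1 R s sr" for j
 proof (rule gsc_map[OF _ _ ph])
  show "0 < 2 * 2 powr s" by simp
  show "\<exists>C'. gsb1 s sr (2 * 2 powr s * h) C' (%x. zak_coeff ph j (x + j))" if "0 < h" "gsb ?s ?sr h C ph" for h C
   using zak_coeff_translate_bounded[OF that(1) s0 sr0] that(2) by (metis mult.assoc)
 qed
 have f1_mem: "?f1 j : gs2 R s sr" for j by (rule gsc_tensor[OF zt_mem pz])
 have z_mem: "zak_coeff ph j : gs1 R s sr" for j using gsc_translate[OF s zt_mem[of j], of j] by simp
 obtain P1 where P1: "0 < P1" "!!j. gsb1 s sr (2 * (2 powr s * h)) (C * P1 / pw j) (%x. zak_coeff ph j (x + j))"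
  using zak_coeff_translate_bounded[OF h(1) s0 sr0] C by metis
 have pz2: "gsb1 sr s (2 * (2 powr s * h)) C' pz" "gsb1 sr s (2 powr s * h) C' pz"
  using gsb_mono[OF C' h(1)] hs by auto
 have f1_bd: "gsb ?s ?sr H (C * P1 * C' / pw j) (?f1 j)" for j
  using gsb_mono[OF gsb_tensor[OF P1(2)[of j] pz2(1) hs(1)] hs(1,2) order_refl] by simp
 have t1: "(%z. \<integral>j. ?f1 j z \<partial>count_space ?J) = (%(x, xi). zak_adjoint e ph x * pz xi)"
  unfolding zak_adjoint_def by (simp only: split_def int_mult_l)
 have t1_mem: "(%(x, xi). zak_adjoint e ph x * pz xi) \<in> gs2 R s sr"
  by (rule gsc_tensor[OF gsc_zak_adjoint[OF dp s0 sr0 ph] pz])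
 have e1: "F (%(x, xi). zak_adjoint e ph x * pz xi) = (\<integral>j. F (?f1 j) \<partial>count_space ?J)"
  unfolding t1[symmetric] by (rule swap) (rule countable_lattice f1_mem f1_bd intJ t1_mem[folded t1])+
 have zt_mem: "(%(x, xi). zak_coeff ph j x * pz xi) \<in> gs2 R s sr" for j by (rule gsc_tensor[OF z_mem pz])
 have f2_mem: "?f2 j : gs2 R s sr" for j
  using gsc_cis[OF two_groups_pos[OF sr s] zt_mem[of j], of "(0, - j)"] by (simp add: split_def inner_prod_def)
 have e2: "F (?f1 j) = F (?f2 j)" if "j : ?J" for j
 proof -
  have "F (%(x, xi). (%(x, xi). zak_coeff ph j x * pz xi) (x - (- j), xi)) = F (%(x, xi). cis (- j *. xi) * (%(x, xi). zak_coeff ph j x * pz xi) (x, xi))"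
   using qp zt_mem[of j] lattice_minus[OF that] unfolding quasi_periodic_def by blast
  thus ?thesis by (simp add: split_def)
 qed
 obtain P2 where P2: "0 < P2" "!!j. smooth (zak_coeff ph j)" "!!j ga al be x. amon ga j * (amon al x * cmod (md be (zak_coeff ph j) x)) \<le>
   C * P2 / pw j * (gsw1 s (2 powr s * h) ga * (gsw1 s (2 powr s * h) al * gsw1 sr (2 powr s * h) be))"
  using zak_coeff_decay[OF h(1) s0 sr0, where 'a="real ^ 'n"] C by metis
 have CP: "0 <= C * P2 / pw j" for j using gsbD(2)[OF C] P2(1) by simp
 have f2_bd: "gsb ?s ?sr H (C * P2 * C' / pw j) (?f2 j)" for j
 proof -
  have "gsb ?s ?sr (2 * (2 powr s * h)) (C * P2 / pw j * C') (?f2 j)"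
   using h(1) by (intro gsb_cis_tensor s0 sr0 P2(2,3) CP pz2(2)) simp
  from gsb_mono[OF this hs(1,2) order_refl] show ?thesis by simp
 qed
 obtain P3 where P3: "!!ka. gsb ?s ?sr H (P3 / pw ka) (?f4 ka)" "!!ka. gsb ?s ?sr H (P3 / pw ka) (?f3 ka)"
  using zak_periodize_bounded[OF h(1) s0 sr0 K_def C C'] unfolding h(2) by blast
 have mem: "?f4 ka \<in> gs2 R s sr" "?f3 ka \<in> gs2 R s sr" "(%z. \<integral>ka. ?f3 ka z \<partial>count_space ?J') : gs2 R s sr" for ka
 proof -
  have *: "\<exists>C''. gsb ?s ?sr (K * h) C'' (?f4 ka)" "\<exists>C''. gsb ?s ?sr (K * h) C'' (?f3 ka)"
   "\<exists>C''. gsb ?s ?sr (K * h) C'' (%z. \<integral>ka. ?f3 ka z \<partial>count_space ?J')"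
   if h: "0 < h" and b: "gsb ?s ?sr h C ph" "gsb1 sr s h D pz" for h C D
  proof -
   obtain P where P: "!!ka. gsb ?s ?sr (K * h) (P / pw ka) (?f4 ka)" "!!ka. gsb ?s ?sr (K * h) (P / pw ka) (?f3 ka)"
    using zak_periodize_bounded[OF h s0 sr0 K_def b] by blast
   show "\<exists>C''. gsb ?s ?sr (K * h) C'' (?f4 ka)" "\<exists>C''. gsb ?s ?sr (K * h) C'' (?f3 ka)" using P by blast+
   have "0 < K * h" using K h by simp
   from gsb_integral[OF this P(2) intJ'] show "\<exists>C''. gsb ?s ?sr (K * h) C'' (%z. \<integral>ka. ?f3 ka z \<partial>count_space ?J')" by auto
  qed
  show "?f4 ka \<in> gs2 R s sr" by (rule gsc_map2[OF K *(1) ph pz])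
  show "?f3 ka \<in> gs2 R s sr" by (rule gsc_map2[OF K *(2) ph pz])
  show "(%z. \<integral>ka. ?f3 ka z \<partial>count_space ?J') : gs2 R s sr" by (rule gsc_map2[OF K *(3) ph pz])
 qed
 obtain Cd where "0 <= Cd" and Cd: "!!x y. cmod (ph (x, y)) <= Cd / pw y"
  using gs2_decay_snd[OF s0 sr0 ph] by metis
 have t2': "(\<integral>j. ?f2 j (x, xi) \<partial>count_space ?J) = of_real ?vol * (\<integral>ka. ?f3 ka (x, xi) \<partial>count_space ?J')" for x xi
 proof -
  have fc: "fco j (%y. ph (x, y)) = zak_coeff ph j x" for j by (simp add: fco_def zak_coeff_def)
  have "cmod (zak_coeff ph j x) <= C * P2 / pw j" for j
   using P2(3)[of "%_. 0" j "%_. 0" x "%_. 0"] by (simp add: multi_deriv_def iterated_deriv_def)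
  hence "(\<integral>j. zak_coeff ph j x * cis (- (j *. xi)) \<partial>count_space ?J) = of_real ?vol * (\<integral>ka. ph (x, xi + ka) \<partial>count_space ?J')"
   using poisson_summation[OF dp gs2_continuous[OF ph, of x] Cd, of "C * P2" xi] orth unfolding fc by blast
  \<comment> \<open>The dual lattice is symmetric. The sign is turned so that moving the summand by
    \<kappa> frees \<phi> from the translation and shifts the window instead.\<close>
  also have "(\<integral>ka. ph (x, xi + ka) \<partial>count_space ?J') = (\<integral>ka. ph (x, xi - ka) \<partial>count_space ?J')"
   using integral_bij_count_space[OF lattice_minus_bij[of e'], of "%ka. ph (x, xi + ka)"] by simp
  finally have "(\<integral>j. zak_coeff ph j x * cis (- (j *. xi)) \<partial>count_space ?J) * pz xi = of_real ?vol * ((\<integral>ka. ph (x, xi - ka) \<partial>count_space ?J') * pz xi)" by simp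
  moreover have "(\<integral>j. ?f2 j (x, xi) \<partial>count_space ?J) = (\<integral>j. zak_coeff ph j x * cis (- (j *. xi)) \<partial>count_space ?J) * pz xi"
   unfolding int_mult_l[symmetric] by (intro integral_cg) simp_all
  ultimately show ?thesis by (simp only: prod.case int_mult_l)
 qed
 have t2: "(%z. \<integral>j. ?f2 j z \<partial>count_space ?J) = (%z. of_real ?vol * (\<integral>ka. ?f3 ka z \<partial>count_space ?J'))"
  by (intro ext, rule prod.induct, rule t2')
 have e3: "(\<integral>j. F (?f2 j) \<partial>count_space ?J) = of_real ?vol * F (%z. \<integral>ka. ?f3 ka z \<partial>count_space ?J')"
  unfolding lfun_scale[OF lin mem(3), symmetric] t2[symmetric]
  by (rule swap[symmetric]) (rule countable_lattice f2_mem f2_bd intJ gsc_scale[OF mem(3), of "of_real ?vol", folded t2])+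
 have e4: "F (%z. \<integral>ka. ?f3 ka z \<partial>count_space ?J') = (\<integral>ka. F (?f3 ka) \<partial>count_space ?J')"
  by (rule swap) (rule countable_lattice mem(2,3) P3(2) intJ')+
 have e5: "F (?f3 ka) = F (?f4 ka)" if "ka \<in> ?J'" for ka
 proof -
  have "F (%(x, xi). ?f4 ka (x, xi - ka)) = F (?f4 ka)"
   using qp mem(1)[of ka] that e' unfolding quasi_periodic_def by blast
  thus ?thesis by (simp add: split_def)
 qed
 have t4: "(%z. \<integral>ka. ?f4 ka z \<partial>count_space ?J') = (%z. of_real (1 / ?vol) * ph z)"
  by (intro ext, rule prod.induct) (simp only: prod.case int_mult_r per mult.commute)
 have e6: "(\<integral>ka. F (?f4 ka) \<partial>count_space ?J') = of_real (1 / ?vol) * F ph"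
  unfolding lfun_scale[OF lin ph, symmetric] t4[symmetric]
  by (rule swap[symmetric]) (rule countable_lattice mem(1) P3(1) intJ' gsc_scale[OF ph, of "of_real (1 / ?vol)", folded t4])+
 have "F (%(x, xi). zak_adjoint e ph x * pz xi) = (\<integral>j. F (?f2 j) \<partial>count_space ?J)"
  unfolding e1 by (rule integral_cg) (auto simp: e2)
 also have "... = of_real ?vol * (\<integral>ka. F (?f4 ka) \<partial>count_space ?J')"
  unfolding e3 e4 by (intro arg_cong[of _ _ "(*) _"] integral_cg) (auto simp: e5)
 finally show ?thesis unfolding e6 using vol by simp
qed

section \<open>The Zak transform of Schwartz functions\<close>

text \<open>In the pairing with the Zak transform one of the two powers of \<open>pw\<close> is
  spent against the growth in Peetre's inequality, the other gives integrability.\<close>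

lemma gsb_pw_sq:
 fixes f :: "'a::euclidean_space => complex"
 assumes f: "gsb s sr h C f" and h: "0 < h" and s: "!!b. 0 <= s b" "!!b. s b <= q"
 obtains D where "0 <= D" "!!x. cmod (f x) <= D / (pw x)\<^sup>2"
proof -
 obtain P where P: "0 < P" "!!(k::'a) A C ga. 0 <= A ==> (!!ga. amon ga k * A <= C * gsw s h ga) ==>
  pw k * (amon ga k * A) <= C * P * gsw s (2 powr q * h) ga"
  using pw_absorb[where h=h and s=s and q=q, OF h s] by blast
 have h': "0 < 2 powr q * h" using h by simp
 obtain P' where P': "0 < P'" "!!(k::'a) A C ga. 0 <= A ==> (!!ga. amon ga k * A <= C * gsw s (2 powr q * h) ga) ==>
  pw k * (amon ga k * A) <= C * P' * gsw s (2 powr q * (2 powr q * h)) ga"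
  using pw_absorb[where h="2 powr q * h" and s=s and q=q, OF h' s] by blast
 have "cmod (f x) <= C * P * P' / (pw x)\<^sup>2" for x
 proof -
  have "amon ga x * cmod (f x) <= C * gsw s h ga" for ga
   using gsbD(3)[OF f, of ga x "%_. 0"] by (simp add: multi_deriv_def iterated_deriv_def)
  hence "amon ga x * (pw x * cmod (f x)) <= C * P * gsw s (2 powr q * h) ga" for ga
   using P(2)[of "cmod (f x)" x C ga] by (simp add: mult_ac)
  hence "pw x * (amon (%_. 0) x * (pw x * cmod (f x))) <= C * P * P' * gsw s (2 powr q * (2 powr q * h)) (%_. 0)"
   by (intro P'(2)) auto
  thus ?thesis using pw_pos[of x] by (simp add: power2_eq_square pos_le_divide_eq mult_ac)
 qed
 thus thesis using that[of "C * P * P'"] gsbD(2)[OF f] P(1) P'(1) by simp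
qed

lemma gs2_decay_sq:
 assumes s: "0 <= s" "0 <= sr" and ph: "ph \<in> gs2 R s sr"
 obtains C where "0 <= C" "!!x y. cmod (ph (x, y)) <= C / ((pw x)\<^sup>2 * (pw y)\<^sup>2)"
proof -
 obtain h C where h: "0 < h" and C: "gsb2 s sr h C ph"
  using gsc_boundedE[OF ph] by blast
 obtain D where "0 <= D" "!!z. cmod (ph z) <= D / (pw z)\<^sup>2"
  by (rule gsb_pw_sq[OF C h, of "max s sr"]) (use s in \<open>auto simp: two_groups_def\<close>)
 thus thesis using that[of D] by (metis pw_Pair power_mult_distrib)
qed

text \<open>\<open>pw\<close> expands into the sum, over the subsets of the basis, of squared
  monomials, each of which is controlled by one Schwartz seminorm.\<close>

lemma schwartz_decay:
 fixes f :: "'a::euclidean_space => complex"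
 assumes "f : schwartz_space"
 obtains C where "0 <= C" "!!x. cmod (f x) <= C / pw x"
proof -
 have "\<exists>B. \<forall>x. amon al x * cmod (f x) <= B" for al
 proof -
  have "bounded (range (%x. mon al x *! md (%_. 0) f x))"
   using assms unfolding schwartz_space_def by blast
  thus ?thesis by (auto simp: bounded_iff multi_deriv_def iterated_deriv_def)
 qed
 then obtain B where B: "!!al x. amon al x * cmod (f x) <= B al" by metis
 define m where "m X = (%b::'a. if b : X then 0 else 2 :: nat)" for X
 have B0: "0 <= B al" for al
  using B[of al 0] by (meson abs_ge_zero mult_nonneg_nonneg norm_ge_zero order_trans)
 have "cmod (f x) <= (\<Sum>X\<in>Pow Basis. B (m X)) / pw x" for x
 proof -
  have "pw x = (\<Sum>X\<in>Pow Basis. (\<Prod>b\<in>X. 1) * (\<Prod>b\<in>Basis - X. (x *. b)\<^sup>2))"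
   unfolding pw_def by (rule prod_add) simp
  also have "... = (\<Sum>X\<in>Pow Basis. amon (m X) x)"
  proof (rule sum.cong[OF refl])
   fix X :: "'a set" assume X: "X : Pow Basis"
   have "(\<Prod>b\<in>Basis - X. (x *. b)\<^sup>2) = (\<Prod>b\<in>Basis. \<bar>x *. b\<bar> ^ m X b)"
    using X by (intro prod.mono_neutral_cong_left) (auto simp: m_def)
   thus "(\<Prod>b\<in>X. 1) * (\<Prod>b\<in>Basis - X. (x *. b)\<^sup>2) = amon (m X) x" by (simp add: abs_monomial_at)
  qed
  finally have "pw x * cmod (f x) = (\<Sum>X\<in>Pow Basis. amon (m X) x * cmod (f x))" by (simp add: sum_distrib_right)
  also have "... <= (\<Sum>X\<in>Pow Basis. B (m X))" by (intro sum_mono B)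
  finally show ?thesis using pw_pos[of x] by (simp add: pos_le_divide_eq mult.commute)
 qed
 thus thesis using that sum_nonneg[of "Pow Basis" "%X. B (m X)"] B0 by blast
qed

lemma gsc_schwartz: "gsc R s sr \<subseteq> schwartz_space"
proof
 fix f assume "f : gsc R s sr"
 then obtain h C where "gsb s sr h C f" by (rule gsc_boundedE)
 note b = gsbD[OF this]
 have "bounded (range (%x. mon al x *! md be f x))" for al be
  unfolding bounded_iff using b(3)[of al _ be] by auto
 thus "f : schwartz_space" using b(1) by (simp add: schwartz_space_def)
qed

lemma integrable_count_space_le:
 fixes a c :: "'j => real"
 assumes c: "integrable (count_space J) c" and "!!j. 0 <= a j" "!!j. a j <= c j"
 shows "integrable (count_space J) a"
 by (rule integrable_bd[OF c]) (use assms(2,3) in \<open>auto intro: order_trans[OF _ abs_ge_self]\<close>)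

lemma lborel_integral_Pair:
 fixes f :: "'a::euclidean_space \<times> 'b::euclidean_space => complex"
 assumes "integrable lborel f"
 shows "(LB z. f z) = (LB x. (LB y. f (x, y)))"
 using lborel_pair.integral_fst'[of f] assms by (simp add: lborel_prod)

text \<open>Sum and integral are exchanged twice, once over phase space and once over x after the
  substitution x \<mapsto> x + j. By Peetre's inequality f(x - j) is at most a constant times pw x /
  pw j: the denominator makes the sum over j converge, and the growth in x is absorbed by the decay
  of \<phi>.\<close>

lemma zak_transform_adjoint:
 fixes e :: "'n::finite => real ^ 'n"
 assumes dp: "dual_pair e e'" and s: "0 <= s" "0 <= sr" and f: "f : schwartz_space" and ph: "ph \<in> gs2 R s sr"
 shows "(LB x. f x * zak_adjoint e ph x) = (LB z. zak_transform e f z * ph z)"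
proof -
 let ?J = "lat e" and ?c = "2 ^ DIM(real ^ 'n) :: real"
 obtain A where A: "0 <= A" "!!x. cmod (f x) <= A / pw x" by (rule schwartz_decay[OF f]) auto
 obtain C where C: "0 <= C" "!!x y. cmod (ph (x, y)) <= C / ((pw x)\<^sup>2 * (pw y)\<^sup>2)"
  using gs2_decay_sq[OF s ph] by metis
 have fm [measurable]: "f : bm" using f by (simp add: schwartz_space_def smooth_borel_measurable)
 have phm [measurable]: "ph \<in> bm" by (rule smooth_borel_measurable[OF gsc_smooth[OF ph]])
 have phm' [measurable]: "(%y. ph (x, y)) : bm" for x
  by (rule bm_contI[OF gs2_continuous[OF ph]])
 obtain h D where h: "0 < h" "gsb2 s sr h D ph" using gsc_boundedE[OF ph] by blast
 have zm: "zak_coeff ph j : bm" for j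
  using zak_coeff_decay[OF h(1) s, where 'a="real ^ 'n"] h(2) by (metis smooth_borel_measurable)
 note pos = pw_pos
 have J: "integrable (count_space ?J) (%j. c / pw j)" for c
  using intb_mult_r[OF integrable_lattice_pw[OF dp], of c] by simp
 have sq: "1 / (pw y)\<^sup>2 <= 1 / pw y" for y :: "real ^ 'n"
  using pw_ge_1[of y] pos[of y] by (simp add: divide_simps power2_eq_square)
 define g where "g j = (%z. f (fst z - j) * (cis (j *. snd z) * ph z))" for j :: "real ^ 'n"
 have fc: "continuous_on UNIV f" using f by (simp add: schwartz_space_def smooth_continuous_on)
 have gm: "g j : bm" for j
  unfolding g_def cis_conv_exp
  by (intro bm_contI continuous_on_mult continuous_on_compose2[OF fc] smooth_continuous_on[OF gsc_smooth[OF ph]])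
   (auto intro!: continuous_intros)
 have gb: "cmod (g j z) <= ?c * A * C / pw j / pw z" for j z
 proof -
  obtain x y where z: "z = (x, y)" by (cases z)
  have "cmod (f (x - j)) <= A / pw (x - j)" by (rule A)
  also have "... <= A * (?c * pw x / pw j)"
   using mult_left_mono[OF inverse_pw_le[of "x - j" "- x"] A(1)] by (simp add: pw_minus[of j, symmetric] del: pw_minus) (simp add: pw_minus)
  finally have 1: "cmod (f (x - j)) <= A * (?c * pw x / pw j)" .
  have "cmod (ph (x, y)) <= C * (1 / (pw x)\<^sup>2 * (1 / pw y))"
   using C(2)[of x y] mult_left_mono[OF mult_left_mono[OF sq[of y], of "1 / (pw x)\<^sup>2"] C(1)] by simp
  hence "cmod (f (x - j)) * cmod (ph (x, y)) <= A * (?c * pw x / pw j) * (C * (1 / (pw x)\<^sup>2 * (1 / pw y)))"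
   using 1 A(1) by (intro mult_mono) auto
  thus ?thesis using pos[of x] by (simp add: g_def z norm_mult pw_Pair power2_eq_square mult_ac)
 qed
 have gi: "integrable lborel (g j)" for j by (rule integrable_pw_bound[OF gm gb])
 have "(LB z. norm (g j z)) <= ?c * A * C * (LB z. 1 / pw (z :: (real ^ 'n) \<times> (real ^ 'n))) / pw j" for j
 proof -
  have "(LB z. norm (g j z)) <= (LB z. ?c * A * C / pw j * (1 / pw (z :: (real ^ 'n) \<times> (real ^ 'n))))"
   by (rule integral_mono[OF integrable_norm[OF gi] intb_mult_r[OF integrable_pw]]) (use gb[of j] in simp)
  thus ?thesis by (simp only: int_mult_r) (simp add: mult_ac)
 qed
 hence gs: "integrable (count_space ?J) (%j. \<integral>z. norm (g j z) \<partial>lborel)"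
  by (rule integrable_count_space_le[OF J, rotated]) (rule integral_nn, simp)
 note sw = integral_count_space_swap[OF countable_lattice sigma_finite_lborel gi gs]
 have zt: "zak_transform e f z * ph z = (\<integral>j. g j z \<partial>count_space ?J)" for z
 proof -
  obtain x xi where z: "z = (x, xi)" by (cases z)
  have b: "cmod (f (x - j)) <= A * ?c * pw x / pw j" for j
   using order_trans[OF A(2)[of "x - j"]] mult_left_mono[OF inverse_pw_le[of "x - j" "- x"] A(1)] by (simp add: pw_minus[of j, symmetric] del: pw_minus) (simp add: pw_minus mult_ac)
  have "integrable (count_space ?J) (%j. f (x - j) * cis (j *. xi))"
   by (rule integrable_bd[OF J[of "A * ?c * pw x"]]) (use b A(1) pos in \<open>auto simp: norm_mult\<close>)
  \<comment> \<open>Absolute summability identifies the unordered sum in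
    \<open>zak_transform\<close> with an integral over the counting measure.\<close>
  from infsetsum_infsum[unfolded Infinite_Set_Sum.abs_summable_on_def, OF this]
  show ?thesis unfolding z zak_transform_def infsetsum_def g_def fst_conv snd_conv prod.case
   by (simp only: mult.assoc[symmetric] int_mult_l)
 qed
 have gz: "(LB z. g j z) = (LB x. f x * zak_coeff ph j (x + j))" for j
 proof -
  have "(LB z. g j z) = (LB x. (LB y. g j (x, y)))" by (rule lborel_integral_Pair[OF gi])
  also have "... = (LB x. f (x - j) * zak_coeff ph j x)"
   unfolding g_def zak_coeff_def fst_conv snd_conv by (simp only: int_mult_r mult.commute[of "cis _"])
  also have "... = (LB x. f (x + j - j) * zak_coeff ph j (x + j))"
  proof (rule lborel_integral_translate[symmetric])
   show "(%x. f (x - j) * zak_coeff ph j x) \<in> bm"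
    by (intro borel_measurable_times zm bm_contI continuous_on_compose2[OF fc]) (auto intro!: continuous_intros)
  qed
  finally show ?thesis by simp
 qed
 define B where "B = C * (LB y. 1 / pw (y :: real ^ 'n))"
 have zb: "cmod (zak_coeff ph j x) <= B / (pw x)\<^sup>2" for j x
 proof -
  have "cmod (ph (x, y) * cis (j *. y)) <= C / (pw x)\<^sup>2 * (1 / pw y)" for y
   using C(2)[of x y] mult_left_mono[OF mult_left_mono[OF sq[of y], of "1 / (pw x)\<^sup>2"] C(1)] by (simp add: norm_mult)
  hence "cmod (zak_coeff ph j x) <= (LB y. C / (pw x)\<^sup>2 * (1 / pw (y :: real ^ 'n)))"
   unfolding zak_coeff_def by (intro norm_integral_le intb_mult_r integrable_pw) auto
  thus ?thesis by (simp only: int_mult_r) (simp add: B_def)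
 qed
 have B: "0 <= B" unfolding B_def using C(1) by (intro mult_nonneg_nonneg integral_nn) auto
 define k where "k j = (%x. f x * zak_coeff ph j (x + j))" for j
 have kb: "cmod (k j x) <= ?c * A * B / pw j * (1 / pw (x + j))" for j x
 proof -
  have "cmod (f x) <= A * (?c * pw (x + j) / pw j)"
   using order_trans[OF A(2)[of x]] mult_left_mono[OF inverse_pw_le[of x "- (x + j)"] A(1)] by (simp add: pw_minus[of j, symmetric] del: pw_minus) (simp add: pw_minus pw_minus[of "x + j", simplified])
  hence "cmod (k j x) <= A * (?c * pw (x + j) / pw j) * (B / (pw (x + j))\<^sup>2)"
   unfolding k_def norm_mult using A(1) by (intro mult_mono zb) auto
  thus ?thesis using pos[of "x + j"] by (simp add: power2_eq_square mult_ac)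
 qed
 have ti: "integrable lborel (%x. 1 / pw (x + j))" for j :: "real ^ 'n"
  by (rule lborel_integrable_translate[OF integrable_pw])
 have ki: "integrable lborel (k j)" for j
 proof (rule integrable_bd[OF intb_mult_r[OF ti[of j], of "?c * A * B / pw j"]])
  have "(%x. zak_coeff ph j (x + j)) : bm" using zm[of j] by measurable
  thus "k j : borel_measurable lborel" unfolding k_def using fm by measurable
 qed (use kb A(1) B in \<open>simp add: norm_mult\<close>)
 have "(LB x. norm (k j x)) <= ?c * A * B * (LB x. 1 / pw (x :: real ^ 'n)) / pw j" for j
 proof -
  have "(LB x. norm (k j x)) <= (LB x. ?c * A * B / pw j * (1 / pw (x + j)))"
   by (rule integral_mono[OF integrable_norm[OF ki] intb_mult_r[OF ti]]) (use kb[of j] in simp)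
  moreover have "(LB x. 1 / pw (x + j)) = (LB x. 1 / pw (x :: real ^ 'n))"
   by (rule lborel_integral_translate[of "%x. 1 / pw x"]) measurable
  ultimately show ?thesis by (simp only: int_mult_r) (simp add: mult_ac)
 qed
 hence ks: "integrable (count_space ?J) (%j. \<integral>x. norm (k j x) \<partial>lborel)"
  by (rule integrable_count_space_le[OF J, rotated]) (rule integral_nn, simp)
 have "(LB z. zak_transform e f z * ph z) = (\<integral>j. (LB x. k j x) \<partial>count_space ?J)"
  unfolding zt sw(1)[symmetric] gz k_def ..
 also have "... = (LB x. (\<integral>j. k j x \<partial>count_space ?J))"
  by (rule integral_count_space_swap(1)[OF countable_lattice sigma_finite_lborel ki ks])
 also have "... = (LB x. f x * zak_adjoint e ph x)"
  unfolding k_def zak_adjoint_def by (simp only: int_mult_r)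
 finally show ?thesis ..
qed

text \<open>Used to pass triviality from the test functions of x to those of (x, \<xi>): if the
  former are all 0, so are all slices of the latter.\<close>

lemma gs2_slice:
 fixes ph :: "'a::euclidean_space \<times> 'a => complex"
 assumes s: "0 <= sr" and ph: "ph \<in> gs2 R s sr"
 shows "(%x. ph (x, y)) : gs1 R s sr"
proof (rule gsc_map[OF zero_less_one _ ph])
 fix h C assume h: "0 < h" and b: "gsb2 s sr h C ph"
 obtain P where P: "0 < P" "!!(ph :: 'a \<times> 'a => complex) C al be ga x y.
  gsb2 s sr h C ph ==>
  amon al x * cmod (md (join be ga) ph (x, y)) \<le>
   C * P * (gsw1 s h al * (gsw1 sr h be * gsw1 s h ga)) / pw y"
  by (rule gsb_slice[OF h s, where ?'a='a and ?'b='a]) blast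
 have e: "(%x. md (join (%_ :: 'a. 0) (%_ :: 'a. 0)) ph (x, y)) = (%x. ph (x, y))"
  by (simp add: multi_deriv_def iterated_deriv_def)
 have sm: "smooth (%x. ph (x, y))" using smooth_slice1[OF gsbD(1)[OF b], of "%_. 0" y] unfolding e .
 have md: "md be (%x. ph (x, y)) x = md (join be (%_. 0)) ph (x, y)" for be x
  using multi_deriv_slice1[OF gsbD(1)[OF b], of be "%_. 0" y] unfolding e by metis
 have "gsb1 s sr (1 * h) (C * P / pw y) (%x. ph (x, y))"
  using P gsbD(2)[OF b] P(2)[OF b, of _ _ _ "%_. 0" y] by (intro gsbI sm) (simp_all add: md)
 thus "\<exists>C'. gsb1 s sr (1 * h) C' (%x. ph (x, y))" by blast
qed

section \<open>Approximation of functionals by functions\<close>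

lemma lborel_integral_affine:
 fixes g :: "'a::euclidean_space => complex"
 assumes c: "c ~= 0" and g: "g : bm"
 shows "(LB z. g z) = of_real (\<bar>c\<bar> ^ DIM('a)) * (LB y. g (t + c *! y))"
proof -
 have m: "(%y. t + c *! y) \<in> borel_measurable (borel :: 'a measure)" by measurable
 have "(LB z. g z) = (\<integral>z. g z \<partial>density (distr lborel borel (%x. t + c *! x)) (%_. \<bar>c\<bar> ^ DIM('a)))"
  using lborel_affine[OF c, of t] by simp
 also have "... = (\<integral>z. (\<bar>c\<bar> ^ DIM('a)) *! g z \<partial>distr lborel borel (%x. t + c *! x))"
  using g by (intro integral_density) auto
 also have "... = (LB y. (\<bar>c\<bar> ^ DIM('a)) *! g (t + c *! y))"
  using g m by (intro integral_distr) auto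
 finally show ?thesis unfolding integral_scaleR_right by (simp only: scaleR_conv_of_real)
qed

lemma norm_le_pw: "norm (y :: 'a::euclidean_space) <= real DIM('a) * pw y"
proof -
 have "\<bar>y *. b\<bar> <= pw y" if b: "b : Basis" for b
 proof -
  have "\<bar>t\<bar> <= 1 + t\<^sup>2" for t :: real
  proof -
   have "0 <= (\<bar>t\<bar> - 1 / 2)\<^sup>2" by simp
   thus ?thesis unfolding power2_diff power2_abs by (simp add: power_divide)
  qed
  hence "\<bar>y *. b\<bar> <= (1 + (y *. b)\<^sup>2) * 1" by simp
  also have "... <= (1 + (y *. b)\<^sup>2) * (\<Prod>c\<in>Basis - {b}. 1 + (y *. c)\<^sup>2)"
   by (intro mult_left_mono prod_ge_1) auto
  also have "... = pw y" unfolding pw_def using b by (simp add: prod.remove)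
  finally show ?thesis .
 qed
 hence "(\<Sum>b\<in>Basis. \<bar>y *. b\<bar>) <= (\<Sum>b\<in>(Basis :: 'a set). pw y)" by (intro sum_mono)
 thus ?thesis using norm_le_l1[of y] by simp
qed

lemma gsb_absorb:
 fixes s sr h :: real
 assumes h: "0 < h" and s: "0 <= s"
 obtains P where "0 < P" "!!(f :: 'a::euclidean_space => complex) C y ga. gsb1 s sr h C f ==>
  amon ga y * (pw y * cmod (f y)) <= C * P * gsw1 s (2 powr s * h) ga"
proof -
 obtain P where P: "0 < P" "!!(k::'a) A C ga. 0 <= A ==> (!!ga. amon ga k * A <= C * gsw1 s h ga) ==>
  pw k * (amon ga k * A) <= C * P * gsw1 s (2 powr s * h) ga"
  using pw_absorb[where h=h and s="%_ :: 'a. s" and q=s, OF h s order_refl] by blast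
 show thesis
 proof (rule that[OF P(1)])
  fix f :: "'a => complex" and C y ga assume f: "gsb1 s sr h C f"
  have "amon ga y * cmod (f y) <= C * gsw1 s h ga" for ga
   using gsbD(3)[OF f, of ga y "%_. 0"] by (simp add: multi_deriv_def iterated_deriv_def)
  from P(2)[OF _ this, of ga] show "amon ga y * (pw y * cmod (f y)) <= C * P * gsw1 s (2 powr s * h) ga"
   by (simp add: mult_ac)
 qed
qed

text \<open>The error of convolving with a kernel shrunk by \<open>ep\<close>, linear in
  \<open>ep\<close>. The loss in scale is the same for every \<open>ep\<close>, so the error becomes
  small in a fixed step norm.\<close>

lemma conv_bound:
 fixes s sr h :: real and G :: "'a::euclidean_space => complex"
 assumes h: "0 < h" and s: "0 < s" and sr: "0 < sr" and G: "gsb1 s sr h CG G"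
 obtains C where "0 <= C" "!!ep ph N. \<bar>ep\<bar> <= 1 ==> gsb1 s sr h N ph ==>
  gsb1 s sr (2 * (2 powr sr * (2 powr s * (2 powr s * h)))) (\<bar>ep\<bar> * C * N) (%x. \<integral>y. G y * (ph (x - ep *! y) - ph x) \<partial>lborel)"
proof -
 let ?h1 = "2 powr s * h" and ?hh = "2 powr s * (2 powr s * h)"
 let ?I = "\<integral>y. 1 / pw (y :: 'a) \<partial>lborel"
 have s0: "0 <= s" "0 <= sr" using s sr by auto
 have h1: "0 < ?h1" and hh: "0 < ?hh" using h by auto
 have hle: "h <= ?hh" by (rule order_trans[OF one_le_two_powr[OF h s0(1)] one_le_two_powr[OF h1 s0(1)]])
 have H: "0 < 2 * (2 powr sr * ?hh)" using h by simp
 obtain P where P: "0 < P" "!!(k::'a) A C ga. 0 <= A ==> (!!ga. amon ga k * A <= C * gsw1 s h ga) ==>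
  pw k * (amon ga k * A) <= C * P * gsw1 s ?h1 ga"
  using pw_absorb[where h=h and s="%_ :: 'a. s" and q=s, OF h s0(1) order_refl] by blast
 obtain P' where P': "0 < P'" "!!(k::'a) A C ga. 0 <= A ==> (!!ga. amon ga k * A <= C * gsw1 s ?h1 ga) ==>
  pw k * (amon ga k * A) <= C * P' * gsw1 s ?hh ga"
  using pw_absorb[where h="?h1" and s="%_ :: 'a. s" and q=s, OF h1 s0(1) order_refl] by blast
 define D where "D = CG * P * P'"
 have CG: "0 <= CG" using gsbD(2)[OF G] .
 have D: "0 <= D" using CG P(1) P'(1) by (simp add: D_def)
 have Gw: "amon ga y * ((pw y)\<^sup>2 * cmod (G y)) <= D * gsw1 s ?hh ga" for ga y
 proof -
  have "amon ga y * cmod (G y) <= CG * gsw1 s h ga" for ga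
   using gsbD(3)[OF G, of ga y "%_. 0"] by (simp add: multi_deriv_def iterated_deriv_def)
  hence "amon ga y * (pw y * cmod (G y)) <= CG * P * gsw1 s ?h1 ga" for ga
   using P(2)[of "cmod (G y)" y CG ga] by (simp add: mult_ac)
  hence "pw y * (amon ga y * (pw y * cmod (G y))) <= CG * P * P' * gsw1 s ?hh ga"
   by (intro P'(2)) auto
  thus ?thesis by (simp add: D_def power2_eq_square mult_ac)
 qed
 define M where "M = real DIM('a) * (2 powr sr * ?hh)"
 have M: "0 <= M" using hh by (simp add: M_def)
 define C where "C = D * M * real DIM('a) * ?I"
 have I: "0 <= ?I" by (intro integral_nn) simp
 show thesis
 proof (rule that[of C])
  show "0 <= C" unfolding C_def using D M I by simp
  fix ep :: real and ph :: "'a => complex" and N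
  assume ep: "\<bar>ep\<bar> <= 1" and ph: "gsb1 s sr h N ph"
  have N: "0 <= N" using gsbD(2)[OF ph] .
  have ph': "gsb1 s sr ?hh N ph" by (rule gsb_mono[OF ph h hle order_refl])
  have pt: "gsb1 s sr (2 * (2 powr sr * ?hh)) (\<bar>ep\<bar> * N * D * M * real DIM('a) * (1 / pw y)) (%x. G y * (ph (x - ep *! y) - ph x))" for y
  proof (cases "G y = 0")
   case True
   thus ?thesis using gsb_mono[OF gsb_zero H order_refl, of "\<bar>ep\<bar> * N * D * M * real DIM('a) * (1 / pw y)"] N D M by simp
  next
   case False
   \<comment> \<open>Translation by \<open>ep\<close> y costs a constant that bounds the powers of y
     against the weights. The decay of \<open>G\<close> at this very point provides one proportional
     to 1 / |G y|, and the factor \<open>G y\<close> in front cancels it, leaving an integrable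
     function of y.\<close>
   define c where "c = D / ((pw y)\<^sup>2 * cmod (G y))"
   have p0: "0 < (pw y)\<^sup>2 * cmod (G y)" using False pw_pos[of y] by (intro mult_pos_pos zero_less_power) auto
   have c: "0 <= c" using D p0 by (simp add: c_def)
   have "amon ga (ep *! y) <= c * gsw1 s ?hh ga" for ga
   proof -
    have "\<bar>ep\<bar> ^ sum ga Basis * amon ga y <= 1 * amon ga y"
     using ep by (intro mult_right_mono power_le_one) auto
    also have "... <= c * gsw1 s ?hh ga"
     using Gw[of ga y] p0 by (simp add: c_def pos_le_divide_eq)
    finally show ?thesis by (simp add: abs_monomial_at_scaleR)
   qed
   from gsb_translate_diff[OF ph' hh s0(1) s0(2) order_refl s0(2) c this]
   have "gsb1 s sr (2 * (2 powr sr * ?hh)) (norm (ep *! y) * (c * N * M)) (%x. ph (x - ep *! y) - ph x)"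
    unfolding M_def .
   from gsb_scale[OF this, of "G y"]
   have b: "gsb1 s sr (2 * (2 powr sr * ?hh)) (cmod (G y) * (norm (ep *! y) * (c * N * M))) (%x. G y * (ph (x - ep *! y) - ph x))" .
   have cG: "cmod (G y) * c = D / (pw y)\<^sup>2" using False by (simp add: c_def)
   have "cmod (G y) * (norm (ep *! y) * (c * N * M)) = cmod (G y) * c * (\<bar>ep\<bar> * norm y * N * M)" by (simp add: mult_ac)
   also have "... = \<bar>ep\<bar> * N * D * M * (norm y / (pw y)\<^sup>2)" unfolding cG by (simp add: mult_ac)
   also have "... <= \<bar>ep\<bar> * N * D * M * (real DIM('a) * pw y / (pw y)\<^sup>2)"
    by (intro mult_left_mono divide_right_mono norm_le_pw) (use N D M in auto)
   also have "... = \<bar>ep\<bar> * N * D * M * real DIM('a) * (1 / pw y)"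
    using pw_pos[of y] by (simp add: power2_eq_square)
   finally show ?thesis by (rule gsb_mono[OF b H order_refl])
  qed
  have sm: "continuous_on UNIV ph" "continuous_on UNIV G" using ph G by (simp_all add: gsbD(1) smooth_continuous_on)
  have meas: "(%y. G y * (ph (x - ep *! y) - ph x)) : borel_measurable lborel" for x
   by (simp, intro bm_contI continuous_intros sm continuous_on_compose2[OF sm(1)]) auto
  have "gsb1 s sr (2 * (2 powr sr * ?hh)) (LB y. \<bar>ep\<bar> * N * D * M * real DIM('a) * (1 / pw (y :: 'a))) (%x. \<integral>y. G y * (ph (x - ep *! y) - ph x) \<partial>lborel)"
   by (rule gsb_integral[OF H pt intb_mult_r[OF integrable_pw] meas])
  moreover have "(LB y. \<bar>ep\<bar> * N * D * M * real DIM('a) * (1 / pw (y :: 'a))) = \<bar>ep\<bar> * C * N"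
   unfolding int_mult_r C_def by (simp add: mult_ac)
  ultimately show "gsb1 s sr (2 * (2 powr sr * (2 powr s * (2 powr s * h)))) (\<bar>ep\<bar> * C * N) (%x. \<integral>y. G y * (ph (x - ep *! y) - ph x) \<partial>lborel)"
   by simp
 qed
qed

text \<open>Simple maps close to the identity turn a convolution into a finite sum of translates.
  The coordinatewise bound lets powers of \<open>S i z\<close> be estimated by those of 2 z.\<close>

lemma simple_approximation_of_identity:
 obtains S :: "nat => 'a::euclidean_space => 'a" where "!!i. simple_function borel (S i)"
  "!!i z b. b : Basis ==> \<bar>S i z *. b\<bar> <= 2 * \<bar>z *. b\<bar>" "!!z. (%i. S i z) \<longlonglongrightarrow> z"
proof -
 have "(%r::real. r) \<in> bm" by simp
 from borel_measurable_implies_sequence_metric[OF this, of 0]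
 obtain t :: "nat => real => real" where t: "!!i. simple_function borel (t i)" "!!r. (%i. t i r) \<longlonglongrightarrow> r" "!!i r. dist (t i r) 0 <= 2 * dist r 0"
  by (auto simp: space_borel)
 define S where "S i z = (\<Sum>b\<in>Basis. t i (z *. b) *! b)" for i and z :: 'a
 show thesis
 proof (rule that[of S])
  show "simple_function borel (S i)" for i
  proof -
   have "simple_function borel (%z::'a. t i (z *. b))" for b
    by (rule simple_function_comp[OF _ t(1), of "%z. z *. b"]) measurable
   thus ?thesis unfolding S_def[abs_def]
    by (intro simple_function_sum) (rule simple_function_compose1)
  qed
  show "\<bar>S i z *. b\<bar> <= 2 * \<bar>z *. b\<bar>" if "b : Basis" for i z b
   using t(3)[of i "z *. b"] that by (simp add: S_def inner_sum_left_Basis)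
  show "(%i. S i z) \<longlonglongrightarrow> z" for z
  proof -
   have "(%i. S i z) \<longlonglongrightarrow> (\<Sum>b\<in>Basis. (z *. b) *! b)" unfolding S_def by (intro tendsto_intros t(2))
   thus ?thesis by (simp add: euclidean_representation)
  qed
 qed
qed

text \<open>Replacing the translates of \<open>H\<close> by finitely many of them over a ball costs
  an error in the step norm that tends to 0 uniformly over \<open>q\<close> of given bound. At each
  z it is controlled by \<open>e i z / pw z\<close>, to which dominated convergence applies.\<close>

lemma disc_bound:
 fixes s sr h :: real and H :: "'a::euclidean_space => complex" and S :: "nat => 'a => 'a"
 assumes h: "0 < h" and s: "0 < s" and sr: "0 < sr" and H: "gsb1 s sr h CH H"
  and S: "!!i. simple_function borel (S i)" "!!i z b. b : Basis ==> \<bar>S i z *. b\<bar> <= 2 * \<bar>z *. b\<bar>" "!!z. (%i. S i z) \<longlonglongrightarrow> z"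
 obtains a where "a \<longlonglongrightarrow> 0" "!!i q N. gsb1 s sr h N q ==>
  gsb1 s sr (2 * (2 * (2 powr sr * (2 * (2 powr s * h))))) (a i * N)
   (%x. \<integral>z. (H (x - z) - indicator (ball 0 (real i)) z * H (x - S i z)) * q z \<partial>lborel)"
proof -
 let ?hh = "2 * (2 powr s * h)" let ?h3 = "2 * (2 powr sr * ?hh)" let ?L = "2 * ?h3"
 let ?B = "gsb1 s sr :: _ => _ => ('a => complex) => _"
 have s0: "0 <= s" "0 <= sr" using s sr by auto
 have hh: "0 < ?hh" and h3: "0 < ?h3" and L: "0 < ?L" using h by auto
 have hle: "h <= ?hh" "?hh <= ?h3" "2 * ?hh <= ?L" using one_le_two_powr[OF h s0(1)] one_le_two_powr[OF hh s0(2)] h by (auto simp: mult.assoc)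
 obtain P where P: "0 < P" "!!(f :: 'a => complex) C y ga. ?B h C f ==>
  amon ga y * (pw y * cmod (f y)) <= C * P * gsw1 s (2 powr s * h) ga"
  using gsb_absorb[OF h s0(1), where 'a='a and sr=sr] by blast
 obtain c1 where c1: "0 < c1" "!!(k::'a) ga. (!!b. b : Basis ==> \<bar>k *. b\<bar> <= 1) ==> amon ga k <= c1 * gsw1 s ?hh ga"
  using monomial_le_gsw[OF hh, of "%_ :: 'a. s" 1] s by metis
 have CH: "0 <= CH" using gsbD(2)[OF H] .
 have H': "?B ?hh CH H" by (rule gsb_mono[OF H h hle(1) order_refl])
 have Sm: "S i : bm" for i using borel_measurable_simple_function[OF S(1)] .
 define M where "M = 2 * CH + c1 * CH * (real DIM('a) * (2 powr sr * ?hh))"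
 have M: "0 <= M" "2 * CH <= M" "c1 * CH * (real DIM('a) * (2 powr sr * ?hh)) <= M" using CH c1(1) h by (auto simp: M_def)
 \<comment> \<open>The local error is proportional to |z - S i z| where this is at most 1 and z lies
   in the ball, by the mean value estimate, and is bounded trivially elsewhere. \<open>M\<close>
   covers both regimes.\<close>
 define e where "e i z = (if norm z < real i \<and> norm (z - S i z) <= 1 then norm (z - S i z) else 1)" for i z
 have e: "0 <= e i z" "e i z <= 1" for i z by (auto simp: e_def)
 have em [measurable]: "e i : bm" for i unfolding e_def[abs_def] using Sm by measurable
 define a where "a i = P * M * (LB z. e i z * (1 / pw z))" for i
 have ei: "integrable lborel (%z. e i z * (1 / pw z))" for i
  by (rule integrable_bd[OF integrable_pw]) (use e in \<open>auto simp: abs_mult intro!: divide_right_mono\<close>)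
 have "(%i. \<integral>z. e i z * (1 / pw z) \<partial>lborel) \<longlonglongrightarrow> (\<integral>z. 0 \<partial>(lborel :: 'a measure))"
 proof (rule integral_dominated_convergence[where w="%z. 1 / pw z"])
  show "AE z in lborel. (%i. e i z * (1 / pw z)) \<longlonglongrightarrow> 0"
  proof (rule AE_I2)
   fix z :: 'a
   have n0: "(%i. norm (z - S i z)) \<longlonglongrightarrow> 0" using tendsto_norm[OF tendsto_diff[OF tendsto_const S(3)[of z], of z]] by simp
   hence "eventually (%i. norm (z - S i z) < 1) sequentially" by (rule order_tendstoD) simp
   moreover have "eventually (%i. norm z < real i) sequentially"
    using filterlim_at_top_dense[THEN iffD1, OF filterlim_real_sequentially] by blast
   ultimately have "eventually (%i. norm (z - S i z) = e i z) sequentially" by eventually_elim (simp add: e_def)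
   from Lim_transform_eventually[OF n0 this] have "(%i. e i z) \<longlonglongrightarrow> 0" .
   from tendsto_mult_right[OF this, of "1 / pw z"] show "(%i. e i z * (1 / pw z)) \<longlonglongrightarrow> 0" by simp
  qed
  show "AE z in lborel. norm (e i z * (1 / pw z)) <= 1 / pw z" for i
   using e by (auto simp: abs_mult intro!: divide_right_mono)
 qed (use integrable_pw in auto)
 hence a0: "a \<longlonglongrightarrow> 0" unfolding a_def[abs_def] using tendsto_mult_left[of _ 0 _ "P * M"] by simp
 show thesis
 proof (rule that[OF a0])
  fix i and q :: "'a => complex" and N assume q: "?B h N q"
  have N: "0 <= N" using gsbD(2)[OF q] .
  let ?ch = "%z. indicator (ball 0 (real i)) z :: complex"
  have pt: "?B ?L (N * P * M * (e i z * (1 / pw z))) (%x. (H (x - z) - ?ch z * H (x - S i z)) * q z)" for z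
  proof (cases "q z = 0")
   case True
   thus ?thesis using gsb_mono[OF gsb_zero L order_refl, of "N * P * M * (e i z * (1 / pw z))"] N P(1) M(1) e[of i z] by simp
  next
   case False
   have p0: "0 < pw z * cmod (q z)" using False pw_pos[of z] by simp
   \<comment> \<open>As with the convolution kernel, the decay of \<open>q\<close> at z pays for the
     translations by z and by \<open>S i z\<close>, and the factor \<open>q z\<close> cancels the
     denominator.\<close>
   define c where "c = N * P / (pw z * cmod (q z))"
   have c: "0 <= c" using N P(1) p0 by (simp add: c_def)
   have cq: "cmod (q z) * c = N * P / pw z" using False by (simp add: c_def)
   have cz: "2 ^ sum ga Basis * amon ga z <= c * gsw1 s ?hh ga" for ga
   proof -
    have "amon ga z <= c * gsw1 s (2 powr s * h) ga"
     using P(2)[OF q, of ga z] p0 by (simp add: c_def pos_le_divide_eq mult_ac)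
    hence "2 ^ sum ga Basis * amon ga z <= 2 ^ sum ga Basis * (c * gsw1 s (2 powr s * h) ga)" by (intro mult_left_mono) auto
    also have "... = c * (2 ^ sum ga Basis * gsw1 s (2 powr s * h) ga)" by simp
    finally show ?thesis unfolding gsw_scale .
   qed
   have c2: "amon ga z <= c * gsw1 s ?hh ga" for ga
   proof -
    have "1 * amon ga z <= 2 ^ sum ga Basis * amon ga z" by (intro mult_right_mono) auto
    thus ?thesis using cz[of ga] by simp
   qed
   have c3: "amon ga (S i z) <= c * gsw1 s ?hh ga" for ga
   proof -
    have "amon ga (S i z) <= amon ga (2 *! z)"
     unfolding abs_monomial_at by (intro prod_mono conjI power_mono) (use S(2) in \<open>auto simp: abs_mult\<close>)
    thus ?thesis using cz[of ga] by (simp add: abs_monomial_at_scaleR)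
   qed
   have b: "\<exists>A. A <= c * M * e i z \<and> ?B ?L A (%x. H (x - z) - ?ch z * H (x - S i z))"
   proof (cases "norm z < real i \<and> norm (z - S i z) <= 1")
    case True
    let ?y = "z - S i z"
    have "\<bar>?y *. b\<bar> <= 1" if "b : Basis" for b using Basis_le_norm[OF that, of ?y] True by linarith
    hence "\<bar>mon ga ?y\<bar> <= c1 * gsw1 s ?hh ga" for ga by (rule c1(2))
    from gsb_translate_diff[OF H' hh s0(1) s0(2) order_refl s0(2) less_imp_le[OF c1(1)] this]
    have d: "?B ?h3 (norm ?y * (c1 * CH * (real DIM('a) * (2 powr sr * ?hh)))) (%x. H (x - ?y) - H x)" .
    have "amon ga (S i z) <= c * gsw1 s ?h3 ga" for ga
     using c3[of ga] mult_left_mono[OF gsw_mono[OF hh hle(2), of "%_. s" ga] c] by linarith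
    from gsb_translate[OF d h3 s0(1) c this]
    have "?B ?L (c * (norm ?y * (c1 * CH * (real DIM('a) * (2 powr sr * ?hh))))) (%x. H (x - z) - H (x - S i z))" by simp
    moreover have "c * (norm ?y * (c1 * CH * (real DIM('a) * (2 powr sr * ?hh)))) <= c * M * e i z"
    proof -
     have "c * (norm ?y * (c1 * CH * (real DIM('a) * (2 powr sr * ?hh)))) <= c * (norm ?y * M)"
      by (intro mult_left_mono M(3) c) auto
     thus ?thesis using True by (simp add: e_def mult_ac)
    qed
    moreover have "?ch z = 1" using True by simp
    ultimately show ?thesis by auto
   next
    case False
    have 1: "?B (2 * ?hh) (c * CH) (%x. H (x - z))" by (rule gsb_translate[OF H' hh s0(1) c c2])
    have 2: "?B (2 * ?hh) (c * CH) (%x. H (x - S i z))" by (rule gsb_translate[OF H' hh s0(1) c c3])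
    have "?B ?L (c * CH + cmod (?ch z) * (c * CH)) (%x. H (x - z) - ?ch z * H (x - S i z))"
     by (rule gsb_mono[OF gsb_diff[OF 1 gsb_scale[OF 2]] _ hle(3) order_refl]) (use hh in simp)
    moreover have "c * CH + cmod (?ch z) * (c * CH) <= c * M * e i z"
    proof -
     have "cmod (?ch z) * (c * CH) <= 1 * (c * CH)" using c CH by (intro mult_right_mono) (auto simp: indicator_def)
     moreover have "c * (2 * CH) <= c * M" by (intro mult_left_mono M(2) c)
     moreover have "e i z = 1" using False by (auto simp: e_def)
     ultimately show ?thesis by simp
    qed
    ultimately show ?thesis by auto
   qed
   then obtain A where A: "A <= c * M * e i z" "?B ?L A (%x. H (x - z) - ?ch z * H (x - S i z))" by blast
   have "?B ?L (cmod (q z) * A) (%x. q z * (H (x - z) - ?ch z * H (x - S i z)))" by (rule gsb_scale[OF A(2)])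
   moreover have "cmod (q z) * A <= N * P * M * (e i z * (1 / pw z))"
   proof -
    have "cmod (q z) * A <= cmod (q z) * (c * M * e i z)" by (intro mult_left_mono A(1)) auto
    also have "... = (cmod (q z) * c) * M * e i z" by simp
    finally show ?thesis unfolding cq by (simp add: mult_ac)
   qed
   ultimately show ?thesis using gsb_mono[OF _ L order_refl] by (simp add: mult.commute[of "q z"])
  qed
  have Hm: "(%z. H (x - T z)) : bm" if "T : bm" for x T
   using measurable_compose[OF _ smooth_borel_measurable[OF gsbD(1)[OF H]], of "%z. x - T z" borel] that by simp
  have meas: "(%z. (H (x - z) - ?ch z * H (x - S i z)) * q z) \<in> borel_measurable lborel" for x
   by (simp, intro borel_measurable_times borel_measurable_diff borel_measurable_indicator Hm Sm smooth_borel_measurable[OF gsbD(1)[OF q]]) auto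
  have "?B ?L (LB z. N * P * M * (e i z * (1 / pw z))) (%x. \<integral>z. (H (x - z) - ?ch z * H (x - S i z)) * q z \<partial>lborel)"
   by (rule gsb_integral[OF L pt intb_mult_r[OF ei] meas])
  thus "?B ?L (a i * N) (%x. \<integral>z. (H (x - z) - ?ch z * H (x - S i z)) * q z \<partial>lborel)"
   unfolding int_mult_r a_def by (simp add: mult_ac)
 qed
qed

lemma simple_integral_expand:
 fixes F :: "'a::euclidean_space => complex" and k :: "'a => complex"
 assumes S: "simple_function borel S" and k: "integrable lborel k"
 shows "(LB z. F (S z) * k z) = (\<Sum>m\<in>range S. (LB z. indicator (S -` {m}) z * k z) * F m)"
proof -
 have fin: "finite (range S)" using simple_functionD(1)[OF S] by simp
 have sets: "S -` {m} \<in> sets borel" for m using simple_functionD(2)[OF S, of "{m}"] by simp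
 have i: "integrable lborel (%z. indicator (S -` {m}) z * k z)" for m
 proof (rule integrable_bd[OF k])
  show "(%z. indicator (S -` {m}) z * k z) \<in> borel_measurable lborel"
   by (intro borel_measurable_times borel_measurable_indicator) (use sets k in auto)
 qed (auto simp: norm_mult indicator_def)
 have "F (S z) * k z = (\<Sum>m\<in>range S. (indicator (S -` {m}) z * k z) * F m)" for z
 proof -
  have "(\<Sum>m\<in>range S. (indicator (S -` {m}) z * k z) * F m) = (\<Sum>m\<in>{S z}. (indicator (S -` {m}) z * k z) * F m)"
   by (rule sum.mono_neutral_right[OF fin]) (auto simp: indicator_def)
  thus ?thesis by simp
 qed
 hence "(LB z. F (S z) * k z) = (LB z. (\<Sum>m\<in>range S. (indicator (S -` {m}) z * k z) * F m))" by simp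
 also have "... = (\<Sum>m\<in>range S. (LB z. (indicator (S -` {m}) z * k z) * F m))"
  by (rule Bochner_Integration.integral_sum) (rule intb_mult_l[OF i])
 finally show ?thesis by (simp only: int_mult_l)
qed

text \<open>\<open>u\<close> acts on a finite combination of translates of \<open>H\<close>. Pulling
  out its values at these translates and applying Fubini's theorem leaves the integral of \<phi>
  against a superposition of translates, which is \<open>f\<close>. It depends neither on \<phi> nor
  on the scale.\<close>

lemma disc_functional:
 fixes s sr :: real and H :: "'a::euclidean_space => complex" and S :: "'a => 'a" and r :: real
 assumes s: "0 < s" and sr: "0 < sr" and H: "H : gs1 R s sr" and S: "simple_function borel S"
  and u: "lfun (gs1 R s sr) u"
 obtains f where "f : gs1 R s sr" "!!ph N h. 0 < h ==> gsb1 s sr h N ph ==>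
  (%x. \<integral>z. indicator (ball 0 r) z * H (x - S z) * (LB w. H (w - z) * ph w) \<partial>lborel) \<in> gs1 R s sr \<and>
  u (%x. \<integral>z. indicator (ball 0 r) z * H (x - S z) * (LB w. H (w - z) * ph w) \<partial>lborel) = (LB w. f w * ph w)"
proof -
 define U where "U m = u (%x. H (x - m))" for m
 define k where "k z = indicator (ball 0 r) z * U (S z)" for z
 have Sm: "S : bm" using borel_measurable_simple_function[OF S] .
 have Um: "(%z. U (S z)) : bm"
  using borel_measurable_simple_function[OF simple_function_compose1[OF S, of U]] .
 have km: "k : bm" unfolding k_def[abs_def] by (intro borel_measurable_times borel_measurable_indicator Um) auto
 have "finite (U ` range S)" using simple_functionD(1)[OF S] by simp
 then obtain Uc where Uc: "!!z. cmod (U (S z)) <= Uc" using finite_imp_bounded bounded_iff by (metis rangeI imageI)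
 have Uc0: "0 <= Uc" using Uc norm_ge_zero order_trans by blast
 have kb: "cmod (k z) <= indicator (ball 0 r) z * Uc" for z unfolding k_def norm_mult using Uc[of z] by (simp add: indicator_def)
 have Ht: "(%x. H (x - m)) : gs1 R s sr" for m by (rule gsc_translate[OF s H])
 have Hc: "continuous_on UNIV H" by (rule smooth_continuous_on[OF gsc_smooth[OF H]])
 have Hm: "H : bm" by (rule smooth_borel_measurable[OF gsc_smooth[OF H]])
 define f where "f w = (LB z. k z * H (w - z))" for w
 have ball: "integrable lborel (%z. indicator (ball (0 :: 'a) r) z * c :: real)" for c
  by (intro intb_mult_l integrable_real_indicator emeasure_bounded_finite) auto
 have f: "f : gs1 R s sr"
 proof (rule gsc_map[OF _ _ H, of 2])
  fix h C assume h: "0 < h" and b: "gsb1 s sr h C H"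
  obtain c where c: "0 < c" "!!(k::'a) ga. (!!b. b : Basis ==> \<bar>k *. b\<bar> <= r) ==> amon ga k <= c * gsw1 s h ga"
   using monomial_le_gsw[OF h, of "%_ :: 'a. s" r] s by metis
  have C: "0 <= C" using gsbD(2)[OF b] .
  have "gsb1 s sr (2 * h) (indicator (ball 0 r) z * (Uc * (c * C))) (%w. k z * H (w - z))" for z
  proof (cases "z : ball 0 r")
   case True
   have "\<bar>z *. b\<bar> <= r" if "b : Basis" for b using Basis_le_norm[OF that, of z] True by simp
   hence "gsb1 s sr (2 * h) (c * C) (%w. H (w - z))"
    using c s by (intro gsb_translate[OF b h]) auto
   from gsb_scale[OF this, of "k z"] have "gsb1 s sr (2 * h) (cmod (k z) * (c * C)) (%w. k z * H (w - z))" .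
   moreover have "cmod (k z) * (c * C) <= indicator (ball 0 r) z * (Uc * (c * C))"
    using mult_right_mono[OF kb[of z], of "c * C"] c C by (simp add: mult_ac)
   ultimately show ?thesis using gsb_mono[of _ _ "2 * h"] h by (metis mult_pos_pos order_refl zero_less_numeral)
  next
   case False
   thus ?thesis using gsb_zero by (simp add: k_def)
  qed
  from gsb_integral[OF _ this ball] h km Hm
  show "\<exists>C'. gsb1 s sr (2 * h) C' f" unfolding f_def[abs_def] by fastforce
 qed simp
 show thesis
 proof (rule that[OF f])
  fix ph :: "'a => complex" and N h :: real assume h: "0 < h" and ph: "gsb1 s sr h N ph"
  let ?q = "%z. \<integral>w. H (w - z) * ph w \<partial>lborel"
  obtain D where D: "0 <= D" "!!x. cmod (ph x) <= D / pw x"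
   by (rule gsb_pw[OF ph h, of s]) (use s in auto)
  obtain h' C where b: "0 < h'" "gsb1 s sr h' C H" using gsc_boundedE[OF H] by blast
  have Hb: "cmod (H x) <= C" for x using gsb_deriv[OF b(2), of "%_. 0" x] by (simp add: multi_deriv_def iterated_deriv_def)
  have C: "0 <= C" using gsbD(2)[OF b(2)] .
  have phm: "ph \<in> bm" by (rule smooth_borel_measurable[OF gsbD(1)[OF ph]])
  have phi: "integrable lborel ph" by (rule integrable_pw_bound[OF phm D(2)])
  have Hm2: "(%(z, w). H (w - z)) : bm"
   unfolding split_def by (intro bm_contI continuous_on_compose2[OF Hc] continuous_intros) auto
  have Hmw: "(%w. H (w - z)) : bm" for z
   by (intro bm_contI continuous_on_compose2[OF Hc] continuous_intros) auto
  have bi: "cmod (H (w - z) * ph w) <= C * D * (1 / pw w)" for w z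
   using mult_mono[OF Hb[of "w - z"] D(2)[of w] C] by (simp add: norm_mult)
  have qm: "?q : bm"
  proof -
   have "(%(z, w). H (w - z) * ph w) \<in> borel_measurable (borel \<Otimes>\<^sub>M lborel)"
    using Hm2 phm by (simp add: split_def borel_prod[symmetric])
   thus ?thesis using lborel.borel_measurable_lebesgue_integral[of "%z w. H (w - z) * ph w" borel] by simp
  qed
  have qb: "cmod (?q z) <= C * D * (LB w. 1 / pw (w :: 'a))" for z
   using norm_integral_le[OF intb_mult_r[OF integrable_pw, of "C * D"], of "%w. H (w - z) * ph w"] bi
   by (simp only: int_mult_r)
  let ?k = "%z. indicator (ball 0 r) z * ?q z"
  have ki: "integrable lborel ?k"
  proof (rule integrable_bd[OF ball[of "C * D * (LB w. 1 / pw (w :: 'a))"]])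
   show "AE z in lborel. norm (?k z) <= norm (indicator (ball 0 r) z * (C * D * (LB w. 1 / pw (w :: 'a))))"
    by (rule AE_I2) (use order_trans[OF qb abs_ge_self] in \<open>auto simp: norm_mult indicator_def\<close>)
  qed (simp, intro borel_measurable_times borel_measurable_indicator qm, simp)
  let ?c = "%m. \<integral>z. indicator (S -` {m}) z * ?k z \<partial>lborel"
  have Pe: "(%x. \<integral>z. indicator (ball 0 r) z * H (x - S z) * ?q z \<partial>lborel) = (%x. \<Sum>m\<in>range S. ?c m * H (x - m))"
   using simple_integral_expand[OF S ki, of "%m. H (x - m)" for x] by (simp add: mult_ac)
  have mem: "(%x. \<Sum>m\<in>range S. ?c m * H (x - m)) : gs1 R s sr" by (intro gsc_sum gsc_scale Ht)
  have "u (%x. \<Sum>m\<in>range S. ?c m * H (x - m)) = (\<Sum>m\<in>range S. u (%x. ?c m * H (x - m)))"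
   using simple_functionD(1)[OF S] by (intro linear_functional_sum[OF u]) (auto intro: gsc_scale Ht)
  also have "... = (\<Sum>m\<in>range S. ?c m * U m)" unfolding U_def by (simp add: lfun_scale[OF u Ht])
  also have "... = (LB z. U (S z) * ?k z)" by (rule simple_integral_expand[OF S ki, symmetric])
  also have "... = (LB z. (LB w. k z * (H (w - z) * ph w)))" unfolding k_def int_mult_r by (simp add: mult_ac)
  also have "... = (LB w. (LB z. k z * (H (w - z) * ph w)))"
  proof (rule lborel_pair.Fubini_integral[symmetric])
   define B where "B = (1 + r\<^sup>2) ^ DIM('a)"
   have pB: "1 <= B / pw z" if "z : ball 0 r" for z :: 'a
    using pw_bounded[of z r] that pw_pos[of z] by (simp add: B_def)
   have "(%(z, w). k z * (H (w - z) * ph w)) : borel_measurable (borel \<Otimes>\<^sub>M borel)"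
    using Hm2 phm km by (simp add: split_def borel_prod[symmetric])
   hence m: "(%(z, w). k z * (H (w - z) * ph w)) : bm" by (simp add: borel_prod)
   have "cmod (case p of (z, w) => k z * (H (w - z) * ph w)) <= Uc * B * C * D / pw p" for p
   proof -
    obtain z w where p: "p = (z, w)" by (cases p)
    have "cmod (k z) <= Uc * (B / pw z)"
    proof (cases "z : ball 0 r")
     case True
     thus ?thesis using order_trans[OF kb[of z]] mult_left_mono[OF pB[OF True] Uc0] by simp
    next
     case False
     have "0 <= B" by (simp add: B_def)
     thus ?thesis using False Uc0 by (simp add: k_def)
    qed
    hence "cmod (k z) * cmod (H (w - z) * ph w) <= Uc * (B / pw z) * (C * D * (1 / pw w))"
     using Uc0 by (intro mult_mono bi) (auto simp: B_def)
    thus ?thesis by (simp add: p norm_mult pw_Pair mult_ac)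
   qed
   from integrable_pw_bound[OF m this] show "integrable (lborel \<Otimes>\<^sub>M lborel) (%(z, w). k z * (H (w - z) * ph w))"
    by (simp add: lborel_prod)
  qed
  also have "... = (LB w. f w * ph w)"
   unfolding f_def int_mult_l[symmetric] by (simp only: mult.assoc)
  finally show "(%x. \<integral>z. indicator (ball 0 r) z * H (x - S z) * ?q z \<partial>lborel) \<in> gs1 R s sr \<and>
   u (%x. \<integral>z. indicator (ball 0 r) z * H (x - S z) * ?q z \<partial>lborel) = (LB w. f w * ph w)"
   unfolding Pe using mem by simp
 qed
qed

lemma gs1_unit_integral:
 fixes f :: "'a::euclidean_space => complex"
 assumes s: "0 < s" and sr: "0 < sr" and f: "f : gs1 R s sr" and nz: "f x0 ~= 0"
 obtains G :: "'a => complex" where "G : gs1 R s sr" "(LB y. G y) = 1"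
proof -
 define g where "g x = cnj (f x) * f x" for x
 have g: "g : gs1 R s sr" unfolding g_def[abs_def] using sr by (intro gsc_mult f gsc_cnj) auto
 have gr: "g x = of_real ((cmod (f x))\<^sup>2)" for x by (simp only: g_def complex_norm_square mult.commute)
 have gi: "integrable lborel g" by (rule gsc_integrable[OF g less_imp_le[OF s]])
 have ri: "integrable lborel (%x. (cmod (f x))\<^sup>2)" using integrable_Re[OF gi] by (simp add: gr)
 have "0 < (LB x. (cmod (f x))\<^sup>2)"
  by (rule integral_pos_continuous[OF ri _ _, of x0])
   (use nz smooth_continuous_on[OF gsc_smooth[OF f]] in \<open>auto intro!: continuous_intros\<close>)
 moreover have "(LB x. g x) = of_real (LB x. (cmod (f x))\<^sup>2)" unfolding gr by (rule integral_complex_of_real)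
 ultimately have c: "(LB x. g x) ~= 0" by simp
 show thesis
  by (rule that[of "%x. 1 / (LB x. g x) * g x"], rule gsc_scale[OF g]) (unfold int_mult_r, use c in simp)
qed

lemma lfun_diff:
 assumes u: "lfun (gsc R s sr) u" and f: "f : gsc R s sr" and g: "g : gsc R s sr"
 shows "u (%x. f x - g x) = u f - u g"
 using lfun_add[OF u f gsc_scale[OF g, of "- 1"]] lfun_scale[OF u g, of "- 1"] by simp

text \<open>In the Beurling class \<open>u\<close> is meaningful only on test functions, while
  convergence in the dual topology is obtained in the dual of a step space; \<open>v\<close> extends
  \<open>u\<close> to all functions bounded at the scale h, as the limit of the approximating
  integrals. In the Roumieu class every function bounded at some scale is a test function, and
  \<open>v\<close> is \<open>u\<close>.\<close>

lemma gsf_approx: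
 fixes G :: "'a::euclidean_space => complex" and s sr h0 :: real
 assumes s: "0 < s" and sr: "0 < sr" and G: "G : gs1 R s sr" "(LB y. G y) = 1"
  and u: "gsf R (%_ :: 'a. s) (%_. sr) u" and h0: "0 < h0"
 obtains h v where "0 < h" "R ==> h0 <= h" "!!ph N. ph \<in> gs1 R s sr ==> gsb1 s sr h N ph ==> v ph = u ph"
  "!!et. 0 < et ==> \<exists>f\<in>gs1 R s sr. \<forall>ph N. gsb1 s sr h N ph --> cmod (v ph - (LB x. f x * ph x)) <= et * N"
proof -
 let ?V = "gs1 R s sr :: ('a => complex) set"
 let ?B = "gsb1 s sr :: _ => _ => ('a => complex) => _"
 have s0: "0 <= s" "0 <= sr" using s sr by auto
 have lin: "lfun ?V u" by (rule gsf_linear[OF u])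
 define K where "K = 2 * (2 powr sr * (2 powr s * 2 powr s))"
 define K' where "K' = 2 * (2 * (2 powr sr * (2 * 2 powr s)))"
 have m1: "1 <= x * y" if "1 <= x" "1 <= y" for x y :: real using mult_mono[of 1 x 1 y] that by simp
 have K: "1 <= K" "1 <= K'" unfolding K_def K'_def using s sr by (auto intro!: m1 ge_one_powr_ge_zero)
 have Kp: "0 < K" "0 < K'" using K by auto
 have Kle: "l <= K * l" "l <= K' * l" if "0 < l" for l using mult_right_mono[OF K(1), of l] mult_right_mono[OF K(2), of l] that by auto
 obtain g0 where g0: "0 < g0" "!!h. 0 < h ==> (R ==> g0 <= h) ==> \<exists>C. ?B h C G" using gsc_level[OF G(1)] by blast
 \<comment> \<open>The two convolutions cost a factor \<open>K\<close> each and the discretization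
   costs \<open>K'\<close>. In the Beurling class all must end below the one scale \<open>H\<close>
   at which \<open>u\<close> is bounded, so h is \<open>H / (K * K * K')\<close>; in the Roumieu
   class h is prescribed and \<open>H\<close> follows.\<close>
 have "\<exists>h H D. 0 < h \<and> (R --> h0 <= h \<and> g0 <= h) \<and> K * (K * h) <= H \<and> 0 <= D \<and> (\<not> R --> K' * (K * h) <= H) \<and>
  (\<forall>g\<in>?V. \<forall>c. ?B H c g --> cmod (u g) <= D * c)"
 proof (cases R)
  case True
  have "0 < K * (K * max h0 g0)" using Kp g0(1) by simp
  then obtain H D where "R ==> K * (K * max h0 g0) <= H" "0 <= D" "!!g c. g : ?V ==> ?B H c g ==> cmod (u g) <= D * c" using gsfE[OF u] by metis
  thus ?thesis using True g0(1) by (intro exI[of _ "max h0 g0"] exI[of _ H] exI[of _ D]) auto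
 next
  case False
  obtain H D where H: "0 < H" "0 <= D" "!!g c. g : ?V ==> ?B H c g ==> cmod (u g) <= D * c" using gsfE[OF u h0] by metis
  define h where "h = H / (K * K * K')"
  have "0 < h" "K * (K * h) = H / K'" "K' * (K * h) = H / K" using H(1) Kp by (auto simp: h_def field_simps)
  moreover have "H / K' <= H" "H / K <= H" using H(1) K by (auto simp: divide_le_eq mult_le_cancel_left1)
  ultimately show ?thesis using H False by (intro exI[of _ h] exI[of _ H] exI[of _ D]) auto
 qed
 then obtain h H D where h: "0 < h" "R ==> h0 <= h" "R ==> g0 <= h" and H: "K * (K * h) <= H" "\<not> R ==> K' * (K * h) <= H"
  and D: "0 <= D" "!!g c. g : ?V ==> ?B H c g ==> cmod (u g) <= D * c" by blast
 have Kh: "0 < K * h" "h <= K * h" using Kp h(1) Kle by auto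
 have KKh: "0 < K * (K * h)" using Kp Kh by simp
 obtain CG where CG: "?B h CG G" using g0(2)[OF h(1) h(3)] by blast
 have CG': "?B (K * h) CG G" by (rule gsb_mono[OF CG h(1) Kh(2) order_refl])
 have Keq: "2 * (2 powr sr * (2 powr s * (2 powr s * l))) = K * l" for l by (simp add: K_def)
 have Keq': "2 * (2 * (2 powr sr * (2 * (2 powr s * l)))) = K' * l" for l by (simp add: K'_def)
 obtain C1 where C1: "0 <= C1" "!!ep ph N. \<bar>ep\<bar> <= 1 ==> ?B h N ph ==> ?B (K * h) (\<bar>ep\<bar> * C1 * N) (%x. \<integral>y. G y * (ph (x - ep *! y) - ph x) \<partial>lborel)"
  using conv_bound[OF h(1) s sr CG] unfolding Keq by blast
 obtain C2 where C2: "0 <= C2" "!!ep ph N. \<bar>ep\<bar> <= 1 ==> ?B (K * h) N ph ==> ?B (K * (K * h)) (\<bar>ep\<bar> * C2 * N) (%x. \<integral>y. G y * (ph (x - ep *! y) - ph x) \<partial>lborel)"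
  using conv_bound[OF Kh(1) s sr CG'] unfolding Keq by blast
 obtain S :: "nat => 'a => 'a" where S: "!!i. simple_function borel (S i)" "!!i z b. b : Basis ==> \<bar>S i z *. b\<bar> <= 2 * \<bar>z *. b\<bar>" "!!z. (%i. S i z) \<longlonglongrightarrow> z"
  using simple_approximation_of_identity by blast
 have Gi: "integrable lborel G" by (rule gsc_integrable[OF G(1) s0(1)])
 have Gc: "continuous_on UNIV G" by (rule smooth_continuous_on[OF gsc_smooth[OF G(1)]])
 have core: "\<exists>f P. f : ?V \<and> (\<forall>ph N. ?B h N ph --> P ph \<in> ?V \<and> u (P ph) = (LB x. f x * ph x) \<and>
  (R --> cmod (u ph - u (P ph)) <= et * N) \<and> (\<not> R --> ?B H (et * N) (%x. P ph x - ph x)))" if et: "0 < et" for et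
 proof -
  \<comment> \<open>The inner convolution has error \<open>C1\<close> and leaves a function of size
    1 + \<open>C1\<close>, on which the outer one has error \<open>C2\<close>. The tolerance is
    halved between convolutions and discretization, and D + 1 in the denominators serves the step
    norm as well as the values of \<open>u\<close>.\<close>
  define C where "C = C1 + C2 * (1 + C1)"
  define et1 where "et1 = et / (2 * (D + 1))"
  define ep where "ep = min 1 (et1 / (C + 1))"
  have C: "0 <= C" using C1(1) C2(1) by (simp add: C_def)
  have et1: "0 < et1" "et1 <= et / 2" "D * et1 <= et / 2"
   using et D(1) by (auto simp: et1_def field_simps)
  have ep: "0 < ep" "ep <= 1" using et1(1) C by (auto simp: ep_def)
  have "ep * C <= et1 / (C + 1) * (C + 1)" using C ep(1) by (intro mult_mono) (auto simp: ep_def)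
  hence epC: "ep * C <= et1" using C by simp
  define A where "A de ph x = (LB y. G y * ph (x - de *! y))" for de and ph :: "'a => complex" and x
  define E where "E de ph x = (LB y. G y * (ph (x - de *! y) - ph x))" for de and ph :: "'a => complex" and x
  have E: "A de ph x = ph x + E de ph x" if "?B l N ph" for de ph x l N
  proof -
   have fc: "continuous_on UNIV ph" using that by (simp add: gsbD(1) smooth_continuous_on)
   have b: "cmod (ph x) <= N" for x using gsb_deriv[OF that, of "%_. 0" x] by (simp add: multi_deriv_def iterated_deriv_def)
   have i: "integrable lborel (%y. G y * ph (x - de *! y))"
   proof (rule integrable_bd[OF intb_mult_l[OF integrable_norm[OF Gi], of N]])
    show "(%y. G y * ph (x - de *! y)) : borel_measurable lborel"
     by (simp, intro bm_contI continuous_intros Gc continuous_on_compose2[OF fc]) auto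
    show "AE y in lborel. norm (G y * ph (x - de *! y)) <= norm (cmod (G y) * N)"
     using order_trans[OF b abs_ge_self] by (intro AE_I2) (simp add: norm_mult abs_mult mult_left_mono)
   qed
   have "E de ph x = A de ph x - (LB y. G y * ph x)"
    unfolding E_def A_def right_diff_distrib by (rule Bochner_Integration.integral_diff[OF i intb_mult_l[OF Gi]])
   thus ?thesis unfolding int_mult_l G(2) by simp
  qed
  \<comment> \<open>The kernel \<open>G\<close> shrunk by \<open>ep\<close> with its integral kept.
    The two convolutions carry opposite signs: the outer one yields translates of \<open>H'\<close>
    in x, to which \<open>u\<close> applies, and the inner one pairs the same translates with
    \<phi>.\<close>
  define H' where "H' t = of_real (1 / ep ^ DIM('a)) * G ((1 / ep) *! t)" for t
  have H': "H' : ?V" unfolding H'_def[abs_def]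
  proof (rule gsc_scale, rule gsc_map[OF _ _ G(1), of "1 / ep"])
   show "\<exists>C'. ?B (1 / ep * l) C' (%x. G ((1 / ep) *! x))" if "0 < l" "?B l C G" for l C
    using gsb_dilate[OF that(2,1), of "1 / ep"] ep by auto
  qed (use ep in simp)
  have H'c: "continuous_on UNIV H'" by (rule smooth_continuous_on[OF gsc_smooth[OF H']])
  have AH: "(LB z. H' (x - z) * p z) = A ep p x" "(LB w. H' (w - x) * p w) = A (- ep) p x" if "?B l N p" for p l N x
  proof -
   have pc: "continuous_on UNIV p" using that by (simp add: gsbD(1) smooth_continuous_on)
   have m: "(%z. H' (x - z) * p z) \<in> bm" "(%z. H' (z - x) * p z) \<in> bm"
    by (intro bm_contI continuous_intros pc continuous_on_compose2[OF H'c]; auto)+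
   have e: "of_real (ep ^ DIM('a)) * (LB y. H' (ep *! y) * p (x - de *! y)) = A de p x" for de
   proof -
    have "H' (ep *! y) * p (x - de *! y) = of_real (1 / ep ^ DIM('a)) * (G y * p (x - de *! y))" for y
     using ep(1) by (simp add: H'_def)
    thus ?thesis unfolding A_def using ep(1) by (simp only: int_mult_r) simp
   qed
   show "(LB z. H' (x - z) * p z) = A ep p x"
    using lborel_integral_affine[OF _ m(1), of "- ep" x] e[of ep] ep(1) by simp
   show "(LB w. H' (w - x) * p w) = A (- ep) p x"
    using lborel_integral_affine[OF _ m(2), of ep x] e[of "- ep"] ep(1) by simp
  qed
  \<comment> \<open>Shrinking enlarges the scale of the kernel. In the Roumieu class it is bounded
    only at some \<open>L\<close> depending on \<open>ep\<close>, so the scale \<open>H2\<close> and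
    the bound \<open>D2\<close> of \<open>u\<close> for the discretization are chosen after
    \<open>ep\<close>; in the Beurling class it is bounded at every scale and \<open>L\<close> stays
    at \<open>K * h\<close>.\<close>
  have "\<exists>L CH. K * h <= L \<and> (\<not> R --> L = K * h) \<and> ?B L CH H'"
  proof (cases R)
   case True
   obtain l C where l: "0 < l" "?B l C H'" using gsc_boundedE[OF H'] by blast
   have "?B (max l (K * h)) C H'" by (rule gsb_mono[OF l(2,1)]) auto
   thus ?thesis using True by (intro exI[of _ "max l (K * h)"] exI[of _ C]) auto
  next
   case False
   thus ?thesis using H' Kh(1) by (auto simp: gsc_def mem_gs_beurling)
  qed
  then obtain L CH where L: "K * h <= L" "\<not> R ==> L = K * h" and CH: "?B L CH H'" by blast
  have L0: "0 < L" "0 < K' * L" using L(1) Kh(1) Kp by auto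
  obtain a where a: "a \<longlonglongrightarrow> 0" "!!i q N. ?B L N q ==> ?B (K' * L) (a i * N)
   (%x. \<integral>z. (H' (x - z) - indicator (ball 0 (real i)) z * H' (x - S i z)) * q z \<partial>lborel)"
   using disc_bound[OF L0(1) s sr CH S] unfolding Keq' by blast
  have "\<exists>H2 D2. K' * L <= H2 \<and> 0 <= D2 \<and> (\<not> R --> H2 = H) \<and> (\<forall>g\<in>?V. \<forall>c. ?B H2 c g --> cmod (u g) <= D2 * c)"
  proof (cases R)
   case True
   thus ?thesis using gsfE[OF u L0(2)] by metis
  next
   case False
   thus ?thesis using H(2) L(2) D by (intro exI[of _ H] exI[of _ D]) auto
  qed
  then obtain H2 D2 where H2: "K' * L <= H2" "\<not> R ==> H2 = H" and D2: "0 <= D2" "!!g c. g : ?V ==> ?B H2 c g ==> cmod (u g) <= D2 * c" by blast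
  define et2 where "et2 = et / (2 * (D2 + 1))"
  have et2: "0 < et2" "et2 <= et / 2" "D2 * et2 <= et / 2" using et D2(1) by (auto simp: et2_def field_simps)
  have "0 < et2 / (1 + C1)" using et2(1) C1(1) by simp
  then obtain i where i: "\<bar>a i\<bar> < et2 / (1 + C1)" using LIMSEQ_D[OF a(1)] by (metis diff_zero order_refl real_norm_def)
  hence i: "a i * (1 + C1) <= et2" using C1(1) by (simp add: pos_less_divide_eq) (smt (verit) mult_right_mono)
  define P where "P ph = (%x. \<integral>z. indicator (ball 0 (real i)) z * H' (x - S i z) * (LB w. H' (w - z) * ph w) \<partial>lborel)" for ph :: "'a => complex"
  obtain f where f: "f : ?V" "!!ph N h. 0 < h ==> ?B h N ph ==> P ph \<in> ?V \<and> u (P ph) = (LB w. f w * ph w)"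
   using disc_functional[OF s sr H' S(1)[of i] lin, of "real i"] unfolding P_def by blast
  show ?thesis
  proof (intro exI[of _ f] exI[of _ P] conjI allI impI f(1))
   fix ph N assume ph: "?B h N ph"
   have N: "0 <= N" using gsbD(2)[OF ph] .
   show "P ph \<in> ?V" "u (P ph) = (LB w. f w * ph w)" using f(2)[OF h(1) ph] by auto
   let ?q = "A (- ep) ph"
   have E1: "?B (K * h) (ep * C1 * N) (E (- ep) ph)" using C1(2)[of "- ep", OF _ ph] ep unfolding E_def[abs_def] by simp
   have q: "?B (K * h) ((1 + C1) * N) ?q"
   proof -
    have "?B (K * h) (N + ep * C1 * N) (%x. ph x + E (- ep) ph x)"
     by (rule gsb_add[OF gsb_mono[OF ph h(1) Kh(2) order_refl] E1])
    moreover have "ep * (C1 * N) <= 1 * (C1 * N)" using ep C1(1) N by (intro mult_right_mono) auto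
    moreover have "(%x. ph x + E (- ep) ph x) = ?q" by (rule ext) (rule E[OF ph, symmetric])
    ultimately show ?thesis using gsb_mono[OF _ Kh(1) order_refl, of _ _ "N + ep * C1 * N" ?q "(1 + C1) * N"]
     by (simp add: algebra_simps)
   qed
   have E2: "?B (K * (K * h)) (ep * C2 * ((1 + C1) * N)) (E ep ?q)" using C2(2)[of ep, OF _ q] ep unfolding E_def[abs_def] by simp
   have E1': "?B (K * (K * h)) (ep * C1 * N) (E (- ep) ph)" by (rule gsb_mono[OF E1 Kh(1) Kle(1)[OF Kh(1)] order_refl])
   have "ep * C1 * N + ep * C2 * ((1 + C1) * N) = ep * C * N" by (simp add: C_def algebra_simps)
   also have "... <= et1 * N" using epC N by (rule mult_right_mono)
   finally have F: "?B H (et1 * N) (%x. E (- ep) ph x + E ep ?q x)"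
    by (rule gsb_mono[OF gsb_add[OF E1' E2] KKh H(1)])
   define E3 where "E3 x = (LB z. (H' (x - z) - indicator (ball 0 (real i)) z * H' (x - S i z)) * ?q z)" for x
   have qL: "?B L ((1 + C1) * N) ?q" by (rule gsb_mono[OF q Kh(1) L(1) order_refl])
   have "a i * (1 + C1) * N <= et2 * N" using i N by (rule mult_right_mono)
   hence E3: "?B H2 (et2 * N) E3"
    using gsb_mono[OF a(2)[OF qL, of i] L0(2) H2(1), of "et2 * N"] unfolding E3_def[abs_def] by (simp add: mult.assoc)
   have P: "P ph x = ph x + ((E (- ep) ph x + E ep ?q x) - E3 x)" for x
   proof -
    have H'b: "cmod (H' t) <= CH" for t using gsb_deriv[OF CH, of "%_. 0" t] by (simp add: multi_deriv_def iterated_deriv_def)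
    have CH0: "0 <= CH" using gsbD(2)[OF CH] .
    obtain Dq where "!!x. cmod (?q x) <= Dq / pw x"
     using gsb_pw[OF q Kh(1), of s] s0(1) by (metis order_refl)
    have qm: "?q : bm" by (rule smooth_borel_measurable[OF gsbD(1)[OF q]])
    have qi: "integrable lborel ?q" by (rule integrable_pw_bound[OF qm]) fact
    have Hm: "(%z. H' (x - T z)) : bm" if "T : bm" for T
     using measurable_compose[OF _ bm_contI[OF H'c], of "%z. x - T z" borel] that by simp
    have Hi: "integrable lborel (%z. c z * H' (x - T z) * ?q z)" if T: "T : bm" and c: "c : bm" "!!z. cmod (c z) <= 1" for T c
    proof (rule integrable_bd[OF intb_mult_r[OF integrable_norm[OF qi], of CH]])
     show "(%z. c z * H' (x - T z) * ?q z) \<in> borel_measurable lborel" by (simp, intro borel_measurable_times c Hm T qm)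
     have "cmod (c z * H' (x - T z)) <= 1 * CH" for z unfolding norm_mult by (intro mult_mono c H'b) auto
     thus "AE z in lborel. norm (c z * H' (x - T z) * ?q z) <= norm (CH * cmod (?q z))"
      using CH0 by (intro AE_I2) (simp add: norm_mult mult_right_mono)
    qed
    have i1: "integrable lborel (%z. H' (x - z) * ?q z)" using Hi[of "%z. z" "%_. 1"] by simp
    have i2: "integrable lborel (%z. indicator (ball 0 (real i)) z * H' (x - S i z) * ?q z)"
     by (rule Hi[OF borel_measurable_simple_function[OF S(1)]]) (auto simp: indicator_def intro!: borel_measurable_indicator[unfolded indicator_def])
    have "E3 x = (LB z. H' (x - z) * ?q z) - (LB z. indicator (ball 0 (real i)) z * H' (x - S i z) * ?q z)"
     unfolding E3_def left_diff_distrib by (rule Bochner_Integration.integral_diff[OF i1 i2])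
    hence "E3 x = A ep ?q x - P ph x" unfolding P_def AH(1)[OF q] AH(2)[OF ph] .
    thus ?thesis using E[OF q, of ep x] E[OF ph, of "- ep" x] by simp
   qed
   show "cmod (u ph - u (P ph)) <= et * N" if R
   proof -
    have mem: "ph \<in> ?V" "(%x. E (- ep) ph x + E ep ?q x) \<in> ?V" "E3 : ?V"
     using that gsc_roumieuI[OF _ h(1) ph] gsc_roumieuI[OF _ _ F] gsc_roumieuI[OF _ _ E3] KKh H(1) L0(2) H2(1) by auto
    have Pe: "P ph = (%x. ph x + ((E (- ep) ph x + E ep ?q x) - E3 x))" by (rule ext) (rule P)
    have "u (P ph) = u ph + (u (%x. E (- ep) ph x + E ep ?q x) - u E3)"
     unfolding Pe by (simp only: lfun_add[OF lin mem(1) gsc_diff[OF mem(2,3)]] lfun_diff[OF lin mem(2,3)])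
    hence eq: "u ph - u (P ph) = u E3 - u (%x. E (- ep) ph x + E ep ?q x)" by simp
    have "cmod (u ph - u (P ph)) <= D2 * (et2 * N) + D * (et1 * N)" unfolding eq
     by (rule order_trans[OF norm_triangle_ineq4 add_mono[OF D2(2)[OF mem(3) E3] D(2)[OF mem(2) F]]])
    also have "... = (D2 * et2 + D * et1) * N" by (simp add: algebra_simps)
    also have "... <= et * N" using et1(3) et2(3) N by (intro mult_right_mono) auto
    finally show ?thesis .
   qed
   show "?B H (et * N) (%x. P ph x - ph x)" if "\<not> R"
   proof -
    have "?B H (et1 * N + et2 * N) (%x. (E (- ep) ph x + E ep ?q x) - E3 x)"
     by (rule gsb_diff[OF F]) (use E3 H2(2) that in simp)
    moreover have "et1 * N + et2 * N <= et * N"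
     using et1(2) et2(2) N mult_right_mono[of "et1 + et2" et N] by (simp add: distrib_right)
    ultimately have "?B H (et * N) (%x. (E (- ep) ph x + E ep ?q x) - E3 x)"
     using gsb_mono[OF _ _ order_refl] KKh H(1) by (meson less_le_trans)
    thus ?thesis by (simp add: P)
   qed
  qed
 qed
 show thesis
 proof (cases R)
  case True
  show thesis
  proof (rule that[of h u, OF h(1,2) refl])
   fix et :: real assume "0 < et"
   from core[OF this] True show "\<exists>f\<in>?V. \<forall>ph N. ?B h N ph --> cmod (u ph - (LB x. f x * ph x)) <= et * N" by metis
  qed
 next
  case False
  \<comment> \<open>Approximants with tolerance 1 / (n + 1). The functions \<open>P n ph\<close> are
    test functions even when \<phi> is only bounded at the scale h, so \<open>u\<close> applies to
    their differences and the integrals form a Cauchy sequence.\<close>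
  define Q where "Q n f P \<longleftrightarrow> f : ?V \<and> (\<forall>ph N. ?B h N ph --> P ph \<in> ?V \<and> u (P ph) = (LB x. f x * ph x) \<and>
   ?B H (rsuc n * N) (%x. P ph x - ph x))" for n f P
  have "\<exists>f P. Q n f P" for n unfolding Q_def using core[of "rsuc n"] False by simp
  then obtain f P where fP: "!!n. Q n (f n) (P n)" by metis
  have f: "f n : ?V" for n using fP[of n] by (simp add: Q_def)
  have P: "P n ph \<in> ?V" "u (P n ph) = (LB x. f n x * ph x)" "?B H (rsuc n * N) (%x. P n ph x - ph x)"
   if "?B h N ph" for n ph N using fP[of n, unfolded Q_def, THEN conjunct2, rule_format, OF that] by simp_all
  define c where "c ph n = (LB x. f n x * ph x)" for ph n
  define v where "v ph = lim (c ph)" for ph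
  have diff: "cmod (c ph m - c ph n) <= D * ((rsuc m + rsuc n) * N)" if ph: "?B h N ph" for ph N m n
  proof -
   have "?B H (rsuc m * N + rsuc n * N) (%x. (P m ph x - ph x) - (P n ph x - ph x))"
    by (rule gsb_diff[OF P(3)[OF ph] P(3)[OF ph]])
   hence "?B H ((rsuc m + rsuc n) * N) (%x. P m ph x - P n ph x)" by (simp add: distrib_right)
   from D(2)[OF gsc_diff[OF P(1)[OF ph] P(1)[OF ph]] this]
   show ?thesis unfolding lfun_diff[OF lin P(1)[OF ph] P(1)[OF ph]] P(2)[OF ph] c_def .
  qed
  have inv0: "(%n. rsuc n) \<longlonglongrightarrow> 0" by (rule LIMSEQ_inverse_real_of_nat)
  have lim: "c ph \<longlonglongrightarrow> v ph" if ph: "?B h N ph" for ph N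
  proof -
   have N: "0 <= N" using gsbD(2)[OF ph] .
   have "Cauchy (c ph)"
   proof (rule metric_CauchyI)
    fix e :: real assume e: "0 < e"
    have "(%n. D * ((rsuc n + rsuc n) * N)) \<longlonglongrightarrow> D * ((0 + 0) * N)"
     by (intro tendsto_intros inv0)
    hence "eventually (%n. D * ((rsuc n + rsuc n) * N) < e) sequentially"
     using e by (intro order_tendstoD(2)) auto
    then obtain M where M: "D * ((rsuc M + rsuc M) * N) < e" by (auto simp: eventually_sequentially)
    have "dist (c ph m) (c ph n) < e" if "M <= m" "M <= n" for m n
    proof -
     have "D * ((rsuc m + rsuc n) * N) <= D * ((rsuc M + rsuc M) * N)"
      using that N D(1) by (intro mult_left_mono mult_right_mono add_mono le_imp_inverse_le) auto
     thus ?thesis using diff[OF ph, of m n] M by (simp add: dist_norm)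
    qed
    thus "\<exists>M. \<forall>m\<ge>M. \<forall>n\<ge>M. dist (c ph m) (c ph n) < e" by blast
   qed
   thus ?thesis unfolding v_def by (simp add: Cauchy_convergent_iff convergent_LIMSEQ_iff)
  qed
  have vb: "cmod (v ph - c ph n) <= D * (rsuc n * N)" if ph: "?B h N ph" for ph N n
  proof (rule LIMSEQ_le)
   show "(%m. cmod (c ph m - c ph n)) \<longlonglongrightarrow> cmod (v ph - c ph n)" by (intro tendsto_intros lim[OF ph])
   have "(%m. D * ((rsuc m + rsuc n) * N)) \<longlonglongrightarrow> D * ((0 + rsuc n) * N)"
    by (intro tendsto_intros inv0)
   thus "(%m. D * ((rsuc m + rsuc n) * N)) \<longlonglongrightarrow> D * (rsuc n * N)" by simp
  qed (use diff[OF ph] in blast)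
  show thesis
  proof (rule that[of h v, OF h(1,2)])
   fix ph N assume V: "ph \<in> ?V" and ph: "?B h N ph"
   have b: "cmod (c ph n - u ph) <= D * (rsuc n * N)" for n
    using D(2)[OF gsc_diff[OF P(1)[OF ph] V] P(3)[OF ph]]
    unfolding lfun_diff[OF lin P(1)[OF ph] V] P(2)[OF ph] c_def .
   have "(%n. D * (rsuc n * N)) \<longlonglongrightarrow> D * (0 * N)" by (intro tendsto_intros inv0)
   hence l0: "(%n. D * (rsuc n * N)) \<longlonglongrightarrow> 0" by (simp del: of_nat_Suc)
   have "eventually (%n. norm (c ph n - u ph) <= D * (rsuc n * N)) sequentially"
    by (rule always_eventually, rule allI, rule b)
   from Lim_null_comparison[OF this l0] have "(%n. c ph n - u ph) \<longlonglongrightarrow> 0" .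
   hence "c ph \<longlonglongrightarrow> u ph" by (rule LIM_zero_cancel)
   from LIMSEQ_unique[OF lim[OF ph] this] show "v ph = u ph" .
  next
   fix et :: real assume et: "0 < et"
   have "(%n. D * rsuc n) \<longlonglongrightarrow> D * 0" by (intro tendsto_intros inv0)
   hence "eventually (%n. D * rsuc n < et) sequentially" using et by (intro order_tendstoD(2)) auto
   then obtain n where n: "D * rsuc n < et" by (auto simp: eventually_sequentially)
   have "cmod (v ph - c ph n) <= et * N" if ph: "?B h N ph" for ph N
    using vb[OF ph, of n] mult_right_mono[OF less_imp_le[OF n] gsbD(2)[OF ph]] by (simp add: mult.assoc)
   thus "\<exists>f\<in>?V. \<forall>ph N. ?B h N ph --> cmod (v ph - (LB x. f x * ph x)) <= et * N" using f unfolding c_def by blast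
  qed (use False in simp)
 qed
qed

section \<open>Topologies on the dual spaces\<close>

lemma generated_limitin:
 assumes u: "u : \<Union>S" and ev: "!!U. U : S ==> u : U ==> eventually (%n. v n : U) F"
 shows "limitin (topology_generated_by S) v u F"
 unfolding limitin_def
proof (intro conjI allI impI)
 show "u : topspace (topology_generated_by S)" using u by (simp add: topology_generated_by_topspace)
 fix U assume "openin (topology_generated_by S) U \<and> u : U"
 hence "generate_topology_on S U" "u : U" by (auto simp: openin_topology_generated_by_iff)
 thus "eventually (%n. v n : U) F"
 proof (induction rule: generate_topology_on.induct)
  case (Int a b)
  thus ?case by (auto intro: eventually_conj)
 next
  case (UN K)
  then obtain k where k: "k : K" "u : k" by blast
  show ?case by (rule eventually_mono[OF UN.IH[OF k]]) (use k in blast)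
 qed (use ev in auto)
qed

lemma seminorm_onD:
 assumes "seminorm_on V p" "f : V"
 shows "g : V ==> p (%x. f x + g x) <= p f + p g" "p (%x. c * f x) = cmod c * p f" "p (%_. 0) = 0"
proof -
 show *: "p (%x. c * f x) = cmod c * p f" for c using assms by (simp add: seminorm_on_def)
 show "p (%_. 0) = 0" using *[of 0] by simp
 show "g : V ==> p (%x. f x + g x) <= p f + p g" for g using assms by (simp add: seminorm_on_def)
qed

definition diff_closed :: "('i => complex) set => bool" where
 "diff_closed V \<longleftrightarrow> (\<forall>f\<in>V. \<forall>g\<in>V. (%x. f x - g x) \<in> V)"

lemma diff_closedD: "diff_closed V ==> f : V ==> g : V ==> (%x. f x - g x) \<in> V"
 by (simp add: diff_closed_def)

lemma seminorm_on_diff: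
 assumes p: "seminorm_on V p" and V: "diff_closed V" and f: "f : V" "g : V" "k : V"
 shows "p (%x. f x - k x) <= p (%x. f x - g x) + p (%x. g x - k x)"
  and "p (%x. f x - g x) = p (%x. g x - f x)"
  and "\<bar>p f - p g\<bar> <= p (%x. f x - g x)"
proof -
 note d = diff_closedD[OF V]
 show "p (%x. f x - k x) <= p (%x. f x - g x) + p (%x. g x - k x)"
  using seminorm_onD(1)[OF p d[OF f(1,2)] d[OF f(2,3)]] by simp
 show s: "p (%x. f x - g x) = p (%x. g x - f x)"
  using seminorm_onD(2)[OF p d[OF f(1,2)], of "- 1"] by simp
 have "p f <= p (%x. f x - g x) + p g" using seminorm_onD(1)[OF p d[OF f(1,2)] f(2)] by simp
 moreover have "p g <= p (%x. g x - f x) + p f" using seminorm_onD(1)[OF p d[OF f(2,1)] f(1)] by simp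
 ultimately show "\<bar>p f - p g\<bar> <= p (%x. f x - g x)" unfolding s by simp
qed

lemma seminorm_nonneg:
 assumes p: "seminorm_on V p" and V: "diff_closed V" and f: "f : V"
 shows "0 <= p f"
proof -
 have z: "(%_. 0) \<in> V" using diff_closedD[OF V f f] by simp
 have "\<bar>p f - p (%_. 0)\<bar> <= p (%x. f x - 0)" by (rule seminorm_on_diff(3)[OF p V f z z])
 thus ?thesis by simp
qed

lemma topspace_lc [simp]: "topspace (lc_topology V P) = V"
 unfolding lc_topology_def topology_generated_by_topspace by auto

lemma lc_limitin:
 assumes V: "diff_closed V" and P: "!!p. p : P ==> seminorm_on V p" and u: "u : V" "!!n. v n : V"
  and lim: "!!p. p : P ==> (%n. p (%x. v n x - u x)) \<longlonglongrightarrow> 0"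
 shows "limitin (lc_topology V P) v u sequentially"
 unfolding lc_topology_def
proof (rule generated_limitin)
 fix U assume "U : insert V {{g : V. p (%x. g x - f x) < r} | p f r. p : P \<and> f : V \<and> 0 < r}" and uU: "u : U"
 then consider "U = V" | p f r where "U = {g : V. p (%x. g x - f x) < r}" "p : P" "f : V" by blast
 thus "eventually (%n. v n : U) sequentially"
 proof cases
  case 2
  hence "0 < r - p (%x. u x - f x)" using uU by simp
  hence "eventually (%n. p (%x. v n x - u x) < r - p (%x. u x - f x)) sequentially" by (rule order_tendstoD(2)[OF lim[OF 2(2)]])
  thus ?thesis
  proof (rule eventually_mono)
   fix n assume "p (%x. v n x - u x) < r - p (%x. u x - f x)"
   thus "v n : U" using seminorm_on_diff(1)[OF P[OF 2(2)] V u(2) u(1) 2(3), of n] u(2) 2(1) by simp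
  qed
 qed (use u in simp)
qed (use u in blast)

lemma continuous_map_of_balls:
 fixes F :: "('i => complex) => 'm::metric_space"
 assumes X: "topspace X = V" and V: "diff_closed V" and p: "seminorm_on V p"
  and op: "!!f r. f : V ==> 0 < r ==> openin X {g : V. p (%x. g x - f x) < r}"
  and C: "!!f g. f : V ==> g : V ==> dist (F g) (F f) <= C * p (%x. g x - f x)"
 shows "continuous_map X euclidean F"
 unfolding continuous_map_def
proof (intro conjI allI impI)
 fix U assume "openin (euclidean :: 'm topology) U"
 hence U: "open U" by simp
 show "openin X {x : topspace X. F x : U}"
 proof (subst openin_subopen, intro ballI)
  fix f assume "f : {x : topspace X. F x : U}"
  hence f: "f : V" "F f : U" using X by auto
  then obtain e where e: "0 < e" "ball (F f) e \<subseteq> U" using U open_contains_ball by blast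
  define r where "r = e / (\<bar>C\<bar> + 1)"
  have r: "0 < r" "(\<bar>C\<bar> + 1) * r = e" using e(1) by (auto simp: r_def add_pos_nonneg divide_simps)
  let ?B = "{g : V. p (%x. g x - f x) < r}"
  have "?B \<subseteq> {x : topspace X. F x : U}"
  proof safe
   fix g assume g: "g : V" "p (%x. g x - f x) < r"
   have p0: "0 <= p (%x. g x - f x)" by (rule seminorm_nonneg[OF p V diff_closedD[OF V g(1) f(1)]])
   have "dist (F g) (F f) <= (\<bar>C\<bar> + 1) * p (%x. g x - f x)"
    by (rule order_trans[OF C[OF f(1) g(1)] mult_right_mono]) (use p0 in auto)
   also have "... < e" using g(2) r(2) by (metis abs_ge_zero add_nonneg_pos mult_strict_left_mono zero_less_one)
   finally show "F g : U" using e(2) by (auto simp: dist_commute)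
  qed (use X in auto)
  moreover have "f : ?B" using f(1) r(1) seminorm_onD(3)[OF p f(1)] by simp
  ultimately show "\<exists>T. openin X T \<and> f : T \<and> T \<subseteq> {x : topspace X. F x : U}" using op[OF f(1) r(1)] by blast
 qed
qed simp

lemma lc_continuous_dist:
 fixes F :: "('i => complex) => 'm::metric_space"
 assumes V: "diff_closed V" and p: "seminorm_on V p" "p : P"
  and C: "!!f g. f : V ==> g : V ==> dist (F g) (F f) <= C * p (%x. g x - f x)"
 shows "continuous_map (lc_topology V P) euclidean F"
proof (rule continuous_map_of_balls[OF topspace_lc V p(1) _ C])
 show "openin (lc_topology V P) {g : V. p (%x. g x - f x) < r}" if "f : V" "0 < r" for f r
  unfolding lc_topology_def using that p(2) by (intro topology_generated_by_Basis) blast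
qed

lemma lc_continuous:
 assumes V: "diff_closed V" and W: "diff_closed W" and T: "!!f. f : V ==> T f : W"
  and TD: "!!f g. f : V ==> g : V ==> T (%x. f x - g x) = (%x. T f x - T g x)"
  and Q: "!!q. q : Q ==> seminorm_on W q"
  and b: "!!q. q : Q ==> \<exists>p\<in>P. seminorm_on V p \<and> (\<exists>C. \<forall>f\<in>V. q (T f) <= C * p f)"
 shows "continuous_map (lc_topology V P) (lc_topology W Q) T"
 unfolding lc_topology_def[of W]
proof (rule continuous_on_generated_topo)
 fix U assume "U : insert W {{g : W. p (%x. g x - f x) < r} | p f r. p : Q \<and> f : W \<and> 0 < r}"
 then consider "U = W" | q f r where "U = {g : W. q (%x. g x - f x) < r}" "q : Q" "f : W" by blast
 thus "openin (lc_topology V P) (T -` U \<inter> topspace (lc_topology V P))"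
 proof cases
  case 1
  hence "T -` U \<inter> topspace (lc_topology V P) = topspace (lc_topology V P)" using T by auto
  thus ?thesis by (metis openin_topspace)
 next
  case 2
  obtain p C where p: "p : P" "seminorm_on V p" "!!f. f : V ==> q (T f) <= C * p f" using b[OF 2(2)] by blast
  have "continuous_map (lc_topology V P) euclidean (%g. q (%x. T g x - f x))"
  proof (rule lc_continuous_dist[OF V p(2,1)])
   fix a c assume ac: "a : V" "c : V"
   have "dist (q (%x. T c x - f x)) (q (%x. T a x - f x)) <= q (%x. (T c x - f x) - (T a x - f x))"
    unfolding dist_real_def
    by (rule seminorm_on_diff(3)[OF Q[OF 2(2)] W _ _ 2(3)]) (intro diff_closedD[OF W] T ac 2(3))+
   also have "... = q (T (%x. c x - a x))" using TD[OF ac(2,1)] by simp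
   also have "... <= C * p (%x. c x - a x)" by (rule p(3)[OF diff_closedD[OF V ac(2,1)]])
   finally show "dist (q (%x. T c x - f x)) (q (%x. T a x - f x)) <= C * p (%x. c x - a x)" .
  qed
  from openin_continuous_map_preimage[OF this, of "{..<r}"]
  have "openin (lc_topology V P) {g : V. q (%x. T g x - f x) < r}" by simp
  moreover have "T -` U \<inter> topspace (lc_topology V P) = {g : V. q (%x. T g x - f x) < r}" using 2(1) T by auto
  ultimately show ?thesis by simp
 qed
qed (use T in auto)

section \<open>Step spaces, and continuity of functionals as boundedness\<close>

lemma gs_step_arith:
 assumes h: "0 < h" and f: "f : gs_step s sr h"
 shows "g : gs_step s sr h ==> (%x. f x + g x) \<in> gs_step s sr h" "(%x. c * f x) \<in> gs_step s sr h"
  "g : gs_step s sr h ==> (%x. f x - g x) \<in> gs_step s sr h"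
 using f unfolding mem_gs_step_iff[OF h] by (blast intro: gsb_add gsb_scale gsb_diff)+

lemma gs_step_zero: "0 < h ==> (%_. 0) \<in> gs_step s sr h"
 using gsb_zero by (auto simp: mem_gs_step_iff)

lemma gs_step_diff_closed: "0 < h ==> diff_closed (gs_step s sr h)"
 unfolding diff_closed_def by (blast intro: gs_step_arith(3))

lemma gsc_diff_closed: "diff_closed (gsc R s sr)"
 by (simp add: diff_closed_def gsc_diff)

lemma gsc_iff: "f : gsc R s sr \<longleftrightarrow> (if R then \<exists>h>0. f : gs_step s sr h else \<forall>h>0. f : gs_step s sr h)"
 by (auto simp: gsc_def gs_roumieu_def gs_beurling_def)

lemma gs_norm_seminorm:
 assumes h: "0 < h"
 shows "seminorm_on (gs_step s sr h) (gsn s sr h)"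
proof -
 let ?N = "gsn s sr h"
 note b = gsb_gs_norm[OF h, of _ s sr] and le = gs_norm_le[OF h, of s sr]
 have sc: "?N (%x. c * f x) <= cmod c * ?N f" if "f : gs_step s sr h" for c f by (rule le[OF gsb_scale[OF b[OF that]]])
 have "?N (%x. c * f x) = cmod c * ?N f" if f: "f : gs_step s sr h" for c f
 proof (cases "c = 0")
  case True
  have "0 <= ?N (%_. 0)" by (rule gsbD(2)[OF b[OF gs_step_zero[OF h]]])
  thus ?thesis using True le[OF gsb_zero] by simp
 next
  case False
  have "?N f <= cmod (1 / c) * ?N (%x. c * f x)" using sc[OF gs_step_arith(2)[OF h f], of "1 / c" c] False by simp
  hence "cmod c * ?N f <= ?N (%x. c * f x)" using False by (simp add: norm_divide field_simps)
  thus ?thesis using sc[OF f, of c] by simp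
 qed
 thus ?thesis unfolding seminorm_on_def using le[OF gsb_add[OF b b]] by blast
qed

lemma lin_diff:
 assumes u: "lfun V u" and V: "!!f. f : V ==> (%x. - 1 * f x) \<in> V" and f: "f : V" "g : V"
 shows "u (%x. f x - g x) = u f - u g"
proof -
 have "u (%x. f x + (- 1 * g x)) = u f + u (%x. - 1 * g x)" by (rule u[unfolded lfun_def, THEN conjunct1, rule_format, OF f(1) V[OF f(2)]])
 moreover have "u (%x. - 1 * g x) = - 1 * u g" by (rule u[unfolded lfun_def, THEN conjunct2, rule_format, OF f(2)])
 ultimately show ?thesis by simp
qed

lemma step_limitin_zero:
 assumes h: "0 < h" and g: "!!n. g n : gs_step s sr h" and ev: "eventually (%n. gsb s sr h (rsuc n) (g n)) sequentially"
 shows "limitin (gs_step_topology s sr h) g (%_. 0) sequentially"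
 unfolding gs_step_topology_def
proof (rule lc_limitin[OF gs_step_diff_closed[OF h] _ gs_step_zero[OF h] g])
 fix p assume "p : {gsn s sr h}"
 hence p: "p = gsn s sr h" by simp
 have "eventually (%n. norm (p (g n)) <= rsuc n) sequentially"
  using ev by (rule eventually_mono) (use gs_norm_le[OF h] gsbD(2)[OF gsb_gs_norm[OF h g]] in \<open>simp add: p\<close>)
 from Lim_null_comparison[OF this LIMSEQ_inverse_real_of_nat] show "(%n. p (%x. g n x - 0)) \<longlonglongrightarrow> 0" by simp
qed (use gs_norm_seminorm[OF h] in simp)

text \<open>Rescaling to the value 1 turns unboundedness into a sequence with constants 1 / (n + 1)
  on which \<open>u\<close> does not tend to 0. The scales may vary: a constant one serves a step
  space, a null sequence the Beurling class.\<close>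

lemma unbounded_functional_sequence:
 assumes k: "!!n :: nat. 0 < k n" and sc: "!!f c. f : V ==> u (%x. c * f x) = c * u f"
  and unb: "!!n. \<exists>f\<in>V. \<exists>c. gsb s sr (k n) c f \<and> \<not> cmod (u f) <= real (Suc n) * c"
  and V: "!!f c. f : V ==> (%x. c * f x) \<in> V"
 obtains g where "!!n. g n : V" "!!n. gsb s sr (k n) (rsuc n) (g n)" "!!n. u (g n) = 1"
proof -
 have "\<exists>g\<in>V. gsb s sr (k n) (rsuc n) g \<and> u g = 1" for n
 proof -
  obtain f c where f: "f : V" "gsb s sr (k n) c f" "real (Suc n) * c < cmod (u f)" using unb[of n] by (auto simp: not_le)
  have c: "0 <= c" using gsbD(2)[OF f(2)] .
  hence u: "0 < cmod (u f)" using f(3) by (meson le_less_trans mult_nonneg_nonneg of_nat_0_le_iff)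
  have b: "gsb s sr (k n) (cmod (1 / u f) * c) (%x. 1 / u f * f x)" by (rule gsb_scale[OF f(2)])
  have le: "cmod (1 / u f) * c <= rsuc n" using f(3) u by (simp add: norm_divide field_simps)
  have "gsb s sr (k n) (rsuc n) (%x. 1 / u f * f x)" by (rule gsb_mono[OF b k order_refl le])
  thus ?thesis using V[OF f(1), of "1 / u f"] sc[OF f(1), of "1 / u f"] u by (intro bexI[of _ "%x. 1 / u f * f x"]) auto
 qed
 then obtain g where "!!n. g n : V \<and> gsb s sr (k n) (rsuc n) (g n) \<and> u (g n) = 1" by metis
 thus thesis by (intro that[of g]) auto
qed

lemma mem_step_dual:
 assumes h: "0 < h"
 shows "w : continuous_dual (gs_step_topology s sr h) \<longleftrightarrow> lfun (gs_step s sr h) w \<and> (\<forall>f. f \<notin> gs_step s sr h --> w f = 0) \<and>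
  (\<exists>D. \<forall>c f. gsb s sr h c f --> cmod (w f) <= D * c)"
proof -
 let ?X = "gs_step s sr h"
 have top: "topspace (gs_step_topology s sr h) = ?X" by (simp add: gs_step_topology_def)
 have "(\<exists>D. \<forall>c f. gsb s sr h c f --> cmod (w f) <= D * c) \<longleftrightarrow> continuous_map (gs_step_topology s sr h) euclidean w"
  if lin: "lfun ?X w"
 proof
  assume "\<exists>D. \<forall>c f. gsb s sr h c f --> cmod (w f) <= D * c"
  then obtain D where D: "!!c f. gsb s sr h c f ==> cmod (w f) <= D * c" by blast
  show "continuous_map (gs_step_topology s sr h) euclidean w"
   unfolding gs_step_topology_def
  proof (rule lc_continuous_dist[OF gs_step_diff_closed[OF h] gs_norm_seminorm[OF h]])
   fix f g assume f: "f : ?X" "g : ?X"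
   show "dist (w g) (w f) <= D * gsn s sr h (%x. g x - f x)"
    using D[OF gsb_gs_norm[OF h gs_step_arith(3)[OF h f(2,1)]]] lin_diff[OF lin gs_step_arith(2)[OF h] f(2,1)] by (simp add: dist_norm)
  qed simp
 next
  assume cont: "continuous_map (gs_step_topology s sr h) euclidean w"
  show "\<exists>D. \<forall>c f. gsb s sr h c f --> cmod (w f) <= D * c"
  proof (rule ccontr)
   assume n: "\<not> ?thesis"
   have unb: "\<exists>f\<in>?X. \<exists>c. gsb s sr h c f \<and> \<not> cmod (w f) <= real (Suc n) * c" for n
    using n mem_gs_step_iff[OF h, of _ s sr] by blast
   obtain g where g: "!!n. g n : ?X" "!!n. gsb s sr h (rsuc n) (g n)" "!!n. w (g n) = 1"
    using unbounded_functional_sequence[where V="?X" and u=w and s=s and sr=sr and k="%_. h", OF h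
     lin[unfolded lfun_def, THEN conjunct2, rule_format] unb gs_step_arith(2)[OF h]] by blast
   have "limitin (gs_step_topology s sr h) g (%_. 0) sequentially" by (rule step_limitin_zero[OF h g(1)]) (use g(2) in simp)
   from continuous_map_limit[OF cont this] have "(%n. w (g n)) \<longlonglongrightarrow> w (%_. 0)" by (simp add: limitin_canonical_iff comp_def)
   moreover have "w (%_. 0) = 0" using lin_diff[OF lin gs_step_arith(2)[OF h] gs_step_zero[OF h] gs_step_zero[OF h]] by simp
   ultimately show False using LIMSEQ_unique[of "%n. w (g n)" 0 1] g(3) by simp
  qed
 qed
 thus ?thesis unfolding continuous_dual_def top by blast
qed

definition "gs_dual R s sr = (if R then gs_roumieu_dual s sr else gs_beurling_dual s sr)"
definition "gs_dual_top R s sr = (if R then gs_roumieu_dual_topology s sr else gs_beurling_dual_topology s sr)"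

lemma topspace_proj:
 assumes "i : I" "!!i. i : I ==> j i ` V \<subseteq> topspace (X i)"
 shows "topspace (projective_limit_topology V I X j) = V"
proof -
 have "openin (pullback_topology V (j i) (X i)) V"
  using assms openin_topspace[of "pullback_topology V (j i) (X i)"] by (simp add: topspace_pullback_topology inf.absorb2 image_subset_iff_subset_vimage)
 moreover have "U \<subseteq> V" if "openin (pullback_topology V (j i) (X i)) U" for i U using that by (auto simp: openin_pullback_topology)
 ultimately show ?thesis unfolding projective_limit_topology_def topology_generated_by_topspace using assms(1) by blast
qed

lemma proj_continuous:
 assumes i: "i : I" and j: "!!i. i : I ==> j i ` V \<subseteq> topspace (X i)"
 shows "continuous_map (projective_limit_topology V I X j) (X i) (j i)"
 unfolding continuous_map_def
proof (intro conjI allI impI)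
 let ?T = "projective_limit_topology V I X j"
 have top: "topspace ?T = V" by (rule topspace_proj[OF i j])
 show "j i : topspace ?T \<rightarrow> topspace (X i)" using j[OF i] unfolding top by auto
 fix U assume U: "openin (X i) U"
 have "{x : topspace ?T. j i x : U} = j i -` U \<inter> V" unfolding top by auto
 thus "openin ?T {x : topspace ?T. j i x : U}"
  unfolding projective_limit_topology_def using i U by (intro topology_generated_by_Basis) (auto simp: openin_pullback_topology)
qed

lemma proj_limitin:
 assumes i: "i0 : I" and j: "!!i. i : I ==> j i ` V \<subseteq> topspace (X i)" and u: "u : V" "!!n. v n : V"
  and lim: "!!i. i : I ==> limitin (X i) (%n. j i (v n)) (j i u) F"
 shows "limitin (projective_limit_topology V I X j) v u F"
proof -
 have uS: "u : \<Union>{U. \<exists>i\<in>I. openin (pullback_topology V (j i) (X i)) U}"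
  using topspace_proj[OF i j] u(1) unfolding projective_limit_topology_def topology_generated_by_topspace by simp
 show ?thesis unfolding projective_limit_topology_def
 proof (rule generated_limitin[OF uS])
  fix U assume "U : {U. \<exists>i\<in>I. openin (pullback_topology V (j i) (X i)) U}" and uU: "u : U"
  then obtain i U' where i: "i : I" "openin (X i) U'" "U = j i -` U' \<inter> V" by (auto simp: openin_pullback_topology)
  hence "eventually (%n. j i (v n) \<in> U') F" using lim[OF i(1)] uU unfolding limitin_def by blast
  thus "eventually (%n. v n : U) F" by (rule eventually_mono) (use i(3) u(2) in auto)
 qed
qed

lemma continuous_map_into_proj:
 assumes j: "!!i. i : I ==> j i ` V \<subseteq> topspace (X i)" and i: "i0 : I" and T: "!!x. x : topspace Y ==> T x : V"
  and c: "!!i. i : I ==> continuous_map Y (X i) (%x. j i (T x))"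
 shows "continuous_map Y (projective_limit_topology V I X j) T"
 unfolding projective_limit_topology_def
proof (rule continuous_on_generated_topo)
 fix U assume "U : {U. \<exists>i\<in>I. openin (pullback_topology V (j i) (X i)) U}"
 then obtain i U' where i: "i : I" "openin (X i) U'" "U = j i -` U' \<inter> V" by (auto simp: openin_pullback_topology)
 have "T -` U \<inter> topspace Y = {x : topspace Y. j i (T x) \<in> U'}" using i(3) T by auto
 thus "openin Y (T -` U \<inter> topspace Y)" using openin_continuous_map_preimage[OF c[OF i(1)] i(2)] by simp
next
 have eq: "\<Union> {U. \<exists>i\<in>I. openin (pullback_topology V (j i) (X i)) U} = V"
  using topspace_proj[OF i j] unfolding projective_limit_topology_def topology_generated_by_topspace .
 show "T ` topspace Y \<subseteq> \<Union> {U. \<exists>i\<in>I. openin (pullback_topology V (j i) (X i)) U}" unfolding eq using T by blast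
qed

lemma gsf_level:
 assumes u: "gsf R s sr u" and R: R and h: "0 < h"
 obtains D where "0 <= D" "!!c f. gsb s sr h c f ==> cmod (u f) <= D * c"
proof -
 obtain h' D where h': "0 < h'" "h <= h'" "0 <= D" "!!g c. g : gsc R s sr ==> gsb s sr h' c g ==> cmod (u g) <= D * c"
  using gsfE[OF u h] R by metis
 show thesis by (rule that[OF h'(3)]) (rule h'(4)[OF gsc_roumieuI[OF R h] gsb_mono[OF _ h h'(2) order_refl]])
qed

text \<open>In the Roumieu class |u| is itself one of the seminorms defining the topology once
  \<open>u\<close> is bounded at each scale, and conversely continuity passes to the step spaces. In
  the Beurling class a sequence with scales and constants 1 / (n + 1) tends to 0 at every fixed
  scale, so a continuous \<open>u\<close> is bounded at one of these scales.\<close>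

lemma mem_gs_dual: "u : gs_dual R s sr \<longleftrightarrow> gsf R s sr u \<and> (\<forall>f. f \<notin> gsc R s sr --> u f = 0)"
proof (cases R)
 case True
 let ?V = "gsc R s sr"
 let ?P = "{p. seminorm_on ?V p \<and> (\<forall>h\<in>{0<..}. continuous_map (gs_step_topology s sr h) euclideanreal (p \<circ> (%f. f)))}"
 have V: "gs_roumieu s sr = ?V" using True by (simp add: gsc_def)
 have X: "gs_step s sr h \<subseteq> ?V" if "0 < h" for h using that True by (auto simp: gsc_iff)
 have top: "topspace (gs_roumieu_topology s sr) = ?V" by (simp add: gs_roumieu_topology_def inductive_limit_topology_def V)
 have "gsf R s sr u \<longleftrightarrow> continuous_map (gs_roumieu_topology s sr) euclidean u" if lin: "lfun ?V u"
 proof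
  assume F: "gsf R s sr u"
  let ?p = "%f. cmod (u f)"
  have sn: "seminorm_on ?V ?p"
   unfolding seminorm_on_def using lfun_add[OF lin] lfun_scale[OF lin] by (simp add: norm_triangle_ineq norm_mult)
  have c: "continuous_map (gs_step_topology s sr h) euclideanreal (?p \<circ> (%f. f))" if h: "0 < h" for h
  proof -
   obtain D where D: "!!c f. gsb s sr h c f ==> cmod (u f) <= D * c" using gsf_level[OF F True h] by metis
   show ?thesis unfolding gs_step_topology_def
   proof (rule lc_continuous_dist[OF gs_step_diff_closed[OF h] gs_norm_seminorm[OF h]])
    fix f g assume f: "f : gs_step s sr h" "g : gs_step s sr h"
    have "dist (?p g) (?p f) <= cmod (u (%x. g x - f x))"
     using lfun_diff[OF lin] f X[OF h] by (simp add: dist_real_def norm_triangle_ineq3 subset_iff)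
    also have "... <= D * gsn s sr h (%x. g x - f x)"
     by (rule D[OF gsb_gs_norm[OF h gs_step_arith(3)[OF h f(2,1)]]])
    finally show "dist ((?p \<circ> (%f. f)) g) ((?p \<circ> (%f. f)) f) <= D * gsn s sr h (%x. g x - f x)" by simp
   qed simp
  qed
  show "continuous_map (gs_roumieu_topology s sr) euclidean u"
   unfolding gs_roumieu_topology_def inductive_limit_topology_def V
  proof (rule lc_continuous_dist[OF gsc_diff_closed sn])
   show "?p : ?P" using sn c by simp
   show "dist (u g) (u f) <= 1 * ?p (%x. g x - f x)" if "f : ?V" "g : ?V" for f g
    using lfun_diff[OF lin that(2,1)] by (simp add: dist_norm)
  qed
 next
  assume cont: "continuous_map (gs_roumieu_topology s sr) euclidean u"
  have "\<exists>D. \<forall>c f. gsb s sr h c f --> cmod (u f) <= D * c" if h: "0 < h" for h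
  proof (rule ccontr)
   assume n: "\<not> ?thesis"
   have "\<exists>f\<in>gs_step s sr h. \<exists>c. gsb s sr h c f \<and> \<not> cmod (u f) <= real (Suc n) * c" for n
    using n mem_gs_step_iff[OF h, of _ s sr] by blast
   note unb = this
   have sc: "u (%x. c * f x) = c * u f" if "f : gs_step s sr h" for f c
    by (rule lfun_scale[OF lin]) (use X[OF h] that in blast)
   obtain g where g: "!!n. g n : gs_step s sr h" "!!n. gsb s sr h (rsuc n) (g n)" "!!n. u (g n) = 1"
    using unbounded_functional_sequence[where V="gs_step s sr h" and u=u and s=s and sr=sr and k="%_. h", OF h sc unb gs_step_arith(2)[OF h]] by blast
   have l: "limitin (gs_step_topology s sr h) g (%_. 0) sequentially" by (rule step_limitin_zero[OF h g(1)]) (use g(2) in simp)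
   have "limitin (gs_roumieu_topology s sr) g (%_. 0) sequentially"
    unfolding gs_roumieu_topology_def inductive_limit_topology_def V
   proof (rule lc_limitin[OF gsc_diff_closed _ gsc_zero])
    fix p assume "p : ?P"
    hence p: "seminorm_on ?V p" "continuous_map (gs_step_topology s sr h) euclideanreal (p \<circ> (%f. f))" using h by auto
    from continuous_map_limit[OF p(2) l] seminorm_onD(3)[OF p(1) gsc_zero] show "(%n. p (%x. g n x - 0)) \<longlonglongrightarrow> 0"
     by (simp add: limitin_canonical_iff comp_def)
   qed (use g(1) X[OF h] in auto)
   from continuous_map_limit[OF cont this] have "(%n. u (g n)) \<longlonglongrightarrow> u (%_. 0)" by (simp add: limitin_canonical_iff comp_def)
   moreover have "u (%_. 0) = 0" using lfun_scale[OF lin gsc_zero, of 0] by simp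
   ultimately show False using LIMSEQ_unique[of "%n. u (g n)" 0 1] g(3) by simp
  qed
  hence "\<exists>D\<ge>0. \<forall>g\<in>?V. \<forall>c. gsb s sr h c g --> cmod (u g) <= D * c" if "0 < h" for h
   using that by (metis abs_ge_self abs_ge_zero gsbD(2) mult_right_mono order_trans)
  thus "gsf R s sr u" unfolding gsf_def using lin by blast
 qed
 thus ?thesis using gsf_linear[of R s sr u] unfolding gs_dual_def gs_roumieu_dual_def continuous_dual_def top if_P[OF True] by blast
next
 case False
 let ?V = "gsc R s sr"
 have V: "gs_beurling s sr = ?V" using False by (simp add: gsc_def)
 have X: "?V \<subseteq> gs_step s sr h" if "0 < h" for h using that False by (auto simp: gsc_iff)
 have j: "(%f. f) ` gs_beurling s sr \<subseteq> topspace (gs_step_topology s sr h)" if "h : {0<..}" for h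
  using X that unfolding V by (auto simp: gs_step_topology_def)
 have top: "topspace (gs_beurling_topology s sr) = ?V"
  unfolding gs_beurling_topology_def by (subst topspace_proj[where i=1]) (use j V in auto)
 have "gsf R s sr u \<longleftrightarrow> continuous_map (gs_beurling_topology s sr) euclidean u" if lin: "lfun ?V u"
 proof
  assume F: "gsf R s sr u"
  obtain h D where h: "0 < h" and D: "!!g c. g : ?V ==> gsb s sr h c g ==> cmod (u g) <= D * c"
   using gsfE[OF F zero_less_one] by metis
  have sn: "seminorm_on ?V (gsn s sr h)"
   using gs_norm_seminorm[OF h, of s sr] X[OF h] unfolding seminorm_on_def by blast
  show "continuous_map (gs_beurling_topology s sr) euclidean u"
  proof (rule continuous_map_of_balls[OF top gsc_diff_closed sn])
   fix f and r :: real assume f: "f : ?V" "0 < r"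
   have "openin (gs_step_topology s sr h) {g : gs_step s sr h. gsn s sr h (%x. g x - f x) < r}"
    unfolding gs_step_topology_def lc_topology_def using f X[OF h] by (intro topology_generated_by_Basis) blast
   moreover have "continuous_map (gs_beurling_topology s sr) (gs_step_topology s sr h) (%f. f)"
    unfolding gs_beurling_topology_def by (rule proj_continuous[where j="%_ f. f", OF _ j]) (use h in auto)
   ultimately have "openin (gs_beurling_topology s sr) {g : ?V. g : {g : gs_step s sr h. gsn s sr h (%x. g x - f x) < r}}"
    using openin_continuous_map_preimage unfolding top[symmetric] by fastforce
   moreover have "{g : ?V. g : {g : gs_step s sr h. gsn s sr h (%x. g x - f x) < r}} = {g : ?V. gsn s sr h (%x. g x - f x) < r}"
    using X[OF h] by auto
   ultimately show "openin (gs_beurling_topology s sr) {g : ?V. gsn s sr h (%x. g x - f x) < r}" by simp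
  next
   fix f g assume f: "f : ?V" "g : ?V"
   show "dist (u g) (u f) <= D * gsn s sr h (%x. g x - f x)"
    using D[OF gsc_diff[OF f(2,1)] gsb_gs_norm[OF h]] X[OF h] gsc_diff[OF f(2,1)] lfun_diff[OF lin f(2,1)]
    by (auto simp: dist_norm)
  qed
 next
  assume cont: "continuous_map (gs_beurling_topology s sr) euclidean u"
  have "\<exists>n. \<forall>f\<in>?V. \<forall>c. gsb s sr (rsuc n) c f --> cmod (u f) <= real (Suc n) * c"
  proof (rule ccontr)
   assume n: "\<not> ?thesis"
   hence unb: "\<exists>f\<in>?V. \<exists>c. gsb s sr (rsuc n) c f \<and> \<not> cmod (u f) <= real (Suc n) * c" for n by blast
   have k: "0 < rsuc n" for n by simp
   obtain g where g: "!!n. g n : ?V" "!!n. gsb s sr (rsuc n) (rsuc n) (g n)" "!!n. u (g n) = 1"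
    using unbounded_functional_sequence[where V="?V" and u=u and s=s and sr=sr and k="%n. rsuc n", OF k lfun_scale[OF lin] unb gsc_scale] by blast
   have "limitin (gs_beurling_topology s sr) g (%_. 0) sequentially"
    unfolding gs_beurling_topology_def
   proof (rule proj_limitin[where j="%_ f. f" and ?i0.0=1, OF _ j])
    fix h :: real assume "h : {0<..}"
    hence h: "0 < h" by simp
    have "eventually (%n. rsuc n < h) sequentially" using order_tendstoD(2)[OF LIMSEQ_inverse_real_of_nat h] .
    hence "eventually (%n. gsb s sr h (rsuc n) (g n)) sequentially"
     by (rule eventually_mono) (rule gsb_mono[OF g(2)], auto)
    thus "limitin (gs_step_topology s sr h) g (%_. 0) sequentially" using X[OF h] g(1) by (intro step_limitin_zero[OF h]) auto
   qed (use g(1) V gsc_zero in auto)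
   from continuous_map_limit[OF cont this] have "(%n. u (g n)) \<longlonglongrightarrow> u (%_. 0)" by (simp add: limitin_canonical_iff comp_def)
   moreover have "u (%_. 0) = 0" using lfun_scale[OF lin gsc_zero, of 0] by simp
   ultimately show False using LIMSEQ_unique[of "%n. u (g n)" 0 1] g(3) by simp
  qed
  then obtain n where "\<forall>f\<in>?V. \<forall>c. gsb s sr (rsuc n) c f --> cmod (u f) <= real (Suc n) * c" by blast
  thus "gsf R s sr u" unfolding gsf_def using lin False
   by (intro conjI allI impI exI[of _ "rsuc n"] exI[of _ "real (Suc n)"]) auto
 qed
 thus ?thesis using gsf_linear[of R s sr u] unfolding gs_dual_def gs_beurling_dual_def continuous_dual_def top if_not_P[OF False] by blast
qed

section \<open>Norms on the duals of the step spaces\<close>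

abbreviation "step_dual s sr h \<equiv> continuous_dual (gs_step_topology s sr h)"
abbreviation "step_dual_norm s sr h \<equiv> dual_norm (gs_step s sr h) (gsn s sr h)"

lemma step_dual_norm_ge:
 assumes h: "0 < h" and w: "w : step_dual s sr h" and f: "gsb s sr h c f"
 shows "cmod (w f) <= step_dual_norm s sr h w * c"
proof -
 obtain D where D: "!!c f. gsb s sr h c f ==> cmod (w f) <= D * c" using w unfolding mem_step_dual[OF h] by blast
 have bdd: "bdd_above {cmod (w f) | f. f : gs_step s sr h \<and> gsn s sr h f <= 1}"
  by (rule bdd_aboveI[of _ "D * 1"]) (use D gsb_mono[OF gsb_gs_norm[OF h] h order_refl, of _ s sr 1] in blast)
 have key: "cmod (w f) <= step_dual_norm s sr h w" if "gsb s sr h 1 f" for f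
  unfolding dual_norm_def by (rule cSup_upper[OF _ bdd]) (use that gs_norm_le[OF h that] mem_gs_step_iff[OF h] in blast)
 show ?thesis
 proof (cases "c = 0")
  case True
  thus ?thesis using D[OF f] by simp
 next
  case False
  hence c: "0 < c" using gsbD(2)[OF f] by simp
  have b1: "gsb s sr h 1 (%x. of_real (1 / c) * f x)" using gsb_scale[OF f, of "of_real (1 / c)"] c by (simp add: norm_divide)
  have fX: "f : gs_step s sr h" using f mem_gs_step_iff[OF h, of f s sr] by blast
  have "w (%x. of_real (1 / c) * f x) = of_real (1 / c) * w f"
   by (rule w[unfolded mem_step_dual[OF h] lfun_def, THEN conjunct1, THEN conjunct2, rule_format, OF fX])
  hence "cmod (of_real (1 / c) * w f) <= step_dual_norm s sr h w" using key[OF b1] by simp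
  thus ?thesis using c by (simp add: norm_mult norm_divide field_simps)
 qed
qed

lemma step_dual_norm_le:
 assumes h: "0 < h" and D: "!!f. gsb s sr h 1 f ==> cmod (w f) <= D"
 shows "step_dual_norm s sr h w <= D"
 unfolding dual_norm_def
proof (rule cSup_least)
 have "gsn s sr h (%_. 0) <= 1" using gs_norm_le[OF h gsb_zero, of s sr] by simp
 thus "{cmod (w f) | f. f : gs_step s sr h \<and> gsn s sr h f <= 1} ~= {}" using gs_step_zero[OF h] by blast
 fix r assume "r : {cmod (w f) | f. f : gs_step s sr h \<and> gsn s sr h f <= 1}"
 thus "r <= D" using D gsb_mono[OF gsb_gs_norm[OF h] h order_refl, of _ s sr 1] by blast
qed

lemma lfun_comb:
 assumes "lfun V u" "lfun V v"
 shows "lfun V (%f. u f - v f)" "lfun V (%f. c * u f)"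
 using assms unfolding lfun_def by (simp_all add: algebra_simps)

lemma step_dual_closed:
 assumes h: "0 < h"
 shows "diff_closed (step_dual s sr h)" "w : step_dual s sr h ==> (%f. c * w f) \<in> step_dual s sr h"
proof -
 show "diff_closed (step_dual s sr h)"
  unfolding diff_closed_def mem_step_dual[OF h]
 proof (intro ballI conjI, unfold mem_step_dual[OF h])
  fix u v assume u: "lfun (gs_step s sr h) u \<and> (\<forall>f. f \<notin> gs_step s sr h --> u f = 0) \<and> (\<exists>D. \<forall>c f. gsb s sr h c f --> cmod (u f) <= D * c)"
   and v: "lfun (gs_step s sr h) v \<and> (\<forall>f. f \<notin> gs_step s sr h --> v f = 0) \<and> (\<exists>D. \<forall>c f. gsb s sr h c f --> cmod (v f) <= D * c)"
  show "lfun (gs_step s sr h) (%f. u f - v f)" using lfun_comb(1) u v by blast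
  show "\<forall>f. f \<notin> gs_step s sr h --> u f - v f = 0" using u v by simp
  obtain D D' where "!!c f. gsb s sr h c f ==> cmod (u f) <= D * c" "!!c f. gsb s sr h c f ==> cmod (v f) <= D' * c" using u v by blast
  hence "cmod (u f - v f) <= (D + D') * c" if "gsb s sr h c f" for c f
   using that order_trans[OF norm_triangle_ineq4 add_mono] by (metis distrib_right)
  thus "\<exists>D. \<forall>c f. gsb s sr h c f --> cmod (u f - v f) <= D * c" by blast
 qed
 assume w: "w : step_dual s sr h"
 then obtain D where "!!c f. gsb s sr h c f ==> cmod (w f) <= D * c" unfolding mem_step_dual[OF h] by blast
 hence "cmod (c * w f) <= (cmod c * D) * a" if "gsb s sr h a f" for a f
  using that by (simp add: norm_mult mult.assoc mult_left_mono)
 thus "(%f. c * w f) \<in> step_dual s sr h" using w lfun_comb(2) unfolding mem_step_dual[OF h] by (metis mult_zero_right)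
qed

lemma step_dual_norm_seminorm:
 assumes h: "0 < h"
 shows "seminorm_on (step_dual s sr h) (step_dual_norm s sr h)"
proof -
 let ?N = "step_dual_norm s sr h"
 note ge = step_dual_norm_ge[OF h] and le = step_dual_norm_le[OF h]
 have add: "?N (%f. v f + w f) <= ?N v + ?N w" if "v : step_dual s sr h" "w : step_dual s sr h" for v w
  by (rule le) (use order_trans[OF norm_triangle_ineq add_mono[OF ge[OF that(1)] ge[OF that(2)]]] in fastforce)
 have sc: "?N (%f. c * w f) <= cmod c * ?N w" if "w : step_dual s sr h" for c w
  by (rule le) (use mult_left_mono[OF ge[OF that], of _ _ "cmod c"] in \<open>fastforce simp: norm_mult\<close>)
 have "?N (%f. c * w f) = cmod c * ?N w" if w: "w : step_dual s sr h" for c w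
 proof (cases "c = 0")
  case True
  have "gsb s sr h 1 (%_. 0)" by (rule gsb_mono[OF gsb_zero h order_refl]) simp
  from ge[OF step_dual_closed(2)[OF h w, of c] this] have "0 <= ?N (%f. c * w f)" by (metis mult_1_right norm_ge_zero order_trans)
  thus ?thesis using sc[OF w, of c] True by simp
 next
  case False
  have "?N (%f. 1 / c * (c * w f)) <= cmod (1 / c) * ?N (%f. c * w f)" by (rule sc[OF step_dual_closed(2)[OF h w]])
  hence "cmod c * ?N w <= ?N (%f. c * w f)" using False by (simp add: norm_divide field_simps)
  thus ?thesis using sc[OF w, of c] by simp
 qed
 thus ?thesis unfolding seminorm_on_def using add by blast
qed

lemma topspace_step_dual [simp]: "topspace (step_dual_top s sr h) = step_dual s sr h"
 by (simp add: gs_step_dual_topology_def)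

lemma step_dual_limitin:
 assumes h: "0 < h" and m: "!!n. v n : step_dual s sr h" "u : step_dual s sr h"
  and b: "eventually (%n. \<forall>f. gsb s sr h 1 f --> cmod (v n f - u f) <= rsuc n) sequentially"
 shows "limitin (step_dual_top s sr h) v u sequentially"
 unfolding gs_step_dual_topology_def
proof (rule lc_limitin[OF step_dual_closed(1)[OF h] _ m(2,1)])
 fix p assume "p : {step_dual_norm s sr h}"
 hence p: "p = step_dual_norm s sr h" by simp
 have nn: "0 <= p (%x. v n x - u x)" for n unfolding p
  by (rule seminorm_nonneg[OF step_dual_norm_seminorm[OF h] step_dual_closed(1)[OF h] diff_closedD[OF step_dual_closed(1)[OF h] m(1,2)]])
 have "eventually (%n. norm (p (%x. v n x - u x)) <= rsuc n) sequentially"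
  using b
 proof (rule eventually_mono)
  fix n assume "\<forall>f. gsb s sr h 1 f --> cmod (v n f - u f) <= rsuc n"
  hence "p (%x. v n x - u x) <= rsuc n" unfolding p by (intro step_dual_norm_le[OF h]) blast
  thus "norm (p (%x. v n x - u x)) <= rsuc n" using nn[of n] by simp
 qed
 from Lim_null_comparison[OF this LIMSEQ_inverse_real_of_nat] show "(%n. p (%x. v n x - u x)) \<longlonglongrightarrow> 0" .
qed (use step_dual_norm_seminorm[OF h] in simp)

lemma step_transpose:
 assumes h: "0 < h" and h': "0 < h'"
  and add: "!!f g. f : gs_step t ta h ==> g : gs_step t ta h ==> A (%x. f x + g x) = (%x. A f x + A g x)"
  and sc: "!!f c. f : gs_step t ta h ==> A (%x. c * f x) = (%x. c * A f x)"
  and bd: "!!ph c. gsb t ta h c ph ==> gsb s sr h' (P * c) (A ph)"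
 shows "w : step_dual s sr h' ==> restr (gs_step t ta h) (%ph. w (A ph)) : step_dual t ta h"
  and "continuous_map (step_dual_top s sr h') (step_dual_top t ta h) (%w. restr (gs_step t ta h) (%ph. w (A ph)))"
proof -
 have Am: "A f : gs_step s sr h'" if "f : gs_step t ta h" for f
  using that bd unfolding mem_gs_step_iff[OF h] mem_gs_step_iff[OF h'] by blast
 have X: "f : gs_step t ta h" if "gsb t ta h c f" for f c using that mem_gs_step_iff[OF h] by blast
 show m: "restr (gs_step t ta h) (%ph. w (A ph)) : step_dual t ta h" if w: "w : step_dual s sr h'" for w
 proof -
  obtain D where D: "!!c f. gsb s sr h' c f ==> cmod (w f) <= D * c" using w unfolding mem_step_dual[OF h'] by blast
  have lin: "lfun (gs_step s sr h') w" using w unfolding mem_step_dual[OF h'] by blast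
  have "w (A (%x. f x + g x)) = w (A f) + w (A g)" if "f : gs_step t ta h" "g : gs_step t ta h" for f g
   unfolding add[OF that] by (rule lin[unfolded lfun_def, THEN conjunct1, rule_format, OF Am[OF that(1)] Am[OF that(2)]])
  moreover have "w (A (%x. c * f x)) = c * w (A f)" if "f : gs_step t ta h" for f c
   unfolding sc[OF that] by (rule lin[unfolded lfun_def, THEN conjunct2, rule_format, OF Am[OF that]])
  ultimately have L: "lfun (gs_step t ta h) (restr (gs_step t ta h) (%ph. w (A ph)))"
   unfolding lfun_def restr_def using gs_step_arith(1,2)[OF h, of _ t ta] by simp
  have B: "cmod (restr (gs_step t ta h) (%ph. w (A ph)) f) <= (D * P) * c" if "gsb t ta h c f" for c f
   using D[OF bd[OF that]] X[OF that] by (simp add: restr_def mult.assoc)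
  show ?thesis unfolding mem_step_dual[OF h]
   by (intro conjI exI[of _ "D * P"] allI impI L B) (simp_all add: restr_def)
 qed
 show "continuous_map (step_dual_top s sr h') (step_dual_top t ta h) (%w. restr (gs_step t ta h) (%ph. w (A ph)))"
  unfolding gs_step_dual_topology_def
 proof (rule lc_continuous[OF step_dual_closed(1)[OF h'] step_dual_closed(1)[OF h] m])
  fix q assume "q : {step_dual_norm t ta h}"
  hence q: "q = step_dual_norm t ta h" by simp
  show "seminorm_on (step_dual t ta h) q" unfolding q by (rule step_dual_norm_seminorm[OF h])
  have "q (restr (gs_step t ta h) (%ph. w (A ph))) <= P * step_dual_norm s sr h' w" if "w : step_dual s sr h'" for w
   unfolding q
  proof (rule step_dual_norm_le[OF h])
   fix f assume f: "gsb t ta h 1 f"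
   show "cmod (restr (gs_step t ta h) (%ph. w (A ph)) f) <= P * step_dual_norm s sr h' w"
    using step_dual_norm_ge[OF h' that bd[OF f]] X[OF f] by (simp add: restr_def mult.commute)
  qed
  thus "\<exists>p\<in>{step_dual_norm s sr h'}. seminorm_on (step_dual s sr h') p \<and> (\<exists>C. \<forall>f\<in>step_dual s sr h'. q (restr (gs_step t ta h) (%ph. f (A ph))) <= C * p f)"
   using step_dual_norm_seminorm[OF h'] by blast
 qed (auto simp: restr_def fun_eq_iff)
qed

section \<open>The limit topologies of the duals and transposed operators\<close>

lemma gs_dual_top_roumieu: "gs_dual_top True s sr = projective_limit_topology (gs_dual True s sr) {0<..} (step_dual_top s sr) (%h. restr (gs_step s sr h))"
 by (simp add: gs_dual_top_def gs_dual_def gs_roumieu_dual_topology_def)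

abbreviation "beurling_seminorms s sr \<equiv> {p. seminorm_on (gs_dual False s sr) p \<and>
 (\<forall>h\<in>{0<..}. continuous_map (step_dual_top s sr h) euclideanreal (p \<circ> restr (gsc False s sr)))}"

lemma gs_dual_top_beurling: "gs_dual_top False s sr = lc_topology (gs_dual False s sr) (beurling_seminorms s sr)"
 by (simp add: gs_dual_top_def gs_dual_def gsc_def gs_beurling_dual_topology_def inductive_limit_topology_def)

lemma gsc_step: "0 < h ==> gs_step s sr h \<subseteq> gsc True s sr" "0 < h ==> gsc False s sr \<subseteq> gs_step s sr h"
 by (auto simp: gsc_iff)

lemma linear_functional_restrict:
 assumes "lfun V u" "W \<subseteq> V" "!!f g. f : W ==> g : W ==> (%x. f x + g x) \<in> W" "!!f c. f : W ==> (%x. c * f x) \<in> W"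
 shows "lfun W (restr W u)"
 using assms unfolding lfun_def restr_def by (simp add: subset_iff)

lemma restrict_step_dual:
 assumes h: "0 < h" and u: "u : gs_dual True s sr"
 shows "restr (gs_step s sr h) u : step_dual s sr h"
proof -
 have F: "gsf True s sr u" using u by (simp add: mem_gs_dual)
 obtain D where D: "!!c f. gsb s sr h c f ==> cmod (u f) <= D * c" using gsf_level[OF F TrueI h] by metis
 show ?thesis unfolding mem_step_dual[OF h]
  using linear_functional_restrict[OF gsf_linear[OF F] gsc_step(1)[OF h] gs_step_arith(1)[OF h] gs_step_arith(2)[OF h]]
   D mem_gs_step_iff[OF h, of _ s sr] by (auto simp: restr_def)
qed

lemma beurling_dualI:
 assumes lin: "lfun (gsc False s sr) u" and off: "!!f. f \<notin> gsc False s sr ==> u f = 0"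
  and h: "0 < h" and bd: "!!g c. g : gsc False s sr ==> gsb s sr h c g ==> cmod (u g) <= D * c"
 shows "u : gs_dual False s sr"
proof -
 have "cmod (u g) <= \<bar>D\<bar> * c" if "g : gsc False s sr" "gsb s sr h c g" for g c
  using bd[OF that] mult_right_mono[OF abs_ge_self gsbD(2)[OF that(2)], of D] by linarith
 hence "\<exists>D\<ge>0. \<forall>g\<in>gsc False s sr. \<forall>c. gsb s sr h c g --> cmod (u g) <= D * c" by (meson abs_ge_zero)
 thus ?thesis unfolding mem_gs_dual gsf_def using lin off h by blast
qed

lemma restrict_step_image: "h : {0<..} ==> restr (gs_step s sr h) ` gs_dual True s sr \<subseteq> topspace (step_dual_top s sr h)"
 using restrict_step_dual by auto

lemma topspace_gs_dual_top [simp]: "topspace (gs_dual_top R s sr) = gs_dual R s sr"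
proof (cases R)
 case True
 thus ?thesis using topspace_proj[of 1 "{0<..}" "%h. restr (gs_step s sr h)" "gs_dual True s sr" "step_dual_top s sr", OF _ restrict_step_image]
  by (simp add: gs_dual_top_roumieu)
qed (simp add: gs_dual_top_beurling)

lemma roumieu_restrict_continuous:
 "0 < h ==> continuous_map (gs_dual_top True s sr) (step_dual_top s sr h) (restr (gs_step s sr h))"
 unfolding gs_dual_top_roumieu
 by (rule proj_continuous[where j="%h. restr (gs_step s sr h)", OF _ restrict_step_image]) auto

lemma gs_dual_diff_closed: "diff_closed (gs_dual R s sr)"
 unfolding diff_closed_def
proof (intro ballI)
 fix u v assume "u : gs_dual R s sr" "v : gs_dual R s sr"
 hence u: "gsf R s sr u" "\<forall>f. f \<notin> gsc R s sr --> u f = 0" and v: "gsf R s sr v" "\<forall>f. f \<notin> gsc R s sr --> v f = 0"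
  by (simp_all add: mem_gs_dual)
 have "\<exists>h>0. (R --> h0 <= h) \<and> (\<exists>D\<ge>0. \<forall>g\<in>gsc R s sr. \<forall>c. gsb s sr h c g --> cmod (u g - v g) <= D * c)" if h0: "0 < h0" for h0
 proof -
  obtain h1 D1 where 1: "0 < h1" "R ==> h0 <= h1" "0 <= D1" "!!g c. g : gsc R s sr ==> gsb s sr h1 c g ==> cmod (u g) <= D1 * c"
   using gsfE[OF u(1) h0] by metis
  obtain h2 D2 where 2: "0 < h2" "R ==> h0 <= h2" "0 <= D2" "!!g c. g : gsc R s sr ==> gsb s sr h2 c g ==> cmod (v g) <= D2 * c"
   using gsfE[OF v(1) h0] by metis
  let ?h = "min h1 h2"
  have h: "0 < ?h" using 1(1) 2(1) by simp
  have "cmod (u g - v g) <= (D1 + D2) * c" if g: "g : gsc R s sr" "gsb s sr ?h c g" for g c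
   using order_trans[OF norm_triangle_ineq4 add_mono[OF 1(4)[OF g(1) gsb_mono[OF g(2) h _ order_refl]] 2(4)[OF g(1) gsb_mono[OF g(2) h _ order_refl]]]]
   by (simp add: distrib_right)
  thus ?thesis using h 1(2,3) 2(2,3) by (intro exI[of _ ?h] conjI exI[of _ "D1 + D2"]) auto
 qed
 hence "gsf R s sr (%f. u f - v f)"
  unfolding gsf_def using lfun_comb(1)[OF gsf_linear[OF u(1)] gsf_linear[OF v(1)]] by blast
 thus "(%f. u f - v f) \<in> gs_dual R s sr" using u(2) v(2) by (simp add: mem_gs_dual)
qed

text \<open>Both dual topologies are finer than that of pointwise convergence, which is what turns
  density into uniqueness. In the Beurling class |u f| is one of the defining seminorms of the
  dual.\<close>

lemma evaluation_continuous:
 assumes f: "f : gsc R s sr"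
 shows "continuous_map (gs_dual_top R s sr) euclidean (%u. u f)"
proof -
 have step: "continuous_map (step_dual_top s sr h) euclidean (%w. w f)" if h: "0 < h" and b: "gsb s sr h c f" for h c
  unfolding gs_step_dual_topology_def
 proof (rule lc_continuous_dist[OF step_dual_closed(1)[OF h] step_dual_norm_seminorm[OF h]])
  fix u v assume "u : step_dual s sr h" "v : step_dual s sr h"
  from step_dual_norm_ge[OF h diff_closedD[OF step_dual_closed(1)[OF h] this(2,1)] b]
  show "dist (v f) (u f) <= c * step_dual_norm s sr h (%x. v x - u x)" by (simp add: dist_norm mult.commute)
 qed simp
 show ?thesis
 proof (cases R)
  case True
  obtain h c where h: "0 < h" and b: "gsb s sr h c f" using gsc_boundedE[OF f] by blast
  have fX: "f : gs_step s sr h" using b mem_gs_step_iff[OF h] by blast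
  have "continuous_map (gs_dual_top True s sr) euclidean ((%w. w f) \<circ> restr (gs_step s sr h))"
   by (rule continuous_map_compose[OF roumieu_restrict_continuous[OF h] step[OF h b]])
  thus ?thesis using True fX by (simp add: comp_def restr_def)
 next
  case False
  let ?p = "%u. cmod (u f) :: real"
  have sn: "seminorm_on (gs_dual False s sr) ?p" unfolding seminorm_on_def by (simp add: norm_triangle_ineq norm_mult)
  have "continuous_map (step_dual_top s sr h) euclideanreal (?p \<circ> restr (gsc False s sr))" if h: "0 < h" for h
  proof -
   have "f : gs_step s sr h" using f False gsc_step(2)[OF h, of s sr] by auto
   then obtain c where "gsb s sr h c f" using mem_gs_step_iff[OF h, of f s sr] by blast
   from step[OF h this] have "continuous_map (step_dual_top s sr h) euclideanreal (%w. cmod (w f))" by (rule continuous_map_norm)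
   thus ?thesis using f False by (simp add: comp_def restr_def)
  qed
  hence "?p : beurling_seminorms s sr" using sn by simp
  hence "continuous_map (gs_dual_top False s sr) euclidean (%u. u f)"
   unfolding gs_dual_top_beurling
   by (intro lc_continuous_dist[OF gs_dual_diff_closed sn, where C=1]) (auto simp: dist_norm)
  thus ?thesis using False by simp
 qed
qed

text \<open>The two bounds differ in their quantifiers as the limits do: every source scale must
  lead to some target scale in the Roumieu class, every target scale must be reached from some
  source scale in the Beurling class. Linearity is asked on \<open>gsc True\<close>, which contains
  all step spaces, because the transposes are formed between duals of step spaces.\<close>

lemma class_transpose:
 fixes A :: "('a::euclidean_space => complex) => ('b::euclidean_space => complex)"
 assumes add: "!!f g. f : gsc True t ta ==> g : gsc True t ta ==> A (%x. f x + g x) = (%x. A f x + A g x)"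
  and sc: "!!f c. f : gsc True t ta ==> A (%x. c * f x) = (%x. c * A f x)"
  and bdR: "!!h. R ==> 0 < h ==> \<exists>h'>0. \<exists>P. \<forall>ph c. gsb t ta h c ph --> gsb s sr h' (P * c) (A ph)"
  and bdB: "!!h'. \<not> R ==> 0 < h' ==> \<exists>h>0. \<exists>P. \<forall>ph c. gsb t ta h c ph --> gsb s sr h' (P * c) (A ph)"
 shows "f : gsc R t ta ==> A f : gsc R s sr"
  and "continuous_map (gs_dual_top R s sr) (gs_dual_top R t ta) (%u. restr (gsc R t ta) (%ph. u (A ph)))"
proof -
 show Am: "A f : gsc R s sr" if f: "f : gsc R t ta" for f
 proof (cases R)
  case True
  obtain h c where h: "0 < h" "gsb t ta h c f" using gsc_boundedE[OF f] by blast
  from bdR[OF True h(1)] h(2) show ?thesis using gsc_roumieuI[OF True] by blast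
 next
  case False
  have "\<exists>C. gsb s sr h' C (A f)" if "0 < h'" for h' using bdB[OF False that] f False by (auto simp: gsc_def mem_gs_beurling) metis
  thus ?thesis using False by (auto simp: gsc_def mem_gs_beurling)
 qed
 let ?T = "%u. restr (gsc R t ta) (%ph. u (A ph))" and ?Th = "%h w. restr (gs_step t ta h) (%ph. w (A ph))"
 show "continuous_map (gs_dual_top R s sr) (gs_dual_top R t ta) ?T"
 proof (cases R)
  case True
  note X = gsc_step(1)[of _ t ta]
  have cont: "continuous_map (gs_dual_top True s sr) (step_dual_top t ta h) (%u. restr (gs_step t ta h) (?T u))" if h: "0 < h" for h
  proof -
   obtain h' P where h': "0 < h'" and P: "!!ph c. gsb t ta h c ph ==> gsb s sr h' (P * c) (A ph)" using bdR[OF True h] by blast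
   have "continuous_map (step_dual_top s sr h') (step_dual_top t ta h) (?Th h)"
    by (rule step_transpose(2)[OF h h' _ _ P]) (use add sc X[OF h] in blast)+
   from continuous_map_compose[OF roumieu_restrict_continuous[OF h'] this]
   have "continuous_map (gs_dual_top True s sr) (step_dual_top t ta h) (?Th h \<circ> restr (gs_step s sr h'))" .
   moreover have "?Th h \<circ> restr (gs_step s sr h') = (%u. restr (gs_step t ta h) (?T u))"
   proof (intro ext)
    fix u f
    have "A f : gs_step s sr h'" if "f : gs_step t ta h" using that P mem_gs_step_iff[OF h] mem_gs_step_iff[OF h'] by blast
    thus "(?Th h \<circ> restr (gs_step s sr h')) u f = restr (gs_step t ta h) (?T u) f"
     using X[OF h] True by (auto simp: restr_def)
   qed
   ultimately show ?thesis by simp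
  qed
  have Tm: "?T u : gs_dual True t ta" if u: "u : gs_dual True s sr" for u
  proof -
   have r: "restr (gs_step t ta h) (?T u) \<in> step_dual t ta h" if "0 < h" for h
    using continuous_map_image_subset_topspace[OF cont[OF that]] u by auto
   have lu: "lfun (gsc True s sr) u" using u gsf_linear by (auto simp: mem_gs_dual)
   have A1: "A f : gsc True s sr" if "f : gsc True t ta" for f using Am that True by simp
   have "lfun (gsc True t ta) (?T u)"
    unfolding lfun_def restr_def
    using lfun_add[OF lu A1 A1] lfun_scale[OF lu A1] True by (simp add: add sc gsc_add gsc_scale)
   moreover have "\<exists>D\<ge>0. \<forall>g\<in>gsc True t ta. \<forall>c. gsb t ta h c g --> cmod (?T u g) <= D * c" if h: "0 < h" for h
   proof -
    obtain D where D: "!!c f. gsb t ta h c f ==> cmod (restr (gs_step t ta h) (?T u) f) <= D * c"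
     using r[OF h] unfolding mem_step_dual[OF h] by blast
    have "cmod (?T u g) <= \<bar>D\<bar> * c" if g: "gsb t ta h c g" for g c
    proof -
     have "g : gs_step t ta h" using g mem_gs_step_iff[OF h] by blast
     hence "cmod (?T u g) <= D * c" using D[OF g] by (simp add: restr_def)
     also have "... <= \<bar>D\<bar> * c" by (rule mult_right_mono[OF abs_ge_self gsbD(2)[OF g]])
     finally show ?thesis .
    qed
    thus ?thesis by (intro exI[of _ "\<bar>D\<bar>"]) auto
   qed
   ultimately show ?thesis unfolding mem_gs_dual gsf_def using True by (auto simp: restr_def)
  qed
  have "continuous_map (gs_dual_top True s sr) (gs_dual_top True t ta) ?T"
   unfolding gs_dual_top_roumieu[of t]
   by (rule continuous_map_into_proj[where j="%h. restr (gs_step t ta h)" and ?i0.0=1, OF restrict_step_image]) (use Tm cont in auto)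
  thus ?thesis using True by simp
 next
  case False
  note X = gsc_step(2)
  have A1: "A f : gsc False s sr" if "f : gsc False t ta" for f using Am that False by simp
  have fs: "gsc False t ta \<subseteq> gsc True t ta" using gsc_step[OF zero_less_one, of t ta] by blast
  have Tm: "?T u : gs_dual False t ta" if u: "u : gs_dual False s sr" for u
  proof -
   have F: "gsf False s sr u" using u by (simp add: mem_gs_dual)
   obtain h' D where h': "0 < h'" "0 <= D" "!!g c. g : gsc False s sr ==> gsb s sr h' c g ==> cmod (u g) <= D * c"
    using gsfE[OF F zero_less_one] by metis
   obtain h P where h: "0 < h" and P: "!!ph c. gsb t ta h c ph ==> gsb s sr h' (P * c) (A ph)" using bdB[OF False h'(1)] by blast
   have lu: "lfun (gsc False s sr) u" by (rule gsf_linear[OF F])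
   have l: "lfun (gsc False t ta) (?T u)"
    unfolding lfun_def restr_def
    using lfun_add[OF lu A1 A1] lfun_scale[OF lu A1] False fs
    by (simp add: add sc gsc_add gsc_scale subset_iff)
   have b: "cmod (?T u g) <= (D * \<bar>P\<bar>) * c" if g: "g : gsc False t ta" "gsb t ta h c g" for g c
   proof -
    have "cmod (u (A g)) <= D * (P * c)" by (rule h'(3)[OF A1[OF g(1)] P[OF g(2)]])
    also have "... <= D * (\<bar>P\<bar> * c)" by (intro mult_left_mono mult_right_mono h'(2) gsbD(2)[OF g(2)]) simp
    finally show ?thesis using g(1) False by (simp add: restr_def mult.assoc)
   qed
   show ?thesis by (rule beurling_dualI[OF l _ h b]) (use False in \<open>simp add: restr_def\<close>)
  qed
  have "continuous_map (gs_dual_top False s sr) (gs_dual_top False t ta) ?T"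
   unfolding gs_dual_top_beurling
  proof (rule lc_continuous[OF gs_dual_diff_closed gs_dual_diff_closed Tm])
   fix q assume q: "q : beurling_seminorms t ta"
   hence sq: "seminorm_on (gs_dual False t ta) q" by simp
   show "seminorm_on (gs_dual False t ta) q" by (rule sq)
   \<comment> \<open>A defining seminorm pulled back along the transpose is again a defining one: on
     the dual of each step space it factors through the transpose between step duals.\<close>
   have "seminorm_on (gs_dual False s sr) (q \<circ> ?T)"
    unfolding seminorm_on_def
   proof (intro conjI ballI allI)
    fix u v assume uv: "u : gs_dual False s sr" "v : gs_dual False s sr"
    have "?T (%x. u x + v x) = (%x. ?T u x + ?T v x)" by (auto simp: restr_def fun_eq_iff)
    thus "(q \<circ> ?T) (%x. u x + v x) <= (q \<circ> ?T) u + (q \<circ> ?T) v" using seminorm_onD(1)[OF sq Tm[OF uv(1)] Tm[OF uv(2)]] by simp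
   next
    fix c u assume u: "u : gs_dual False s sr"
    have "?T (%x. c * u x) = (%x. c * ?T u x)" by (auto simp: restr_def fun_eq_iff)
    thus "(q \<circ> ?T) (%x. c * u x) = cmod c * (q \<circ> ?T) u" using seminorm_onD(2)[OF sq Tm[OF u]] by simp
   qed
   moreover have "continuous_map (step_dual_top s sr h') euclideanreal ((q \<circ> ?T) \<circ> restr (gsc False s sr))" if h': "0 < h'" for h'
   proof -
    obtain h P where h: "0 < h" and P: "!!ph c. gsb t ta h c ph ==> gsb s sr h' (P * c) (A ph)" using bdB[OF False h'] by blast
    have "continuous_map (step_dual_top s sr h') (step_dual_top t ta h) (?Th h)"
     by (rule step_transpose(2)[OF h h' _ _ P]) (use add sc gsc_step(1)[OF h] in blast)+
    moreover have "continuous_map (step_dual_top t ta h) euclideanreal (q \<circ> restr (gsc False t ta))" using q h by simp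
    ultimately have "continuous_map (step_dual_top s sr h') euclideanreal ((q \<circ> restr (gsc False t ta)) \<circ> ?Th h)"
     by (rule continuous_map_compose)
    moreover have "restr (gsc False t ta) (?Th h w) = ?T (restr (gsc False s sr) w)" for w
     using X[OF h, of t ta] A1 False by (auto simp: restr_def fun_eq_iff)
    ultimately show ?thesis by (simp add: comp_def)
   qed
   ultimately have "q \<circ> ?T : beurling_seminorms s sr" "seminorm_on (gs_dual False s sr) (q \<circ> ?T)" by simp_all
   thus "\<exists>p\<in>beurling_seminorms s sr. seminorm_on (gs_dual False s sr) p \<and> (\<exists>C. \<forall>f\<in>gs_dual False s sr. q (?T f) <= C * p f)"
    by (intro bexI[of _ "q \<circ> ?T"] conjI exI[of _ 1]) auto
  qed (auto simp: restr_def fun_eq_iff)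
  thus ?thesis using False by simp
 qed
qed

section \<open>Functions as functionals, and their density\<close>

lemma integral_functional_bound:
 assumes f: "integrable lborel f" and ph: "gsb s sr h c ph"
 shows "integrable lborel (%x. f x * ph x)" "cmod (LB x. f x * ph x) <= (LB x. cmod (f x)) * c"
proof -
 have b: "cmod (f x * ph x) <= cmod (f x) * c" for x
  using gsb_deriv[OF ph, of "%_. 0" x] by (simp add: multi_deriv_def iterated_deriv_def norm_mult mult_left_mono)
 have i: "integrable lborel (%x. cmod (f x) * c)" by (intro intb_mult_l integrable_norm f)
 show "integrable lborel (%x. f x * ph x)"
  by (rule integrable_bd[OF i])
   (use f smooth_borel_measurable[OF gsbD(1)[OF ph]] order_trans[OF b abs_ge_self] in auto)
 have "cmod (LB x. f x * ph x) <= (LB x. cmod (f x) * c)" by (rule norm_integral_le[OF i b])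
 thus "cmod (LB x. f x * ph x) <= (LB x. cmod (f x)) * c" by (simp only: int_mult_l)
qed

lemma integral_functional_linear:
 assumes f: "integrable lborel f" and V: "!!ph. ph \<in> V ==> \<exists>h c. gsb s sr h c ph"
 shows "lfun V (%ph. \<integral>x. f x * ph x \<partial>lborel)"
proof -
 have "(LB x. f x * (ph x + pz x)) = (LB x. f x * ph x) + (LB x. f x * pz x)" if "ph \<in> V" "pz \<in> V" for ph pz
  unfolding distrib_left using V[OF that(1)] V[OF that(2)] integral_functional_bound(1)[OF f]
  by (intro Bochner_Integration.integral_add) blast+
 moreover have "(LB x. f x * (c * ph x)) = c * (LB x. f x * ph x)" for c ph
  by (simp only: mult.left_commute[of _ c] int_mult_r)
 ultimately show ?thesis unfolding lfun_def by blast
qed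

lemma integral_step_dual:
 assumes h: "0 < h" and f: "integrable lborel f"
 shows "restr (gs_step s sr h) (%ph. \<integral>x. f x * ph x \<partial>lborel) \<in> step_dual s sr h"
proof -
 have "lfun (gs_step s sr h) (%ph. \<integral>x. f x * ph x \<partial>lborel)"
  by (rule integral_functional_linear[OF f]) (use mem_gs_step_iff[OF h, of _ s sr] in blast)
 hence l: "lfun (gs_step s sr h) (restr (gs_step s sr h) (%ph. \<integral>x. f x * ph x \<partial>lborel))"
  by (rule linear_functional_restrict[OF _ order_refl gs_step_arith(1)[OF h] gs_step_arith(2)[OF h]])
 have b: "cmod (restr (gs_step s sr h) (%ph. \<integral>x. f x * ph x \<partial>lborel) g) <= (LB x. cmod (f x)) * c" if "gsb s sr h c g" for c g
  using integral_functional_bound(2)[OF f that] that mem_gs_step_iff[OF h, of g s sr] unfolding restr_def by auto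
 show ?thesis unfolding mem_step_dual[OF h]
  by (intro conjI exI[of _ "\<integral>x. cmod (f x) \<partial>lborel"] allI impI l b) (simp_all add: restr_def)
qed

lemma distribution_gs_dual:
 assumes f: "integrable lborel f"
 shows "distribution_of (gsc R s sr) f : gs_dual R s sr"
proof -
 have "lfun (gsc R s sr) (%ph. \<integral>x. f x * ph x \<partial>lborel)"
  by (rule integral_functional_linear[OF f]) (use gsc_boundedE in blast)
 hence l: "lfun (gsc R s sr) (distribution_of (gsc R s sr) f)"
  unfolding distribution_of_def by (rule linear_functional_restrict[OF _ order_refl gsc_add gsc_scale])
 have b: "cmod (distribution_of (gsc R s sr) f g) <= (LB x. cmod (f x)) * c" if "g : gsc R s sr" "gsb s sr h c g" for c g h
  using integral_functional_bound(2)[OF f that(2)] that(1) by (simp add: distribution_of_def restr_def)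
 have "0 <= (LB x. cmod (f x))" by (rule integral_nn) simp
 hence "gsf R s sr (distribution_of (gsc R s sr) f)" unfolding gsf_def using l b by blast
 thus ?thesis unfolding mem_gs_dual by (simp add: distribution_of_def restr_def)
qed

text \<open>If the test space is {0}, so is the dual, and the zero function serves. Otherwise a test
  function of integral 1 exists, the kernel of the approximation.\<close>

lemma gs_dual_dense:
 fixes u :: "('a::euclidean_space => complex) => complex"
 assumes s: "0 < s" and sr: "0 < sr" and u: "u : gs_dual R (%_. s) (%_. sr)"
 obtains f :: "nat => 'a => complex" where "!!n. f n : gs1 R s sr"
  "limitin (gs_dual_top R (%_. s) (%_. sr)) (%n. distribution_of (gs1 R s sr) (f n)) u sequentially"
proof -
 let ?V = "gs1 R s sr :: ('a => complex) set"
 have F: "gsf R (%_ :: 'a. s) (%_. sr) u" and off: "!!f. f \<notin> ?V ==> u f = 0" using u by (auto simp: mem_gs_dual)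
 have lin: "lfun ?V u" by (rule gsf_linear[OF F])
 have int: "integrable lborel f" if "f : ?V" for f by (rule gsc_integrable[OF that less_imp_le[OF s]])
 show thesis
 proof (cases "\<forall>f\<in>?V. f = (%_. 0)")
  case True
  have "u (%_. 0) = 0" using lfun_scale[OF lin gsc_zero, of 0] by simp
  hence "u ph = 0" for ph using True off by metis
  hence "distribution_of ?V (%_. 0) = u" by (auto simp: distribution_of_def restr_def fun_eq_iff)
  hence "limitin (gs_dual_top R (%_. s) (%_. sr)) (%n. distribution_of ?V (%_. 0)) u sequentially"
   using u unfolding limitin_def by simp
  thus thesis by (intro that[of "%_ _. 0"] gsc_zero)
 next
  case False
  then obtain f0 x0 where "f0 : ?V" "f0 x0 ~= 0" by blast
  then obtain G :: "'a => complex" where G: "G : ?V" "(LB y. G y) = 1" using gs1_unit_integral[OF s sr] by metis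
  show thesis
  proof (cases R)
   case True
   \<comment> \<open>The n-th function is accurate to 1 / (n + 1) at the scale n + 1, hence at every
     fixed scale once n is large; this is convergence in the projective limit of the step
     duals.\<close>
   have "\<exists>f. f : ?V \<and> (\<forall>ph N. gsb1 s sr (real (Suc n)) N ph --> cmod (u ph - (LB x. f x * ph x)) <= rsuc n * N)" for n
   proof -
    have n: "0 < real (Suc n)" by simp
    show ?thesis
    proof (rule gsf_approx[OF s sr G F n])
     fix h v assume h: "0 < h" "R ==> real (Suc n) <= h" and v: "!!ph N. ph \<in> ?V ==> gsb1 s sr h N ph ==> v ph = u ph"
      and a: "!!et. 0 < et ==> \<exists>f\<in>?V. \<forall>ph N. gsb1 s sr h N ph --> cmod (v ph - (LB x. f x * ph x)) <= et * N"
     obtain f where f: "f : ?V" "!!ph N. gsb1 s sr h N ph ==> cmod (v ph - (LB x. f x * ph x)) <= rsuc n * N"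
      using a[of "rsuc n"] by auto
     have "cmod (u ph - (LB x. f x * ph x)) <= rsuc n * N" if ph: "gsb1 s sr (real (Suc n)) N ph" for ph N
     proof -
      have b: "gsb1 s sr h N ph" by (rule gsb_mono[OF ph n h(2)[OF True] order_refl])
      show ?thesis using f(2)[OF b] v[OF gsc_roumieuI[OF True h(1) b] b] by simp
     qed
     thus ?thesis using f(1) by blast
    qed
   qed
   then obtain f where f: "!!n. f n : ?V \<and> (\<forall>ph N. gsb1 s sr (real (Suc n)) N ph --> cmod (u ph - (LB x. f n x * ph x)) <= rsuc n * N)"
    by metis
   let ?d = "%n. distribution_of ?V (f n)"
   have dm: "?d n : gs_dual True (%_. s) (%_. sr)" for n using distribution_gs_dual[OF int, of "f n" R] f[of n] True by simp
   have uT: "u : gs_dual True (%_. s) (%_. sr)" using u True by simp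
   have "limitin (gs_dual_top True (%_. s) (%_. sr)) ?d u sequentially"
    unfolding gs_dual_top_roumieu
   proof (rule proj_limitin[where j="%h. restr (gs_step (%_. s) (%_. sr) h)" and ?i0.0=1, OF _ restrict_step_image uT dm])
    fix h :: real assume "h : {0<..}"
    hence h: "0 < h" by simp
    show "limitin (step_dual_top (%_. s) (%_. sr) h) (%n. restr (gs_step (%_. s) (%_. sr) h) (?d n)) (restr (gs_step (%_. s) (%_. sr) h) u) sequentially"
    proof (rule step_dual_limitin[OF h restrict_step_dual[OF h dm] restrict_step_dual[OF h uT]])
     obtain M where M: "h < real M" using reals_Archimedean2 by blast
     have "cmod (restr (gs_step (%_. s) (%_. sr) h) (?d n) ph - restr (gs_step (%_. s) (%_. sr) h) u ph) <= rsuc n"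
      if n: "M <= n" and ph: "gsb1 s sr h 1 ph" for n ph
     proof -
      have "h <= real (Suc n)" using M n by simp
      hence b: "gsb1 s sr (real (Suc n)) 1 ph" by (rule gsb_mono[OF ph h _ order_refl])
      have "ph \<in> ?V" "ph \<in> gs_step (%_. s) (%_. sr) h" using gsc_roumieuI[OF True h ph] ph mem_gs_step_iff[OF h, of ph "%_. s" "%_. sr"] by auto
      thus ?thesis using conjunct2[OF f[of n], rule_format, OF b] by (simp add: restr_def distribution_of_def norm_minus_commute)
     qed
     thus "eventually (%n. \<forall>ph. gsb1 s sr h 1 ph --> cmod (restr (gs_step (%_. s) (%_. sr) h) (?d n) ph - restr (gs_step (%_. s) (%_. sr) h) u ph) <= rsuc n) sequentially"
      unfolding eventually_sequentially by blast
    qed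
   qed simp
   thus thesis using that[of f] f True by simp
  next
   case False
   show thesis
   \<comment> \<open>A single scale is enough: the integrals converge to \<open>v\<close> in the
     dual of one step space, and restriction to test functions, which sends \<open>v\<close> to
     \<open>u\<close>, is continuous into the inductive limit.\<close>
   proof (rule gsf_approx[OF s sr G F zero_less_one])
    fix h v assume h: "0 < h" and v: "!!ph N. ph \<in> ?V ==> gsb1 s sr h N ph ==> v ph = u ph"
     and a: "!!et. 0 < et ==> \<exists>f\<in>?V. \<forall>ph N. gsb1 s sr h N ph --> cmod (v ph - (LB x. f x * ph x)) <= et * N"
    let ?X = "gs_step (%_. s) (%_. sr) h :: ('a => complex) set"
    have "\<exists>f. f : ?V \<and> (\<forall>ph N. gsb1 s sr h N ph --> cmod (v ph - (LB x. f x * ph x)) <= rsuc n * N)" for n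
     using a[of "rsuc n"] by auto
    then obtain f where f: "!!n. f n : ?V \<and> (\<forall>ph N. gsb1 s sr h N ph --> cmod (v ph - (LB x. f n x * ph x)) <= rsuc n * N)"
     by metis
    have fi: "integrable lborel (f n)" for n using f[of n] int by blast
    define I where "I n ph = (LB x. f n x * ph x)" for n ph
    have fb: "cmod (v ph - I n ph) <= rsuc n * N" if "gsb1 s sr h N ph" for n ph N
     using conjunct2[OF f[of n], rule_format, OF that] unfolding I_def .
    have Ilin: "lfun ?X (I n)" for n
     unfolding I_def[abs_def] by (rule integral_functional_linear[OF fi]) (use mem_gs_step_iff[OF h, of _ "%_. s" "%_. sr"] in blast)
    have lim: "(%n. I n ph) \<longlonglongrightarrow> v ph" if "ph \<in> ?X" for ph
    proof -
     obtain N where N: "gsb1 s sr h N ph" using \<open>ph \<in> ?X\<close> mem_gs_step_iff[OF h, of ph "%_. s" "%_. sr"] by blast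
     have b: "norm (I n ph - v ph) <= rsuc n * N" for n using fb[OF N, of n] by (subst norm_minus_commute)
     have l0: "(%n. rsuc n * N) \<longlonglongrightarrow> 0" using tendsto_mult_right[OF LIMSEQ_inverse_real_of_nat, of N] by (simp del: of_nat_Suc)
     have "eventually (%n. norm (I n ph - v ph) <= rsuc n * N) sequentially"
      by (rule always_eventually, rule allI, rule b)
     from Lim_null_comparison[OF this l0] have "(%n. I n ph - v ph) \<longlonglongrightarrow> 0" .
     thus ?thesis by (rule LIM_zero_cancel)
    qed
    have "v (%x. ph x + pz x) = v ph + v pz" if p: "ph \<in> ?X" "pz \<in> ?X" for ph pz
    proof -
     have "I n (%x. ph x + pz x) = I n ph + I n pz" for n
      by (rule Ilin[unfolded lfun_def, THEN conjunct1, rule_format, OF p])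
     hence "(%n. I n (%x. ph x + pz x)) \<longlonglongrightarrow> v ph + v pz" using tendsto_add[OF lim[OF p(1)] lim[OF p(2)]] by simp
     from LIMSEQ_unique[OF lim[OF gs_step_arith(1)[OF h p]] this] show ?thesis .
    qed
    moreover have "v (%x. c * ph x) = c * v ph" if p: "ph \<in> ?X" for ph c
    proof -
     have "I n (%x. c * ph x) = c * I n ph" for n
      by (rule Ilin[unfolded lfun_def, THEN conjunct2, rule_format, OF p])
     hence "(%n. I n (%x. c * ph x)) \<longlonglongrightarrow> c * v ph" using tendsto_mult_left[OF lim[OF p], of c] by simp
     from LIMSEQ_unique[OF lim[OF gs_step_arith(2)[OF h p]] this] show ?thesis .
    qed
    ultimately have "lfun ?X v" unfolding lfun_def by blast
    hence vl: "lfun ?X (restr ?X v)"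
     by (rule linear_functional_restrict[OF _ order_refl gs_step_arith(1)[OF h] gs_step_arith(2)[OF h]])
    let ?v = "restr ?X v" and ?w = "%n. restr ?X (I n)"
    have vb: "cmod (?v ph) <= (1 + (LB x. cmod (f 0 x))) * c" if ph: "gsb1 s sr h c ph" for ph c
    proof -
     have "cmod (v ph) <= cmod (v ph - I 0 ph) + cmod (I 0 ph)" using norm_triangle_ineq[of "v ph - I 0 ph" "I 0 ph"] by simp
     thus ?thesis using fb[OF ph, of 0] integral_functional_bound(2)[OF fi[of 0] ph] gsbD(2)[OF ph] ph mem_gs_step_iff[OF h, of ph "%_. s" "%_. sr"]
      by (auto simp: restr_def I_def distrib_right)
    qed
    have vm: "?v : step_dual (%_. s) (%_. sr) h" unfolding mem_step_dual[OF h]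
     by (intro conjI exI[of _ "1 + (LB x. cmod (f 0 x))"] allI impI vl vb) (simp_all add: restr_def)
    have wm: "?w n : step_dual (%_. s) (%_. sr) h" for n unfolding I_def[abs_def] by (rule integral_step_dual[OF h fi])
    note dc = step_dual_closed(1)[OF h, of "%_ :: 'a. s" "%_. sr"]
    let ?z = "%n (ph :: 'a => complex). ?w n ph - ?v ph"
    have zm: "?z n : step_dual (%_. s) (%_. sr) h" for n by (rule diff_closedD[OF dc wm vm])
    have 0: "(%_. 0) \<in> step_dual (%_. s) (%_ :: 'a. sr) h" using diff_closedD[OF dc vm vm] by simp
    have zl: "limitin (step_dual_top (%_. s) (%_. sr) h) ?z (%_. 0) sequentially"
    proof (rule step_dual_limitin[OF h zm 0], rule always_eventually, intro allI impI)
     fix n :: nat and ph :: "'a => complex" assume ph: "gsb1 s sr h 1 ph"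
     show "cmod (?z n ph - 0) <= rsuc n"
      using fb[OF ph, of n] by (simp add: restr_def norm_minus_commute del: of_nat_Suc)
    qed
    let ?d = "%n. distribution_of ?V (f n)"
    have dm: "?d n : gs_dual False (%_. s) (%_. sr)" for n using distribution_gs_dual[OF fi, of R] False by simp
    have uF: "u : gs_dual False (%_. s) (%_. sr)" using u False by simp
    have "limitin (gs_dual_top False (%_. s) (%_. sr)) ?d u sequentially"
     unfolding gs_dual_top_beurling
    proof (rule lc_limitin[OF gs_dual_diff_closed _ uF dm])
     fix p assume p: "p : beurling_seminorms (%_ :: 'a. s) (%_. sr)"
     hence sp: "seminorm_on (gs_dual False (%_. s) (%_. sr)) p" by simp
     let ?r = "restr (gsc False (%_ :: 'a. s) (%_. sr))"
     have "continuous_map (step_dual_top (%_. s) (%_. sr) h) euclideanreal (p \<circ> ?r)" using p h by simp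
     from continuous_map_limit[OF this zl] have "(%n. p (?r (?z n))) \<longlonglongrightarrow> p (?r (%_. 0))" by (simp add: limitin_canonical_iff comp_def)
     moreover have "?r (%_. 0) = (%_. 0)" by (auto simp: restr_def)
     moreover have "?r (?z n) = (%ph. ?d n ph - u ph)" for n
     proof
      fix ph
      show "?r (?z n) ph = ?d n ph - u ph"
      proof (cases "ph \<in> ?V")
       case True
       hence "ph \<in> ?X" using gsc_step(2)[OF h, of "%_. s" "%_. sr"] False by auto
       moreover from this obtain N where "gsb1 s sr h N ph" using mem_gs_step_iff[OF h, of ph "%_. s" "%_. sr"] by blast
       ultimately show ?thesis using True False v[OF True] by (simp add: restr_def distribution_of_def I_def)
      qed (use False off in \<open>simp add: restr_def distribution_of_def\<close>)
     qed
     ultimately show "(%n. p (%x. ?d n x - u x)) \<longlonglongrightarrow> 0" using seminorm_onD(3)[OF sp uF] by simp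
    qed simp
    thus thesis using that[of f] f False by simp
   qed
  qed
 qed
qed

section \<open>The extended Zak transform as a homeomorphism, and its uniqueness\<close>

lemma zak_functional_quasi_periodic:
 assumes dp: "dual_pair e (dual_basis e)" and s: "0 < s" and sr: "0 < sr"
 shows "quasi_periodic e (gs2 R s sr) (restr (gs2 R s sr) (%ph. u (zak_adjoint e ph)))"
 unfolding quasi_periodic_def
proof (intro conjI ballI)
 fix k and ph :: "(real ^ 'a) \<times> (real ^ 'a) => complex" assume k: "k : lat e" and ph: "ph \<in> gs2 R s sr"
 have "(%(x, xi). ph (x - k, xi)) : gs2 R s sr"
  using gsc_translate[OF two_groups_pos[OF s sr] ph, of "(k, 0)"] by (simp add: split_def minus_prod_def)
 moreover have "(%(x, xi). cis (k *. xi) * ph (x, xi)) : gs2 R s sr"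
  using gsc_cis[OF two_groups_pos[OF sr s] ph, of "(0, k)"] by (simp add: split_def inner_prod_def)
 ultimately show "restr (gs2 R s sr) (%ph. u (zak_adjoint e ph)) (%(x, xi). ph (x - k, xi)) =
  restr (gs2 R s sr) (%ph. u (zak_adjoint e ph)) (%(x, xi). cis (k *. xi) * ph (x, xi))"
  by (simp add: restr_def zak_adjoint_shift_fst[OF k])
next
 fix ka and ph :: "(real ^ 'a) \<times> (real ^ 'a) => complex" assume ka: "ka \<in> lat (dual_basis e)" and ph: "ph \<in> gs2 R s sr"
 have "(%(x, xi). ph (x, xi - ka)) : gs2 R s sr"
  using gsc_translate[OF two_groups_pos[OF s sr] ph, of "(0, ka)"] by (simp add: split_def minus_prod_def)
 thus "restr (gs2 R s sr) (%ph. u (zak_adjoint e ph)) (%(x, xi). ph (x, xi - ka)) =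
  restr (gs2 R s sr) (%ph. u (zak_adjoint e ph)) ph"
  using ph by (simp add: restr_def zak_adjoint_shift_snd[OF dp ka ph])
qed

text \<open>If the test functions of x are all 0, so are those of (x, \<xi>), and the zero window
  satisfies both identities; otherwise a nonzero one feeds the construction. In this way no relation
  between s and sr has to be assumed.\<close>

lemma zak_window:
 fixes e :: "'n::finite => real ^ 'n"
 assumes dp: "dual_pair e (dual_basis e)" and s: "0 < s" and sr: "0 < sr"
 obtains pz where "pz \<in> gs1 R sr s" "!!ph. ph \<in> gs1 R s sr ==> zak_adjoint e (%(x, y). ph x * pz y) = ph"
  "!!F ph. gsf R (two_groups s sr) (two_groups sr s) F ==> quasi_periodic e (gs2 R s sr) F ==> ph \<in> gs2 R s sr ==>
   F (%(x, xi). zak_adjoint e ph x * pz xi) = F ph"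
proof (cases "\<forall>f\<in>gs1 R s sr. f = (%_ :: real ^ 'n. 0)")
 case True
 have z: "zak_adjoint e (%_. 0) = (%_. 0)" using zak_adjoint_scale[of e 0 "%_. 0"] by simp
 have "ph = (%_. 0)" if ph: "ph \<in> gs2 R s sr" for ph :: "(real ^ 'n) \<times> (real ^ 'n) => complex"
 proof
  fix z :: "(real ^ 'n) \<times> (real ^ 'n)"
  have "(%x. ph (x, snd z)) = (%_. 0)" using gs2_slice[OF less_imp_le[OF sr] ph] True less_imp_le[OF s] by blast
  from fun_cong[OF this, of "fst z"] show "ph z = 0" by simp
 qed
 thus thesis using True z by (intro that[of "%_. 0"] gsc_zero) (auto simp: split_def)
next
 case False
 then obtain f :: "real ^ 'n => complex" and x0 where f: "f : gs1 R s sr" "f x0 ~= 0" by blast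
 show thesis
 proof (rule zak_window_exists[OF dp s sr f])
  fix pz :: "real ^ 'n => complex" assume pz: "pz \<in> gs1 R sr s"
   and per: "!!xi. (\<integral>ka. pz (xi + ka) \<partial>csl (dual_basis e)) = of_real (1 / measure lborel (cell e))"
   and fc: "!!j. j : lat e ==> fco j pz = (if j = 0 then 1 else 0)"
   and orth: "!!j. j : lat e ==> (LB et. indicator (cell e) et *! cis (j *. et)) = (if j = 0 then of_real (measure lborel (cell e)) else 0)"
  show thesis
   by (rule that[OF pz zak_adjoint_tensor[OF fc] zak_adjoint_of_quasi_periodic[OF dp refl s sr _ _ _ pz per orth]])
 qed
qed

text \<open>One statement for both classes, to be specialised through \<open>R\<close>. Agreement on
  Schwartz functions determines the extension, because test functions are Schwartz functions, they
  are dense in the dual, and evaluations are continuous.\<close>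

lemma zak_extension:
 fixes e :: "'n::finite => real ^ 'n" and s sr :: real
 assumes s: "0 < s" and sr: "0 < sr" and e: "basis_family e"
 shows "\<exists>T. homeomorphic_map (gs_dual_top R (%_. s) (%_. sr))
   (subtopology (gs_dual_top R (two_groups s sr) (two_groups sr s)) {F : gs_dual R (two_groups s sr) (two_groups sr s). quasi_periodic e (gs2 R s sr) F}) T \<and>
  linear_operator_on (gs_dual R (%_. s) (%_. sr)) T \<and> extends_from_schwartz (gs1 R s sr) (gs2 R s sr) (zak_transform e) T \<and>
  (\<forall>T'. homeomorphic_map (gs_dual_top R (%_. s) (%_. sr))
    (subtopology (gs_dual_top R (two_groups s sr) (two_groups sr s)) {F : gs_dual R (two_groups s sr) (two_groups sr s). quasi_periodic e (gs2 R s sr) F}) T' \<and>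
   extends_from_schwartz (gs1 R s sr) (gs2 R s sr) (zak_transform e) T' --> (\<forall>u\<in>gs_dual R (%_. s) (%_. sr). T' u = T u))"
proof -
 let ?D1 = "gs_dual R (%_. s) (%_. sr) :: ((real ^ 'n => complex) => complex) set" and ?X1 = "gs_dual_top R (%_. s) (%_. sr) :: ((real ^ 'n => complex) => complex) topology"
 let ?D2 = "gs_dual R (two_groups s sr) (two_groups sr s) :: (((real ^ 'n) \<times> (real ^ 'n) => complex) => complex) set"
  and ?X2 = "gs_dual_top R (two_groups s sr) (two_groups sr s) :: (((real ^ 'n) \<times> (real ^ 'n) => complex) => complex) topology"
 let ?V1 = "gs1 R s sr :: (real ^ 'n => complex) set" and ?V2 = "gs2 R s sr :: ((real ^ 'n) \<times> (real ^ 'n) => complex) set"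
 let ?Q = "{F : ?D2. quasi_periodic e ?V2 F}"
 note dp = dual_pair_dual_basis[OF e] and s0 = less_imp_le[OF s] and sr0 = less_imp_le[OF sr]
 obtain pz where pz: "pz \<in> gs1 R sr s" and inv1: "!!ph. ph \<in> ?V1 ==> zak_adjoint e (%(x, y). ph x * pz y) = ph"
  and inv2: "!!F ph. gsf R (two_groups s sr) (two_groups sr s) F ==> quasi_periodic e ?V2 F ==> ph \<in> ?V2 ==> F (%(x, xi). zak_adjoint e ph x * pz xi) = F ph"
  using zak_window[OF dp s sr, of R] by blast
 define T where "T u = restr ?V2 (%ph. u (zak_adjoint e ph))" for u :: "(real ^ 'n => complex) => complex"
 define B where "B ph = (%(x, y). ph x * pz y)" for ph :: "real ^ 'n => complex"
 define S where "S F = restr ?V1 (%ph. F (B ph))" for F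
 have zb: "\<exists>P. \<forall>ph c. gsb2 s sr h c ph --> gsb1 s sr (2 * (2 powr s * h)) (P * c) (zak_adjoint e ph)" if h: "0 < h" for h
 proof (rule zak_adjoint_bounded[OF dp h s0 sr0])
  fix P assume P: "!!ph C. gsb2 s sr h C ph ==> gsb1 s sr (2 * (2 powr s * h)) (C * P) (zak_adjoint e ph)"
  show ?thesis by (intro exI[of _ P] allI impI, subst mult.commute) (rule P)
 qed
 have Tt: "!!f. f : ?V2 ==> zak_adjoint e f : ?V1" "continuous_map ?X1 ?X2 T"
 proof -
  have r: "\<exists>h'>0. \<exists>P. \<forall>ph c. gsb2 s sr h c ph --> gsb1 s sr h' (P * c) (zak_adjoint e ph)" if "R" "0 < h" for h
   using zb[OF that(2)] that by (intro exI[of _ "2 * (2 powr s * h)"]) auto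
  have b: "\<exists>h>0. \<exists>P. \<forall>ph c. gsb2 s sr h c ph --> gsb1 s sr h' (P * c) (zak_adjoint e ph)" if "\<not> R" and h': "0 < h'" for h'
  proof -
   have "0 < h' / (2 * 2 powr s)" "2 * (2 powr s * (h' / (2 * 2 powr s))) = h'" using h' by auto
   thus ?thesis using zb[of "h' / (2 * 2 powr s)"] by (intro exI[of _ "h' / (2 * 2 powr s)"]) simp
  qed
  note ct = class_transpose[where A="zak_adjoint e" and t="two_groups s sr" and ta="two_groups sr s" and s="%_. s" and sr="%_. sr" and R=R,
   OF zak_adjoint_add[OF dp s0 sr0] zak_adjoint_scale r b]
  show "!!f. f : ?V2 ==> zak_adjoint e f : ?V1" by (rule ct(1))
  show "continuous_map ?X1 ?X2 T" unfolding T_def[abs_def] by (rule ct(2))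
 qed
 have St: "!!f. f : ?V1 ==> B f : ?V2" "continuous_map ?X2 ?X1 S"
 proof -
  \<comment> \<open>The window is bounded from the scale \<open>h0\<close> on, in the Beurling class
    at every scale. For the Roumieu class the target scale of tensoring with it is therefore
    \<open>max h h0\<close>.\<close>
  obtain h0 where h0: "0 < h0" "!!h. 0 < h ==> (R ==> h0 <= h) ==> \<exists>C. gsb1 sr s h C pz" using gsc_level[OF pz] by blast
  have key: "\<exists>P. \<forall>ph c. gsb1 s sr h c ph --> gsb2 s sr h' (P * c) (B ph)"
   if h: "0 < h" "h <= h'" "R ==> h0 <= h'" for h h'
  proof -
   have h'0: "0 < h'" using h by simp
   obtain C where C: "gsb1 sr s h' C pz" using h0(2)[OF h'0 h(3)] by blast
   have "gsb2 s sr h' (C * c) (B ph)" if "gsb1 s sr h c ph" for ph c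
    using gsb_tensor[OF gsb_mono[OF that h(1,2) order_refl] C h'0] unfolding B_def by (simp only: mult.commute)
   thus ?thesis by blast
  qed
  have add: "B (%x. f x + g x) = (%z. B f z + B g z)" and sc: "B (%x. c * f x) = (%z. c * B f z)" for f g c
   by (auto simp: B_def fun_eq_iff algebra_simps)
  have r: "\<exists>h'>0. \<exists>P. \<forall>ph c. gsb1 s sr h c ph --> gsb2 s sr h' (P * c) (B ph)" if "R" "0 < h" for h
   using key[OF that(2), of "max h h0"] that by (intro exI[of _ "max h h0"]) auto
  have b: "\<exists>h>0. \<exists>P. \<forall>ph c. gsb1 s sr h c ph --> gsb2 s sr h' (P * c) (B ph)" if "\<not> R" "0 < h'" for h'
   using key[OF that(2) order_refl] that by (intro exI[of _ h']) auto
  note ct = class_transpose[where A=B and t="%_. s" and ta="%_. sr" and s="two_groups s sr" and sr="two_groups sr s" and R=R, OF add sc r b]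
  show "!!f. f : ?V1 ==> B f : ?V2" by (rule ct(1))
  show "continuous_map ?X2 ?X1 S" unfolding S_def[abs_def] by (rule ct(2))
 qed
 have TQ: "T u : ?Q" if "u : ?D1" for u
  using continuous_map_image_subset_topspace[OF Tt(2)] that zak_functional_quasi_periodic[OF dp s sr, of R u] by (auto simp: T_def)
 have hm: "homeomorphic_maps ?X1 (subtopology ?X2 ?Q) T S"
  unfolding homeomorphic_maps_def
 proof (intro conjI ballI)
  show "continuous_map ?X1 (subtopology ?X2 ?Q) T" using Tt(2) TQ by (auto simp: continuous_map_in_subtopology)
  show "continuous_map (subtopology ?X2 ?Q) ?X1 S" by (rule continuous_map_from_subtopology[OF St(2)])
  fix u assume "u : topspace ?X1"
  hence off: "u f = 0" if "f \<notin> ?V1" for f using that by (simp add: mem_gs_dual)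
  show "S (T u) = u"
  proof
   fix ph show "S (T u) ph = u ph"
    using off St(1)[of ph] inv1[of ph] by (cases "ph \<in> ?V1") (simp_all add: S_def T_def restr_def B_def)
  qed
 next
  fix F assume "F : topspace (subtopology ?X2 ?Q)"
  hence F: "gsf R (two_groups s sr) (two_groups sr s) F" "quasi_periodic e ?V2 F" "!!f. f \<notin> ?V2 ==> F f = 0"
   by (auto simp: mem_gs_dual)
  show "T (S F) = F"
  proof
   fix ph show "T (S F) ph = F ph"
    using F(3)[of ph] Tt(1)[of ph] inv2[OF F(1,2), of ph] by (cases "ph \<in> ?V2") (simp_all add: S_def T_def restr_def B_def)
  qed
 qed
 have ext: "extends_from_schwartz ?V1 ?V2 (zak_transform e) T"
  unfolding extends_from_schwartz_def
 proof (intro ballI ext)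
  fix f :: "real ^ 'n => complex" and ph assume f: "f : schwartz_space"
  show "T (distribution_of ?V1 f) ph = distribution_of ?V2 (zak_transform e f) ph"
   using Tt(1)[of ph] zak_transform_adjoint[OF dp s0 sr0 f, of ph R] by (simp add: T_def distribution_of_def restr_def)
 qed
 have lin: "linear_operator_on ?D1 T"
  unfolding linear_operator_on_def T_def by (auto simp: restr_def fun_eq_iff)
 have uniq: "T' u = T u"
  if hT: "homeomorphic_map ?X1 (subtopology ?X2 ?Q) T'" and eT: "extends_from_schwartz ?V1 ?V2 (zak_transform e) T'" and u: "u : ?D1" for T' u
 proof -
  obtain f :: "nat => real ^ 'n => complex" where f: "!!n. f n : ?V1" "limitin ?X1 (%n. distribution_of ?V1 (f n)) u sequentially"
   using gs_dual_dense[OF s sr u] by blast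
  have cT: "continuous_map ?X1 ?X2 T'"
   using homeomorphic_imp_continuous_map[OF hT] by (simp add: continuous_map_in_subtopology)
  have mem: "T' u : ?D2" "T u : ?D2" using continuous_map_image_subset_topspace[OF cT] TQ[OF u] u by auto
  have agree: "T' (distribution_of ?V1 (f n)) = T (distribution_of ?V1 (f n))" for n
   using eT ext gsc_schwartz f(1)[of n] unfolding extends_from_schwartz_def by fastforce
  show ?thesis
  proof
   fix ph
   show "T' u ph = T u ph"
   proof (cases "ph \<in> ?V2")
    case True
    have "(%n. U (distribution_of ?V1 (f n)) ph) \<longlonglongrightarrow> U u ph" if "continuous_map ?X1 ?X2 U" for U
     using continuous_map_limit[OF continuous_map_compose[OF that evaluation_continuous[OF True]] f(2)]
     by (simp add: limitin_canonical_iff comp_def)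
    from LIMSEQ_unique[OF this[OF cT, unfolded agree] this[OF Tt(2)]] show ?thesis .
   next
    case False
    thus ?thesis using mem by (simp add: mem_gs_dual)
   qed
  qed
 qed
 show ?thesis
  using homeomorphic_maps_map[THEN iffD1, OF hm] lin ext uniq by blast
qed

theorem theorem3p5:
  fixes e :: "'n::finite \<Rightarrow> real ^ 'n" and s \<sigma> :: real
  assumes "0 < s" and "0 < \<sigma>" and "basis_family e"
  shows
    "(\<exists>T. homeomorphic_map (gs_roumieu_dual_topology (\<lambda>_. s) (\<lambda>_. \<sigma>))
             (zak_roumieu_dual_topology e s \<sigma>) T \<and>
          linear_operator_on (gs_roumieu_dual (\<lambda>_. s) (\<lambda>_. \<sigma>)) T \<and>
          extends_from_schwartz (gs_roumieu (\<lambda>_. s) (\<lambda>_. \<sigma>))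
             (gs_roumieu (two_groups s \<sigma>) (two_groups \<sigma> s)) (zak_transform e) T \<and>
          (\<forall>T'. homeomorphic_map (gs_roumieu_dual_topology (\<lambda>_. s) (\<lambda>_. \<sigma>))
                   (zak_roumieu_dual_topology e s \<sigma>) T' \<and>
                extends_from_schwartz (gs_roumieu (\<lambda>_. s) (\<lambda>_. \<sigma>))
                   (gs_roumieu (two_groups s \<sigma>) (two_groups \<sigma> s)) (zak_transform e) T' \<longrightarrow>
                (\<forall>u \<in> gs_roumieu_dual (\<lambda>_. s) (\<lambda>_. \<sigma>). T' u = T u))) \<and>
     (\<exists>T. homeomorphic_map (gs_beurling_dual_topology (\<lambda>_. s) (\<lambda>_. \<sigma>))
             (zak_beurling_dual_topology e s \<sigma>) T \<and>
          linear_operator_on (gs_beurling_dual (\<lambda>_. s) (\<lambda>_. \<sigma>)) T \<and>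
          extends_from_schwartz (gs_beurling (\<lambda>_. s) (\<lambda>_. \<sigma>))
             (gs_beurling (two_groups s \<sigma>) (two_groups \<sigma> s)) (zak_transform e) T \<and>
          (\<forall>T'. homeomorphic_map (gs_beurling_dual_topology (\<lambda>_. s) (\<lambda>_. \<sigma>))
                   (zak_beurling_dual_topology e s \<sigma>) T' \<and>
                extends_from_schwartz (gs_beurling (\<lambda>_. s) (\<lambda>_. \<sigma>))
                   (gs_beurling (two_groups s \<sigma>) (two_groups \<sigma> s)) (zak_transform e) T' \<longrightarrow>
                (\<forall>u \<in> gs_beurling_dual (\<lambda>_. s) (\<lambda>_. \<sigma>). T' u = T u)))"
  using zak_extension[OF assms, of True] zak_extension[OF assms, of False]
  unfolding zak_roumieu_dual_topology_def zak_beurling_dual_topology_def gs_dual_top_def gs_dual_def gsc_def if_True if_False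
  by (rule conjI)

end
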